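(* Let $(S,\Omega)$ be a relative Sierpiński carpet, let $u:S\to\mathbb R$ be a (normalized) carpet-harmonic function and let $V\subset\subset\Omega$ be an open set. Then $$\sup_{x\in S\cap\overline V}u(x)=\sup_{x\in\partial_*V}u(x)\quad\text{and}\quad\inf_{x\in S\cap\overline V}u(x)=\inf_{x\in\partial_*V}u(x),$$ where $\partial_*V=S\cap\partial V$.
   Context: Relative Sierpiński carpets. Let $\Omega\subset\mathbb C$ be a connected open set and $\{Q_i\}_{i\in\mathbb N}$ open Jordan regions compactly contained in $\Omega$, with pairwise disjoint closures, such that $S:=\Omega\setminus\bigcup_iQ_i$ has empty interior and is locally connected. Then $(S,\Omega)$ is a relative Sierpiński carpet with peripheral disks $Q_i$. Standing assumptions on every relative Sierpiński carpet: (i) $\mathcal H^2(S)=0$; (ii) there is $K_0\ge1$ such that for each $i$ there are concentric balls $B(x,r)\subset Q_i\subset B(x,R)$ with $R/r\le K_0$; (iii) there is $K_1>0$ such that $\mathcal H^2(B(x,r)\cap Q_i)\ge K_1r^2$ for all $i$, $x\in Q_i$, $0<r<\operatorname{diam}(Q_i)$. $\mathcal H^m$ is Hausdorff measure normalized to agree with Lebesgue measure. Notation. $\widehat{\mathbb R}=\mathbb R\cup\{\pm\infty\}$. $V\subset\subset\Omega$: $\overline V$ is compact and contained in $\Omega$. $I_V=\{i:Q_i\cap V\ne\emptyset\}$. $S^\circ$: points of $S$ on no $\partial Q_i$. A path is a continuous map from a bounded interval to $\mathbb C$ with a continuous extension to the closed interval (also its image); it is open if the interval is open; subpaths are restrictions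 to subintervals. For $g:S\to\widehat{\mathbb R}$: $M_{Q_i}(g)=\sup_{\partial Q_i}g$, $m_{Q_i}(g)=\inf_{\partial Q_i}g$, $\operatorname{osc}_{Q_i}(g)=M_{Q_i}(g)-m_{Q_i}(g)$. If $S\cap\overline V=\emptyset$, all quantities in the claim are vacuous. Moduli of a path family $\Gamma$ in $\Omega$. $\mathrm{mod}_2(\Gamma)=\inf\int\lambda^2d\mathcal H^2$ over Borel $\lambda\ge0$ with $\int_\gamma\lambda\,ds\ge1$ for all $\gamma\in\Gamma$ (with $\int_\gamma\lambda\,ds:=\infty$ if $\gamma$ is not locally rectifiable). Weak modulus $\mathrm{mod}_w(\Gamma)=\inf\sum_i\rho(Q_i)^2$ over non-negative sequences for which there is $\Gamma_0\subset\Gamma$ with $\mathrm{mod}_2(\Gamma_0)=0$ and $\sum_{i:Q_i\cap\gamma\ne\emptyset}\rho(Q_i)\ge1$ for $\gamma\in\Gamma\setminus\Gamma_0$. Strong modulus $\mathrm{mod}_s(\Gamma)$: the same infimum over sequences satisfying this inequality for all $\gamma\in\Gamma$ with $\mathcal H^1(\gamma\cap S)=0$. Sobolev spaces. $\{\rho(Q_i)\}$ is a weak (strong) upper gradient of $g:S\to\widehat{\mathbb R}$ if there is $\Gamma_0$ with $\mathrm{mod}_w(\Gamma_0)=0$ ($\mathrm{mod}_s(\Gamma_0)=0$) such that for all paths $\gamma\subset\Omega$, $\gamma\notin\Gamma_0$, and $x,y\in\gamma\cap S$: $g(x),g(y)\neq\pm\infty$ and $|g(x)-g(y)|\le\sum_{i:Q_i\cap\gamma\ne\emptyset}\rho(Q_i)$.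 $g\in\mathcal W^{1,2}_{\mathrm{loc}}(S)$ if $M_{Q_i}(g),m_{Q_i}(g)$ are finite for all $i$, $\sum_{i\in I_B}M_{Q_i}(g)^2\operatorname{diam}(Q_i)^2<\infty$ and $\sum_{i\in I_B}\operatorname{osc}_{Q_i}(g)^2<\infty$ for every ball $B\subset\subset\Omega$, and $\{\operatorname{osc}_{Q_i}(g)\}$ is an upper gradient of $g$; $g\in\mathcal W^{1,2}(S)$ if moreover the sums over all $i\in\mathbb N$ are finite. There is a weak and a strong version; the statement holds for each, with one version fixed throughout. Dirichlet energy: $D_V(g)=\sum_{i\in I_V}\operatorname{osc}_{Q_i}(g)^2$. $u\in\mathcal W^{1,2}_{\mathrm{loc}}(S)$ is carpet-harmonic if $D_V(u)\le D_V(u+\zeta)$ for every open $V\subset\subset\Omega$ and $\zeta\in\mathcal W^{1,2}(S)$ with $\zeta|_{S\setminus V}\equiv0$. Normalized functions. For $g\in\mathcal W^{1,2}_{\mathrm{loc}}(S)$ let $\hat g(Q_i)=M_{Q_i}(g)$. Let $\mathcal G_{\hat g}$ be the family of non-constant paths $\gamma\subset\Omega$ with: $\mathcal H^1(\gamma\cap S)=0$; for every subpath $\gamma'$ of $\gamma$ and $Q_{i_1},Q_{i_2}$ meeting $\gamma'$, $|\hat g(Q_{i_1})-\hat g(Q_{i_2})|\le\sum_{i:Q_i\cap\gamma'\neq\emptyset}\operatorname{osc}_{Q_i}(g)$; $\sum_{i:Q_i\cap\gamma'\ne\emptyset}\operatorname{osc}_{Q_i}(g)<\infty$ for subpaths $\gamma'\subset\subset\Omega$;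 and, if $\sum_{i\in\mathbb N}\operatorname{osc}_{Q_i}(g)^2<\infty$, also $\sum_{i:Q_i\cap\gamma\ne\emptyset}\operatorname{osc}_{Q_i}(g)<\infty$. A point $x\in S$ is accessible by $\gamma_0$ if $x\in\gamma_0\cap S^\circ$ (put $\gamma=\gamma_0$), or there is an open subpath $\gamma$ of $\gamma_0$ with $x\in\overline\gamma\setminus\gamma$ and $\gamma\cap Q_{i_0}=\emptyset$ whenever $x\in\partial Q_{i_0}$. The normalized version $\tilde g$ of $g$ is: $\tilde g(x)=\liminf_{Q_i\to x,\,Q_i\cap\gamma\ne\emptyset}\hat g(Q_i)$ if $x$ is accessible by a path $\gamma_0\in\mathcal G_{\hat g}$, where $\gamma=\gamma_0$ if $x\in\gamma_0\cap S^\circ$, and otherwise $\gamma$ is an open subpath of $\gamma_0$ with $x\in\overline\gamma\setminus\gamma$ and $\gamma\cap Q_{i_0}=\emptyset$ whenever $x\in\partial Q_{i_0}$ (the value is independent of $\gamma$); for non-accessible $x\in\partial Q_{i_0}$, $\tilde g(x)=\liminf\tilde g(y)$ as $y\to x$ through accessible $y\in\partial Q_{i_0}$; for all other $x$, $\tilde g(x)=\liminf\tilde g(y)$ as $y\to x$ through accessible $y$. A function is normalized if it equals the normalized version of some function in the Sobolev space. Standing convention: carpet-harmonic functions are normalized. *)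

theory Defs
  imports "HOL-Analysis.Analysis"
begin

section \<open>Paths\<close>

text \<open>A path is a pair of its parameter interval (of any kind: open, closed, half-open, degenerate)
  and a map; the values of the map off the interval play no role. The domain is not fixed to be
  \<open>{0..1}\<close> because paths need not contain their endpoints.\<close>

type_synonym cpath = "real set \<times> (real \<Rightarrow> complex)"

definition is_cpath :: "cpath \<Rightarrow> bool" where
  "is_cpath \<gamma> \<longleftrightarrow> fst \<gamma> \<noteq> {} \<and> is_interval (fst \<gamma>) \<and> bounded (fst \<gamma>) \<and>
     (\<exists>h. continuous_on (closure (fst \<gamma>)) h \<and> (\<forall>t\<in>fst \<gamma>. h t = snd \<gamma> t))"

definition trace :: "cpath \<Rightarrow> complex set" where
  "trace \<gamma> = snd \<gamma> ` fst \<gamma>"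

definition paths_in :: "complex set \<Rightarrow> cpath set" where
  "paths_in \<Omega> = {\<gamma>. is_cpath \<gamma> \<and> trace \<gamma> \<subseteq> \<Omega>}"

definition subpaths :: "cpath \<Rightarrow> cpath set" where
  "subpaths \<gamma> = {(J, snd \<gamma>) | J. J \<noteq> {} \<and> is_interval J \<and> J \<subseteq> fst \<gamma>}"

definition open_subpaths :: "cpath \<Rightarrow> cpath set" where
  "open_subpaths \<gamma> = {\<gamma>' \<in> subpaths \<gamma>. open (fst \<gamma>')}"

definition compactly_contained :: "complex set \<Rightarrow> complex set \<Rightarrow> bool" where
  "compactly_contained V \<Omega> \<longleftrightarrow> compact (closure V) \<and> closure V \<subseteq> \<Omega>"


section \<open>Length, line integrals, one-dimensional Hausdorff measure\<close>

definition curve_length :: "(real \<Rightarrow> complex) \<Rightarrow> real set \<Rightarrow> ennreal" where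
  "curve_length f I = (SUP ts\<in>{ts. sorted ts \<and> set ts \<subseteq> I}.
     \<Sum>j<length ts - 1. ennreal (dist (f (ts ! j)) (f (ts ! Suc j))))"

definition locally_rectifiable :: "cpath \<Rightarrow> bool" where
  "locally_rectifiable \<gamma> \<longleftrightarrow>
     (\<forall>a b. a \<le> b \<and> {a..b} \<subseteq> fst \<gamma> \<longrightarrow> curve_length (snd \<gamma>) {a..b} < \<infinity>)"

text \<open>Arc-length parametrization of \<open>f\<close> on \<open>{a..b}\<close>. Parameters with the same value of the length
  function have the same image, so the choice of \<open>t\<close> does not matter.\<close>

definition arclength_param :: "(real \<Rightarrow> complex) \<Rightarrow> real \<Rightarrow> real \<Rightarrow> real \<Rightarrow> complex" where
  "arclength_param f a b s = f (SOME t. t \<in> {a..b} \<and> curve_length f {a..t} = ennreal s)"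

definition line_integral :: "(complex \<Rightarrow> ennreal) \<Rightarrow> cpath \<Rightarrow> ennreal" where
  "line_integral l \<gamma> =
     (if locally_rectifiable \<gamma>
      then SUP (a, b)\<in>{(a, b). a \<le> b \<and> {a..b} \<subseteq> fst \<gamma>}.
             \<integral>\<^sup>+ s. l (arclength_param (snd \<gamma>) a b s)
                    * indicator {0..enn2real (curve_length (snd \<gamma>) {a..b})} s \<partial>lborel
      else \<infinity>)"

text \<open>The normalizing constant \<open>unit_ball_vol 1 / 2\<close> is 1. Covering sets must be required to be
  bounded since \<open>diameter\<close> is not meaningful on unbounded sets. The two-dimensional Hausdorff
  measure is only ever applied to Borel sets and functions of the plane and, with the normalization
  that makes it agree with Lebesgue measure, is written \<open>lborel\<close>.\<close>

definition hausdorff1 :: "complex set \<Rightarrow> ennreal" where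
  "hausdorff1 A = (SUP \<delta>\<in>{0<..}.
     INF C\<in>{C :: nat \<Rightarrow> complex set.
              A \<subseteq> (\<Union>n. C n) \<and> (\<forall>n. bounded (C n) \<and> diameter (C n) \<le> \<delta>)}.
       \<Sum>n. ennreal (diameter (C n)))"


section \<open>Relative Sierpinski carpets\<close>

definition jordan_region :: "complex set \<Rightarrow> bool" where
  "jordan_region U \<longleftrightarrow>
     (\<exists>c. simple_path c \<and> pathfinish c = pathstart c \<and> U = inside (path_image c))"

definition carpet :: "complex set \<Rightarrow> (nat \<Rightarrow> complex set) \<Rightarrow> complex set" where
  "carpet \<Omega> Q = \<Omega> - (\<Union>i. Q i)"

definition carpet_interior :: "complex set \<Rightarrow> (nat \<Rightarrow> complex set) \<Rightarrow> complex set" where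
  "carpet_interior \<Omega> Q = carpet \<Omega> Q - (\<Union>i. frontier (Q i))"

text \<open>The last three conjuncts are the standing assumptions: null area, uniformly quasiround and
  uniformly fat peripheral disks.\<close>

definition relative_carpet :: "complex set \<Rightarrow> (nat \<Rightarrow> complex set) \<Rightarrow> bool" where
  "relative_carpet \<Omega> Q \<longleftrightarrow>
     open \<Omega> \<and> connected \<Omega> \<and>
     (\<forall>i. jordan_region (Q i) \<and> compactly_contained (Q i) \<Omega>) \<and>
     (\<forall>i j. i \<noteq> j \<longrightarrow> closure (Q i) \<inter> closure (Q j) = {}) \<and>
     interior (carpet \<Omega> Q) = {} \<and> locally connected (carpet \<Omega> Q) \<and>
     emeasure lborel (carpet \<Omega> Q) = 0 \<and>
     (\<exists>K0\<ge>1. \<forall>i. \<exists>x r R. 0 < r \<and> ball x r \<subseteq> Q i \<and> Q i \<subseteq> ball x R \<and> R / r \<le> K0) \<and>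
     (\<exists>K1>0. \<forall>i. \<forall>x\<in>Q i. \<forall>r. 0 < r \<and> r < diameter (Q i) \<longrightarrow>
        emeasure lborel (ball x r \<inter> Q i) \<ge> ennreal (K1 * r\<^sup>2))"

definition meeting :: "(nat \<Rightarrow> complex set) \<Rightarrow> complex set \<Rightarrow> nat set" where
  "meeting Q A = {i. Q i \<inter> A \<noteq> {}}"


section \<open>Moduli\<close>

text \<open>\<open>ennreal\<close>-valued sums over arbitrary index sets always exist, and an infimum over the empty
  set is \<open>\<infinity>\<close>.\<close>

definition mod2 :: "cpath set \<Rightarrow> ennreal" where
  "mod2 \<Gamma> = (INF l\<in>{l :: complex \<Rightarrow> ennreal.
                       l \<in> borel_measurable borel \<and> (\<forall>\<gamma>\<in>\<Gamma>. line_integral l \<gamma> \<ge> 1)}.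
               \<integral>\<^sup>+ z. (l z)\<^sup>2 \<partial>lborel)"

definition mod_weak :: "(nat \<Rightarrow> complex set) \<Rightarrow> cpath set \<Rightarrow> ennreal" where
  "mod_weak Q \<Gamma> = (INF \<rho>\<in>{\<rho> :: nat \<Rightarrow> ennreal. (\<forall>i. \<rho> i < \<infinity>) \<and>
       (\<exists>\<Gamma>0 \<subseteq> \<Gamma>. mod2 \<Gamma>0 = 0 \<and>
          (\<forall>\<gamma> \<in> \<Gamma> - \<Gamma>0. (\<Sum>\<^sub>\<infinity>i\<in>meeting Q (trace \<gamma>). \<rho> i) \<ge> 1))}.
     \<Sum>\<^sub>\<infinity>i\<in>UNIV. (\<rho> i)\<^sup>2)"

definition mod_strong :: "complex set \<Rightarrow> (nat \<Rightarrow> complex set) \<Rightarrow> cpath set \<Rightarrow> ennreal" where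
  "mod_strong \<Omega> Q \<Gamma> = (INF \<rho>\<in>{\<rho> :: nat \<Rightarrow> ennreal. (\<forall>i. \<rho> i < \<infinity>) \<and>
       (\<forall>\<gamma> \<in> \<Gamma>. hausdorff1 (trace \<gamma> \<inter> carpet \<Omega> Q) = 0 \<longrightarrow>
          (\<Sum>\<^sub>\<infinity>i\<in>meeting Q (trace \<gamma>). \<rho> i) \<ge> 1)}.
     \<Sum>\<^sub>\<infinity>i\<in>UNIV. (\<rho> i)\<^sup>2)"

datatype version = Weak | Strong

definition carpet_modulus ::
  "version \<Rightarrow> complex set \<Rightarrow> (nat \<Rightarrow> complex set) \<Rightarrow> cpath set \<Rightarrow> ennreal" where
  "carpet_modulus v \<Omega> Q \<Gamma> = (case v of Weak \<Rightarrow> mod_weak Q \<Gamma> | Strong \<Rightarrow> mod_strong \<Omega> Q \<Gamma>)"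


section \<open>Sobolev spaces\<close>

text \<open>An extended real function on the carpet is a total function of which only the values on the
  carpet are used.\<close>

definition sup_bd :: "(nat \<Rightarrow> complex set) \<Rightarrow> (complex \<Rightarrow> ereal) \<Rightarrow> nat \<Rightarrow> ereal" where
  "sup_bd Q g i = (SUP x\<in>frontier (Q i). g x)"

definition inf_bd :: "(nat \<Rightarrow> complex set) \<Rightarrow> (complex \<Rightarrow> ereal) \<Rightarrow> nat \<Rightarrow> ereal" where
  "inf_bd Q g i = (INF x\<in>frontier (Q i). g x)"

definition osc :: "(nat \<Rightarrow> complex set) \<Rightarrow> (complex \<Rightarrow> ereal) \<Rightarrow> nat \<Rightarrow> ennreal" where
  "osc Q g i = e2ennreal (sup_bd Q g i - inf_bd Q g i)"

definition upper_gradient ::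
  "version \<Rightarrow> complex set \<Rightarrow> (nat \<Rightarrow> complex set) \<Rightarrow> (nat \<Rightarrow> ennreal) \<Rightarrow> (complex \<Rightarrow> ereal) \<Rightarrow> bool"
  where
  "upper_gradient v \<Omega> Q \<rho> g \<longleftrightarrow>
     (\<exists>\<Gamma>0 \<subseteq> paths_in \<Omega>. carpet_modulus v \<Omega> Q \<Gamma>0 = 0 \<and>
        (\<forall>\<gamma> \<in> paths_in \<Omega> - \<Gamma>0. \<forall>x \<in> trace \<gamma> \<inter> carpet \<Omega> Q. \<forall>y \<in> trace \<gamma> \<inter> carpet \<Omega> Q.
           \<bar>g x\<bar> \<noteq> \<infinity> \<and> \<bar>g y\<bar> \<noteq> \<infinity> \<and>
           \<bar>g x - g y\<bar> \<le> enn2ereal (\<Sum>\<^sub>\<infinity>i\<in>meeting Q (trace \<gamma>). \<rho> i)))"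

definition finite_energy_on ::
  "(nat \<Rightarrow> complex set) \<Rightarrow> nat set \<Rightarrow> (complex \<Rightarrow> ereal) \<Rightarrow> bool" where
  "finite_energy_on Q I g \<longleftrightarrow>
     (\<Sum>\<^sub>\<infinity>i\<in>I. ennreal ((real_of_ereal (sup_bd Q g i))\<^sup>2 * (diameter (Q i))\<^sup>2)) < \<infinity> \<and>
     (\<Sum>\<^sub>\<infinity>i\<in>I. (osc Q g i)\<^sup>2) < \<infinity>"

definition sobolev_loc ::
  "version \<Rightarrow> complex set \<Rightarrow> (nat \<Rightarrow> complex set) \<Rightarrow> (complex \<Rightarrow> ereal) set" where
  "sobolev_loc v \<Omega> Q =
     {g. (\<forall>i. \<bar>sup_bd Q g i\<bar> \<noteq> \<infinity> \<and> \<bar>inf_bd Q g i\<bar> \<noteq> \<infinity>) \<and>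
         (\<forall>x r. 0 < r \<and> compactly_contained (ball x r) \<Omega> \<longrightarrow>
            finite_energy_on Q (meeting Q (ball x r)) g) \<and>
         upper_gradient v \<Omega> Q (osc Q g) g}"

definition sobolev ::
  "version \<Rightarrow> complex set \<Rightarrow> (nat \<Rightarrow> complex set) \<Rightarrow> (complex \<Rightarrow> ereal) set" where
  "sobolev v \<Omega> Q = {g \<in> sobolev_loc v \<Omega> Q. finite_energy_on Q UNIV g}"

definition dirichlet_energy ::
  "(nat \<Rightarrow> complex set) \<Rightarrow> complex set \<Rightarrow> (complex \<Rightarrow> ereal) \<Rightarrow> ennreal" where
  "dirichlet_energy Q V g = (\<Sum>\<^sub>\<infinity>i\<in>meeting Q V. (osc Q g i)\<^sup>2)"

definition carpet_harmonic ::
  "version \<Rightarrow> complex set \<Rightarrow> (nat \<Rightarrow> complex set) \<Rightarrow> (complex \<Rightarrow> ereal) \<Rightarrow> bool" where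
  "carpet_harmonic v \<Omega> Q u \<longleftrightarrow>
     u \<in> sobolev_loc v \<Omega> Q \<and>
     (\<forall>V \<zeta>. open V \<and> compactly_contained V \<Omega> \<and> \<zeta> \<in> sobolev v \<Omega> Q \<and>
            (\<forall>x \<in> carpet \<Omega> Q - V. \<zeta> x = 0) \<longrightarrow>
        dirichlet_energy Q V u \<le> dirichlet_energy Q V (\<lambda>x. u x + \<zeta> x))"


section \<open>Normalized functions\<close>

definition good_paths ::
  "complex set \<Rightarrow> (nat \<Rightarrow> complex set) \<Rightarrow> (complex \<Rightarrow> ereal) \<Rightarrow> cpath set" where
  "good_paths \<Omega> Q g =
     {\<gamma> \<in> paths_in \<Omega>.
        \<not> snd \<gamma> constant_on fst \<gamma> \<and>
        hausdorff1 (trace \<gamma> \<inter> carpet \<Omega> Q) = 0 \<and>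
        (\<forall>\<gamma>' \<in> subpaths \<gamma>. \<forall>i \<in> meeting Q (trace \<gamma>'). \<forall>j \<in> meeting Q (trace \<gamma>').
           \<bar>sup_bd Q g i - sup_bd Q g j\<bar> \<le> enn2ereal (\<Sum>\<^sub>\<infinity>l\<in>meeting Q (trace \<gamma>'). osc Q g l)) \<and>
        (\<forall>\<gamma>' \<in> subpaths \<gamma>. compactly_contained (trace \<gamma>') \<Omega> \<longrightarrow>
           (\<Sum>\<^sub>\<infinity>l\<in>meeting Q (trace \<gamma>'). osc Q g l) < \<infinity>) \<and>
        ((\<Sum>\<^sub>\<infinity>l\<in>UNIV. (osc Q g l)\<^sup>2) < \<infinity> \<longrightarrow>
           (\<Sum>\<^sub>\<infinity>l\<in>meeting Q (trace \<gamma>). osc Q g l) < \<infinity>)}"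

text \<open>\<open>access_path \<Omega> Q x \<gamma>0 \<gamma>\<close>: the point \<open>x\<close> is accessible by \<open>\<gamma>0\<close>, and \<open>\<gamma>\<close> is a path along which
  the value of the normalized version at \<open>x\<close> may be computed.\<close>

definition access_path ::
  "complex set \<Rightarrow> (nat \<Rightarrow> complex set) \<Rightarrow> complex \<Rightarrow> cpath \<Rightarrow> cpath \<Rightarrow> bool" where
  "access_path \<Omega> Q x \<gamma>0 \<gamma> \<longleftrightarrow>
     (if x \<in> trace \<gamma>0 \<inter> carpet_interior \<Omega> Q then \<gamma> = \<gamma>0
      else x \<in> carpet \<Omega> Q \<and> \<gamma> \<in> open_subpaths \<gamma>0 \<and> x \<in> closure (trace \<gamma>) - trace \<gamma> \<and>
           (\<forall>i. x \<in> frontier (Q i) \<longrightarrow> trace \<gamma> \<inter> Q i = {}))"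

definition accessible ::
  "complex set \<Rightarrow> (nat \<Rightarrow> complex set) \<Rightarrow> (complex \<Rightarrow> ereal) \<Rightarrow> complex set" where
  "accessible \<Omega> Q g = {x. \<exists>\<gamma>0 \<in> good_paths \<Omega> Q g. \<exists>\<gamma>. access_path \<Omega> Q x \<gamma>0 \<gamma>}"

text \<open>\<open>Q i \<rightarrow> x\<close> along the disks meeting \<open>\<gamma>\<close>: the disks lie in arbitrarily small balls around \<open>x\<close>.\<close>

definition disks_to :: "(nat \<Rightarrow> complex set) \<Rightarrow> cpath \<Rightarrow> complex \<Rightarrow> nat filter" where
  "disks_to Q \<gamma> x = (INF e\<in>{0<..}. principal {i \<in> meeting Q (trace \<gamma>). Q i \<subseteq> ball x e})"

text \<open>The value does not depend on the path chosen.\<close>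

definition accessible_value ::
  "complex set \<Rightarrow> (nat \<Rightarrow> complex set) \<Rightarrow> (complex \<Rightarrow> ereal) \<Rightarrow> complex \<Rightarrow> ereal" where
  "accessible_value \<Omega> Q g x =
     (let \<gamma> = (SOME \<gamma>. \<exists>\<gamma>0 \<in> good_paths \<Omega> Q g. access_path \<Omega> Q x \<gamma>0 \<gamma>)
      in Liminf (disks_to Q \<gamma> x) (sup_bd Q g))"

text \<open>The disk with a given boundary point is unique since closures of peripheral disks are
  disjoint.\<close>

definition normalized_version ::
  "complex set \<Rightarrow> (nat \<Rightarrow> complex set) \<Rightarrow> (complex \<Rightarrow> ereal) \<Rightarrow> complex \<Rightarrow> ereal" where
  "normalized_version \<Omega> Q g x =
     (if x \<in> accessible \<Omega> Q g then accessible_value \<Omega> Q g x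
      else if \<exists>i. x \<in> frontier (Q i)
      then Liminf (at x within (frontier (Q (THE i. x \<in> frontier (Q i))) \<inter> accessible \<Omega> Q g))
             (accessible_value \<Omega> Q g)
      else Liminf (at x within accessible \<Omega> Q g) (accessible_value \<Omega> Q g))"

definition normalized ::
  "version \<Rightarrow> complex set \<Rightarrow> (nat \<Rightarrow> complex set) \<Rightarrow> (complex \<Rightarrow> ereal) \<Rightarrow> bool" where
  "normalized v \<Omega> Q u \<longleftrightarrow>
     (\<exists>g \<in> sobolev_loc v \<Omega> Q. \<forall>x \<in> carpet \<Omega> Q. u x = normalized_version \<Omega> Q g x)"

end

theory Submission
  imports Defs
begin

text \<open>Suppose \<open>sup u\<close> over \<open>S \<inter> frontier V\<close> is less than \<open>a < u x\<close> with \<open>x \<in> S \<inter> V\<close>, and let \<open>\<psi>\<close> be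
  \<open>min (max (u - a) 0) 1\<close> on \<open>V\<close> and \<open>0\<close> elsewhere. Comparing \<open>u\<close> with \<open>u - \<psi>\<close>, minimality forces
  \<open>\<psi>\<close> to have no oscillation on any peripheral disk, except on those whose boundary leaves \<open>V\<close> while
  reaching a value of \<open>u\<close> above \<open>a\<close> inside \<open>V\<close>. Once \<open>u\<close> is known to be continuous, compactness of
  \<open>S \<inter> frontier V\<close> leaves only finitely many such exceptional disks. A Sobolev function without
  oscillation off finitely many disks is constant on the boundaries of the remaining ones: the upper
  gradient inequality holds along almost every square loop, and by Janiszewski's theorem \<open>\<Omega>\<close> stays
  connected when the closures of the exceptional disks are removed. This contradicts \<open>\<psi> = 0\<close> off \<open>V\<close>
  and \<open>\<psi> > 0\<close> near \<open>x\<close>.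

  Continuity at \<open>p\<close> is the same argument on a small region around \<open>p\<close>, on whose boundary \<open>u\<close> hardly
  varies since the sum of the oscillations along a suitable square loop is small. If \<open>p\<close> lies on the
  boundary of a disk, the loop may run through that disk, and the region is then bounded by an arc of
  the loop and a part of the disk.

  Normalization enters only in that \<open>u\<close> is approximated at each point of \<open>S\<close> by its values on the
  boundaries of small disks nearby. The infimum is the supremum of \<open>- u\<close>.\<close>

section \<open>Sums over disks\<close>

text \<open>Membership in the Sobolev space demands that the oscillations of the function itself
  form an upper gradient. For \<open>\<psi>\<close> the direct estimate gives only twice the
  oscillations of \<open>u\<close>, since a path may leave V inside a disk whose boundary curve
  meets the frontier of V away from the path. Loop erasure repairs this: an estimate on all
  subpaths, with a weight summable along the path, improves to any smaller weight that bounds the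
  jumps on the boundary curves. The weak and the strong version are treated together. What enters
  about the modulus is that null families are stable under countable unions and under passing to
  paths with a subpath in the family, that paths with infinite sum of a square-summable weight form
  a null family, that for almost every radius all arcs of a square loop avoid a given null family,
  and that constant paths at carpet points are never exceptional. Continuity has to precede the
  maximum principle, since exceptional disks could otherwise occur at all small scales along the
  frontier of V. In the local argument the region reaches into the disk at p, so that its frontier
  meets S only on the arc where \<open>u\<close> hardly varies.\<close>

lemma ennreal_summable_on: "(f :: 'a \<Rightarrow> ennreal) summable_on A"
  by (rule nonneg_summable_on_complete) simp

text \<open>Sums over index sets become series, for which termwise integration and the comparison
  rules of measure theory are at hand.\<close>

lemma infsum_ennreal_suminf:
  fixes f :: "nat \<Rightarrow> ennreal"
  shows "infsum f A = (\<Sum>n. if n \<in> A then f n else 0)"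
proof -
  let ?g = "\<lambda>n. if n \<in> A then f n else 0"
  have "infsum f A = (SUP F\<in>{F. finite F \<and> F \<subseteq> A}. sum f F)"
    by (rule nonneg_infsum_complete) auto
  also have "\<dots> = (SUP n. sum ?g {..<n})"
  proof (rule antisym)
    show "(SUP F\<in>{F. finite F \<and> F \<subseteq> A}. sum f F) \<le> (SUP n. sum ?g {..<n})"
    proof (rule SUP_least, clarify)
      fix F assume F: "finite F" "F \<subseteq> A"
      then obtain n where n: "F \<subseteq> {..<n}"
        using finite_nat_iff_bounded by auto
      have "sum f F = sum ?g F" using F by (intro sum.cong) auto
      also have "\<dots> \<le> sum ?g {..<n}" using n by (intro sum_mono2) auto
      also have "\<dots> \<le> (SUP n. sum ?g {..<n})" by (rule SUP_upper) simp
      finally show "sum f F \<le> (SUP n. sum ?g {..<n})" .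
    qed
    show "(SUP n. sum ?g {..<n}) \<le> (SUP F\<in>{F. finite F \<and> F \<subseteq> A}. sum f F)"
    proof (rule SUP_least)
      fix n
      have "sum ?g {..<n} = sum f ({..<n} \<inter> A)" by (simp add: sum.inter_restrict)
      also have "\<dots> \<le> (SUP F\<in>{F. finite F \<and> F \<subseteq> A}. sum f F)"
        by (rule SUP_upper) auto
      finally show "sum ?g {..<n} \<le> (SUP F\<in>{F. finite F \<and> F \<subseteq> A}. sum f F)" .
    qed
  qed
  also have "\<dots> = (\<Sum>n. ?g n)" by (simp add: suminf_eq_SUP)
  finally show ?thesis .
qed

lemma infsum_ennreal_mono:
  fixes f g :: "nat \<Rightarrow> ennreal"
  assumes "A \<subseteq> B" "\<And>i. i \<in> A \<Longrightarrow> f i \<le> g i"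
  shows "infsum f A \<le> infsum g B"
  using assms by (intro infsum_mono_neutral) (auto intro: ennreal_summable_on)

lemma infsum_ennreal_ge:
  fixes f :: "nat \<Rightarrow> ennreal"
  assumes "i \<in> A" shows "f i \<le> infsum f A"
  using infsum_ennreal_mono[of "{i}" A f f] assms by simp

lemma infsum_ennreal_add:
  fixes f g :: "nat \<Rightarrow> ennreal"
  shows "(\<Sum>\<^sub>\<infinity>i\<in>A. f i + g i) = infsum f A + infsum g A"
  by (rule infsum_add) (rule ennreal_summable_on)+

lemma infsum_ennreal_cmult:
  fixes f :: "nat \<Rightarrow> ennreal"
  shows "(\<Sum>\<^sub>\<infinity>i\<in>A. c * f i) = c * infsum f A"
  unfolding infsum_ennreal_suminf ennreal_suminf_cmult[symmetric] by (intro suminf_cong) auto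

lemma infsum_ennreal_Un_le:
  fixes f :: "nat \<Rightarrow> ennreal"
  shows "infsum f (A \<union> B) \<le> infsum f A + infsum f B"
proof -
  have "infsum f (A \<union> B) = infsum f (A \<union> (B - A))" by simp
  also have "\<dots> = infsum f A + infsum f (B - A)" by (rule infsum_Un_disjoint) (auto intro: ennreal_summable_on)
  also have "\<dots> \<le> infsum f A + infsum f B" by (intro add_left_mono infsum_ennreal_mono) auto
  finally show ?thesis .
qed

lemma infsum_ennreal_UN_finite_less_top:
  fixes f :: "nat \<Rightarrow> ennreal"
  assumes "finite F" "\<And>k. k \<in> F \<Longrightarrow> infsum f (A k) < \<infinity>" "B \<subseteq> (\<Union>k\<in>F. A k)"
  shows "infsum f B < \<infinity>"
proof -
  have "infsum f (\<Union>k\<in>F. A k) < \<infinity>"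
    using assms(1,2)
  proof (induction F)
    case (insert k F)
    have "infsum f (\<Union>k\<in>insert k F. A k) \<le> infsum f (A k) + infsum f (\<Union>k\<in>F. A k)"
      using infsum_ennreal_Un_le by simp
    also have "\<dots> < \<infinity>" using insert by simp
    finally show ?case .
  qed simp
  then show ?thesis using infsum_ennreal_mono[OF assms(3), of f f] by (meson order_le_less_trans order_refl)
qed

lemma infsum_ennreal_tail:
  fixes f :: "nat \<Rightarrow> ennreal"
  assumes "infsum f A < \<infinity>" "0 < e"
  obtains F where "finite F" "F \<subseteq> A" "infsum f (A - F) < e"
proof -
  obtain t where t: "infsum f A = ennreal t" "0 \<le> t"
    using assms(1) by (cases "infsum f A") auto
  \<comment> \<open>\<open>e\<close> may be infinite and is replaced by a finite bound.\<close>
  obtain e' where e': "0 < e'" "ennreal e' \<le> e"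
    using assms(2) by (cases e) (auto intro: that[of 1])
  have "\<exists>F. finite F \<and> F \<subseteq> A \<and> infsum f A < sum f F + ennreal e'"
  \<comment> \<open>For \<open>t = 0\<close> there is no level strictly below the sum for a finite
    partial sum to exceed.\<close>
  proof (cases "t = 0")
    case True
    then show ?thesis using t e' by (intro exI[of _ "{}"]) auto
  next
    case False
    have "ennreal (max 0 (t - e' / 2)) < infsum f A"
      using t e' False by (auto simp: ennreal_less_iff)
    also have "infsum f A = (SUP F\<in>{F. finite F \<and> F \<subseteq> A}. sum f F)"
      by (rule nonneg_infsum_complete) auto
    finally obtain F where F: "finite F" "F \<subseteq> A" "ennreal (max 0 (t - e' / 2)) < sum f F"
      by (auto simp: less_SUP_iff)
    have "infsum f A < ennreal (max 0 (t - e' / 2)) + ennreal e'"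
      using t e' by (simp add: ennreal_plus[symmetric] ennreal_less_iff del: ennreal_plus)
    also have "\<dots> \<le> sum f F + ennreal e'" using F by (intro add_right_mono) simp
    finally show ?thesis using F by blast
  qed
  then obtain F where F: "finite F" "F \<subseteq> A" "infsum f A < sum f F + ennreal e'" by blast
  have "infsum f A = infsum f (F \<union> (A - F))" using F by (simp add: Un_absorb1)
  also have "\<dots> = infsum f F + infsum f (A - F)"
    by (rule infsum_Un_disjoint) (auto intro: ennreal_summable_on)
  finally have "sum f F + infsum f (A - F) < sum f F + ennreal e'" using F by simp
  then have "infsum f (A - F) < ennreal e'" by (meson add_left_mono not_le)
  then show ?thesis using F e' that[of F] by (meson order_less_le_trans)
qed

lemma finite_ge_of_infsum_less_top:
  fixes f :: "nat \<Rightarrow> ennreal"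
  assumes "infsum f A < \<infinity>" "0 < e"
  shows "finite {i\<in>A. e \<le> f i}"
proof (rule ccontr)
  assume "infinite {i\<in>A. e \<le> f i}"
  then have "infsum f {i\<in>A. e \<le> f i} = \<infinity>"
    using assms by (intro infsum_superconst_infinite_ennreal[of _ e]) auto
  with infsum_ennreal_mono[of "{i\<in>A. e \<le> f i}" A f f] assms show False by auto
qed

lemma infsum_le_of_finite_sums:
  fixes f :: "nat \<Rightarrow> ennreal"
  assumes "\<And>F. finite F \<Longrightarrow> F \<subseteq> A \<Longrightarrow> sum f F \<le> c"
  shows "infsum f A \<le> c"
  by (subst nonneg_infsum_complete) (auto intro!: SUP_least assms)

section \<open>Topology and area packing of the peripheral disks\<close>

locale rel_carpet =
  fixes \<Omega> :: "complex set" and Q :: "nat \<Rightarrow> complex set"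
  assumes carpet: "relative_carpet \<Omega> Q"
begin

abbreviation S where "S \<equiv> carpet \<Omega> Q"

lemma open_Omega: "open \<Omega>" and connected_Omega: "connected \<Omega>"
  and jordan_Q: "jordan_region (Q i)" and cc_Q: "compactly_contained (Q i) \<Omega>"
  and disjoint_closures: "i \<noteq> j \<Longrightarrow> closure (Q i) \<inter> closure (Q j) = {}"
  and interior_S: "interior S = {}" and null_S: "emeasure lborel S = 0"
  using carpet unfolding relative_carpet_def by auto

text \<open>The Jordan curve theorem in one package: the same curve is the frontier of the disk and
  of its exterior. The crosscuts work on the exterior side.\<close>

lemma jordan_QE:
  obtains c where "simple_path c" "pathfinish c = pathstart c" "Q i = inside (path_image c)"
    "frontier (Q i) = path_image c" "- closure (Q i) = outside (path_image c)"
    "frontier (outside (path_image c)) = path_image c"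
proof -
  obtain c where c: "simple_path c" "pathfinish c = pathstart c" "Q i = inside (path_image c)"
    using jordan_Q[of i] unfolding jordan_region_def by auto
  note J = Jordan_inside_outside[OF c(1,2)]
  have f: "frontier (Q i) = path_image c" using J c by auto
  have "- closure (Q i) = - (inside (path_image c) \<union> path_image c)"
    using f c(3) by (metis closure_Un_frontier)
  also have "\<dots> = outside (path_image c)" using J by blast
  finally show ?thesis using that c f J by auto
qed

lemma open_Q: "open (Q i)" and connected_Q: "connected (Q i)" and Q_ne: "Q i \<noteq> {}"
  and bounded_Q: "bounded (Q i)"
  using jordan_QE[of i] Jordan_inside_outside by metis+

lemma connected_frontier_Q: "connected (frontier (Q i))"
  by (metis connected_simple_path_image jordan_QE)

lemma frontier_Q_ne: "frontier (Q i) \<noteq> {}"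
  by (metis jordan_QE path_image_nonempty)

lemma connected_compl_closure_Q: "connected (- closure (Q i))"
  by (metis jordan_QE Jordan_inside_outside)

lemma frontier_subset_closure_outside: "frontier (Q i) \<subseteq> closure (- closure (Q i))"
  by (metis jordan_QE frontier_def Diff_subset)

lemma closure_Q_subset: "closure (Q i) \<subseteq> \<Omega>" and compact_closure_Q: "compact (closure (Q i))"
  using cc_Q unfolding compactly_contained_def by auto

lemma Q_subset: "Q i \<subseteq> \<Omega>" using closure_Q_subset[of i] closure_subset[of "Q i"] by blast

lemma compact_frontier_Q: "compact (frontier (Q i))"
  using compact_frontier_bounded[OF bounded_Q] .

lemma frontier_Q_eq: "frontier (Q i) = closure (Q i) - Q i"
  by (simp add: frontier_def interior_open open_Q)

lemma disjoint_Q: "i \<noteq> j \<Longrightarrow> Q i \<inter> Q j = {}"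
  using disjoint_closures[of i j] closure_subset[of "Q i"] closure_subset[of "Q j"] by blast

lemma closure_Q_disjoint_Q: "i \<noteq> j \<Longrightarrow> closure (Q i) \<inter> Q j = {}"
  using disjoint_closures[of i j] closure_subset[of "Q j"] by blast

lemma frontier_Q_subset_S: "frontier (Q i) \<subseteq> S"
proof
  fix x assume x: "x \<in> frontier (Q i)"
  have "x \<notin> Q j" for j
    using x closure_Q_disjoint_Q[of i j] by (cases "i = j") (auto simp: frontier_Q_eq)
  then show "x \<in> S" using x closure_Q_subset by (auto simp: carpet_def frontier_Q_eq)
qed

lemma frontier_Q_unique: "x \<in> frontier (Q i) \<Longrightarrow> x \<in> frontier (Q j) \<Longrightarrow> i = j"
  using disjoint_closures[of i j] by (auto simp: frontier_Q_eq)

lemma S_or_Q: "x \<in> \<Omega> \<Longrightarrow> x \<in> S \<or> (\<exists>i. x \<in> Q i)"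
  by (auto simp: carpet_def)

lemma S_not_Q: "x \<in> S \<Longrightarrow> x \<notin> Q i" and S_subset: "S \<subseteq> \<Omega>"
  by (auto simp: carpet_def)

lemma compact_Int_S:
  assumes "compact K" "K \<subseteq> \<Omega>" shows "compact (K \<inter> S)"
proof -
  have "K \<inter> S = K - (\<Union>i. Q i)" using assms by (auto simp: carpet_def)
  then show ?thesis using assms open_Q by (simp add: compact_diff open_UN)
qed

lemma diameter_Q_pos: "0 < diameter (Q i)"
proof -
  obtain x where x: "x \<in> Q i" using Q_ne by blast
  then obtain e where e: "0 < e" "ball x e \<subseteq> Q i" using open_Q open_contains_ball by metis
  have "0 < diameter (ball x e)" using e by (simp add: diameter_ball)
  also have "\<dots> \<le> diameter (Q i)" using e bounded_Q by (intro diameter_subset)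
  finally show ?thesis .
qed

text \<open>Area packing: by fatness each disk meeting \<open>ball p R\<close> fills, inside
  \<open>ball p (2 * R)\<close>, an area comparable to its squared diameter truncated at
  \<open>R\<close>, and the disks are disjoint. A disk much larger than \<open>R\<close> can only be
  charged about \<open>R^2\<close>, hence the minimum.\<close>

lemma sum_min_diameter:
  obtains C where "0 < C" and "\<And>p R. 0 < R \<Longrightarrow>
    (\<Sum>\<^sub>\<infinity>i\<in>meeting Q (ball p R). ennreal ((min (diameter (Q i)) R)\<^sup>2)) \<le> ennreal (C * R\<^sup>2)"
proof -
  obtain K where K: "K > 0" "\<And>i x r. x \<in> Q i \<Longrightarrow> 0 < r \<Longrightarrow> r < diameter (Q i) \<Longrightarrow>
        emeasure lborel (ball x r \<inter> Q i) \<ge> ennreal (K * r\<^sup>2)"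
    using carpet unfolding relative_carpet_def by blast
  have "(\<Sum>\<^sub>\<infinity>i\<in>meeting Q (ball p R). ennreal ((min (diameter (Q i)) R)\<^sup>2)) \<le> ennreal ((16 * pi / K) * R\<^sup>2)"
    if R: "0 < R" for p R
  proof (rule infsum_le_of_finite_sums)
    fix F assume F: "finite F" "F \<subseteq> meeting Q (ball p R)"
    let ?m = "\<lambda>i. min (diameter (Q i)) R"
    have "ennreal (K / 4) * ennreal ((?m i)\<^sup>2) \<le> emeasure lborel (ball p (2*R) \<inter> Q i)" if i: "i \<in> F" for i
    proof -
      obtain x where x: "x \<in> Q i" "x \<in> ball p R" using F i unfolding meeting_def by blast
      have m: "0 < ?m i" using R diameter_Q_pos by simp
      \<comment> \<open>Half of the truncated diameter is a radius strictly below the diameter, as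
        fatness requires, and keeps the ball around \<open>x\<close> inside
        \<open>ball p (2 * R)\<close>.\<close>
      have "ennreal (K / 4) * ennreal ((?m i)\<^sup>2) = ennreal (K * (?m i / 2)\<^sup>2)"
        using K by (subst ennreal_mult[symmetric]) (auto simp: power2_eq_square)
      also have "\<dots> \<le> emeasure lborel (ball x (?m i / 2) \<inter> Q i)"
        using m x by (intro K) (auto simp: min_def split: if_splits)
      also have "\<dots> \<le> emeasure lborel (ball p (2*R) \<inter> Q i)"
      proof (rule emeasure_mono)
        have "dist p y < 2 * R" if "dist x y < ?m i / 2" for y
        proof -
          have "dist p y \<le> dist p x + dist x y" by (rule dist_triangle)
          also have "\<dots> < 2 * R" using that x R by (auto simp: min_def split: if_splits)
          finally show ?thesis .
        qed
        then show "ball x (?m i / 2) \<inter> Q i \<subseteq> ball p (2*R) \<inter> Q i" by auto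
      qed (simp add: open_Q borel_open)
      finally show ?thesis .
    qed
    then have "ennreal (K / 4) * (\<Sum>i\<in>F. ennreal ((?m i)\<^sup>2)) \<le> (\<Sum>i\<in>F. emeasure lborel (ball p (2*R) \<inter> Q i))"
      by (subst sum_distrib_left) (rule sum_mono)
    also have "\<dots> = emeasure lborel (\<Union>i\<in>F. ball p (2*R) \<inter> Q i)"
      using F disjoint_Q by (intro sum_emeasure) (auto simp: open_Q borel_open disjoint_family_on_def)
    also have "\<dots> \<le> emeasure lborel (ball p (2*R))"
      by (intro emeasure_mono) auto
    also have "\<dots> = ennreal (pi * (2*R)\<^sup>2)"
      using R by (simp add: emeasure_ball unit_ball_vol_2)
    finally have *: "ennreal (K / 4) * (\<Sum>i\<in>F. ennreal ((?m i)\<^sup>2)) \<le> ennreal (pi * (2*R)\<^sup>2)" .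
    have "(\<Sum>i\<in>F. ennreal ((?m i)\<^sup>2)) = ennreal (4 / K) * (ennreal (K / 4) * (\<Sum>i\<in>F. ennreal ((?m i)\<^sup>2)))"
      using K by (simp add: mult.assoc[symmetric] ennreal_mult[symmetric])
    also have "\<dots> \<le> ennreal (4 / K) * ennreal (pi * (2*R)\<^sup>2)"
      using * by (rule mult_left_mono) simp
    also have "\<dots> = ennreal ((16 * pi / K) * R\<^sup>2)"
      using K by (subst ennreal_mult[symmetric]) (auto simp: power2_eq_square)
    finally show "(\<Sum>i\<in>F. ennreal ((?m i)\<^sup>2)) \<le> ennreal ((16 * pi / K) * R\<^sup>2)" .
  qed
  moreover have "0 < 16 * pi / K" using K by simp
  ultimately show ?thesis using that by blast
qed

text \<open>Once the radius of the surrounding ball is at least \<open>d\<close>, the truncated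
  diameter of a large disk is still at least \<open>d\<close>, and infinitely many of them would
  contradict area packing.\<close>

lemma finite_large_disks:
  assumes "bounded B" "0 < d"
  shows "finite {i \<in> meeting Q B. d \<le> diameter (Q i)}"
proof -
  obtain C where C: "0 < C" "\<And>p R. 0 < R \<Longrightarrow>
    (\<Sum>\<^sub>\<infinity>i\<in>meeting Q (ball p R). ennreal ((min (diameter (Q i)) R)\<^sup>2)) \<le> ennreal (C * R\<^sup>2)"
    using sum_min_diameter by blast
  obtain R0 where "B \<subseteq> ball 0 R0" using bounded_subset_ballD[OF assms(1)] by blast
  then have R: "B \<subseteq> ball 0 (max R0 d)" "0 < max R0 d" using assms by auto
  let ?R = "max R0 d"
  have "finite {i\<in>meeting Q (ball 0 ?R). ennreal (d\<^sup>2) \<le> ennreal ((min (diameter (Q i)) ?R)\<^sup>2)}"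
    using C(2)[OF R(2), of 0] assms
    by (intro finite_ge_of_infsum_less_top) (auto intro: order_le_less_trans)
  then show ?thesis
  proof (rule rev_finite_subset, safe)
    fix i assume "i \<in> meeting Q B" "d \<le> diameter (Q i)"
    then show "i \<in> meeting Q (ball 0 ?R)" "ennreal (d\<^sup>2) \<le> ennreal ((min (diameter (Q i)) ?R)\<^sup>2)"
      using R assms by (auto simp: meeting_def intro!: ennreal_leI power_mono)
  qed
qed

lemma dist_le_diameter_Q:
  assumes "x \<in> closure (Q i)" "y \<in> closure (Q i)" shows "dist x y \<le> diameter (Q i)"
  using diameter_bounded_bound[of "closure (Q i)" x y] assms bounded_Q
  by (simp add: diameter_closure bounded_closure)

lemma finite_disks_near:
  assumes "finite F"
  obtains e where "0 < e" "\<And>i. i \<in> F \<Longrightarrow> x \<notin> closure (Q i) \<Longrightarrow> ball x e \<inter> closure (Q i) = {}"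
    "\<And>i. i \<in> F \<Longrightarrow> \<not> Q i \<subseteq> ball x e"
proof -
  have "\<exists>e>0. \<forall>i\<in>F. (x \<notin> closure (Q i) \<longrightarrow> ball x e \<inter> closure (Q i) = {}) \<and> \<not> Q i \<subseteq> ball x e"
    using assms
  proof (induction F)
    case empty show ?case by (auto intro: exI[of _ 1])
  next
    case (insert i F)
    then obtain e where e: "e>0" "\<forall>i\<in>F. (x \<notin> closure (Q i) \<longrightarrow> ball x e \<inter> closure (Q i) = {}) \<and> \<not> Q i \<subseteq> ball x e"
      by blast
    obtain e1 where e1: "e1 > 0" "x \<notin> closure (Q i) \<longrightarrow> ball x e1 \<inter> closure (Q i) = {}"
    proof (cases "x \<in> closure (Q i)")
      case False
      then have "x \<in> - closure (Q i)" "open (- closure (Q i))" by auto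
      then obtain e where "e > 0" "ball x e \<subseteq> - closure (Q i)" using open_contains_ball by metis
      then show ?thesis by (intro that[of e]) auto
    qed (auto intro: that[of 1])
    have d: "0 < diameter (Q i)" by (rule diameter_Q_pos)
    \<comment> \<open>A ball of radius at most a quarter of the diameter is too small to contain the
      disk; this also covers disks with \<open>x\<close> in their closure.\<close>
    define e' where "e' = min e (min e1 (diameter (Q i) / 4))"
    have "\<not> Q i \<subseteq> ball x e'"
    proof
      assume "Q i \<subseteq> ball x e'"
      then have "diameter (Q i) \<le> diameter (ball x e')" by (intro diameter_subset) auto
      also have "\<dots> = 2 * e'" using d e e1 by (auto simp: diameter_ball e'_def)
      finally show False using d by (auto simp: e'_def min_def split: if_splits)
    qed
    moreover have "e' > 0" "ball x e' \<subseteq> ball x e" "ball x e' \<subseteq> ball x e1"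
      using e e1 d by (auto simp: e'_def)
    ultimately show ?case using e e1 by (intro exI[of _ e']) blast
  qed
  then show ?thesis using that by blast
qed

end

section \<open>Square loops\<close>

text \<open>Squares rather than circles, as the sides of concentric squares sweep out the plane by
  translations up to isometry and Fubini's theorem suffices.\<close>

definition sqn :: "complex \<Rightarrow> real" where
  "sqn z = max \<bar>Re z\<bar> \<bar>Im z\<bar>"

lemma sqn_nonneg [simp]: "0 \<le> sqn z" by (simp add: sqn_def)

lemma sqn_0_iff [simp]: "sqn z = 0 \<longleftrightarrow> z = 0"
  by (auto simp: sqn_def complex_eq_iff max_def split: if_splits)

lemma sqn_le_norm: "sqn z \<le> norm z"
  by (simp add: sqn_def abs_Re_le_cmod abs_Im_le_cmod)

lemma norm_le_sqn: "norm z \<le> 2 * sqn z"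
  using cmod_le[of z] by (simp add: sqn_def)

lemma sqn_triangle: "sqn (x + y) \<le> sqn x + sqn y"
  by (auto simp: sqn_def)

lemma sqn_minus_commute: "sqn (x - y) = sqn (y - x)"
  by (simp add: sqn_def abs_minus_commute)

lemma sqn_Lipschitz: "\<bar>sqn x - sqn y\<bar> \<le> dist x y"
proof -
  have "sqn x \<le> sqn (x - y) + sqn y" "sqn y \<le> sqn (y - x) + sqn x"
    using sqn_triangle[of "x - y" y] sqn_triangle[of "y - x" x] by simp_all
  then show ?thesis using sqn_le_norm[of "x - y"] by (simp add: sqn_minus_commute dist_norm)
qed

lemma sqn_mult_of_real [simp]: "sqn (of_real r * z) = \<bar>r\<bar> * sqn z"
  by (simp add: sqn_def abs_mult max_mult_distrib_left)

lemma sqn_ii_power [simp]: "sqn (\<i> ^ m * z) = sqn z"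
proof (induction m)
  case (Suc m)
  have "sqn (\<i> ^ Suc m * z) = sqn (\<i> * (\<i> ^ m * z))" by (simp add: mult.assoc)
  also have "\<dots> = sqn (\<i> ^ m * z)" by (simp add: sqn_def max.commute)
  finally show ?case using Suc by simp
qed simp

lemma continuous_on_sqn [continuous_intros]:
  "continuous_on A f \<Longrightarrow> continuous_on A (\<lambda>x. sqn (f x))"
  unfolding sqn_def by (intro continuous_intros)

text \<open>The unit square is run through twice at unit speed on \<open>{0..16}\<close>, so that every arc of it is the
  image of a parameter interval.\<close>

definition kappa :: "real \<Rightarrow> complex" where
  "kappa t = (let m = nat (round (t / 2)) in \<i> ^ m * Complex 1 (t - 2 * real m))"

text \<open>At a corner two values of \<open>m\<close> qualify. The two formulas agree there, so any
  admissible side may be used and the rounding convention never matters.\<close>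

lemma kappa_side:
  assumes "0 \<le> t" "\<bar>t - 2 * real m\<bar> \<le> 1"
  shows "kappa t = \<i> ^ m * Complex 1 (t - 2 * real m)"
proof -
  define n where "n = nat (round (t / 2))"
  have "0 \<le> round (t / 2)" using assms(1) by (metis divide_nonneg_nonneg round_0 round_mono zero_le_numeral)
  then have "real n = of_int (round (t / 2))" by (simp add: n_def)
  then have n: "\<bar>t - 2 * real n\<bar> \<le> 1" using of_int_round_abs_le[of "t / 2"] by linarith
  then consider "n = m" | "n = Suc m" | "m = Suc n" using assms(2) by linarith
  then have "\<i> ^ n * Complex 1 (t - 2 * real n) = \<i> ^ m * Complex 1 (t - 2 * real m)"
  proof cases
    case 2
    then have t: "t = 2 * real m + 1" using n assms(2) by linarith
    have "\<i> * Complex 1 (t - 2 * real n) = Complex 1 (t - 2 * real m)"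
      using 2 t by (simp add: complex_eq_iff)
    then show ?thesis using 2 by (simp add: mult.assoc mult.left_commute)
  next
    case 3
    then have t: "t = 2 * real n + 1" using n assms(2) by linarith
    have "\<i> * Complex 1 (t - 2 * real m) = Complex 1 (t - 2 * real n)"
      using 3 t by (simp add: complex_eq_iff)
    then show ?thesis using 3 by (simp add: mult.assoc mult.left_commute)
  qed simp
  then show ?thesis by (simp add: kappa_def Let_def n_def)
qed

lemma side_exists:
  assumes "0 \<le> (t::real)" obtains m :: nat where "\<bar>t - 2 * real m\<bar> \<le> 1"
proof (rule that)
  have "0 \<le> round (t / 2)" using assms by (metis divide_nonneg_nonneg round_0 round_mono zero_le_numeral)
  then have "real (nat (round (t / 2))) = of_int (round (t / 2))" by simp
  then show "\<bar>t - 2 * real (nat (round (t / 2)))\<bar> \<le> 1" using of_int_round_abs_le[of "t / 2"] by linarith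
qed

lemma sqn_kappa [simp]:
  assumes "0 \<le> t" shows "sqn (kappa t) = 1"
proof -
  obtain m where "\<bar>t - 2 * real m\<bar> \<le> 1" using side_exists[OF assms] .
  moreover from this have "sqn (Complex 1 (t - 2 * real m)) = 1" by (simp add: sqn_def)
  ultimately show ?thesis by (simp only: kappa_side[OF assms] sqn_ii_power)
qed

lemma kappa_dist_side:
  assumes "0 \<le> s" "0 \<le> t" "\<bar>s - 2 * real m\<bar> \<le> 1" "\<bar>t - 2 * real m\<bar> \<le> 1"
  shows "dist (kappa s) (kappa t) = \<bar>s - t\<bar>"
proof -
  have "kappa s - kappa t = \<i> ^ m * (Complex 0 (s - t))"
    using kappa_side[OF assms(1,3)] kappa_side[OF assms(2,4)]
    by (simp add: algebra_simps complex_eq_iff flip: right_diff_distrib)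
  then show ?thesis by (simp add: dist_norm norm_mult norm_power complex_norm)
qed

text \<open>The map is isometric on each closed side, and the sides are glued. Nine indices occur
  because \<open>{0..16}\<close> starts and ends in the middle of a side.\<close>

lemma kappa_lipschitz: "1-lipschitz_on {0..16} kappa"
proof (rule lipschitz_on_closed_Union[where I="{0..8::nat}" and U="\<lambda>m. {0..} \<inter> {2 * real m - 1..2 * real m + 1}"])
  fix m :: nat
  show "1-lipschitz_on ({0..} \<inter> {2 * real m - 1..2 * real m + 1}) kappa"
    by (rule lipschitz_onI) (use kappa_dist_side[where m=m] in \<open>auto simp: dist_real_def\<close>)
next
  show "{0..16} \<subseteq> (\<Union>m\<in>{0..8::nat}. {0..} \<inter> {2 * real m - 1..2 * real m + 1})"
  proof
    fix t :: real assume t: "t \<in> {0..16}"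
    then obtain m :: nat where m: "\<bar>t - 2 * real m\<bar> \<le> 1" using side_exists by auto
    then have "m \<in> {0..8}" using t by auto
    with m t show "t \<in> (\<Union>m\<in>{0..8::nat}. {0..} \<inter> {2 * real m - 1..2 * real m + 1})" by force
  qed
qed (auto intro: closed_Int)

text \<open>Within one turn of length 8 the sides of \<open>s\<close> and \<open>t\<close> are at
  most four steps apart. Adjacent sides share only their corner, opposite sides are disjoint, and a
  coincidence after three or four steps would need the full turn \<open>t = s + 8\<close>.\<close>

lemma kappa_inj:
  assumes "0 \<le> s" "s \<le> t" "t < s + 8" "kappa s = kappa t"
  shows "s = t"
proof -
  have t0: "0 \<le> t" using assms by linarith
  obtain m :: nat where m: "\<bar>s - 2 * real m\<bar> \<le> 1" using side_exists assms by auto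
  show ?thesis
  proof (cases "\<bar>t - 2 * real m\<bar> \<le> 1")
    case True
    then show ?thesis using kappa_dist_side[OF assms(1) t0 m] assms(4) by simp
  next
    case False
    obtain n :: nat where n: "\<bar>t - 2 * real n\<bar> \<le> 1" using side_exists t0 by auto
    have mn: "m < n" using False m n assms(2) by linarith
    have "n - m < 5" using m n assms(3) by linarith
    have eq: "\<i> ^ m * Complex 1 (s - 2 * real m) = \<i> ^ m * (\<i> ^ (n - m) * Complex 1 (t - 2 * real n))"
      using kappa_side[OF assms(1) m] kappa_side[OF t0 n] assms(4) mn
      by (simp add: mult.assoc[symmetric] power_add[symmetric])
    then have eq: "Complex 1 (s - 2 * real m) = \<i> ^ (n - m) * Complex 1 (t - 2 * real n)" by simp
    from \<open>n - m < 5\<close> mn consider "n - m = 1" | "n - m = 2" | "n - m = 3" | "n - m = 4" by linarith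
    then show ?thesis
    proof cases
      case 1
      then have "n = m + 1" by linarith
      then show ?thesis using eq 1 by (simp add: complex_eq_iff)
    next
      case 2
      then show ?thesis using eq by (simp add: complex_eq_iff)
    next
      case 3
      then have "n = m + 3" by linarith
      then show ?thesis using eq 3 assms(3) by (simp add: complex_eq_iff power3_eq_cube)
    next
      case 4
      then have n: "n = m + 4" by linarith
      have "\<i> ^ 4 = 1" by (simp add: numeral_eq_Suc)
      then show ?thesis using eq 4 n assms(3) by (simp add: complex_eq_iff)
    qed
  qed
qed

lemma kappa_periodic:
  assumes "0 \<le> t" shows "kappa (t + 8) = kappa t"
proof -
  obtain m :: nat where m: "\<bar>t - 2 * real m\<bar> \<le> 1" using side_exists assms by auto
  have "\<i> ^ 4 = 1" by (simp add: numeral_eq_Suc)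
  then have "\<i> ^ (m + 4) = \<i> ^ m" by (simp add: power_add)
  moreover have "\<bar>t + 8 - 2 * real (m + 4)\<bar> \<le> 1" using m by simp
  ultimately show ?thesis using kappa_side[OF assms m] kappa_side[of "t + 8" "m + 4"] assms by simp
qed

lemma kappa_surj:
  assumes "sqn z = 1" obtains t where "0 \<le> t" "t \<le> 8" "kappa t = z"
proof -
  note result = that
  have *: thesis if "\<bar>y\<bar> \<le> 1" "0 \<le> y + 2 * real m" "y + 2 * real m \<le> 8" "z = \<i> ^ m * Complex 1 y" for y m
    using that kappa_side[of "y + 2 * real m" m] by (intro result[of "y + 2 * real m"]) auto
  have le: "\<bar>Re z\<bar> \<le> 1" "\<bar>Im z\<bar> \<le> 1" using assms by (auto simp: sqn_def)
  from assms consider "Re z = 1" "0 \<le> Im z" | "Re z = 1" "Im z < 0" | "Im z = 1" | "Re z = -1" | "Im z = -1"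
    by (auto simp: sqn_def max_def abs_if split: if_splits)
  then show thesis
  proof cases
    case 1 then show ?thesis using le by (intro *[of "Im z" 0]) (auto simp: complex_eq_iff)
  next
    \<comment> \<open>Parameters are nonnegative, so the lower half of the side
      \<open>Re z = 1\<close> is reached only at the end of the turn, with index 4 in place of
      0.\<close>
    case 2 then show ?thesis using le by (intro *[of "Im z" 4]) (auto simp: complex_eq_iff numeral_eq_Suc)
  next
    case 3 then show ?thesis using le by (intro *[of "- Re z" 1]) (auto simp: complex_eq_iff)
  next
    case 4 then show ?thesis using le by (intro *[of "- Im z" 2]) (auto simp: complex_eq_iff)
  next
    case 5 then show ?thesis using le by (intro *[of "Re z" 3]) (auto simp: complex_eq_iff numeral_eq_Suc)
  qed
qed

section \<open>Square loops, their length and line integrals over them\<close>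

definition loop :: "complex \<Rightarrow> real \<Rightarrow> real \<Rightarrow> complex" where
  "loop p r t = p + of_real r * kappa t"

definition sqs :: "complex \<Rightarrow> real \<Rightarrow> complex set" where
  "sqs p r = {z. sqn (z - p) = r}"

definition sqb :: "complex \<Rightarrow> real \<Rightarrow> complex set" where
  "sqb p r = {z. sqn (z - p) < r}"

lemma loop_in_sqs: "0 \<le> r \<Longrightarrow> 0 \<le> t \<Longrightarrow> loop p r t \<in> sqs p r"
  by (simp add: loop_def sqs_def)

lemma loop_surj:
  assumes "0 < r" "z \<in> sqs p r" obtains t where "0 \<le> t" "t \<le> 8" "loop p r t = z"
proof -
  have "sqn (of_real (1 / r) * (z - p)) = 1" using assms by (simp only: sqn_mult_of_real) (simp add: sqs_def)
  then obtain t where "0 \<le> t" "t \<le> 8" "kappa t = of_real (1 / r) * (z - p)" using kappa_surj by blast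
  then show ?thesis using assms by (intro that[of t]) (auto simp: loop_def)
qed

lemma loop_inj:
  assumes "0 < r" "0 \<le> s" "s \<le> t" "t < s + 8" "loop p r s = loop p r t" shows "s = t"
  using assms by (intro kappa_inj) (auto simp: loop_def)

lemma loop_periodic: "0 \<le> t \<Longrightarrow> loop p r (t + 8) = loop p r t"
  by (simp add: loop_def kappa_periodic)

lemma dist_loop: "0 \<le> r \<Longrightarrow> dist (loop p r s) (loop p r t) = r * dist (kappa s) (kappa t)"
proof -
  assume "0 \<le> r"
  have "loop p r s - loop p r t = of_real r * (kappa s - kappa t)" by (simp add: loop_def algebra_simps)
  then show ?thesis using \<open>0 \<le> r\<close> by (simp only: dist_norm norm_mult) simp
qed

lemma continuous_on_loop: "continuous_on {0..16} (loop p r)"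
  unfolding loop_def by (intro continuous_intros lipschitz_on_continuous_on[OF kappa_lipschitz])

text \<open>A partition of \<open>{a..b}\<close> is extended by the points \<open>b\<close> and
  \<open>c\<close>; the jump from its last point to \<open>b\<close> is discarded.\<close>

lemma curve_length_append:
  assumes "a \<le> b" "b \<le> c"
  shows "curve_length f {a..b} + ennreal (dist (f b) (f c)) \<le> curve_length f {a..c}"
proof -
  let ?s = "\<lambda>ts. \<Sum>j<length ts - 1. ennreal (dist (f (ts ! j)) (f (ts ! Suc j)))"
  let ?I = "{ts. sorted ts \<and> set ts \<subseteq> {a..b}}"
  have "curve_length f {a..b} + ennreal (dist (f b) (f c)) = (SUP ts\<in>?I. ?s ts + ennreal (dist (f b) (f c)))"
    unfolding curve_length_def by (subst ennreal_SUP_add_left) (auto intro: exI[of _ "[]"])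
  also have "\<dots> \<le> curve_length f {a..c}"
  proof (rule SUP_least)
    fix ts assume ts: "ts \<in> ?I"
    let ?n = "length ts"
    have "?s ts + ennreal (dist (f b) (f c)) \<le> (\<Sum>j<?n. ennreal (dist (f ((ts @ [b, c]) ! j)) (f ((ts @ [b, c]) ! Suc j)))) + ennreal (dist (f b) (f c))"
    proof (rule add_right_mono)
      have "?s ts = (\<Sum>j<?n - 1. ennreal (dist (f ((ts @ [b, c]) ! j)) (f ((ts @ [b, c]) ! Suc j))))"
        by (intro sum.cong) (auto simp: nth_append)
      also have "\<dots> \<le> (\<Sum>j<?n. ennreal (dist (f ((ts @ [b, c]) ! j)) (f ((ts @ [b, c]) ! Suc j))))"
        by (intro sum_mono2) auto
      finally show "?s ts \<le> (\<Sum>j<?n. ennreal (dist (f ((ts @ [b, c]) ! j)) (f ((ts @ [b, c]) ! Suc j))))" .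
    qed
    also have "\<dots> = ?s (ts @ [b, c])"
      by (simp add: nth_append)
    also have "\<dots> \<le> curve_length f {a..c}"
      unfolding curve_length_def using ts assms
      by (intro SUP_upper) (auto simp: sorted_append)
    finally show "?s ts + ennreal (dist (f b) (f c)) \<le> curve_length f {a..c}" .
  qed
  finally show ?thesis .
qed

text \<open>The upper bound is the Lipschitz constant 1 of \<open>kappa\<close>. The lower bound is
  an induction over the sides, on each of which the loop is isometric up to the factor
  \<open>r\<close>.\<close>

lemma curve_length_loop:
  assumes "0 \<le> r" "0 \<le> a" "a \<le> b" "b \<le> 16"
  shows "curve_length (loop p r) {a..b} = ennreal (r * (b - a))"
proof (rule antisym)
  show "curve_length (loop p r) {a..b} \<le> ennreal (r * (b - a))"
    unfolding curve_length_def
  proof (rule SUP_least, clarify)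
    fix ts assume ts: "sorted ts" "set ts \<subseteq> {a..b}"
    let ?n = "length ts - 1"
    have "(\<Sum>j<?n. ennreal (dist (loop p r (ts ! j)) (loop p r (ts ! Suc j)))) \<le> (\<Sum>j<?n. ennreal (r * (ts ! Suc j - ts ! j)))"
    proof (intro sum_mono ennreal_leI)
      fix j assume j: "j \<in> {..<?n}"
      then have "ts ! j \<in> set ts" "ts ! Suc j \<in> set ts" by auto
      then have m: "ts ! j \<in> {a..b}" "ts ! Suc j \<in> {a..b}" using ts(2) by blast+
      have le: "ts ! j \<le> ts ! Suc j" using ts(1) j by (intro sorted_nth_mono) auto
      have "dist (kappa (ts ! j)) (kappa (ts ! Suc j)) \<le> ts ! Suc j - ts ! j"
        using lipschitz_onD[OF kappa_lipschitz, of "ts ! j" "ts ! Suc j"] m le assms by (auto simp: dist_real_def)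
      then show "dist (loop p r (ts ! j)) (loop p r (ts ! Suc j)) \<le> r * (ts ! Suc j - ts ! j)"
        using assms(1) by (simp add: dist_loop mult_left_mono)
    qed
    also have "\<dots> = ennreal (\<Sum>j<?n. r * (ts ! Suc j - ts ! j))"
    proof (rule sum_ennreal)
      fix j assume "j \<in> {..<?n}"
      then have "ts ! j \<le> ts ! Suc j" using ts(1) by (intro sorted_nth_mono) auto
      then show "0 \<le> r * (ts ! Suc j - ts ! j)" using assms by simp
    qed
    also have "(\<Sum>j<?n. r * (ts ! Suc j - ts ! j)) = r * (ts ! ?n - ts ! 0)"
      by (simp add: sum_distrib_left[symmetric] sum_lessThan_telescope)
    also have "ennreal \<dots> \<le> ennreal (r * (b - a))"
    proof (cases ts)
      case Nil then show ?thesis using assms by simp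
    next
      case (Cons x xs)
      then have "?n < length ts" "0 < length ts" by auto
      then have "ts ! ?n \<in> set ts" "ts ! 0 \<in> set ts" using nth_mem by blast+
      then have "ts ! ?n \<in> {a..b}" "ts ! 0 \<in> {a..b}" using ts(2) by blast+
      then show ?thesis using assms by (intro ennreal_leI mult_left_mono) auto
    qed
    finally show "(\<Sum>j<?n. ennreal (dist (loop p r (ts ! j)) (loop p r (ts ! Suc j)))) \<le> ennreal (r * (b - a))" .
  qed
  have side: "ennreal (r * (b - a)) \<le> curve_length (loop p r) {a..b}"
    if "\<bar>a - 2 * real m\<bar> \<le> 1" "\<bar>b - 2 * real m\<bar> \<le> 1" "0 \<le> a" "a \<le> b" for m a b
  proof -
    have "ennreal (r * (b - a)) = ennreal (dist (loop p r a) (loop p r b))"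
      using that kappa_dist_side[of a b m] assms(1) by (simp add: dist_loop)
    also have "\<dots> \<le> curve_length (loop p r) {a..a} + ennreal (dist (loop p r a) (loop p r b))" by simp
    also have "\<dots> \<le> curve_length (loop p r) {a..b}" using that by (intro curve_length_append) auto
    finally show ?thesis .
  qed
  have "\<bar>b - 2 * real m\<bar> \<le> 1 \<Longrightarrow> a \<le> b \<Longrightarrow> ennreal (r * (b - a)) \<le> curve_length (loop p r) {a..b}" for m b
  proof (induction m arbitrary: b)
    case 0
    then show ?case using assms(2) by (intro side[where m=0]) auto
  next
    case (Suc m)
    show ?case
    proof (cases "\<bar>a - 2 * real (Suc m)\<bar> \<le> 1")
      case True
      then show ?thesis using Suc assms by (intro side[where m="Suc m"]) auto
    next
      case False
      \<comment> \<open>The corner at which side \<open>Suc m\<close> begins.\<close>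
      define c where "c = 2 * real m + 1"
      have c: "a \<le> c" "c \<le> b" "\<bar>c - 2 * real m\<bar> \<le> 1" "\<bar>c - 2 * real (Suc m)\<bar> \<le> 1" "0 \<le> c"
        using False Suc.prems by (auto simp: c_def)
      have "ennreal (r * (b - a)) = ennreal (r * (c - a)) + ennreal (r * (b - c))"
        using c assms by (simp add: ennreal_plus[symmetric] ring_distribs[symmetric] del: ennreal_plus)
      also have "\<dots> \<le> curve_length (loop p r) {a..c} + ennreal (dist (loop p r c) (loop p r b))"
        using Suc.IH[of c] c Suc.prems kappa_dist_side[of c b "Suc m"] assms by (intro add_mono) (auto simp: dist_loop)
      also have "\<dots> \<le> curve_length (loop p r) {a..b}" using c by (intro curve_length_append) auto
      finally show ?thesis .
    qed
  qed
  moreover obtain m :: nat where "\<bar>b - 2 * real m\<bar> \<le> 1" using side_exists assms by (metis order_trans)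
  ultimately show "ennreal (r * (b - a)) \<le> curve_length (loop p r) {a..b}" using assms by blast
qed

text \<open>The loop has constant speed \<open>r > 0\<close>, so the length function is injective
  and the choice inside \<open>arclength_param\<close> has only one candidate.\<close>

lemma arclength_param_loop:
  assumes "0 < r" "0 \<le> a" "a \<le> b" "b \<le> 16" "0 \<le> s" "s \<le> r * (b - a)"
  shows "arclength_param (loop p r) a b s = loop p r (a + s / r)"
proof -
  have "(SOME t. t \<in> {a..b} \<and> curve_length (loop p r) {a..t} = ennreal s) = a + s / r"
  proof (rule some_equality)
    have "s / r \<le> b - a" using assms by (simp add: pos_divide_le_eq mult.commute)
    then show "a + s / r \<in> {a..b} \<and> curve_length (loop p r) {a..a + s / r} = ennreal s"
      using assms by (auto simp: curve_length_loop)
    fix t assume "t \<in> {a..b} \<and> curve_length (loop p r) {a..t} = ennreal s"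
    then have "ennreal (r * (t - a)) = ennreal s" "a \<le> t" using assms by (auto simp: curve_length_loop)
    then show "t = a + s / r" using assms by (simp add: field_simps)
  qed
  then show ?thesis by (simp add: arclength_param_def)
qed

section \<open>Fubini's theorem for the sides of concentric squares\<close>

definition side :: "complex \<Rightarrow> nat \<Rightarrow> real \<Rightarrow> real \<Rightarrow> complex" where
  "side p m r y = p + \<i> ^ m * Complex r y"

lemma loop_side:
  assumes "0 \<le> t" "\<bar>t - 2 * real m\<bar> \<le> 1"
  shows "loop p r t = side p m r (r * (t - 2 * real m))"
proof -
  have "of_real r * Complex 1 (t - 2 * real m) = Complex r (r * (t - 2 * real m))"
    by (simp add: complex_eq_iff)
  then show ?thesis unfolding loop_def side_def kappa_side[OF assms] by (metis mult.left_commute)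
qed

lemma measurable_Complex [measurable]:
  "(\<lambda>x. Complex (fst x) (snd x)) \<in> borel_measurable (borel \<Otimes>\<^sub>M borel)"
  unfolding borel_prod by (intro borel_measurable_continuous_onI continuous_intros)

lemma measurable_side [measurable]:
  assumes [measurable]: "f \<in> borel_measurable M" "g \<in> borel_measurable M"
  shows "(\<lambda>x. side p m (f x) (g x)) \<in> borel_measurable M"
proof -
  have "(\<lambda>x. Complex (fst x) (snd x)) \<circ> (\<lambda>x. (f x, g x)) \<in> borel_measurable M"
    by (rule measurable_comp[of _ _ "borel \<Otimes>\<^sub>M borel"]) measurable
  then have [measurable]: "(\<lambda>x. Complex (f x) (g x)) \<in> borel_measurable M" by (simp add: comp_def)
  show ?thesis unfolding side_def by measurable
qed

lemma distr_Complex: "distr (lborel \<Otimes>\<^sub>M lborel) borel (\<lambda>x. Complex (fst x) (snd x)) = (lborel :: complex measure)"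
proof (rule sym, rule lborel_eqI)
  fix l u :: complex
  assume le: "\<And>b. b \<in> Basis \<Longrightarrow> l \<bullet> b \<le> u \<bullet> b"
  have M: "(\<lambda>x. Complex (fst x) (snd x)) \<in> measurable (lborel \<Otimes>\<^sub>M lborel) borel"
    using measurable_Complex by (simp add: measurable_cong_sets sets_pair_measure)
  have "(\<lambda>x. Complex (fst x) (snd x)) -` box l u \<inter> space (lborel \<Otimes>\<^sub>M lborel) = {Re l<..<Re u} \<times> {Im l<..<Im u}"
    by (auto simp: in_box_complex_iff space_pair_measure)
  then have "emeasure (distr (lborel \<Otimes>\<^sub>M lborel) borel (\<lambda>x. Complex (fst x) (snd x))) (box l u)
     = emeasure (lborel \<Otimes>\<^sub>M lborel) ({Re l<..<Re u} \<times> {Im l<..<Im u})"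
    using M by (subst emeasure_distr) auto
  also have "\<dots> = emeasure lborel {Re l<..<Re u} * emeasure lborel {Im l<..<Im u}"
    by (intro lborel.emeasure_pair_measure_Times) auto
  also have "\<dots> = (\<Prod>b\<in>Basis. (u - l) \<bullet> b)"
    using le[of 1] le[of \<i>] by (simp add: Basis_complex_def ennreal_mult[symmetric])
  finally show "emeasure (distr (lborel \<Otimes>\<^sub>M lborel) borel (\<lambda>x. Complex (fst x) (snd x))) (box l u) = (\<Prod>b\<in>Basis. (u - l) \<bullet> b)" .
qed simp

lemma nn_integral_complex:
  assumes [measurable]: "f \<in> borel_measurable borel"
  shows "(\<integral>\<^sup>+z. f z \<partial>lborel) = (\<integral>\<^sup>+x. \<integral>\<^sup>+y. f (Complex x y) \<partial>lborel \<partial>lborel)"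
proof -
  have M: "(\<lambda>x. Complex (fst x) (snd x)) \<in> measurable (lborel \<Otimes>\<^sub>M lborel) borel"
    using measurable_Complex by (simp add: measurable_cong_sets sets_pair_measure)
  have "(\<integral>\<^sup>+z. f z \<partial>lborel) = (\<integral>\<^sup>+x. f (Complex (fst x) (snd x)) \<partial>(lborel \<Otimes>\<^sub>M lborel))"
    unfolding distr_Complex[symmetric] using M by (rule nn_integral_distr) measurable
  also have "\<dots> = (\<integral>\<^sup>+x. \<integral>\<^sup>+y. f (Complex x y) \<partial>lborel \<partial>lborel)"
    using measurable_compose[OF M assms] by (subst lborel.nn_integral_fst[symmetric]) auto
  finally show ?thesis .
qed

lemma nn_integral_uminus_real:
  fixes f :: "real \<Rightarrow> ennreal"
  assumes [measurable]: "f \<in> borel_measurable borel"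
  shows "(\<integral>\<^sup>+x. f (- x) \<partial>lborel) = (\<integral>\<^sup>+x. f x \<partial>lborel)"
  by (subst (2) lborel_distr_uminus[symmetric]) (simp add: nn_integral_distr)

text \<open>A quarter turn swaps the coordinates and reverses one of them, so invariance follows
  from Fubini and the reflection invariance on the line.\<close>

lemma nn_integral_ii:
  assumes [measurable]: "f \<in> borel_measurable borel"
  shows "(\<integral>\<^sup>+z. f (\<i> * z) \<partial>lborel) = (\<integral>\<^sup>+z. f z \<partial>lborel)"
proof -
  have C: "(\<lambda>(x, y). f (Complex x y)) \<in> borel_measurable (lborel \<Otimes>\<^sub>M lborel)"
    using measurable_compose[OF measurable_Complex assms]
    by (simp add: measurable_cong_sets sets_pair_measure case_prod_beta)
  have C1: "(\<lambda>y. f (Complex x y)) \<in> borel_measurable borel" for x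
    using measurable_compose[of "\<lambda>y. (x, y)" borel "borel \<Otimes>\<^sub>M borel", OF _ measurable_compose[OF measurable_Complex assms]]
    by simp
  have C2: "(\<lambda>x. f (Complex x y)) \<in> borel_measurable borel" for y
    using measurable_compose[of "\<lambda>x. (x, y)" borel "borel \<Otimes>\<^sub>M borel", OF _ measurable_compose[OF measurable_Complex assms]]
    by simp
  have Ceq: "\<i> * Complex x y = Complex (- y) x" for x y by (simp add: complex_eq_iff)
  have "(\<integral>\<^sup>+z. f (\<i> * z) \<partial>lborel) = (\<integral>\<^sup>+x. \<integral>\<^sup>+y. f (Complex (- y) x) \<partial>lborel \<partial>lborel)"
    by (subst nn_integral_complex) (simp_all add: Ceq)
  also have "\<dots> = (\<integral>\<^sup>+x. \<integral>\<^sup>+y. f (Complex y x) \<partial>lborel \<partial>lborel)"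
    using C2 by (subst nn_integral_uminus_real[of "\<lambda>y. f (Complex y _)"]) auto
  also have "\<dots> = (\<integral>\<^sup>+y. \<integral>\<^sup>+x. f (Complex y x) \<partial>lborel \<partial>lborel)"
    using lborel_pair.Fubini'[of "\<lambda>y x. f (Complex y x)"] C by simp
  also have "\<dots> = (\<integral>\<^sup>+z. f z \<partial>lborel)"
    by (rule nn_integral_complex[symmetric]) simp
  finally show ?thesis .
qed

text \<open>For fixed \<open>m\<close> the map sending \<open>(x, y)\<close> to
  \<open>side p m x y\<close> is a rigid motion of the plane, and \<open>x\<close> is the radius of
  the square whose side lies on that line. Integrals over the lines add up to an integral over the
  plane.\<close>

lemma nn_integral_side:
  assumes [measurable]: "f \<in> borel_measurable borel"
  shows "(\<integral>\<^sup>+x. \<integral>\<^sup>+y. f (side p m x y) \<partial>lborel \<partial>lborel) = (\<integral>\<^sup>+z. f z \<partial>lborel)"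
proof -
  have *: "(\<integral>\<^sup>+z. g (\<i> ^ m * z) \<partial>lborel) = (\<integral>\<^sup>+z. g z \<partial>lborel)" if [measurable]: "g \<in> borel_measurable borel" for g :: "complex \<Rightarrow> ennreal"
  proof (induction m)
    case (Suc m)
    have "(\<integral>\<^sup>+z. g (\<i> ^ Suc m * z) \<partial>lborel) = (\<integral>\<^sup>+z. (\<lambda>w. g (\<i> ^ m * w)) (\<i> * z) \<partial>lborel)"
      by (simp add: mult.assoc mult.left_commute)
    also have "\<dots> = (\<integral>\<^sup>+z. g (\<i> ^ m * z) \<partial>lborel)" by (rule nn_integral_ii) measurable
    finally show ?case using Suc by simp
  qed simp
  have "(\<integral>\<^sup>+x. \<integral>\<^sup>+y. f (side p m x y) \<partial>lborel \<partial>lborel) = (\<integral>\<^sup>+z. f (p + \<i> ^ m * z) \<partial>lborel)"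
    unfolding side_def by (rule nn_integral_complex[of "\<lambda>z. f (p + \<i> ^ m * z)", symmetric]) measurable
  also have "\<dots> = (\<integral>\<^sup>+z. f (p + z) \<partial>lborel)" by (rule *) measurable
  also have "\<dots> = (\<integral>\<^sup>+z. f z \<partial>distr lborel borel ((+) p))"
    by (subst nn_integral_distr) simp_all
  also have "\<dots> = (\<integral>\<^sup>+z. f z \<partial>lborel)" by (simp add: lborel_distr_plus)
  finally show ?thesis .
qed

text \<open>The double loop runs through parts of the sides with index at most 8, so the integral
  over any piece of it is bounded by the sum over these nine full sides.\<close>

lemma line_integral_loop_le:
  assumes [measurable]: "l \<in> borel_measurable borel" and "0 < r" "0 \<le> a" "a \<le> b" "b \<le> 16"
  shows "line_integral l ({a..b}, loop p r) \<le> (\<Sum>m\<le>8. \<integral>\<^sup>+y. l (side p m r y) * indicator {-r..r} y \<partial>lborel)"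
proof -
  have rect: "locally_rectifiable ({a..b}, loop p r)"
    unfolding locally_rectifiable_def
  proof clarify
    fix c d :: real assume cd: "c \<le> d" "{c..d} \<subseteq> fst ({a..b}, loop p r)"
    then have "0 \<le> c" "d \<le> 16" using assms by auto
    then show "curve_length (snd ({a..b}, loop p r)) {c..d} < \<infinity>" using cd assms by (simp add: curve_length_loop)
  qed
  show ?thesis
    unfolding line_integral_def if_P[OF rect] fst_conv snd_conv
  proof (rule SUP_least, clarify)
    fix c d :: real assume cd: "c \<le> d" "{c..d} \<subseteq> {a..b}"
    then have c: "0 \<le> c" "d \<le> 16" using assms by auto
    have L: "enn2real (curve_length (loop p r) {c..d}) = r * (d - c)"
      using cd c assms by (simp add: curve_length_loop)
    let ?g = "\<lambda>m y. l (side p m r y) * indicator {-r..r} y"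
    have "(\<integral>\<^sup>+ s. l (arclength_param (loop p r) c d s) * indicator {0..r * (d - c)} s \<partial>lborel)
       \<le> (\<integral>\<^sup>+ s. (\<Sum>m\<le>8. ?g m (r * (c - 2 * real m) + s)) \<partial>lborel)"
    proof (rule nn_integral_mono)
      fix s :: real
      show "l (arclength_param (loop p r) c d s) * indicator {0..r * (d - c)} s \<le> (\<Sum>m\<le>8. ?g m (r * (c - 2 * real m) + s))"
      proof (cases "s \<in> {0..r * (d - c)}")
        case True
        define t where "t = c + s / r"
        have "s / r \<le> d - c" using True assms by (simp add: pos_divide_le_eq mult.commute)
        then have t: "0 \<le> t" "t \<le> 16" using c True assms by (auto simp: t_def)
        obtain m :: nat where m: "\<bar>t - 2 * real m\<bar> \<le> 1" using side_exists t by auto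
        \<comment> \<open>Arc length and the coordinate along a side differ by a translation that
          depends on the side only, and Lebesgue measure does not see it.\<close>
        have y: "r * (t - 2 * real m) = r * (c - 2 * real m) + s" using assms by (simp add: t_def field_simps)
        have "\<bar>r * (t - 2 * real m)\<bar> \<le> r" using m assms by (simp add: abs_mult)
        then have "l (arclength_param (loop p r) c d s) * indicator {0..r * (d - c)} s = ?g m (r * (c - 2 * real m) + s)"
          using True arclength_param_loop[of r c d s p] assms c cd loop_side[OF t(1) m, of p r]
          by (simp add: t_def[symmetric] y abs_le_iff)
        also have "\<dots> \<le> (\<Sum>m\<le>8. ?g m (r * (c - 2 * real m) + s))"
          using m t by (intro member_le_sum) auto
        finally show ?thesis .
      qed simp
    qed
    also have "\<dots> = (\<Sum>m\<le>8. \<integral>\<^sup>+ s. ?g m (r * (c - 2 * real m) + s) \<partial>lborel)"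
      by (rule nn_integral_sum) measurable
    also have "\<dots> = (\<Sum>m\<le>8. \<integral>\<^sup>+ s. ?g m s \<partial>lborel)"
    proof (rule sum.cong[OF refl])
      fix m
      have "(\<integral>\<^sup>+ s. ?g m (r * (c - 2 * real m) + s) \<partial>lborel) = (\<integral>\<^sup>+ s. ?g m s \<partial>distr lborel borel ((+) (r * (c - 2 * real m))))"
        by (subst nn_integral_distr) simp_all
      then show "(\<integral>\<^sup>+ s. ?g m (r * (c - 2 * real m) + s) \<partial>lborel) = (\<integral>\<^sup>+ s. ?g m s \<partial>lborel)"
        by (simp add: lborel_distr_plus)
    qed
    finally show "(\<integral>\<^sup>+ s. l (arclength_param (loop p r) c d s) * indicator {0..enn2real (curve_length (loop p r) {c..d})} s \<partial>lborel)
        \<le> (\<Sum>m\<le>8. \<integral>\<^sup>+ s. ?g m s \<partial>lborel)"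
      unfolding L .
  qed
qed

text \<open>Sets of bad radii are not known to be measurable. The intersection of measurable covers
  of small measure is a null set containing \<open>N\<close>.\<close>

lemma AE_notin_of_small_covers:
  fixes N :: "real set"
  assumes "\<And>e. 0 < e \<Longrightarrow> \<exists>A\<in>sets lborel. N \<subseteq> A \<and> emeasure lborel A \<le> ennreal e"
  shows "AE x in lborel. x \<notin> N"
proof -
  have "\<forall>n. \<exists>A\<in>sets lborel. N \<subseteq> A \<and> emeasure lborel A \<le> ennreal (1 / Suc n)"
    using assms by simp
  then obtain A where A: "\<And>n. A n \<in> sets lborel" "\<And>n. N \<subseteq> A n" "\<And>n. emeasure lborel (A n) \<le> ennreal (1 / Suc n)"
    by metis
  let ?B = "\<Inter>n. A n"
  have B: "?B \<in> sets lborel" using A by auto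
  have "emeasure lborel ?B \<le> ennreal (1 / Suc n)" for n
    using A by (intro order_trans[OF emeasure_mono A(3)[of n]]) auto
  then have "emeasure lborel ?B \<le> 0"
    using LIMSEQ_le_const[OF tendsto_ennrealI[OF LIMSEQ_inverse_real_of_nat], of "emeasure lborel ?B"]
    by (simp add: inverse_eq_divide)
  then have "?B \<in> null_sets lborel" using B by auto
  then show ?thesis by (rule AE_I') (use A in auto)
qed

text \<open>An admissible density has integral at least 1 over each bad loop. The inequality
  \<open>x <= \<theta> * x^2 + 1 / (4 * \<theta>)\<close> replaces this integral by one of the
  squared density, and Fubini together with Markov's inequality bounds the measure of the bad radii
  by the energy.\<close>

lemma AE_loop_mod2_null:
  assumes "mod2 \<Gamma> = 0" "0 < R"
  shows "AE r in lborel. 0 < r \<and> r < R \<longrightarrow> (\<forall>a b. 0 \<le> a \<and> a \<le> b \<and> b \<le> 16 \<longrightarrow> ({a..b}, loop p r) \<notin> \<Gamma>)"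
proof -
  let ?N = "{r. 0 < r \<and> r < R \<and> (\<exists>a b. 0 \<le> a \<and> a \<le> b \<and> b \<le> 16 \<and> ({a..b}, loop p r) \<in> \<Gamma>)}"
  have "AE r in lborel. r \<notin> ?N"
  proof (rule AE_notin_of_small_covers)
    fix e :: real assume e: "0 < e"
    \<comment> \<open>Nine sides of length at most \<open>2 * R\<close> contribute at most
      \<open>9 * 2 * R / (4 * \<theta>) = 1 / 2\<close> through the constant term, which leaves half
      of the unit to the energy term.\<close>
    define \<theta> where "\<theta> = 9 * R"
    have th: "0 < \<theta>" using assms by (simp add: \<theta>_def)
    have "mod2 \<Gamma> < ennreal (e / (18 * \<theta>))" using assms e th by simp
    then obtain l where l: "l \<in> borel_measurable borel" "\<forall>\<gamma>\<in>\<Gamma>. line_integral l \<gamma> \<ge> 1" "(\<integral>\<^sup>+ z. (l z)\<^sup>2 \<partial>lborel) < ennreal (e / (18 * \<theta>))"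
      unfolding mod2_def by (auto simp: INF_less_iff)
    note [measurable] = l(1)
    define F where "F = (\<lambda>r. \<Sum>m\<le>8. \<integral>\<^sup>+y. (l (side p m r y))\<^sup>2 \<partial>lborel)"
    have F [measurable]: "F \<in> borel_measurable lborel" unfolding F_def by measurable
    let ?A = "{r \<in> space lborel. 1 \<le> ennreal (2 * \<theta>) * F r}"
    have intF: "(\<integral>\<^sup>+r. F r \<partial>lborel) = 9 * (\<integral>\<^sup>+ z. (l z)\<^sup>2 \<partial>lborel)"
      unfolding F_def by (subst nn_integral_sum) (auto simp: nn_integral_side[of "\<lambda>z. (l z)\<^sup>2"])
    have "emeasure lborel ?A \<le> ennreal (2 * \<theta>) * (\<integral>\<^sup>+r. F r * indicator UNIV r \<partial>lborel)"
      using nn_integral_Markov_inequality[of F UNIV lborel "ennreal (2 * \<theta>)"] by simp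
    also have "\<dots> \<le> ennreal (2 * \<theta>) * (9 * ennreal (e / (18 * \<theta>)))"
      using l(3) by (intro mult_left_mono) (auto simp: intF intro!: mult_left_mono)
    also have "\<dots> = ennreal e"
    proof -
      have "9 * ennreal (e / (18 * \<theta>)) = ennreal (9 * (e / (18 * \<theta>)))"
        using e th by (subst ennreal_mult) auto
      then show ?thesis using e th by (simp add: ennreal_mult[symmetric])
    qed
    finally have A: "emeasure lborel ?A \<le> ennreal e" .
    have "?N \<subseteq> ?A"
    proof
      fix r assume r: "r \<in> ?N"
      then obtain a b where ab: "0 \<le> a" "a \<le> b" "b \<le> 16" "({a..b}, loop p r) \<in> \<Gamma>" and r: "0 < r" "r < R" by auto
      have "1 \<le> line_integral l ({a..b}, loop p r)" using l(2) ab by auto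
      also have "\<dots> \<le> (\<Sum>m\<le>8. \<integral>\<^sup>+y. l (side p m r y) * indicator {-r..r} y \<partial>lborel)"
        using ab r by (intro line_integral_loop_le) auto
      also have "\<dots> \<le> (\<Sum>m\<le>8. (\<integral>\<^sup>+y. ennreal \<theta> * (l (side p m r y))\<^sup>2 + ennreal (1 / (4 * \<theta>)) * indicator {-r..r} y \<partial>lborel))"
      proof (intro sum_mono nn_integral_mono)
        fix m y
        have "x \<le> ennreal \<theta> * x\<^sup>2 + ennreal (1 / (4 * \<theta>))" for x :: ennreal
        proof (cases x)
          case (real z)
          have "0 \<le> (2 * \<theta> * z - 1)\<^sup>2" by simp
          then have "z \<le> \<theta> * z\<^sup>2 + 1 / (4 * \<theta>)" using th by (simp add: power2_eq_square field_simps)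
          then show ?thesis using real th by (simp add: ennreal_mult[symmetric] ennreal_power ennreal_plus[symmetric] del: ennreal_plus)
        next
          case top
          then show ?thesis using th by (simp add: ennreal_mult_top)
        qed
        then show "l (side p m r y) * indicator {-r..r} y \<le> ennreal \<theta> * (l (side p m r y))\<^sup>2 + ennreal (1 / (4 * \<theta>)) * indicator {-r..r} y"
          by (cases "y \<in> {-r..r}") auto
      qed
      also have "\<dots> = ennreal \<theta> * F r + 9 * ennreal (1 / (4 * \<theta>)) * ennreal (2 * r)"
      proof -
        have "(\<integral>\<^sup>+y. ennreal \<theta> * (l (side p m r y))\<^sup>2 + ennreal (1 / (4 * \<theta>)) * indicator {-r..r} y \<partial>lborel)
           = ennreal \<theta> * (\<integral>\<^sup>+y. (l (side p m r y))\<^sup>2 \<partial>lborel) + ennreal (1 / (4 * \<theta>)) * ennreal (2 * r)" for m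
          using r by (subst nn_integral_add) (auto simp: nn_integral_cmult nn_integral_cmult_indicator)
        then show ?thesis by (simp add: F_def sum.distrib sum_distrib_left mult.assoc)
      qed
      also have "9 * ennreal (1 / (4 * \<theta>)) * ennreal (2 * r) \<le> ennreal (1 / 2)"
      proof -
        have "9 * ennreal (1 / (4 * \<theta>)) * ennreal (2 * r) = ennreal (9 * (1 / (4 * \<theta>)) * (2 * r))"
          using th r by (subst ennreal_numeral[symmetric], subst ennreal_mult[symmetric], simp, simp, subst ennreal_mult[symmetric]) auto
        also have "\<dots> \<le> ennreal (1 / 2)" using r by (intro ennreal_leI) (simp add: \<theta>_def field_simps)
        finally show ?thesis .
      qed
      finally have *: "1 \<le> ennreal \<theta> * F r + ennreal (1 / 2)" by (simp add: add_left_mono)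
      have "1 \<le> ennreal (2 * \<theta>) * F r"
      proof (cases "ennreal \<theta> * F r")
        case (real z)
        then have "1 \<le> ennreal (z + 1 / 2)" using * by (simp add: ennreal_plus)
        then have "1 \<le> 2 * z" by simp
        moreover have "ennreal (2 * \<theta>) * F r = ennreal 2 * (ennreal \<theta> * F r)"
          using th by (simp add: ennreal_mult mult.assoc)
        then have "ennreal (2 * \<theta>) * F r = ennreal (2 * z)" using real by (simp add: ennreal_mult)
        ultimately show ?thesis by simp
      next
        case top
        moreover have "ennreal (2 * \<theta>) * F r = ennreal 2 * (ennreal \<theta> * F r)"
          using th by (simp add: ennreal_mult mult.assoc)
        ultimately show ?thesis by (simp add: ennreal_mult_top)
      qed
      then show "r \<in> ?A" by simp
    qed
    then show "\<exists>A\<in>sets lborel. ?N \<subseteq> A \<and> emeasure lborel A \<le> ennreal e" using A by (intro bexI[of _ ?A]) auto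
  qed
  then show ?thesis by eventually_elim auto
qed

section \<open>Almost every square loop is good\<close>

text \<open>For null sets a single parameter can bound both the mesh and the sum of the cover, which
  removes the nested supremum and infimum.\<close>

lemma hausdorff1_eq_0_iff:
  "hausdorff1 A = 0 \<longleftrightarrow> (\<forall>e>0. \<exists>C :: nat \<Rightarrow> complex set. A \<subseteq> (\<Union>n. C n) \<and>
     (\<forall>n. bounded (C n) \<and> diameter (C n) \<le> e) \<and> (\<Sum>n. ennreal (diameter (C n))) \<le> ennreal e)"
proof
  assume 0: "hausdorff1 A = 0"
  show "\<forall>e>0. \<exists>C :: nat \<Rightarrow> complex set. A \<subseteq> (\<Union>n. C n) \<and>
     (\<forall>n. bounded (C n) \<and> diameter (C n) \<le> e) \<and> (\<Sum>n. ennreal (diameter (C n))) \<le> ennreal e"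
  proof (intro allI impI)
    fix e :: real assume e: "0 < e"
    have "(INF C\<in>{C :: nat \<Rightarrow> complex set. A \<subseteq> (\<Union>n. C n) \<and> (\<forall>n. bounded (C n) \<and> diameter (C n) \<le> e)}.
       \<Sum>n. ennreal (diameter (C n))) \<le> hausdorff1 A"
      unfolding hausdorff1_def by (rule SUP_upper) (use e in auto)
    also have "\<dots> < ennreal e" using 0 e by simp
    finally show "\<exists>C :: nat \<Rightarrow> complex set. A \<subseteq> (\<Union>n. C n) \<and>
     (\<forall>n. bounded (C n) \<and> diameter (C n) \<le> e) \<and> (\<Sum>n. ennreal (diameter (C n))) \<le> ennreal e"
      unfolding INF_less_iff by (auto intro: order_less_imp_le)
  qed
next
  assume *: "\<forall>e>0. \<exists>C :: nat \<Rightarrow> complex set. A \<subseteq> (\<Union>n. C n) \<and>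
     (\<forall>n. bounded (C n) \<and> diameter (C n) \<le> e) \<and> (\<Sum>n. ennreal (diameter (C n))) \<le> ennreal e"
  have "hausdorff1 A \<le> 0"
    unfolding hausdorff1_def
  proof (rule SUP_least)
    fix d :: real assume d: "d \<in> {0<..}"
    show "(INF C\<in>{C :: nat \<Rightarrow> complex set. A \<subseteq> (\<Union>n. C n) \<and> (\<forall>n. bounded (C n) \<and> diameter (C n) \<le> d)}.
       \<Sum>n. ennreal (diameter (C n))) \<le> 0"
    proof (rule ennreal_le_epsilon)
      fix e :: real assume e: "0 < e"
      obtain C :: "nat \<Rightarrow> complex set" where C: "A \<subseteq> (\<Union>n. C n)" "\<And>n. bounded (C n)" "\<And>n. diameter (C n) \<le> min d e"
        "(\<Sum>n. ennreal (diameter (C n))) \<le> ennreal (min d e)"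
        using *[rule_format, of "min d e"] d e by auto
      have "(INF C\<in>{C :: nat \<Rightarrow> complex set. A \<subseteq> (\<Union>n. C n) \<and> (\<forall>n. bounded (C n) \<and> diameter (C n) \<le> d)}.
       \<Sum>n. ennreal (diameter (C n))) \<le> (\<Sum>n. ennreal (diameter (C n)))"
        using C(1,2,3) by (intro INF_lower) auto
      also have "\<dots> \<le> ennreal e" using C(4) by (rule order_trans) (auto intro: ennreal_leI)
      finally show "(INF C\<in>{C :: nat \<Rightarrow> complex set. A \<subseteq> (\<Union>n. C n) \<and> (\<forall>n. bounded (C n) \<and> diameter (C n) \<le> d)}.
       \<Sum>n. ennreal (diameter (C n))) \<le> 0 + ennreal e" by simp
    qed
  qed
  then show "hausdorff1 A = 0" by simp
qed

lemma hausdorff1_mono_null: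
  assumes "hausdorff1 B = 0" "A \<subseteq> B" shows "hausdorff1 A = 0"
  using assms unfolding hausdorff1_eq_0_iff by (meson order_trans)

lemma hausdorff1_Un_null:
  assumes "hausdorff1 A = 0" "hausdorff1 B = 0" shows "hausdorff1 (A \<union> B) = 0"
  unfolding hausdorff1_eq_0_iff
proof (intro allI impI)
  fix e :: real assume e: "0 < e"
  obtain C where C: "A \<subseteq> (\<Union>n. C n)" "\<And>n. bounded (C n)" "\<And>n. diameter (C n) \<le> e / 2"
     "(\<Sum>n. ennreal (diameter (C n))) \<le> ennreal (e / 2)"
    using assms(1)[unfolded hausdorff1_eq_0_iff, rule_format, of "e / 2"] e by auto
  obtain D where D: "B \<subseteq> (\<Union>n. D n)" "\<And>n. bounded (D n)" "\<And>n. diameter (D n) \<le> e / 2"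
     "(\<Sum>n. ennreal (diameter (D n))) \<le> ennreal (e / 2)"
    using assms(2)[unfolded hausdorff1_eq_0_iff, rule_format, of "e / 2"] e by auto
  define E where "E n = (if even n then C (n div 2) else D (n div 2))" for n
  have "A \<union> B \<subseteq> (\<Union>n. E n)"
  proof
    fix x assume "x \<in> A \<union> B"
    then consider n where "x \<in> C n" | n where "x \<in> D n" using C D by blast
    then show "x \<in> (\<Union>n. E n)"
    proof cases
      case 1 then have "x \<in> E (2 * n)" by (simp add: E_def)
      then show ?thesis by blast
    next
      case 2 then have "x \<in> E (2 * n + 1)" by (simp add: E_def)
      then show ?thesis by blast
    qed
  qed
  moreover have "bounded (E n) \<and> diameter (E n) \<le> e" for n
    using C(2,3)[of "n div 2"] D(2,3)[of "n div 2"] e by (auto simp: E_def)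
  moreover have "(\<Sum>n. ennreal (diameter (E n))) \<le> ennreal e"
  proof (rule suminf_le_const)
    fix n
    have "(\<Sum>k<n. ennreal (diameter (E k))) \<le> (\<Sum>k<2 * n. ennreal (diameter (E k)))"
      by (rule sum_mono2) auto
    also have "\<dots> = (\<Sum>k<n. ennreal (diameter (C k)) + ennreal (diameter (D k)))"
    proof (induction n)
      case (Suc n)
      have "(\<Sum>k<2 * Suc n. ennreal (diameter (E k))) = (\<Sum>k<2 * n. ennreal (diameter (E k))) + ennreal (diameter (E (2 * n))) + ennreal (diameter (E (2 * n + 1)))"
        by (simp add: add.assoc)
      then show ?case using Suc by (simp add: E_def add.assoc)
    qed simp
    also have "\<dots> \<le> (\<Sum>k. ennreal (diameter (C k))) + (\<Sum>k. ennreal (diameter (D k)))"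
      unfolding sum.distrib by (intro add_mono sum_le_suminf) auto
    also have "\<dots> \<le> ennreal (e / 2) + ennreal (e / 2)" using C D by (intro add_mono)
    also have "\<dots> = ennreal e" using e by (simp add: ennreal_plus[symmetric] del: ennreal_plus)
    finally show "(\<Sum>k<n. ennreal (diameter (E k))) \<le> ennreal e" .
  qed simp
  ultimately show "\<exists>C. A \<union> B \<subseteq> (\<Union>n. C n) \<and> (\<forall>n. bounded (C n) \<and> diameter (C n) \<le> e) \<and> (\<Sum>n. ennreal (diameter (C n))) \<le> ennreal e"
    by blast
qed

lemma hausdorff1_UN_null:
  assumes "finite F" "\<And>m. m \<in> F \<Longrightarrow> hausdorff1 (A m) = 0" shows "hausdorff1 (\<Union>m\<in>F. A m) = 0"
  using assms
proof (induction F)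
  case empty
  show ?case unfolding hausdorff1_eq_0_iff by (auto intro!: exI[of _ "\<lambda>_. {}"])
next
  case (insert x F)
  then show ?case using hausdorff1_Un_null by simp
qed

text \<open>An open set of small measure around \<open>N\<close> splits into intervals whose
  diameters are at most their measures. Their isometric images form the cover.\<close>

lemma hausdorff1_isometric_image_null:
  fixes g :: "real \<Rightarrow> complex"
  assumes "N \<in> null_sets lborel" and g: "\<And>x y. dist (g x) (g y) = dist x y"
  shows "hausdorff1 (g ` N) = 0"
  unfolding hausdorff1_eq_0_iff
proof (intro allI impI)
  fix e :: real assume e: "0 < e"
  have N: "N \<in> sets borel" "emeasure lborel N = 0" using assms by auto
  obtain U where U: "open U" "N \<subseteq> U" "emeasure lborel (U - N) < ennreal e"
    using outer_regular_lborel[of N e] e N by auto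
  have "emeasure lborel U = emeasure lborel (N \<union> (U - N))" using U by (simp add: Un_absorb1)
  also have "\<dots> \<le> emeasure lborel N + emeasure lborel (U - N)"
    using N U by (intro emeasure_subadditive) auto
  finally have mU: "emeasure lborel U < ennreal e" using U N by simp
  define D where "D = components U"
  have D: "open K" "connected K" "K \<noteq> {}" "K \<subseteq> U" if "K \<in> D" for K
    using that U by (auto simp: D_def open_components in_components_connected in_components_nonempty in_components_subset)
  have "disjoint D" unfolding D_def using pairwise_disjoint_components by (simp add: disjoint_def pairwise_def disjnt_def)
  then have "countable D" using D by (intro countable_disjoint_open_subsets)
  define C where "C n = (if n \<in> to_nat_on D ` D then from_nat_into D n else {})" for n
  have C_D: "C n \<in> D \<or> C n = {}" for n
    using \<open>countable D\<close> by (auto simp: C_def)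
  have UC: "(\<Union>n. C n) = U"
  proof
    show "(\<Union>n. C n) \<subseteq> U" using C_D D by blast
    show "U \<subseteq> (\<Union>n. C n)"
    proof
      fix x assume "x \<in> U"
      then obtain K where K: "K \<in> D" "x \<in> K" unfolding D_def by (metis Union_components UnionE)
      then have "C (to_nat_on D K) = K" using \<open>countable D\<close> by (auto simp: C_def)
      then show "x \<in> (\<Union>n. C n)" using K by blast
    qed
  qed
  have disj: "disjoint_family C"
    unfolding disjoint_family_on_def
  proof (intro ballI impI)
    fix m n :: nat assume mn: "m \<noteq> n"
    show "C m \<inter> C n = {}"
    proof (cases "m \<in> to_nat_on D ` D \<and> n \<in> to_nat_on D ` D")
      case True
      then obtain K L where KL: "K \<in> D" "L \<in> D" "m = to_nat_on D K" "n = to_nat_on D L" by auto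
      then have "C m = K" "C n = L" "K \<noteq> L" using \<open>countable D\<close> mn by (auto simp: C_def)
      then show ?thesis using \<open>disjoint D\<close> KL by (auto dest: disjointD)
    qed (auto simp: C_def)
  qed
  have openC: "open (C n)" for n using C_D[of n] D by auto
  have "(\<Sum>n. emeasure lborel (C n)) = emeasure lborel U"
    using disj openC UC by (subst suminf_emeasure) auto
  then have sumC: "(\<Sum>n. emeasure lborel (C n)) < ennreal e" using mU by simp
  have small: "bounded (g ` C n) \<and> diameter (g ` C n) \<le> e \<and> ennreal (diameter (g ` C n)) \<le> emeasure lborel (C n)" for n
  proof (cases "C n = {}")
    case False
    then have K: "C n \<in> D" using C_D by blast
    have "emeasure lborel (C n) \<le> emeasure lborel U" using D[OF K] U by (intro emeasure_mono) auto
    then have "emeasure lborel (C n) < ennreal e" using mU by simp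
    then obtain m where m: "emeasure lborel (C n) = ennreal m" "0 \<le> m" "m < e"
      using e by (cases "emeasure lborel (C n)") (auto simp: ennreal_less_iff)
    have d: "dist x y \<le> m" if "x \<in> C n" "y \<in> C n" for x y
    proof -
      have "{min x y..max x y} \<subseteq> C n" using that D(2)[OF K] connected_contains_Icc[of "C n" "min x y" "max x y"]
        by (auto simp: min_def max_def split: if_splits)
      then have "emeasure lborel {min x y..max x y} \<le> emeasure lborel (C n)" using openC by (intro emeasure_mono) auto
      then show ?thesis using m by (auto simp: dist_real_def min_def max_def split: if_splits)
    qed
    have "bounded (g ` C n)" unfolding bounded_two_points using d by (auto simp: g)
    moreover have "diameter (g ` C n) \<le> m"
      using False d by (intro diameter_le) (auto simp: dist_norm[symmetric] g)
    ultimately show ?thesis using m by (auto intro: ennreal_leI)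
  qed (use e in auto)
  show "\<exists>C :: nat \<Rightarrow> complex set. g ` N \<subseteq> (\<Union>n. C n) \<and>
     (\<forall>n. bounded (C n) \<and> diameter (C n) \<le> e) \<and> (\<Sum>n. ennreal (diameter (C n))) \<le> ennreal e"
  proof (intro exI[of _ "\<lambda>n. g ` C n"] conjI allI)
    show "g ` N \<subseteq> (\<Union>n. g ` C n)" using U UC by blast
    have "(\<Sum>n. ennreal (diameter (g ` C n))) \<le> (\<Sum>n. emeasure lborel (C n))"
      using small by (intro suminf_le) auto
    then show "(\<Sum>n. ennreal (diameter (g ` C n))) \<le> ennreal e" using sumC by simp
  qed (use small in auto)
qed

lemma sqs_subset_sides:
  assumes "0 < r" shows "sqs p r \<subseteq> (\<Union>m\<le>8. side p m r ` UNIV)"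
proof
  fix z assume "z \<in> sqs p r"
  then obtain t where t: "0 \<le> t" "t \<le> 8" "loop p r t = z" using loop_surj assms by metis
  obtain m :: nat where m: "\<bar>t - 2 * real m\<bar> \<le> 1" using side_exists t by auto
  then have "m \<le> 8" using t by linarith
  then show "z \<in> (\<Union>m\<le>8. side p m r ` UNIV)" using loop_side[OF t(1) m, of p r] t by blast
qed

lemma dist_side: "dist (side p m r x) (side p m r y) = dist x y"
proof -
  have "side p m r x - side p m r y = \<i> ^ m * Complex 0 (x - y)"
    by (simp add: side_def complex_eq_iff flip: right_diff_distrib)
  then show ?thesis by (simp add: dist_norm norm_mult norm_power complex_norm)
qed

text \<open>By Fubini almost every line carrying a side meets \<open>E\<close> in a linear null set,
  and these lines are isometric copies of the real axis.\<close>

lemma AE_sqs_hausdorff1_null: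
  assumes E: "E \<in> sets borel" "emeasure lborel E = 0"
  shows "AE r in lborel. 0 < r \<longrightarrow> hausdorff1 (sqs p r \<inter> E) = 0"
proof -
  note [measurable] = E(1)
  have "AE r in lborel. {y. side p m r y \<in> E} \<in> null_sets lborel" for m
  proof -
    have "(\<integral>\<^sup>+x. \<integral>\<^sup>+y. indicator E (side p m x y) \<partial>lborel \<partial>lborel) = (\<integral>\<^sup>+z. indicator E z \<partial>lborel)"
      by (rule nn_integral_side) measurable
    also have "\<dots> = 0" using E by simp
    finally have "AE x in lborel. (\<integral>\<^sup>+y. indicator E (side p m x y) \<partial>lborel) = (0::ennreal)"
      by (subst (asm) nn_integral_0_iff_AE) auto
    then show ?thesis
    proof eventually_elim
      case (elim x)
      have M: "{y. side p m x y \<in> E} \<in> sets borel"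
      proof -
        have "(\<lambda>y. side p m x y) \<in> borel_measurable borel"
          unfolding side_def Complex_eq by (intro borel_measurable_continuous_onI continuous_intros)
        from measurable_sets[OF this E(1)] show ?thesis by (simp add: vimage_def)
      qed
      have "(\<integral>\<^sup>+y. indicator E (side p m x y) \<partial>lborel) = (\<integral>\<^sup>+y. indicator {y. side p m x y \<in> E} y \<partial>lborel)"
        by (intro nn_integral_cong) (auto simp: indicator_def)
      also have "\<dots> = emeasure lborel {y. side p m x y \<in> E}" using M by simp
      finally show ?case using elim M by auto
    qed
  qed
  then have "AE r in lborel. \<forall>m\<in>{..8}. {y. side p m r y \<in> E} \<in> null_sets lborel"
    by (intro AE_finite_allI) auto
  then show ?thesis
  proof eventually_elim
    case (elim r)
    show ?case
    proof
      assume r: "0 < r"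
      have "hausdorff1 (\<Union>m\<in>{..8}. side p m r ` {y. side p m r y \<in> E}) = 0"
        using elim by (intro hausdorff1_UN_null hausdorff1_isometric_image_null) (auto simp: dist_side)
      then show "hausdorff1 (sqs p r \<inter> E) = 0"
      proof (rule hausdorff1_mono_null, safe)
        fix z assume z: "z \<in> sqs p r" "z \<in> E"
        then obtain m y where "m \<le> 8" "z = side p m r y" using sqs_subset_sides[OF r, of p] by auto
        then show "z \<in> (\<Union>m\<in>{..8}. side p m r ` {y. side p m r y \<in> E})" using z by auto
      qed
    qed
  qed
qed

text \<open>The function \<open>sqn (z - p)\<close> is 1-Lipschitz and turns covers with a small sum
  of diameters into covers of small length. This lets a square loop avoid the carpet points of a
  given path.\<close>

lemma AE_sqs_disjoint_of_hausdorff1_null: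
  assumes "hausdorff1 T = 0"
  shows "AE r in lborel. sqs p r \<inter> T = {}"
proof -
  have "AE r in lborel. r \<notin> (\<lambda>z. sqn (z - p)) ` T"
  proof (rule AE_notin_of_small_covers)
    fix e :: real assume e: "0 < e"
    obtain C :: "nat \<Rightarrow> complex set" where C: "T \<subseteq> (\<Union>n. C n)" "\<And>n. bounded (C n)" "(\<Sum>n. ennreal (diameter (C n))) \<le> ennreal (e / 2)"
      using assms[unfolded hausdorff1_eq_0_iff, rule_format, of "e / 2"] e by auto
    define w where "w n = sqn ((SOME z. z \<in> C n) - p)" for n
    define A where "A n = (if C n = {} then {} else {w n - diameter (C n)..w n + diameter (C n)})" for n
    have d0: "0 \<le> diameter (C n)" for n using C(2) by (rule diameter_ge_0)
    have "(\<lambda>z. sqn (z - p)) ` T \<subseteq> (\<Union>n. A n)"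
    proof clarify
      fix z assume "z \<in> T"
      then obtain n where n: "z \<in> C n" using C by blast
      then have "(SOME z. z \<in> C n) \<in> C n" by (rule someI)
      then have "dist z (SOME z. z \<in> C n) \<le> diameter (C n)" using n C(2) by (intro diameter_bounded_bound) auto
      then have "\<bar>sqn (z - p) - w n\<bar> \<le> diameter (C n)"
        using sqn_Lipschitz[of "z - p" "(SOME z. z \<in> C n) - p"] by (simp add: w_def dist_norm)
      then have "sqn (z - p) \<in> A n" using n by (auto simp: A_def abs_le_iff)
      then show "sqn (z - p) \<in> (\<Union>n. A n)" by blast
    qed
    moreover have "emeasure lborel (\<Union>n. A n) \<le> ennreal e"
    proof -
      have "emeasure lborel (\<Union>n. A n) \<le> (\<Sum>n. emeasure lborel (A n))"
        by (rule emeasure_subadditive_countably) (auto simp: A_def)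
      also have "\<dots> \<le> (\<Sum>n. 2 * ennreal (diameter (C n)))"
        using d0 by (intro suminf_le) (auto simp: A_def ennreal_mult)
      also have "\<dots> = 2 * (\<Sum>n. ennreal (diameter (C n)))" by simp
      also have "\<dots> \<le> 2 * ennreal (e / 2)" using C(3) by (intro mult_left_mono) auto
      also have "\<dots> = ennreal e" using e by (subst ennreal_numeral[symmetric], subst ennreal_mult[symmetric]) auto
      finally show ?thesis .
    qed
    moreover have "(\<Union>n. A n) \<in> sets lborel" by (auto simp: A_def)
    ultimately show "\<exists>A\<in>sets lborel. (\<lambda>z. sqn (z - p)) ` T \<subseteq> A \<and> emeasure lborel A \<le> ennreal e" by blast
  qed
  then show ?thesis by eventually_elim (auto simp: sqs_def)
qed

context rel_carpet
begin

lemma S_borel: "S \<in> sets borel"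
  unfolding carpet_def using open_Omega open_Q by (intro sets.Diff borel_open open_UN) auto

text \<open>Weighted arithmetic-geometric mean inequality replaces Cauchy-Schwarz.\<close>

lemma sum_over_square:
  shows "\<exists>C>0. \<forall>p R \<theta> I (\<rho> :: nat \<Rightarrow> ennreal). 0 < R \<longrightarrow> 0 < \<theta> \<longrightarrow>
    (\<lambda>r. (\<Sum>\<^sub>\<infinity>i\<in>I \<inter> meeting Q (sqs p r). \<rho> i) * indicator {0<..<R} r) \<in> borel_measurable lborel \<and>
    (\<integral>\<^sup>+r. (\<Sum>\<^sub>\<infinity>i\<in>I \<inter> meeting Q (sqs p r). \<rho> i) * indicator {0<..<R} r \<partial>lborel)
      \<le> ennreal \<theta> * (\<Sum>\<^sub>\<infinity>i\<in>I \<inter> meeting Q (ball p (2 * R)). (\<rho> i)\<^sup>2) + ennreal (C * R\<^sup>2 / \<theta>)"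
proof -
  obtain C where C: "0 < C" "\<And>p R. 0 < R \<Longrightarrow>
    (\<Sum>\<^sub>\<infinity>i\<in>meeting Q (ball p R). ennreal ((min (diameter (Q i)) R)\<^sup>2)) \<le> ennreal (C * R\<^sup>2)"
    using sum_min_diameter by blast
  show ?thesis
  proof (intro exI[of _ "4 * C"] conjI allI impI)
    show "0 < 4 * C" using C by simp
    fix p and R \<theta> :: real and I and \<rho> :: "nat \<Rightarrow> ennreal"
    assume R: "0 < R" and th: "0 < \<theta>"
    \<comment> \<open>The radii below \<open>R\<close> whose square meets \<open>Q i\<close>. They
      form an interval, as the disk is connected, of length at most twice the diameter truncated at
      \<open>2 * R\<close>. The squares in question lie in \<open>ball p (2 * R)\<close>, where area
      packing is applied.\<close>
    define T where "T i = (\<lambda>z. sqn (z - p)) ` Q i \<inter> {0<..<R}" for i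
    have T_iff: "r \<in> T i \<longleftrightarrow> i \<in> meeting Q (sqs p r) \<and> r \<in> {0<..<R}" for r i
      by (auto simp: T_def meeting_def sqs_def)
    have Tm [measurable]: "T i \<in> sets borel" for i
    proof -
      have "connected ((\<lambda>z. sqn (z - p)) ` Q i)"
        by (intro connected_continuous_image continuous_intros connected_Q)
      then have "is_interval ((\<lambda>z. sqn (z - p)) ` Q i)" by (simp add: is_interval_connected_1)
      then show ?thesis unfolding T_def by (intro sets.Int real_interval_borel_measurable) auto
    qed
    let ?m = "\<lambda>i. min (diameter (Q i)) (2 * R)"
    have m0: "0 \<le> ?m i" for i using diameter_Q_pos[of i] R by simp
    have Te: "emeasure lborel (T i) \<le> ennreal (2 * ?m i)" for i
    proof (cases "T i = {}")
      case False
      then obtain z where z: "z \<in> Q i" by (auto simp: T_def)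
      have "T i \<subseteq> {sqn (z - p) - diameter (Q i)..sqn (z - p) + diameter (Q i)}"
      proof
        fix r assume "r \<in> T i"
        then obtain w where w: "w \<in> Q i" "r = sqn (w - p)" by (auto simp: T_def)
        then have "dist w z \<le> diameter (Q i)" using z bounded_Q by (intro diameter_bounded_bound)
        then show "r \<in> {sqn (z - p) - diameter (Q i)..sqn (z - p) + diameter (Q i)}"
          using sqn_Lipschitz[of "w - p" "z - p"] w by (simp add: dist_norm abs_le_iff)
      qed
      then have "emeasure lborel (T i) \<le> emeasure lborel {sqn (z - p) - diameter (Q i)..sqn (z - p) + diameter (Q i)}"
        by (intro emeasure_mono) auto
      then have 1: "emeasure lborel (T i) \<le> ennreal (2 * diameter (Q i))" using diameter_Q_pos[of i] by simp
      have "emeasure lborel (T i) \<le> emeasure lborel {0<..<R}" by (intro emeasure_mono) (auto simp: T_def)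
      also have "\<dots> \<le> ennreal (2 * (2 * R))" using R by (simp add: ennreal_leI)
      finally show ?thesis using 1 by (auto simp: min_def)
    qed simp
    let ?f = "\<lambda>i r. (if i \<in> I then \<rho> i else 0) * indicator (T i) r"
    have eq: "(\<Sum>\<^sub>\<infinity>i\<in>I \<inter> meeting Q (sqs p r). \<rho> i) * indicator {0<..<R} r = (\<Sum>i. ?f i r)" for r
    proof (cases "r \<in> {0<..<R}")
      case True
      then show ?thesis by (auto simp: infsum_ennreal_suminf T_iff indicator_def intro!: suminf_cong)
    next
      case False
      then have "r \<notin> T i" for i by (auto simp: T_def)
      with False show ?thesis by simp
    qed
    have M: "(\<lambda>r. \<Sum>i. ?f i r) \<in> borel_measurable lborel" by measurable
    have "(\<integral>\<^sup>+r. (\<Sum>i. ?f i r) \<partial>lborel) = (\<Sum>i. \<integral>\<^sup>+r. ?f i r \<partial>lborel)"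
      by (rule nn_integral_suminf) measurable
    also have "\<dots> = (\<Sum>i. (if i \<in> I then \<rho> i else 0) * emeasure lborel (T i))"
      by (intro suminf_cong nn_integral_cmult_indicator) simp
    also have "\<dots> \<le> (\<Sum>i. ennreal \<theta> * (if i \<in> I \<inter> meeting Q (ball p (2 * R)) then (\<rho> i)\<^sup>2 else 0)
        + ennreal (1 / \<theta>) * (if i \<in> meeting Q (ball p (2 * R)) then ennreal ((?m i)\<^sup>2) else 0))"
    proof (intro suminf_le)
      fix i
      show "(if i \<in> I then \<rho> i else 0) * emeasure lborel (T i) \<le> ennreal \<theta> * (if i \<in> I \<inter> meeting Q (ball p (2 * R)) then (\<rho> i)\<^sup>2 else 0)
        + ennreal (1 / \<theta>) * (if i \<in> meeting Q (ball p (2 * R)) then ennreal ((?m i)\<^sup>2) else 0)"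
      proof (cases "i \<in> I \<and> T i \<noteq> {}")
        case True
        then obtain z where z: "z \<in> Q i" "sqn (z - p) < R" by (auto simp: T_def)
        then have "z \<in> ball p (2 * R)" using norm_le_sqn[of "z - p"] by (simp add: dist_norm norm_minus_commute)
        then have mt: "i \<in> meeting Q (ball p (2 * R))" using z by (auto simp: meeting_def)
        have AM: "x * ennreal (2 * m) \<le> ennreal \<theta> * x\<^sup>2 + ennreal (1 / \<theta>) * ennreal (m\<^sup>2)" if "0 \<le> m" for x m
        proof (cases x)
          case (real y)
          have "0 \<le> (\<theta> * y - m)\<^sup>2" by simp
          then have "y * (2 * m) \<le> \<theta> * y\<^sup>2 + 1 / \<theta> * m\<^sup>2" using th by (simp add: power2_eq_square field_simps)
          then show ?thesis using real th that
            by (simp add: ennreal_mult[symmetric] ennreal_power ennreal_plus[symmetric] del: ennreal_plus)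
        next
          case top
          then show ?thesis using th by (simp add: ennreal_mult_top)
        qed
        have "\<rho> i * emeasure lborel (T i) \<le> \<rho> i * ennreal (2 * ?m i)" using Te by (rule mult_left_mono) simp
        also have "\<dots> \<le> ennreal \<theta> * (\<rho> i)\<^sup>2 + ennreal (1 / \<theta>) * ennreal ((?m i)\<^sup>2)" using m0 by (rule AM)
        finally show ?thesis using True mt by simp
      qed auto
    qed auto
    also have "\<dots> = ennreal \<theta> * (\<Sum>\<^sub>\<infinity>i\<in>I \<inter> meeting Q (ball p (2 * R)). (\<rho> i)\<^sup>2)
        + ennreal (1 / \<theta>) * (\<Sum>\<^sub>\<infinity>i\<in>meeting Q (ball p (2 * R)). ennreal ((?m i)\<^sup>2))"
      unfolding infsum_ennreal_suminf by (subst suminf_add[symmetric]) auto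
    also have "\<dots> \<le> ennreal \<theta> * (\<Sum>\<^sub>\<infinity>i\<in>I \<inter> meeting Q (ball p (2 * R)). (\<rho> i)\<^sup>2) + ennreal (1 / \<theta>) * ennreal (C * (2 * R)\<^sup>2)"
      using R by (intro add_left_mono mult_left_mono C(2)) auto
    also have "ennreal (1 / \<theta>) * ennreal (C * (2 * R)\<^sup>2) = ennreal (4 * C * R\<^sup>2 / \<theta>)"
      using th C by (subst ennreal_mult[symmetric]) (auto simp: power2_eq_square)
    finally show "(\<integral>\<^sup>+r. (\<Sum>\<^sub>\<infinity>i\<in>I \<inter> meeting Q (sqs p r). \<rho> i) * indicator {0<..<R} r \<partial>lborel)
      \<le> ennreal \<theta> * (\<Sum>\<^sub>\<infinity>i\<in>I \<inter> meeting Q (ball p (2 * R)). (\<rho> i)\<^sup>2) + ennreal (4 * C * R\<^sup>2 / \<theta>)"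
      unfolding eq .
    show "(\<lambda>r. (\<Sum>\<^sub>\<infinity>i\<in>I \<inter> meeting Q (sqs p r). \<rho> i) * indicator {0<..<R} r) \<in> borel_measurable lborel"
      unfolding eq by (rule M)
  qed
qed

text \<open>Integrating an admissible weight of small energy over the radii shows that few squares
  carry a sum of at least 1. Loops not controlled by admissibility are discarded beforehand: a
  family of vanishing \<open>mod2\<close> in the weak version, squares meeting the carpet in
  positive length in the strong one.\<close>

lemma AE_loop_nonexceptional:
  assumes null: "carpet_modulus v \<Omega> Q \<Gamma> = 0" and R: "0 < R"
  shows "AE r in lborel. 0 < r \<and> r < R \<longrightarrow> (\<forall>a b. 0 \<le> a \<and> a \<le> b \<and> b \<le> 16 \<longrightarrow> ({a..b}, loop p r) \<notin> \<Gamma>)"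
proof -
  obtain C where C: "0 < C" "\<forall>p R \<theta> I (\<rho> :: nat \<Rightarrow> ennreal). 0 < R \<longrightarrow> 0 < \<theta> \<longrightarrow>
    (\<lambda>r. (\<Sum>\<^sub>\<infinity>i\<in>I \<inter> meeting Q (sqs p r). \<rho> i) * indicator {0<..<R} r) \<in> borel_measurable lborel \<and>
    (\<integral>\<^sup>+r. (\<Sum>\<^sub>\<infinity>i\<in>I \<inter> meeting Q (sqs p r). \<rho> i) * indicator {0<..<R} r \<partial>lborel)
      \<le> ennreal \<theta> * (\<Sum>\<^sub>\<infinity>i\<in>I \<inter> meeting Q (ball p (2 * R)). (\<rho> i)\<^sup>2) + ennreal (C * R\<^sup>2 / \<theta>)"
    using sum_over_square by blast
  let ?bad = "\<lambda>\<Gamma>. {r. 0 < r \<and> r < R \<and> (\<exists>a b. 0 \<le> a \<and> a \<le> b \<and> b \<le> 16 \<and> ({a..b}, loop p r) \<in> \<Gamma>)}"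
  have "AE r in lborel. r \<notin> ?bad \<Gamma>"
  proof (rule AE_notin_of_small_covers)
    fix e :: real assume e: "0 < e"
    \<comment> \<open>The choices of \<open>\<theta>\<close> and \<open>\<delta>\<close> make each
      of the two terms in \<open>sum_over_square\<close> equal to \<open>e / 2\<close>.\<close>
    define \<theta> where "\<theta> = 2 * C * R\<^sup>2 / e"
    have th: "0 < \<theta>" using C R e by (simp add: \<theta>_def)
    define \<delta> where "\<delta> = e / (2 * \<theta>)"
    have d: "0 < ennreal \<delta>" using e th by (simp add: \<delta>_def)
    have "\<exists>\<rho> N. (\<Sum>\<^sub>\<infinity>i\<in>UNIV. (\<rho> i)\<^sup>2) < ennreal \<delta> \<and> (AE r in lborel. r \<notin> N) \<and>
      (\<forall>r\<in>?bad \<Gamma> - N. (\<Sum>\<^sub>\<infinity>i\<in>meeting Q (sqs p r). \<rho> i) \<ge> 1)"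
    proof (cases v)
      case Weak
      then have "mod_weak Q \<Gamma> < ennreal \<delta>" using null d by (simp add: carpet_modulus_def)
      then obtain \<rho> \<Gamma>0 where \<rho>: "(\<Sum>\<^sub>\<infinity>i\<in>UNIV. (\<rho> i)\<^sup>2) < ennreal \<delta>" "\<Gamma>0 \<subseteq> \<Gamma>" "mod2 \<Gamma>0 = 0"
          "\<forall>\<gamma> \<in> \<Gamma> - \<Gamma>0. (\<Sum>\<^sub>\<infinity>i\<in>meeting Q (trace \<gamma>). \<rho> i) \<ge> 1"
        unfolding mod_weak_def by (auto simp: INF_less_iff)
      have "(\<Sum>\<^sub>\<infinity>i\<in>meeting Q (sqs p r). \<rho> i) \<ge> 1" if r: "r \<in> ?bad \<Gamma> - ?bad \<Gamma>0" for r
      proof -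
        obtain a b where ab: "0 \<le> a" "a \<le> b" "b \<le> 16" "({a..b}, loop p r) \<in> \<Gamma>" and r': "0 < r" "r < R" using r by auto
        then have "({a..b}, loop p r) \<in> \<Gamma> - \<Gamma>0" using r by auto
        then have "1 \<le> (\<Sum>\<^sub>\<infinity>i\<in>meeting Q (trace ({a..b}, loop p r)). \<rho> i)" using \<rho> by blast
        also have "\<dots> \<le> (\<Sum>\<^sub>\<infinity>i\<in>meeting Q (sqs p r). \<rho> i)"
          using loop_in_sqs[of r _ p] ab r' by (intro infsum_ennreal_mono) (fastforce simp: meeting_def trace_def)+
        finally show ?thesis .
      qed
      moreover have "AE r in lborel. r \<notin> ?bad \<Gamma>0"
        using AE_loop_mod2_null[OF \<rho>(3) R, of p] by eventually_elim auto
      ultimately show ?thesis using \<rho>(1) by blast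
    next
      case Strong
      then have "mod_strong \<Omega> Q \<Gamma> < ennreal \<delta>" using null d by (simp add: carpet_modulus_def)
      then obtain \<rho> where \<rho>: "(\<Sum>\<^sub>\<infinity>i\<in>UNIV. (\<rho> i)\<^sup>2) < ennreal \<delta>"
          "\<forall>\<gamma> \<in> \<Gamma>. hausdorff1 (trace \<gamma> \<inter> S) = 0 \<longrightarrow> (\<Sum>\<^sub>\<infinity>i\<in>meeting Q (trace \<gamma>). \<rho> i) \<ge> 1"
        unfolding mod_strong_def by (auto simp: INF_less_iff)
      let ?N = "{r. 0 < r \<and> hausdorff1 (sqs p r \<inter> S) \<noteq> 0}"
      have "(\<Sum>\<^sub>\<infinity>i\<in>meeting Q (sqs p r). \<rho> i) \<ge> 1" if r: "r \<in> ?bad \<Gamma> - ?N" for r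
      proof -
        obtain a b where ab: "0 \<le> a" "a \<le> b" "b \<le> 16" "({a..b}, loop p r) \<in> \<Gamma>" and r': "0 < r" "r < R" using r by auto
        have tr: "trace ({a..b}, loop p r) \<subseteq> sqs p r" using loop_in_sqs[of r _ p] ab r' by (auto simp: trace_def)
        then have "hausdorff1 (trace ({a..b}, loop p r) \<inter> S) = 0" using r r' by (auto intro: hausdorff1_mono_null)
        then have "1 \<le> (\<Sum>\<^sub>\<infinity>i\<in>meeting Q (trace ({a..b}, loop p r)). \<rho> i)" using \<rho> ab by blast
        also have "\<dots> \<le> (\<Sum>\<^sub>\<infinity>i\<in>meeting Q (sqs p r). \<rho> i)"
          using tr by (intro infsum_ennreal_mono) (auto simp: meeting_def)
        finally show ?thesis .
      qed
      moreover have "AE r in lborel. r \<notin> ?N"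
        using AE_sqs_hausdorff1_null[OF S_borel null_S, of p] by eventually_elim auto
      ultimately show ?thesis using \<rho>(1) by blast
    qed
    then obtain \<rho> N where \<rho>: "(\<Sum>\<^sub>\<infinity>i\<in>UNIV. (\<rho> i)\<^sup>2) < ennreal \<delta>" "AE r in lborel. r \<notin> N"
      "\<And>r. r \<in> ?bad \<Gamma> - N \<Longrightarrow> (\<Sum>\<^sub>\<infinity>i\<in>meeting Q (sqs p r). \<rho> i) \<ge> 1" by blast
    obtain N' where N': "N \<subseteq> N'" "N' \<in> null_sets lborel"
      using \<rho>(2) unfolding eventually_ae_filter by auto
    let ?F = "\<lambda>r. (\<Sum>\<^sub>\<infinity>i\<in>UNIV \<inter> meeting Q (sqs p r). \<rho> i) * indicator {0<..<R} r"
    have F: "?F \<in> borel_measurable lborel" and intF: "(\<integral>\<^sup>+r. ?F r \<partial>lborel) \<le> ennreal \<theta> * (\<Sum>\<^sub>\<infinity>i\<in>UNIV \<inter> meeting Q (ball p (2 * R)). (\<rho> i)\<^sup>2) + ennreal (C * R\<^sup>2 / \<theta>)"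
      using C(2)[rule_format, OF R th, where I=UNIV and p=p and \<rho>=\<rho>] by auto
    note intF
    also have "\<dots> \<le> ennreal \<theta> * ennreal \<delta> + ennreal (C * R\<^sup>2 / \<theta>)"
    proof (intro add_right_mono mult_left_mono)
      have "(\<Sum>\<^sub>\<infinity>i\<in>UNIV \<inter> meeting Q (ball p (2 * R)). (\<rho> i)\<^sup>2) \<le> (\<Sum>\<^sub>\<infinity>i\<in>UNIV. (\<rho> i)\<^sup>2)"
        by (rule infsum_ennreal_mono) auto
      then show "(\<Sum>\<^sub>\<infinity>i\<in>UNIV \<inter> meeting Q (ball p (2 * R)). (\<rho> i)\<^sup>2) \<le> ennreal \<delta>" using \<rho>(1) by simp
    qed simp
    also have "\<dots> = ennreal e"
    proof -
      have "\<theta> * \<delta> + C * R\<^sup>2 / \<theta> = e" using C R e th by (simp add: \<delta>_def) (simp add: \<theta>_def field_simps)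
      then show ?thesis using th e C by (simp add: \<delta>_def ennreal_mult[symmetric] ennreal_plus[symmetric] del: ennreal_plus)
    qed
    finally have intF: "(\<integral>\<^sup>+r. ?F r \<partial>lborel) \<le> ennreal e" .
    let ?A = "{r \<in> space lborel. 1 \<le> 1 * ?F r}"
    have A1: "?A \<in> sets lborel" using F by measurable
    have A2: "emeasure lborel ?A \<le> ennreal e"
      using nn_integral_Markov_inequality[of ?F UNIV lborel 1] F intF by simp
    have "emeasure lborel (?A \<union> N') \<le> ennreal e"
      using A1 A2 N' by (subst emeasure_Un_null_set) auto
    moreover have "?bad \<Gamma> \<subseteq> ?A \<union> N'"
    proof
      fix r assume r: "r \<in> ?bad \<Gamma>"
      then have "r \<in> {0<..<R}" by auto
      then show "r \<in> ?A \<union> N'" using \<rho>(3)[of r] r N' by (cases "r \<in> N") auto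
    qed
    ultimately show "\<exists>A\<in>sets lborel. ?bad \<Gamma> \<subseteq> A \<and> emeasure lborel A \<le> ennreal e"
      using A1 N' by (intro bexI[of _ "?A \<union> N'"]) auto
  qed
  then show ?thesis by eventually_elim auto
qed

end

section \<open>Real-valued Sobolev functions and families of modulus zero\<close>

definition oscr :: "(nat \<Rightarrow> complex set) \<Rightarrow> (complex \<Rightarrow> real) \<Rightarrow> nat \<Rightarrow> real" where
  "oscr Q u i = Sup (u ` frontier (Q i)) - Inf (u ` frontier (Q i))"

text \<open>Real counterpart of \<open>sobolev_loc\<close>, keeping the local Dirichlet energy. The
  sum of squared suprema weighted by squared diameters is recovered in
  \<open>sobolev_of_real\<close> for bounded functions that vanish off a relatively compact open
  set.\<close>

definition sobolev_real ::
  "version \<Rightarrow> complex set \<Rightarrow> (nat \<Rightarrow> complex set) \<Rightarrow> (complex \<Rightarrow> real) \<Rightarrow> bool" where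
  "sobolev_real v \<Omega> Q u \<longleftrightarrow>
     (\<forall>i. bounded (u ` frontier (Q i))) \<and>
     (\<forall>x r. 0 < r \<and> compactly_contained (ball x r) \<Omega> \<longrightarrow>
        (\<Sum>\<^sub>\<infinity>i\<in>meeting Q (ball x r). (ennreal (oscr Q u i))\<^sup>2) < \<infinity>) \<and>
     upper_gradient v \<Omega> Q (\<lambda>i. ennreal (oscr Q u i)) (\<lambda>x. ereal (u x))"

lemma line_integral_mono:
  assumes "\<And>z. l z \<le> l' z" shows "line_integral l \<gamma> \<le> line_integral l' \<gamma>"
  unfolding line_integral_def
  by (auto intro!: SUP_mono' nn_integral_mono mult_right_mono assms)

lemma line_integral_subpath:
  assumes "J \<subseteq> fst \<gamma>" shows "line_integral l (J, snd \<gamma>) \<le> line_integral l \<gamma>"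
proof (cases "locally_rectifiable \<gamma>")
  case True
  then have "locally_rectifiable (J, snd \<gamma>)" using assms unfolding locally_rectifiable_def by auto
  with True show ?thesis using assms unfolding line_integral_def
    by (auto intro!: SUP_subset_mono)
qed (simp add: line_integral_def)

lemma mod2_null_iff:
  "mod2 \<Gamma> = 0 \<longleftrightarrow> (\<forall>e>0. \<exists>l. l \<in> borel_measurable borel \<and> (\<forall>\<gamma>\<in>\<Gamma>. line_integral l \<gamma> \<ge> 1) \<and>
     (\<integral>\<^sup>+ z. (l z)\<^sup>2 \<partial>lborel) \<le> ennreal e)"
proof (intro iffI allI impI)
  fix e :: real assume "mod2 \<Gamma> = 0" "0 < e"
  then have "mod2 \<Gamma> < ennreal e" by simp
  then show "\<exists>l. l \<in> borel_measurable borel \<and> (\<forall>\<gamma>\<in>\<Gamma>. line_integral l \<gamma> \<ge> 1) \<and> (\<integral>\<^sup>+ z. (l z)\<^sup>2 \<partial>lborel) \<le> ennreal e"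
    unfolding mod2_def INF_less_iff by (auto intro: order_less_imp_le)
next
  assume *: "\<forall>e>0. \<exists>l. l \<in> borel_measurable borel \<and> (\<forall>\<gamma>\<in>\<Gamma>. line_integral l \<gamma> \<ge> 1) \<and> (\<integral>\<^sup>+ z. (l z)\<^sup>2 \<partial>lborel) \<le> ennreal e"
  have "mod2 \<Gamma> \<le> 0"
  proof (rule ennreal_le_epsilon)
    fix e :: real assume "0 < e"
    then obtain l where "l \<in> borel_measurable borel" "\<forall>\<gamma>\<in>\<Gamma>. line_integral l \<gamma> \<ge> 1" "(\<integral>\<^sup>+ z. (l z)\<^sup>2 \<partial>lborel) \<le> ennreal e"
      using * by blast
    then show "mod2 \<Gamma> \<le> 0 + ennreal e" unfolding mod2_def by (auto intro!: INF_lower2)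
  qed
  then show "mod2 \<Gamma> = 0" by simp
qed

lemma mod_weak_null_iff:
  "mod_weak Q \<Gamma> = 0 \<longleftrightarrow> (\<forall>e>0. \<exists>\<rho> \<Gamma>0. \<Gamma>0 \<subseteq> \<Gamma> \<and> mod2 \<Gamma>0 = 0 \<and>
     (\<forall>\<gamma> \<in> \<Gamma> - \<Gamma>0. (\<Sum>\<^sub>\<infinity>i\<in>meeting Q (trace \<gamma>). \<rho> i) \<ge> 1) \<and> (\<Sum>\<^sub>\<infinity>i\<in>UNIV. (\<rho> i)\<^sup>2) \<le> ennreal e)"
proof (intro iffI allI impI)
  fix e :: real assume "mod_weak Q \<Gamma> = 0" "0 < e"
  then have "mod_weak Q \<Gamma> < ennreal e" by simp
  then obtain \<rho> \<Gamma>0 where "\<Gamma>0 \<subseteq> \<Gamma>" "mod2 \<Gamma>0 = 0"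
     "\<forall>\<gamma> \<in> \<Gamma> - \<Gamma>0. (\<Sum>\<^sub>\<infinity>i\<in>meeting Q (trace \<gamma>). \<rho> i) \<ge> 1" "(\<Sum>\<^sub>\<infinity>i\<in>UNIV. (\<rho> i)\<^sup>2) < ennreal e"
    unfolding mod_weak_def INF_less_iff by auto
  then show "\<exists>\<rho> \<Gamma>0. \<Gamma>0 \<subseteq> \<Gamma> \<and> mod2 \<Gamma>0 = 0 \<and>
     (\<forall>\<gamma> \<in> \<Gamma> - \<Gamma>0. (\<Sum>\<^sub>\<infinity>i\<in>meeting Q (trace \<gamma>). \<rho> i) \<ge> 1) \<and> (\<Sum>\<^sub>\<infinity>i\<in>UNIV. (\<rho> i)\<^sup>2) \<le> ennreal e"
    by (blast intro: order_less_imp_le)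
next
  assume *: "\<forall>e>0. \<exists>\<rho> \<Gamma>0. \<Gamma>0 \<subseteq> \<Gamma> \<and> mod2 \<Gamma>0 = 0 \<and>
     (\<forall>\<gamma> \<in> \<Gamma> - \<Gamma>0. (\<Sum>\<^sub>\<infinity>i\<in>meeting Q (trace \<gamma>). \<rho> i) \<ge> 1) \<and> (\<Sum>\<^sub>\<infinity>i\<in>UNIV. (\<rho> i)\<^sup>2) \<le> ennreal e"
  have "mod_weak Q \<Gamma> \<le> 0"
  proof (rule ennreal_le_epsilon)
    fix e :: real assume "0 < e"
    then obtain \<rho> \<Gamma>0 where \<rho>: "\<Gamma>0 \<subseteq> \<Gamma>" "mod2 \<Gamma>0 = 0"
     "\<forall>\<gamma> \<in> \<Gamma> - \<Gamma>0. (\<Sum>\<^sub>\<infinity>i\<in>meeting Q (trace \<gamma>). \<rho> i) \<ge> 1" "(\<Sum>\<^sub>\<infinity>i\<in>UNIV. (\<rho> i)\<^sup>2) \<le> ennreal e"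
      using * by metis
    \<comment> \<open>A finite bound on the energy makes each weight finite, as
      \<open>mod_weak\<close> asks.\<close>
    have "\<rho> i < \<infinity>" for i
    proof -
      have "(\<rho> i)\<^sup>2 \<le> ennreal e" using infsum_ennreal_ge[of i UNIV "\<lambda>i. (\<rho> i)\<^sup>2"] \<rho>(4) by simp
      then show ?thesis by (cases "\<rho> i") (auto simp: power2_eq_square top_unique)
    qed
    then show "mod_weak Q \<Gamma> \<le> 0 + ennreal e" unfolding mod_weak_def using \<rho>
      by (intro INF_lower2[of \<rho>]) auto
  qed
  then show "mod_weak Q \<Gamma> = 0" by simp
qed

lemma mod_strong_null_iff:
  "mod_strong \<Omega> Q \<Gamma> = 0 \<longleftrightarrow> (\<forall>e>0. \<exists>\<rho>.
     (\<forall>\<gamma> \<in> \<Gamma>. hausdorff1 (trace \<gamma> \<inter> carpet \<Omega> Q) = 0 \<longrightarrow> (\<Sum>\<^sub>\<infinity>i\<in>meeting Q (trace \<gamma>). \<rho> i) \<ge> 1) \<and> (\<Sum>\<^sub>\<infinity>i\<in>UNIV. (\<rho> i)\<^sup>2) \<le> ennreal e)"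
proof (intro iffI allI impI)
  fix e :: real assume "mod_strong \<Omega> Q \<Gamma> = 0" "0 < e"
  then have "mod_strong \<Omega> Q \<Gamma> < ennreal e" by simp
  then obtain \<rho> where
     "\<forall>\<gamma> \<in> \<Gamma>. hausdorff1 (trace \<gamma> \<inter> carpet \<Omega> Q) = 0 \<longrightarrow> (\<Sum>\<^sub>\<infinity>i\<in>meeting Q (trace \<gamma>). \<rho> i) \<ge> 1" "(\<Sum>\<^sub>\<infinity>i\<in>UNIV. (\<rho> i)\<^sup>2) < ennreal e"
    unfolding mod_strong_def INF_less_iff by auto
  then show "\<exists>\<rho>.
     (\<forall>\<gamma> \<in> \<Gamma>. hausdorff1 (trace \<gamma> \<inter> carpet \<Omega> Q) = 0 \<longrightarrow> (\<Sum>\<^sub>\<infinity>i\<in>meeting Q (trace \<gamma>). \<rho> i) \<ge> 1) \<and> (\<Sum>\<^sub>\<infinity>i\<in>UNIV. (\<rho> i)\<^sup>2) \<le> ennreal e"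
    by (blast intro: order_less_imp_le)
next
  assume *: "\<forall>e>0. \<exists>\<rho>.
     (\<forall>\<gamma> \<in> \<Gamma>. hausdorff1 (trace \<gamma> \<inter> carpet \<Omega> Q) = 0 \<longrightarrow> (\<Sum>\<^sub>\<infinity>i\<in>meeting Q (trace \<gamma>). \<rho> i) \<ge> 1) \<and> (\<Sum>\<^sub>\<infinity>i\<in>UNIV. (\<rho> i)\<^sup>2) \<le> ennreal e"
  have "mod_strong \<Omega> Q \<Gamma> \<le> 0"
  proof (rule ennreal_le_epsilon)
    fix e :: real assume "0 < e"
    then obtain \<rho> where \<rho>:
     "\<forall>\<gamma> \<in> \<Gamma>. hausdorff1 (trace \<gamma> \<inter> carpet \<Omega> Q) = 0 \<longrightarrow> (\<Sum>\<^sub>\<infinity>i\<in>meeting Q (trace \<gamma>). \<rho> i) \<ge> 1" "(\<Sum>\<^sub>\<infinity>i\<in>UNIV. (\<rho> i)\<^sup>2) \<le> ennreal e"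
      using * by metis
    have "\<rho> i < \<infinity>" for i
    proof -
      have "(\<rho> i)\<^sup>2 \<le> ennreal e" using infsum_ennreal_ge[of i UNIV "\<lambda>i. (\<rho> i)\<^sup>2"] \<rho>(2) by simp
      then show ?thesis by (cases "\<rho> i") (auto simp: power2_eq_square top_unique)
    qed
    then show "mod_strong \<Omega> Q \<Gamma> \<le> 0 + ennreal e" unfolding mod_strong_def using \<rho>
      by (intro INF_lower2[of \<rho>]) auto
  qed
  then show "mod_strong \<Omega> Q \<Gamma> = 0" by simp
qed

lemma SUP_power2_le_suminf: "(SUP n. a n)\<^sup>2 \<le> (\<Sum>n. (a n :: ennreal)\<^sup>2)"
proof (cases "\<Sum>n. (a n)\<^sup>2")
  case (real t)
  have "a n \<le> ennreal (sqrt t)" for n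
  proof -
    have "sum (\<lambda>n. (a n)\<^sup>2) {n} \<le> (\<Sum>n. (a n)\<^sup>2)" by (rule sum_le_suminf) auto
    then have "(a n)\<^sup>2 \<le> ennreal t" using real by simp
    then show ?thesis
      using real by (cases "a n") (auto simp: ennreal_power power2_eq_square[of top] top_unique real_le_rsqrt)
  qed
  then have "(SUP n. a n) \<le> ennreal (sqrt t)" by (intro SUP_least)
  then have "(SUP n. a n)\<^sup>2 \<le> (ennreal (sqrt t))\<^sup>2" by (intro power_mono) auto
  then show ?thesis using real by (simp add: ennreal_power)
qed simp

lemma suminf_half_powers:
  assumes "0 < e" shows "(\<Sum>n. ennreal (e * (1 / 2) ^ Suc n)) = ennreal e"
proof -
  have "(\<lambda>n. e * (1 / 2) ^ Suc n) sums (e * 1)" by (intro sums_mult power_half_series)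
  then show ?thesis using assms by (intro suminf_ennreal_eq) auto
qed

lemma choice2: "\<forall>x. \<exists>y z. P x y z \<Longrightarrow> \<exists>f g. \<forall>x. P x (f x) (g x)"
  by metis

text \<open>Densities of energy \<open>e / 2^(n + 1)\<close> are combined by their supremum: it is
  admissible for the union, and its square is at most the sum of the squares.\<close>

lemma mod2_null_UN:
  assumes "\<And>n::nat. mod2 (\<Gamma> n) = 0" shows "mod2 (\<Union>n. \<Gamma> n) = 0"
  unfolding mod2_null_iff
proof (intro allI impI)
  fix e :: real assume e: "0 < e"
  have "\<exists>l. l \<in> borel_measurable borel \<and> (\<forall>\<gamma>\<in>\<Gamma> n. line_integral l \<gamma> \<ge> 1) \<and>
     (\<integral>\<^sup>+ z. (l z)\<^sup>2 \<partial>lborel) \<le> ennreal (e * (1 / 2) ^ Suc n)" for n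
    using assms[of n, unfolded mod2_null_iff, rule_format, of "e * (1 / 2) ^ Suc n"] e by simp
  then obtain l where l: "\<And>n. l n \<in> borel_measurable borel" "\<And>n \<gamma>. \<gamma> \<in> \<Gamma> n \<Longrightarrow> line_integral (l n) \<gamma> \<ge> 1"
     "\<And>n. (\<integral>\<^sup>+ z. (l n z)\<^sup>2 \<partial>lborel) \<le> ennreal (e * (1 / 2) ^ Suc n)" by metis
  note [measurable] = l(1)
  let ?l = "\<lambda>z. SUP n. l n z"
  have "line_integral ?l \<gamma> \<ge> 1" if "\<gamma> \<in> (\<Union>n. \<Gamma> n)" for \<gamma>
  proof -
    from that obtain n where "\<gamma> \<in> \<Gamma> n" by blast
    then have "1 \<le> line_integral (l n) \<gamma>" using l by blast
    also have "\<dots> \<le> line_integral ?l \<gamma>" by (rule line_integral_mono) (rule SUP_upper, simp)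
    finally show ?thesis .
  qed
  moreover have "(\<integral>\<^sup>+ z. (?l z)\<^sup>2 \<partial>lborel) \<le> ennreal e"
  proof -
    have "(\<integral>\<^sup>+ z. (?l z)\<^sup>2 \<partial>lborel) \<le> (\<integral>\<^sup>+ z. (\<Sum>n. (l n z)\<^sup>2) \<partial>lborel)"
      by (intro nn_integral_mono SUP_power2_le_suminf)
    also have "\<dots> = (\<Sum>n. \<integral>\<^sup>+ z. (l n z)\<^sup>2 \<partial>lborel)" by (rule nn_integral_suminf) measurable
    also have "\<dots> \<le> (\<Sum>n. ennreal (e * (1 / 2) ^ Suc n))" by (intro suminf_le l) auto
    finally show ?thesis using suminf_half_powers[OF e] by simp
  qed
  moreover have "?l \<in> borel_measurable borel" by measurable
  ultimately show "\<exists>l. l \<in> borel_measurable borel \<and> (\<forall>\<gamma>\<in>\<Union>n. \<Gamma> n. line_integral l \<gamma> \<ge> 1) \<and> (\<integral>\<^sup>+ z. (l z)\<^sup>2 \<partial>lborel) \<le> ennreal e"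
    by blast
qed

lemma infsum_SUP_power2_le:
  fixes \<rho> :: "nat \<Rightarrow> nat \<Rightarrow> ennreal"
  assumes "0 < e" "\<And>n. (\<Sum>\<^sub>\<infinity>i\<in>UNIV. (\<rho> n i)\<^sup>2) \<le> ennreal (e * (1 / 2) ^ Suc n)"
  shows "(\<Sum>\<^sub>\<infinity>i\<in>UNIV. (SUP n. \<rho> n i)\<^sup>2) \<le> ennreal e"
proof -
  have "(\<Sum>\<^sub>\<infinity>i\<in>UNIV. (SUP n. \<rho> n i)\<^sup>2) = (\<Sum>i. (SUP n. \<rho> n i)\<^sup>2)" by (simp add: infsum_ennreal_suminf)
  also have "\<dots> \<le> (\<Sum>i. \<Sum>n. (\<rho> n i)\<^sup>2)" by (intro suminf_le SUP_power2_le_suminf) auto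
  \<comment> \<open>The interchange of the two summations, read as integration over counting
    measure.\<close>
  also have "\<dots> = (\<integral>\<^sup>+i. (\<Sum>n. (\<rho> n i)\<^sup>2) \<partial>count_space UNIV)" by (simp add: nn_integral_count_space_nat)
  also have "\<dots> = (\<Sum>n. \<integral>\<^sup>+i. (\<rho> n i)\<^sup>2 \<partial>count_space UNIV)" by (rule nn_integral_suminf) auto
  also have "\<dots> = (\<Sum>n. \<Sum>\<^sub>\<infinity>i\<in>UNIV. (\<rho> n i)\<^sup>2)" by (simp add: nn_integral_count_space_nat infsum_ennreal_suminf)
  also have "\<dots> \<le> (\<Sum>n. ennreal (e * (1 / 2) ^ Suc n))" by (intro suminf_le assms) auto
  finally show ?thesis using suminf_half_powers[OF assms(1)] by simp
qed

text \<open>Suprema of weights play the part of suprema of densities in \<open>mod2_null_UN\<close>.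
  In the weak version the discarded families are united as well.\<close>

lemma carpet_modulus_null_UN:
  assumes "\<And>n::nat. carpet_modulus v \<Omega> Q (\<Gamma> n) = 0" shows "carpet_modulus v \<Omega> Q (\<Union>n. \<Gamma> n) = 0"
proof -
  have UP: "1 \<le> (\<Sum>\<^sub>\<infinity>i\<in>A. (SUP n. \<rho> n i))" if "1 \<le> (\<Sum>\<^sub>\<infinity>i\<in>A. \<rho> n i)" for A n and \<rho> :: "nat \<Rightarrow> nat \<Rightarrow> ennreal"
    using that by (rule order_trans) (intro infsum_ennreal_mono SUP_upper order_refl UNIV_I)
  show ?thesis
  proof (cases v)
    case Weak
    then have null: "\<And>n. mod_weak Q (\<Gamma> n) = 0" using assms by (simp add: carpet_modulus_def)
    have "mod_weak Q (\<Union>n. \<Gamma> n) = 0"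
      unfolding mod_weak_null_iff
    proof (intro allI impI)
      fix e :: real assume e: "0 < e"
      let ?P = "\<lambda>n \<rho> \<Gamma>0. \<Gamma>0 \<subseteq> \<Gamma> n \<and> mod2 \<Gamma>0 = 0 \<and>
        (\<forall>\<gamma> \<in> \<Gamma> n - \<Gamma>0. (\<Sum>\<^sub>\<infinity>i\<in>meeting Q (trace \<gamma>). \<rho> i) \<ge> 1) \<and> (\<Sum>\<^sub>\<infinity>i\<in>UNIV. (\<rho> i)\<^sup>2) \<le> ennreal (e * (1 / 2) ^ Suc n)"
      have "\<exists>\<rho> \<Gamma>0. ?P n \<rho> \<Gamma>0" for n
        using null[of n, unfolded mod_weak_null_iff, rule_format, of "e * (1 / 2) ^ Suc n"] e by simp
      then have "\<exists>\<rho> \<Gamma>0. \<forall>n. ?P n (\<rho> n) (\<Gamma>0 n)" by (intro choice2) blast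
      then obtain \<rho> \<Gamma>0 where P: "\<forall>n. ?P n (\<rho> n) (\<Gamma>0 n)" by blast
      then have \<rho>: "\<And>n. \<Gamma>0 n \<subseteq> \<Gamma> n" "\<And>n. mod2 (\<Gamma>0 n) = 0"
        "\<And>n \<gamma>. \<gamma> \<in> \<Gamma> n - \<Gamma>0 n \<Longrightarrow> (\<Sum>\<^sub>\<infinity>i\<in>meeting Q (trace \<gamma>). \<rho> n i) \<ge> 1" "\<And>n. (\<Sum>\<^sub>\<infinity>i\<in>UNIV. (\<rho> n i)\<^sup>2) \<le> ennreal (e * (1 / 2) ^ Suc n)"
        by blast+
      have "\<forall>\<gamma> \<in> (\<Union>n. \<Gamma> n) - (\<Union>n. \<Gamma>0 n). (\<Sum>\<^sub>\<infinity>i\<in>meeting Q (trace \<gamma>). SUP n. \<rho> n i) \<ge> 1"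
        using UP \<rho>(3) by blast
      then show "\<exists>\<rho> \<Gamma>0. \<Gamma>0 \<subseteq> (\<Union>n. \<Gamma> n) \<and> mod2 \<Gamma>0 = 0 \<and>
        (\<forall>\<gamma> \<in> (\<Union>n. \<Gamma> n) - \<Gamma>0. (\<Sum>\<^sub>\<infinity>i\<in>meeting Q (trace \<gamma>). \<rho> i) \<ge> 1) \<and> (\<Sum>\<^sub>\<infinity>i\<in>UNIV. (\<rho> i)\<^sup>2) \<le> ennreal e"
        using UN_mono[OF order_refl \<rho>(1)] mod2_null_UN[of \<Gamma>0, OF \<rho>(2)] infsum_SUP_power2_le[OF e \<rho>(4)]
        by (intro exI[of _ "\<lambda>i. SUP n. \<rho> n i"] exI[of _ "\<Union>n. \<Gamma>0 n"] conjI) assumption+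
    qed
    then show ?thesis using Weak by (simp add: carpet_modulus_def)
  next
    case Strong
    then have null: "\<And>n. mod_strong \<Omega> Q (\<Gamma> n) = 0" using assms by (simp add: carpet_modulus_def)
    have "mod_strong \<Omega> Q (\<Union>n. \<Gamma> n) = 0"
      unfolding mod_strong_null_iff
    proof (intro allI impI)
      fix e :: real assume e: "0 < e"
      let ?P = "\<lambda>n \<rho>. (\<forall>\<gamma> \<in> \<Gamma> n. hausdorff1 (trace \<gamma> \<inter> carpet \<Omega> Q) = 0 \<longrightarrow>
        (\<Sum>\<^sub>\<infinity>i\<in>meeting Q (trace \<gamma>). \<rho> i) \<ge> 1) \<and> (\<Sum>\<^sub>\<infinity>i\<in>UNIV. (\<rho> i)\<^sup>2) \<le> ennreal (e * (1 / 2) ^ Suc n)"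
      have "\<exists>\<rho>. ?P n \<rho>" for n
        using null[of n, unfolded mod_strong_null_iff, rule_format, of "e * (1 / 2) ^ Suc n"] e by simp
      then have "\<exists>\<rho>. \<forall>n. ?P n (\<rho> n)" by (intro choice) blast
      then obtain \<rho> where P: "\<forall>n. ?P n (\<rho> n)" by blast
      then have \<rho>: "\<And>n \<gamma>. \<gamma> \<in> \<Gamma> n \<Longrightarrow> hausdorff1 (trace \<gamma> \<inter> carpet \<Omega> Q) = 0 \<Longrightarrow> (\<Sum>\<^sub>\<infinity>i\<in>meeting Q (trace \<gamma>). \<rho> n i) \<ge> 1"
        "\<And>n. (\<Sum>\<^sub>\<infinity>i\<in>UNIV. (\<rho> n i)\<^sup>2) \<le> ennreal (e * (1 / 2) ^ Suc n)"
        by blast+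
      have "\<forall>\<gamma> \<in> (\<Union>n. \<Gamma> n). hausdorff1 (trace \<gamma> \<inter> carpet \<Omega> Q) = 0 \<longrightarrow> (\<Sum>\<^sub>\<infinity>i\<in>meeting Q (trace \<gamma>). SUP n. \<rho> n i) \<ge> 1"
        using UP \<rho>(1) by blast
      then show "\<exists>\<rho>. (\<forall>\<gamma> \<in> (\<Union>n. \<Gamma> n). hausdorff1 (trace \<gamma> \<inter> carpet \<Omega> Q) = 0 \<longrightarrow> (\<Sum>\<^sub>\<infinity>i\<in>meeting Q (trace \<gamma>). \<rho> i) \<ge> 1) \<and> (\<Sum>\<^sub>\<infinity>i\<in>UNIV. (\<rho> i)\<^sup>2) \<le> ennreal e"
        using infsum_SUP_power2_le[OF e \<rho>(2)] by blast
    qed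
    then show ?thesis using Strong by (simp add: carpet_modulus_def)
  qed
qed

lemma carpet_modulus_null_Un:
  assumes "carpet_modulus v \<Omega> Q \<Gamma> = 0" "carpet_modulus v \<Omega> Q \<Gamma>' = 0" shows "carpet_modulus v \<Omega> Q (\<Gamma> \<union> \<Gamma>') = 0"
proof -
  have "carpet_modulus v \<Omega> Q (\<Union>n::nat. if n = 0 then \<Gamma> else \<Gamma>') = 0"
    using assms by (intro carpet_modulus_null_UN) simp
  also have "(\<Union>n::nat. if n = 0 then \<Gamma> else \<Gamma>') = \<Gamma> \<union> \<Gamma>'" by (auto split: if_splits)
  finally show ?thesis .
qed

lemma meeting_mono: "A \<subseteq> B \<Longrightarrow> meeting Q A \<subseteq> meeting Q B"
  by (auto simp: meeting_def)

lemma trace_subpath: "J \<subseteq> fst \<gamma> \<Longrightarrow> trace (J, snd \<gamma>) \<subseteq> trace \<gamma>"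
  by (auto simp: trace_def)

text \<open>Sums over disks and line integrals only grow from a subpath to the path, so weights and
  densities stay admissible; in the strong version a path with null carpet part has subpaths of the
  same kind. This is what makes the upper gradient inequality available on every closed subpath of a
  good path.\<close>

lemma carpet_modulus_null_subpaths:
  assumes "carpet_modulus v \<Omega> Q \<Gamma> = 0"
  shows "carpet_modulus v \<Omega> Q {\<gamma> \<in> P. \<exists>J\<subseteq>fst \<gamma>. (J, snd \<gamma>) \<in> \<Gamma>} = 0" (is "carpet_modulus v \<Omega> Q (?U \<Gamma>) = 0")
proof (cases v)
  case Weak
  then have null: "mod_weak Q \<Gamma> = 0" using assms by (simp add: carpet_modulus_def)
  have "mod_weak Q (?U \<Gamma>) = 0"
    unfolding mod_weak_null_iff
  proof (intro allI impI)
    fix e :: real assume e: "0 < e"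
    obtain \<rho> \<Gamma>0 where \<rho>: "\<Gamma>0 \<subseteq> \<Gamma>" "mod2 \<Gamma>0 = 0"
      "\<And>\<gamma>. \<gamma> \<in> \<Gamma> - \<Gamma>0 \<Longrightarrow> (\<Sum>\<^sub>\<infinity>i\<in>meeting Q (trace \<gamma>). \<rho> i) \<ge> 1" "(\<Sum>\<^sub>\<infinity>i\<in>UNIV. (\<rho> i)\<^sup>2) \<le> ennreal e"
      using null[unfolded mod_weak_null_iff, rule_format, OF e] by blast
    have "mod2 (?U \<Gamma>0) = 0"
      unfolding mod2_null_iff
    proof (intro allI impI)
      fix e :: real assume e: "0 < e"
      obtain l where l: "l \<in> borel_measurable borel" "\<And>\<gamma>. \<gamma> \<in> \<Gamma>0 \<Longrightarrow> line_integral l \<gamma> \<ge> 1" "(\<integral>\<^sup>+ z. (l z)\<^sup>2 \<partial>lborel) \<le> ennreal e"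
        using \<rho>(2)[unfolded mod2_null_iff, rule_format, OF e] by blast
      have "line_integral l \<gamma> \<ge> 1" if "\<gamma> \<in> ?U \<Gamma>0" for \<gamma>
      proof -
        from that obtain J where J: "J \<subseteq> fst \<gamma>" "(J, snd \<gamma>) \<in> \<Gamma>0" by (elim CollectE conjE exE)
        show ?thesis by (rule order_trans[OF l(2)[OF J(2)] line_integral_subpath[OF J(1)]])
      qed
      then show "\<exists>l. l \<in> borel_measurable borel \<and> (\<forall>\<gamma>\<in>?U \<Gamma>0. line_integral l \<gamma> \<ge> 1) \<and> (\<integral>\<^sup>+ z. (l z)\<^sup>2 \<partial>lborel) \<le> ennreal e"
        using l by blast
    qed
    moreover have "(\<Sum>\<^sub>\<infinity>i\<in>meeting Q (trace \<gamma>). \<rho> i) \<ge> 1" if "\<gamma> \<in> ?U \<Gamma> - ?U \<Gamma>0" for \<gamma>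
    proof -
      from that have "\<gamma> \<in> P" by simp
      with that obtain J where J: "J \<subseteq> fst \<gamma>" "(J, snd \<gamma>) \<in> \<Gamma> - \<Gamma>0" by auto
      have "1 \<le> (\<Sum>\<^sub>\<infinity>i\<in>meeting Q (trace (J, snd \<gamma>)). \<rho> i)" using J \<rho> by blast
      also have "\<dots> \<le> (\<Sum>\<^sub>\<infinity>i\<in>meeting Q (trace \<gamma>). \<rho> i)"
        using J by (intro infsum_ennreal_mono meeting_mono trace_subpath) auto
      finally show ?thesis .
    qed
    ultimately show "\<exists>\<rho> \<Gamma>0. \<Gamma>0 \<subseteq> ?U \<Gamma> \<and> mod2 \<Gamma>0 = 0 \<and>
      (\<forall>\<gamma> \<in> ?U \<Gamma> - \<Gamma>0. (\<Sum>\<^sub>\<infinity>i\<in>meeting Q (trace \<gamma>). \<rho> i) \<ge> 1) \<and> (\<Sum>\<^sub>\<infinity>i\<in>UNIV. (\<rho> i)\<^sup>2) \<le> ennreal e"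
      using \<rho>(1,4) by (intro exI[of _ \<rho>] exI[of _ "?U \<Gamma>0"]) blast
  qed
  then show ?thesis using Weak by (simp add: carpet_modulus_def)
next
  case Strong
  then have null: "mod_strong \<Omega> Q \<Gamma> = 0" using assms by (simp add: carpet_modulus_def)
  have "mod_strong \<Omega> Q (?U \<Gamma>) = 0"
    unfolding mod_strong_null_iff
  proof (intro allI impI)
    fix e :: real assume e: "0 < e"
    obtain \<rho> where \<rho>:
      "\<And>\<gamma>. \<gamma> \<in> \<Gamma> \<Longrightarrow> hausdorff1 (trace \<gamma> \<inter> carpet \<Omega> Q) = 0 \<Longrightarrow> (\<Sum>\<^sub>\<infinity>i\<in>meeting Q (trace \<gamma>). \<rho> i) \<ge> 1" "(\<Sum>\<^sub>\<infinity>i\<in>UNIV. (\<rho> i)\<^sup>2) \<le> ennreal e"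
      using null[unfolded mod_strong_null_iff, rule_format, OF e] by blast
    have "(\<Sum>\<^sub>\<infinity>i\<in>meeting Q (trace \<gamma>). \<rho> i) \<ge> 1" if "\<gamma> \<in> ?U \<Gamma>" "hausdorff1 (trace \<gamma> \<inter> carpet \<Omega> Q) = 0" for \<gamma>
    proof -
      from that(1) obtain J where J: "J \<subseteq> fst \<gamma>" "(J, snd \<gamma>) \<in> \<Gamma>" by (elim CollectE conjE exE)
      have "hausdorff1 (trace (J, snd \<gamma>) \<inter> carpet \<Omega> Q) = 0"
        using that(2) trace_subpath[OF J(1)] by (auto intro: hausdorff1_mono_null)
      then have "1 \<le> (\<Sum>\<^sub>\<infinity>i\<in>meeting Q (trace (J, snd \<gamma>)). \<rho> i)" using J \<rho> by blast
      also have "\<dots> \<le> (\<Sum>\<^sub>\<infinity>i\<in>meeting Q (trace \<gamma>). \<rho> i)"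
        using J by (intro infsum_ennreal_mono meeting_mono trace_subpath) auto
      finally show ?thesis .
    qed
    then show "\<exists>\<rho>. (\<forall>\<gamma> \<in> ?U \<Gamma>. hausdorff1 (trace \<gamma> \<inter> carpet \<Omega> Q) = 0 \<longrightarrow> (\<Sum>\<^sub>\<infinity>i\<in>meeting Q (trace \<gamma>). \<rho> i) \<ge> 1) \<and> (\<Sum>\<^sub>\<infinity>i\<in>UNIV. (\<rho> i)\<^sup>2) \<le> ennreal e"
      using \<rho>(2) by blast
  qed
  then show ?thesis using Strong by (simp add: carpet_modulus_def)
qed

text \<open>A weight with infinite sum along a path stays admissible after multiplication by any
  positive constant, while its energy becomes arbitrarily small.\<close>

lemma carpet_modulus_null_infinite_sum:
  fixes \<rho> :: "nat \<Rightarrow> ennreal"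
  assumes "(\<Sum>\<^sub>\<infinity>i\<in>UNIV. (\<rho> i)\<^sup>2) < \<infinity>"
  shows "carpet_modulus v \<Omega> Q {\<gamma> \<in> P. (\<Sum>\<^sub>\<infinity>i\<in>meeting Q (trace \<gamma>). \<rho> i) = \<infinity>} = 0"
proof -
  let ?\<Gamma> = "{\<gamma> \<in> P. (\<Sum>\<^sub>\<infinity>i\<in>meeting Q (trace \<gamma>). \<rho> i) = \<infinity>}"
  obtain E where E: "(\<Sum>\<^sub>\<infinity>i\<in>UNIV. (\<rho> i)\<^sup>2) = ennreal E" "0 \<le> E"
    using assms by (cases "\<Sum>\<^sub>\<infinity>i\<in>UNIV. (\<rho> i)\<^sup>2") auto
  have *: "\<exists>\<rho>'. (\<forall>\<gamma>\<in>?\<Gamma>. (\<Sum>\<^sub>\<infinity>i\<in>meeting Q (trace \<gamma>). \<rho>' i) \<ge> 1) \<and> (\<Sum>\<^sub>\<infinity>i\<in>UNIV. (\<rho>' i)\<^sup>2) \<le> ennreal e"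
    if e: "0 < e" for e
  proof (intro exI conjI ballI)
    define c where "c = sqrt (e / (E + 1))"
    have c: "0 < c" "c\<^sup>2 * E \<le> e" using e E by (auto simp: c_def field_simps)
    let ?r = "\<lambda>i. ennreal c * \<rho> i"
    show "1 \<le> (\<Sum>\<^sub>\<infinity>i\<in>meeting Q (trace \<gamma>). ?r i)" if "\<gamma> \<in> ?\<Gamma>" for \<gamma>
      using that c by (simp add: infsum_ennreal_cmult ennreal_mult_top)
    have "(\<Sum>\<^sub>\<infinity>i\<in>UNIV. (?r i)\<^sup>2) = ennreal (c\<^sup>2) * ennreal E"
      using c by (simp add: power_mult_distrib infsum_ennreal_cmult E ennreal_power)
    also have "\<dots> \<le> ennreal e" using c E by (simp add: ennreal_mult[symmetric] ennreal_leI)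
    finally show "(\<Sum>\<^sub>\<infinity>i\<in>UNIV. (?r i)\<^sup>2) \<le> ennreal e" .
  qed
  have m0: "mod2 {} = 0" unfolding mod2_null_iff by (auto intro!: exI[of _ "\<lambda>_. 0"])
  have "mod_weak Q ?\<Gamma> = 0"
    unfolding mod_weak_null_iff
  proof (intro allI impI)
    fix e :: real assume "0 < e"
    then obtain \<rho>' where "\<forall>\<gamma>\<in>?\<Gamma>. (\<Sum>\<^sub>\<infinity>i\<in>meeting Q (trace \<gamma>). \<rho>' i) \<ge> 1" "(\<Sum>\<^sub>\<infinity>i\<in>UNIV. (\<rho>' i)\<^sup>2) \<le> ennreal e"
      using * by blast
    then show "\<exists>\<rho> \<Gamma>0. \<Gamma>0 \<subseteq> ?\<Gamma> \<and> mod2 \<Gamma>0 = 0 \<and>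
      (\<forall>\<gamma> \<in> ?\<Gamma> - \<Gamma>0. (\<Sum>\<^sub>\<infinity>i\<in>meeting Q (trace \<gamma>). \<rho> i) \<ge> 1) \<and> (\<Sum>\<^sub>\<infinity>i\<in>UNIV. (\<rho> i)\<^sup>2) \<le> ennreal e"
      using m0 by (intro exI[of _ \<rho>'] exI[of _ "{}"]) simp
  qed
  moreover have "mod_strong \<Omega> Q ?\<Gamma> = 0"
    unfolding mod_strong_null_iff
  proof (intro allI impI)
    fix e :: real assume "0 < e"
    then obtain \<rho>' where "\<forall>\<gamma>\<in>?\<Gamma>. (\<Sum>\<^sub>\<infinity>i\<in>meeting Q (trace \<gamma>). \<rho>' i) \<ge> 1" "(\<Sum>\<^sub>\<infinity>i\<in>UNIV. (\<rho>' i)\<^sup>2) \<le> ennreal e"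
      using * by blast
    then show "\<exists>\<rho>. (\<forall>\<gamma> \<in> ?\<Gamma>. hausdorff1 (trace \<gamma> \<inter> carpet \<Omega> Q) = 0 \<longrightarrow>
      (\<Sum>\<^sub>\<infinity>i\<in>meeting Q (trace \<gamma>). \<rho> i) \<ge> 1) \<and> (\<Sum>\<^sub>\<infinity>i\<in>UNIV. (\<rho> i)\<^sup>2) \<le> ennreal e"
      by (intro exI[of _ \<rho>']) simp
  qed
  ultimately show ?thesis by (cases v) (simp_all add: carpet_modulus_def)
qed

section \<open>Upper gradient inequalities along paths and square loops\<close>

context rel_carpet
begin

lemma abs_diff_le_oscr:
  assumes "bounded (u ` frontier (Q i))" "x \<in> frontier (Q i)" "y \<in> frontier (Q i)"
  shows "\<bar>u x - u y\<bar> \<le> oscr Q u i"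
proof -
  have "bdd_above (u ` frontier (Q i))" "bdd_below (u ` frontier (Q i))"
    using assms(1) bounded_imp_bdd_above bounded_imp_bdd_below by auto
  then have "u z \<le> Sup (u ` frontier (Q i)) \<and> Inf (u ` frontier (Q i)) \<le> u z" if "z \<in> frontier (Q i)" for z
    using that by (auto intro: cSUP_upper cINF_lower)
  from this[OF assms(2)] this[OF assms(3)] show ?thesis by (auto simp: oscr_def)
qed

lemma oscr_nonneg:
  assumes "bounded (u ` frontier (Q i))" shows "0 \<le> oscr Q u i"
proof -
  obtain x where "x \<in> frontier (Q i)" using frontier_Q_ne by blast
  from abs_diff_le_oscr[OF assms this this] show ?thesis by simp
qed

lemma oscr_le:
  assumes "\<And>x y. x \<in> frontier (Q i) \<Longrightarrow> y \<in> frontier (Q i) \<Longrightarrow> u x - u y \<le> c"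
  shows "oscr Q u i \<le> c"
proof -
  have "Sup (u ` frontier (Q i)) \<le> Inf (u ` frontier (Q i)) + c"
  proof (rule cSUP_least[OF frontier_Q_ne])
    fix x assume x: "x \<in> frontier (Q i)"
    have "u x - c \<le> Inf (u ` frontier (Q i))"
      using assms[OF x] by (intro cINF_greatest[OF frontier_Q_ne]) (simp add: algebra_simps)
    then show "u x \<le> Inf (u ` frontier (Q i)) + c" by simp
  qed
  then show ?thesis by (simp add: oscr_def)
qed

lemma oscr_uminus: "oscr Q (\<lambda>x. - u x) i = oscr Q u i"
proof -
  have "(\<lambda>x. - u x) ` A = uminus ` u ` A" "u ` A = uminus ` (\<lambda>x. - u x) ` A" for A :: "complex set"
    by (auto simp: image_image)
  then show ?thesis unfolding oscr_def Inf_real_def by simp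
qed

lemma sobolev_realD:
  assumes "sobolev_real v \<Omega> Q u"
  shows "bounded (u ` frontier (Q i))"
    "0 < r \<Longrightarrow> compactly_contained (ball x r) \<Omega> \<Longrightarrow> (\<Sum>\<^sub>\<infinity>i\<in>meeting Q (ball x r). (ennreal (oscr Q u i))\<^sup>2) < \<infinity>"
    "upper_gradient v \<Omega> Q (\<lambda>i. ennreal (oscr Q u i)) (\<lambda>x. ereal (u x))"
  using assms by (auto simp: sobolev_real_def)

lemma ball_at:
  assumes "x \<in> \<Omega>" obtains r where "0 < r" "compactly_contained (ball x r) \<Omega>" "cball x r \<subseteq> \<Omega>"
proof -
  obtain r where r: "0 < r" "cball x r \<subseteq> \<Omega>" using open_Omega assms open_contains_cball by metis
  then have "closure (ball x r) \<subseteq> \<Omega>" by simp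
  with r show ?thesis by (intro that[of r]) (auto simp: compactly_contained_def)
qed

lemma compact_energy:
  assumes u: "sobolev_real v \<Omega> Q u" and K: "compact K" "K \<subseteq> \<Omega>"
  shows "(\<Sum>\<^sub>\<infinity>i\<in>meeting Q K. (ennreal (oscr Q u i))\<^sup>2) < \<infinity>"
proof -
  have "\<forall>x\<in>K. \<exists>r>0. compactly_contained (ball x r) \<Omega>" using ball_at K by (metis subsetD)
  then obtain r where r: "\<And>x. x \<in> K \<Longrightarrow> 0 < r x" "\<And>x. x \<in> K \<Longrightarrow> compactly_contained (ball x (r x)) \<Omega>" by metis
  obtain F where F: "finite F" "F \<subseteq> K" "K \<subseteq> (\<Union>x\<in>F. ball x (r x))"
    by (rule compactE_image[OF K(1), of K "\<lambda>x. ball x (r x)"]) (use r(1) in auto)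
  show ?thesis
  proof (rule infsum_ennreal_UN_finite_less_top[OF F(1)])
    show "(\<Sum>\<^sub>\<infinity>i\<in>meeting Q (ball x (r x)). (ennreal (oscr Q u i))\<^sup>2) < \<infinity>" if "x \<in> F" for x
      using that F r by (intro sobolev_realD(2)[OF u]) auto
    show "meeting Q K \<subseteq> (\<Union>x\<in>F. meeting Q (ball x (r x)))" using F(3) by (fastforce simp: meeting_def)
  qed
qed

lemma countable_ball_cover:
  obtains B :: "nat \<Rightarrow> complex set" where "\<And>n. \<exists>x r. 0 < r \<and> B n = ball x r \<and> compactly_contained (ball x r) \<Omega>"
    "\<Omega> \<subseteq> (\<Union>n. B n)"
proof -
  let ?U = "{B. \<exists>x r. 0 < r \<and> B = ball x r \<and> compactly_contained (ball x r) \<Omega>}"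
  obtain U where U: "U \<subseteq> ?U" "countable U" "\<Union>U = \<Union>?U"
    using Lindelof[of ?U] by auto
  have sub: "\<Omega> \<subseteq> \<Union>U"
  proof
    fix x assume "x \<in> \<Omega>"
    then obtain r where "0 < r" "compactly_contained (ball x r) \<Omega>" using ball_at by metis
    then have "ball x r \<in> ?U" "x \<in> ball x r" by auto
    then show "x \<in> \<Union>U" unfolding U by blast
  qed
  have "U \<noteq> {}" using sub Q_subset[of 0] Q_ne[of 0] by auto
  then have r: "range (from_nat_into U) = U" using U(2) by (rule range_from_nat_into)
  show ?thesis
  proof (rule that[of "from_nat_into U"])
    fix n
    have "from_nat_into U n \<in> ?U" using r U(1) by blast
    then show "\<exists>x r. 0 < r \<and> from_nat_into U n = ball x r \<and> compactly_contained (ball x r) \<Omega>" by blast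
  qed (use r sub in simp)
qed

lemma compact_cpath:
  assumes "\<gamma> \<in> paths_in \<Omega>" "a \<le> b" "{a..b} \<subseteq> fst \<gamma>"
  shows "continuous_on {a..b} (snd \<gamma>)" "({a..b}, snd \<gamma>) \<in> paths_in \<Omega>"
proof -
  obtain h where h: "continuous_on (closure (fst \<gamma>)) h" "\<And>t. t \<in> fst \<gamma> \<Longrightarrow> h t = snd \<gamma> t"
    using assms(1) unfolding paths_in_def is_cpath_def by blast
  have "continuous_on {a..b} h" using h(1) assms(3) closure_subset[of "fst \<gamma>"] by (meson continuous_on_subset order_trans)
  then show c: "continuous_on {a..b} (snd \<gamma>)"
    by (rule continuous_on_eq) (use h(2) assms(3) in auto)
  show "({a..b}, snd \<gamma>) \<in> paths_in \<Omega>"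
    using c assms by (auto simp: paths_in_def is_cpath_def is_interval_cc trace_def)
qed

text \<open>The energy is finite only over relatively compact balls, so finite sums along compact
  paths are arranged ball by ball over a countable cover. Paths with an exceptional subpath are
  discarded too, so that two points are compared through the disks met between them only.\<close>

lemma sobolev_good_family:
  assumes u: "sobolev_real v \<Omega> Q u"
  obtains \<Gamma> where "\<Gamma> \<subseteq> paths_in \<Omega>" "carpet_modulus v \<Omega> Q \<Gamma> = 0"
    "\<And>\<gamma> a b. \<gamma> \<in> paths_in \<Omega> - \<Gamma> \<Longrightarrow> a \<le> b \<Longrightarrow> {a..b} \<subseteq> fst \<gamma> \<Longrightarrow>
       (\<Sum>\<^sub>\<infinity>i\<in>meeting Q (snd \<gamma> ` {a..b}). ennreal (oscr Q u i)) < \<infinity>"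
    "\<And>\<gamma> a b. \<gamma> \<in> paths_in \<Omega> - \<Gamma> \<Longrightarrow> a \<le> b \<Longrightarrow> {a..b} \<subseteq> fst \<gamma> \<Longrightarrow> snd \<gamma> a \<in> S \<Longrightarrow> snd \<gamma> b \<in> S \<Longrightarrow>
       ennreal \<bar>u (snd \<gamma> a) - u (snd \<gamma> b)\<bar> \<le> (\<Sum>\<^sub>\<infinity>i\<in>meeting Q (snd \<gamma> ` {a..b}). ennreal (oscr Q u i))"
proof -
  obtain \<Gamma>0 where \<Gamma>0: "\<Gamma>0 \<subseteq> paths_in \<Omega>" "carpet_modulus v \<Omega> Q \<Gamma>0 = 0"
    "\<And>\<gamma> x y. \<gamma> \<in> paths_in \<Omega> - \<Gamma>0 \<Longrightarrow> x \<in> trace \<gamma> \<inter> S \<Longrightarrow> y \<in> trace \<gamma> \<inter> S \<Longrightarrow>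
      \<bar>ereal (u x) - ereal (u y)\<bar> \<le> enn2ereal (\<Sum>\<^sub>\<infinity>i\<in>meeting Q (trace \<gamma>). ennreal (oscr Q u i))"
    using sobolev_realD(3)[OF u] unfolding upper_gradient_def by blast
  obtain B :: "nat \<Rightarrow> complex set" where B: "\<And>n. \<exists>x r. 0 < r \<and> B n = ball x r \<and> compactly_contained (ball x r) \<Omega>"
    "\<Omega> \<subseteq> (\<Union>n. B n)" using countable_ball_cover by blast
  define \<rho> where "\<rho> n i = (if i \<in> meeting Q (B n) then ennreal (oscr Q u i) else 0)" for n i
  define G1 where "G1 = {\<gamma> \<in> paths_in \<Omega>. \<exists>J\<subseteq>fst \<gamma>. (J, snd \<gamma>) \<in> \<Gamma>0}"
  define G2 where "G2 n = {\<gamma> \<in> paths_in \<Omega>. (\<Sum>\<^sub>\<infinity>i\<in>meeting Q (trace \<gamma>). \<rho> n i) = \<infinity>}" for n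
  show ?thesis
  proof (rule that[of "G1 \<union> (\<Union>n. G2 n)"])
    show "G1 \<union> (\<Union>n. G2 n) \<subseteq> paths_in \<Omega>" by (auto simp: G1_def G2_def)
    have "carpet_modulus v \<Omega> Q (G2 n) = 0" for n
      unfolding G2_def
    proof (rule carpet_modulus_null_infinite_sum)
      obtain x r where xr: "0 < r" "B n = ball x r" "compactly_contained (ball x r) \<Omega>" using B(1) by blast
      have "(\<Sum>\<^sub>\<infinity>i\<in>UNIV. (\<rho> n i)\<^sup>2) = (\<Sum>\<^sub>\<infinity>i\<in>meeting Q (B n). (ennreal (oscr Q u i))\<^sup>2)"
        by (rule infsum_cong_neutral) (auto simp: \<rho>_def)
      also have "\<dots> < \<infinity>" unfolding xr(2) using xr by (intro sobolev_realD(2)[OF u])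
      finally show "(\<Sum>\<^sub>\<infinity>i\<in>UNIV. (\<rho> n i)\<^sup>2) < \<infinity>" .
    qed
    then show "carpet_modulus v \<Omega> Q (G1 \<union> (\<Union>n. G2 n)) = 0"
      unfolding G1_def by (intro carpet_modulus_null_Un carpet_modulus_null_subpaths carpet_modulus_null_UN \<Gamma>0)
  next
    fix \<gamma> a b assume g: "\<gamma> \<in> paths_in \<Omega> - (G1 \<union> (\<Union>n. G2 n))" "a \<le> b" "{a..b} \<subseteq> fst \<gamma>"
    have c: "continuous_on {a..b} (snd \<gamma>)" and p: "({a..b}, snd \<gamma>) \<in> paths_in \<Omega>"
      using compact_cpath[of \<gamma> a b] g by auto
    have K: "compact (snd \<gamma> ` {a..b})" using c by (intro compact_continuous_image) auto
    have sub: "snd \<gamma> ` {a..b} \<subseteq> \<Omega>" "snd \<gamma> ` {a..b} \<subseteq> trace \<gamma>" using p g by (auto simp: paths_in_def trace_def)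
    have "open (B n)" for n using B(1)[of n] by auto
    then obtain N where N: "finite N" "snd \<gamma> ` {a..b} \<subseteq> (\<Union>n\<in>N. B n)"
      using compactE_image[OF K, of UNIV B] sub B(2) by (metis order_trans)
    show "(\<Sum>\<^sub>\<infinity>i\<in>meeting Q (snd \<gamma> ` {a..b}). ennreal (oscr Q u i)) < \<infinity>"
    proof (rule infsum_ennreal_UN_finite_less_top[OF N(1)])
      fix n
      have "(\<Sum>\<^sub>\<infinity>i\<in>meeting Q (snd \<gamma> ` {a..b}) \<inter> meeting Q (B n). ennreal (oscr Q u i)) \<le> (\<Sum>\<^sub>\<infinity>i\<in>meeting Q (trace \<gamma>). \<rho> n i)"
        using meeting_mono[OF sub(2), of Q] by (intro infsum_ennreal_mono) (auto simp: \<rho>_def)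
      also have "\<dots> < \<infinity>" using g(1) by (auto simp: G2_def top.not_eq_extremum)
      finally show "(\<Sum>\<^sub>\<infinity>i\<in>meeting Q (snd \<gamma> ` {a..b}) \<inter> meeting Q (B n). ennreal (oscr Q u i)) < \<infinity>" .
    next
      show "meeting Q (snd \<gamma> ` {a..b}) \<subseteq> (\<Union>n\<in>N. meeting Q (snd \<gamma> ` {a..b}) \<inter> meeting Q (B n))"
      proof
        fix i assume i: "i \<in> meeting Q (snd \<gamma> ` {a..b})"
        then obtain z where "z \<in> Q i" "z \<in> snd \<gamma> ` {a..b}" by (auto simp: meeting_def)
        moreover from this obtain n where "n \<in> N" "z \<in> B n" using N by blast
        ultimately show "i \<in> (\<Union>n\<in>N. meeting Q (snd \<gamma> ` {a..b}) \<inter> meeting Q (B n))" using i by (auto simp: meeting_def)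
      qed
    qed
    assume ab: "snd \<gamma> a \<in> S" "snd \<gamma> b \<in> S"
    have "({a..b}, snd \<gamma>) \<notin> \<Gamma>0" using g by (auto simp: G1_def)
    then have "\<bar>ereal (u (snd \<gamma> a)) - ereal (u (snd \<gamma> b))\<bar> \<le> enn2ereal (\<Sum>\<^sub>\<infinity>i\<in>meeting Q (trace ({a..b}, snd \<gamma>)). ennreal (oscr Q u i))"
      using p g ab by (intro \<Gamma>0(3)) (auto simp: trace_def)
    then show "ennreal \<bar>u (snd \<gamma> a) - u (snd \<gamma> b)\<bar> \<le> (\<Sum>\<^sub>\<infinity>i\<in>meeting Q (snd \<gamma> ` {a..b}). ennreal (oscr Q u i))"
      by (simp add: trace_def less_eq_ennreal.rep_eq enn2ereal_ennreal)
  qed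
qed

lemma AE_loop_sobolev:
  assumes u: "sobolev_real v \<Omega> Q u" and R: "0 < R"
  shows "AE r in lborel. 0 < r \<and> r < R \<and> sqs p r \<subseteq> \<Omega> \<longrightarrow> (\<forall>s t. 0 \<le> s \<and> s \<le> t \<and> t \<le> 16 \<and> loop p r s \<in> S \<and> loop p r t \<in> S \<longrightarrow>
     ennreal \<bar>u (loop p r s) - u (loop p r t)\<bar> \<le> (\<Sum>\<^sub>\<infinity>i\<in>meeting Q (loop p r ` {s..t}). ennreal (oscr Q u i)))"
proof -
  obtain \<Gamma> where G: "\<Gamma> \<subseteq> paths_in \<Omega>" "carpet_modulus v \<Omega> Q \<Gamma> = 0"
    "\<And>\<gamma> a b. \<gamma> \<in> paths_in \<Omega> - \<Gamma> \<Longrightarrow> a \<le> b \<Longrightarrow> {a..b} \<subseteq> fst \<gamma> \<Longrightarrow> snd \<gamma> a \<in> S \<Longrightarrow> snd \<gamma> b \<in> S \<Longrightarrow>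
       ennreal \<bar>u (snd \<gamma> a) - u (snd \<gamma> b)\<bar> \<le> (\<Sum>\<^sub>\<infinity>i\<in>meeting Q (snd \<gamma> ` {a..b}). ennreal (oscr Q u i))"
    by (rule sobolev_good_family[OF u]) (rule that)
  show ?thesis
    using AE_loop_nonexceptional[OF G(2) R, of p]
  proof eventually_elim
    case (elim r)
    show ?case
    proof (intro impI allI)
      fix s t assume r: "0 < r \<and> r < R \<and> sqs p r \<subseteq> \<Omega>" and st: "0 \<le> s \<and> s \<le> t \<and> t \<le> 16 \<and> loop p r s \<in> S \<and> loop p r t \<in> S"
      have c: "continuous_on {s..t} (loop p r)" using st by (intro continuous_on_subset[OF continuous_on_loop]) auto
      have "({s..t}, loop p r) \<in> paths_in \<Omega>"
        using c st r loop_in_sqs[of r _ p] by (fastforce simp: paths_in_def is_cpath_def is_interval_cc trace_def)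
      moreover have "({s..t}, loop p r) \<notin> \<Gamma>" using elim r st by blast
      ultimately show "ennreal \<bar>u (loop p r s) - u (loop p r t)\<bar> \<le> (\<Sum>\<^sub>\<infinity>i\<in>meeting Q (loop p r ` {s..t}). ennreal (oscr Q u i))"
        using G(3)[of "({s..t}, loop p r)" s t] st by auto
    qed
  qed
qed

text \<open>An averaging argument over the radii in \<open>(0, R')\<close>: the mean of the sums of
  oscillations along the squares is at most \<open>e / 2\<close>, so the radii with a sum of at
  least \<open>e\<close> cannot exhaust the interval up to a null set. Disks with \<open>p\<close>
  in their closure are left out, for they may meet every small square and their oscillation does not
  shrink. \<open>P\<close> imposes a further almost sure property on the same radius.\<close>

lemma good_radius:
  assumes u: "sobolev_real v \<Omega> Q u" and p: "p \<in> \<Omega>" and R: "0 < R" and e: "0 < e" and P: "AE r in lborel. P r"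
  obtains r where "0 < r" "r < R" "P r" "cball p (2 * r) \<subseteq> \<Omega>"
    "\<And>s t. 0 \<le> s \<Longrightarrow> s \<le> t \<Longrightarrow> t \<le> 16 \<Longrightarrow> loop p r s \<in> S \<Longrightarrow> loop p r t \<in> S \<Longrightarrow>
       ennreal \<bar>u (loop p r s) - u (loop p r t)\<bar> \<le> (\<Sum>\<^sub>\<infinity>i\<in>meeting Q (loop p r ` {s..t}). ennreal (oscr Q u i))"
    "(\<Sum>\<^sub>\<infinity>i\<in>{i. p \<notin> closure (Q i)} \<inter> meeting Q (sqs p r). ennreal (oscr Q u i)) < ennreal e"
proof -
  let ?I = "{i. p \<notin> closure (Q i)}"
  obtain C where C: "0 < C" "\<forall>p R \<theta> I (\<rho> :: nat \<Rightarrow> ennreal). 0 < R \<longrightarrow> 0 < \<theta> \<longrightarrow>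
    (\<lambda>r. (\<Sum>\<^sub>\<infinity>i\<in>I \<inter> meeting Q (sqs p r). \<rho> i) * indicator {0<..<R} r) \<in> borel_measurable lborel \<and>
    (\<integral>\<^sup>+r. (\<Sum>\<^sub>\<infinity>i\<in>I \<inter> meeting Q (sqs p r). \<rho> i) * indicator {0<..<R} r \<partial>lborel)
      \<le> ennreal \<theta> * (\<Sum>\<^sub>\<infinity>i\<in>I \<inter> meeting Q (ball p (2 * R)). (\<rho> i)\<^sup>2) + ennreal (C * R\<^sup>2 / \<theta>)"
    using sum_over_square by blast
  \<comment> \<open>With \<open>\<theta> = R' * T\<close> both terms of
    \<open>sum_over_square\<close> become \<open>R' * e / 4\<close>, whatever the scale
    \<open>R'\<close>.\<close>
  define T where "T = 4 * C / e"
  have T: "0 < T" using C e by (simp add: T_def)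
  define \<eta> where "\<eta> = e / (4 * T)"
  have \<eta>: "0 < \<eta>" using e T by (simp add: \<eta>_def)
  obtain r1 where r1: "0 < r1" "compactly_contained (ball p r1) \<Omega>" "cball p r1 \<subseteq> \<Omega>" using ball_at p by blast
  have "0 < ennreal \<eta>" using \<eta> by simp
  obtain F where F: "finite F" "(\<Sum>\<^sub>\<infinity>i\<in>meeting Q (ball p r1) - F. (ennreal (oscr Q u i))\<^sup>2) < ennreal \<eta>"
    by (rule infsum_ennreal_tail[OF sobolev_realD(2)[OF u r1(1,2)] \<open>0 < ennreal \<eta>\<close>]) (rule that)
  obtain r2 where r2: "0 < r2" "\<And>i. i \<in> F \<Longrightarrow> p \<notin> closure (Q i) \<Longrightarrow> ball p r2 \<inter> closure (Q i) = {}"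
    by (rule finite_disks_near[OF F(1), of p]) (rule that)
  define R' where "R' = min R (min r1 r2 / 2)"
  have R': "0 < R'" "R' \<le> R" "2 * R' \<le> r1" "2 * R' \<le> r2" using R r1 r2 by (auto simp: R'_def)
  have sub: "?I \<inter> meeting Q (ball p (2 * R')) \<subseteq> meeting Q (ball p r1) - F"
  proof
    fix i assume i: "i \<in> ?I \<inter> meeting Q (ball p (2 * R'))"
    have "ball p (2 * R') \<subseteq> ball p r1" "ball p (2 * R') \<subseteq> ball p r2" using R' by (simp_all add: subset_ball)
    then have "i \<in> meeting Q (ball p r1)" using meeting_mono[of "ball p (2 * R')" "ball p r1" Q] i by blast
    moreover have "i \<notin> F"
    proof
      assume "i \<in> F"
      then have "ball p (2 * R') \<inter> closure (Q i) = {}" using r2(2)[of i] i \<open>ball p (2 * R') \<subseteq> ball p r2\<close> by blast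
      then show False using i closure_subset[of "Q i"] by (auto simp: meeting_def)
    qed
    ultimately show "i \<in> meeting Q (ball p r1) - F" by blast
  qed
  have th: "0 < R' * T" using R' T by simp
  let ?F = "\<lambda>r. (\<Sum>\<^sub>\<infinity>i\<in>?I \<inter> meeting Q (sqs p r). ennreal (oscr Q u i)) * indicator {0<..<R'} r"
  have M: "?F \<in> borel_measurable lborel" and I: "(\<integral>\<^sup>+r. ?F r \<partial>lborel)
      \<le> ennreal (R' * T) * (\<Sum>\<^sub>\<infinity>i\<in>?I \<inter> meeting Q (ball p (2 * R')). (ennreal (oscr Q u i))\<^sup>2) + ennreal (C * R'\<^sup>2 / (R' * T))"
    using C(2)[rule_format, OF R'(1) th, where I="?I" and p=p and \<rho>="\<lambda>i. ennreal (oscr Q u i)"] by auto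
  note I
  also have "\<dots> \<le> ennreal (R' * T) * ennreal \<eta> + ennreal (C * R'\<^sup>2 / (R' * T))"
  proof (intro add_right_mono mult_left_mono)
    have "(\<Sum>\<^sub>\<infinity>i\<in>?I \<inter> meeting Q (ball p (2 * R')). (ennreal (oscr Q u i))\<^sup>2) \<le> (\<Sum>\<^sub>\<infinity>i\<in>meeting Q (ball p r1) - F. (ennreal (oscr Q u i))\<^sup>2)"
      using sub by (rule infsum_ennreal_mono) auto
    then show "(\<Sum>\<^sub>\<infinity>i\<in>?I \<inter> meeting Q (ball p (2 * R')). (ennreal (oscr Q u i))\<^sup>2) \<le> ennreal \<eta>" using F(2) by simp
  qed simp
  also have "\<dots> = ennreal (R' * e / 2)"
  proof -
    have "R' * T * \<eta> = R' * e / 4" using T by (simp add: \<eta>_def)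
    moreover have "C * R'\<^sup>2 / (R' * T) = R' * e / 4" using C e R' by (simp add: T_def power2_eq_square field_simps)
    ultimately have "R' * T * \<eta> + C * R'\<^sup>2 / (R' * T) = R' * e / 2" by linarith
    moreover have "ennreal (R' * T) * ennreal \<eta> + ennreal (C * R'\<^sup>2 / (R' * T)) = ennreal (R' * T * \<eta> + C * R'\<^sup>2 / (R' * T))"
      using th \<eta> C(1) R' by (subst ennreal_plus) (auto simp: ennreal_mult)
    ultimately show ?thesis by metis
  qed
  finally have I: "(\<integral>\<^sup>+r. ?F r \<partial>lborel) \<le> ennreal (R' * e / 2)" .
  let ?A = "{r \<in> space lborel. 1 \<le> ennreal (1 / e) * ?F r}"
  have A1: "?A \<in> sets lborel" using M by measurable
  have "emeasure lborel ?A \<le> ennreal (1 / e) * (\<integral>\<^sup>+r. ?F r * indicator UNIV r \<partial>lborel)"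
    using nn_integral_Markov_inequality[of ?F UNIV lborel "ennreal (1 / e)"] M by simp
  also have "\<dots> \<le> ennreal (1 / e) * ennreal (R' * e / 2)" using I by (intro mult_left_mono) auto
  also have "\<dots> = ennreal (R' / 2)" using e R' by (simp add: ennreal_mult[symmetric])
  finally have A2: "emeasure lborel ?A \<le> ennreal (R' / 2)" .
  have "\<exists>r. 0 < r \<and> r < R' \<and> r \<notin> ?A \<and> P r \<and> (0 < r \<and> r < R \<and> sqs p r \<subseteq> \<Omega> \<longrightarrow> (\<forall>s t. 0 \<le> s \<and> s \<le> t \<and> t \<le> 16 \<and> loop p r s \<in> S \<and> loop p r t \<in> S \<longrightarrow>
     ennreal \<bar>u (loop p r s) - u (loop p r t)\<bar> \<le> (\<Sum>\<^sub>\<infinity>i\<in>meeting Q (loop p r ` {s..t}). ennreal (oscr Q u i))))" (is "\<exists>r. 0 < r \<and> r < R' \<and> r \<notin> ?A \<and> P r \<and> ?H r")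
  proof (rule ccontr)
    assume no: "\<not> ?thesis"
    have "AE r in lborel. P r \<and> ?H r" using P AE_loop_sobolev[OF u R, of p] by eventually_elim blast
    then obtain N where N: "{r. \<not> (P r \<and> ?H r)} \<subseteq> N" "N \<in> null_sets lborel"
      unfolding eventually_ae_filter by auto
    have "{0<..<R'} \<subseteq> ?A \<union> N"
    proof
      fix r assume "r \<in> {0<..<R'}"
      then have "0 < r" "r < R'" by auto
      moreover from no[unfolded not_ex] have "\<not> (0 < r \<and> r < R' \<and> r \<notin> ?A \<and> P r \<and> ?H r)" by (rule spec)
      ultimately have "r \<in> ?A \<or> \<not> (P r \<and> ?H r)" by argo
      then show "r \<in> ?A \<union> N" using N(1) by (elim disjE) (simp, auto simp only: mem_Collect_eq Un_iff subset_iff)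
    qed
    then have "emeasure lborel {0<..<R'} \<le> emeasure lborel (?A \<union> N)"
      using A1 N(2) by (intro emeasure_mono) auto
    also have "\<dots> = emeasure lborel ?A" using A1 N(2) by (intro emeasure_Un_null_set) auto
    also note A2
    finally have "ennreal R' \<le> ennreal (R' / 2)" using R' by simp
    then show False using R' by simp
  qed
  then obtain r where r: "0 < r" "r < R'" "r \<notin> ?A" "P r" "?H r" by blast
  have cb: "cball p (2 * r) \<subseteq> \<Omega>" using r R' r1 by (intro order_trans[OF _ r1(3)]) auto
  have sq: "sqs p r \<subseteq> \<Omega>"
  proof
    fix z assume "z \<in> sqs p r"
    then have "z \<in> cball p (2 * r)" using norm_le_sqn[of "z - p"] by (simp add: sqs_def dist_norm norm_minus_commute)
    then show "z \<in> \<Omega>" using cb by blast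
  qed
  have "r \<in> {0<..<R'}" using r by simp
  then have "ennreal (1 / e) * (\<Sum>\<^sub>\<infinity>i\<in>?I \<inter> meeting Q (sqs p r). ennreal (oscr Q u i)) < 1" using r(3) by (simp add: not_le)
  then have "(\<Sum>\<^sub>\<infinity>i\<in>?I \<inter> meeting Q (sqs p r). ennreal (oscr Q u i)) < ennreal e"
  proof (cases "\<Sum>\<^sub>\<infinity>i\<in>?I \<inter> meeting Q (sqs p r). ennreal (oscr Q u i)")
    case (real x)
    then show ?thesis using \<open>ennreal (1 / e) * _ < 1\<close> e by (simp add: ennreal_mult[symmetric] ennreal_less_iff)
  next
    case top
    then show ?thesis using \<open>ennreal (1 / e) * _ < 1\<close> e by (simp add: ennreal_mult_top)
  qed
  then show ?thesis using r R' cb sq by (intro that[of r]) auto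
qed

section \<open>Oscillation along paths and test functions\<close>

lemma finite_disks_meeting_compact:
  assumes "compact K" "0 < d"
  shows "finite {i. closure (Q i) \<inter> K \<noteq> {} \<and> d \<le> diameter (Q i)}"
proof -
  obtain B where B: "K \<subseteq> ball 0 B" using compact_imp_bounded[OF assms(1)] bounded_subset_ballD by blast
  have "{i. closure (Q i) \<inter> K \<noteq> {} \<and> d \<le> diameter (Q i)} \<subseteq> {i \<in> meeting Q (ball 0 B). d \<le> diameter (Q i)}"
  proof clarsimp
    fix i assume "closure (Q i) \<inter> K \<noteq> {}"
    then have "ball 0 B \<inter> closure (Q i) \<noteq> {}" using B by blast
    then have "ball 0 B \<inter> Q i \<noteq> {}" using open_Int_closure_eq_empty[OF open_ball] by metis
    then show "i \<in> meeting Q (ball 0 B)" by (auto simp: meeting_def)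
  qed
  then show ?thesis by (rule finite_subset) (intro finite_large_disks assms bounded_ball)
qed

text \<open>If the limit parameters have distinct images, the disks relating nearby pairs have
  diameters bounded below; only finitely many such disks touch the compact path, and they give a
  closed relation. If the disks shrink, the two images coincide in the limit, which is why equality
  of images is part of the relation.\<close>

lemma compact_loop_relation:
  fixes f :: "real \<Rightarrow> complex"
  assumes f: "continuous_on {a..b} f" and I: "{s..p} \<subseteq> {a..b}" "{q..t} \<subseteq> {a..b}"
  shows "compact {z \<in> {s..p} \<times> {q..t}. f (fst z) = f (snd z) \<or> (\<exists>i\<in>M. f (fst z) \<in> closure (Q i) \<and> f (snd z) \<in> closure (Q i))}"
    (is "compact ?R")
proof -
  let ?P = "{s..p} \<times> {q..t}"
  have P: "compact ?P" by (intro compact_Times) auto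
  have c1: "continuous_on ?P (\<lambda>z. f (fst z))" "continuous_on ?P (\<lambda>z. f (snd z))"
    using I by (auto intro!: continuous_on_compose2[OF f] continuous_intros)
  have "closed ?R"
    unfolding closed_sequential_limits
  proof (intro allI impI)
    fix z l assume zl: "(\<forall>n. z n \<in> ?R) \<and> z \<longlonglongrightarrow> l"
    have zP: "\<And>n. z n \<in> ?P" using zl by blast
    have lP: "l \<in> ?P" using zl zP compact_imp_closed[OF P] closed_sequentially by blast
    have lim: "(\<lambda>n. f (fst (z n))) \<longlonglongrightarrow> f (fst l)" "(\<lambda>n. f (snd (z n))) \<longlonglongrightarrow> f (snd l)"
      using continuous_on_tendsto_compose[OF c1(1), of z l] continuous_on_tendsto_compose[OF c1(2), of z l] zl zP lP
      by simp_all
    show "l \<in> ?R"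
    proof (cases "f (fst l) = f (snd l)")
      case False
      define d where "d = dist (f (fst l)) (f (snd l)) / 2"
      have d: "0 < d" using False by (simp add: d_def)
      have "(\<lambda>n. dist (f (fst (z n))) (f (snd (z n)))) \<longlonglongrightarrow> dist (f (fst l)) (f (snd l))"
        using lim by (intro tendsto_dist)
      then have ev: "eventually (\<lambda>n. d < dist (f (fst (z n))) (f (snd (z n)))) sequentially"
        by (rule order_tendstoD(1)) (use False in \<open>simp add: d_def\<close>)
      let ?G = "M \<inter> {i. closure (Q i) \<inter> f ` {a..b} \<noteq> {} \<and> d \<le> diameter (Q i)}"
      have fin: "finite ?G" using finite_disks_meeting_compact[of "f ` {a..b}" d] d f
        by (auto intro: compact_continuous_image)
      let ?H = "\<Union>i\<in>?G. {z \<in> ?P. f (fst z) \<in> closure (Q i)} \<inter> {z \<in> ?P. f (snd z) \<in> closure (Q i)}"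
      have "closed {z \<in> ?P. f (fst z) \<in> closure (Q i)}" "closed {z \<in> ?P. f (snd z) \<in> closure (Q i)}" for i
        using continuous_closed_preimage[OF c1(1) compact_imp_closed[OF P] closed_closure, of "Q i"]
          continuous_closed_preimage[OF c1(2) compact_imp_closed[OF P] closed_closure, of "Q i"]
        by (simp_all add: vimage_def Int_def)
      then have "closed ?H" by (intro closed_UN closed_Int fin ballI)
      moreover have "eventually (\<lambda>n. z n \<in> ?H) sequentially"
        using ev
      proof eventually_elim
        case (elim n)
        then have "f (fst (z n)) \<noteq> f (snd (z n))" using d by auto
        then obtain i where i: "i \<in> M" "f (fst (z n)) \<in> closure (Q i)" "f (snd (z n)) \<in> closure (Q i)" using zl by blast
        then have "d \<le> diameter (Q i)" using elim dist_le_diameter_Q by (meson less_imp_le order_trans)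
        moreover have "fst (z n) \<in> {a..b}" using zP[of n] I(1) by (auto simp: mem_Times_iff)
        then have "closure (Q i) \<inter> f ` {a..b} \<noteq> {}" using i(2) by blast
        ultimately have "i \<in> ?G" using i(1) by simp
        moreover have "z n \<in> {z \<in> ?P. f (fst z) \<in> closure (Q i)} \<inter> {z \<in> ?P. f (snd z) \<in> closure (Q i)}"
          using i(2,3) zP[of n] by simp
        ultimately show ?case by (rule UN_I)
      qed
      ultimately have "l \<in> ?H" using zl by (intro Lim_in_closed_set[of ?H z sequentially l]) simp_all
      then obtain i where "i \<in> M" "f (fst l) \<in> closure (Q i)" "f (snd l) \<in> closure (Q i)" by (elim UN_E) (simp, metis)
      then have "\<exists>i\<in>M. f (fst l) \<in> closure (Q i) \<and> f (snd l) \<in> closure (Q i)" by blast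
      then show ?thesis using lP by simp
    qed (use lP in blast)
  qed
  moreover have "bounded ?R" using compact_imp_bounded[OF P] by (rule bounded_subset) auto
  ultimately show ?thesis by (simp add: compact_eq_bounded_closed)
qed

text \<open>The path is shortened so that no disk is visited twice: when a disk of \<open>F\<close> is crossed, the two
  remaining pieces are cut at the earliest parameter and the latest parameter that are identified by
  \<open>f\<close> or by a common closed disk; then the pieces meet disjoint sets of disks.\<close>

lemma loop_erasure_finite:
  fixes f :: "real \<Rightarrow> complex" and o' w :: "nat \<Rightarrow> ennreal" and \<psi> :: "complex \<Rightarrow> real"
  assumes f: "continuous_on {a..b} f" and f\<Omega>: "f ` {a..b} \<subseteq> \<Omega>"
    and d: "\<And>s t. a \<le> s \<Longrightarrow> s \<le> t \<Longrightarrow> t \<le> b \<Longrightarrow> f s \<in> S \<Longrightarrow> f t \<in> S \<Longrightarrow>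
        ennreal \<bar>\<psi> (f s) - \<psi> (f t)\<bar> \<le> infsum o' (meeting Q (f ` {s..t}))"
    and w: "\<And>i x y. x \<in> frontier (Q i) \<Longrightarrow> y \<in> frontier (Q i) \<Longrightarrow> ennreal \<bar>\<psi> x - \<psi> y\<bar> \<le> w i"
    and wo: "\<And>i. w i \<le> o' i"
    and F: "finite F"
  shows "a \<le> s \<Longrightarrow> s \<le> t \<Longrightarrow> t \<le> b \<Longrightarrow> f s \<in> S \<Longrightarrow> f t \<in> S \<Longrightarrow>
    ennreal \<bar>\<psi> (f s) - \<psi> (f t)\<bar> \<le> (\<Sum>\<^sub>\<infinity>i\<in>meeting Q (f ` {s..t}). if i \<in> F then w i else o' i)"
  using F
proof (induction F arbitrary: s t)
  case empty
  then show ?case using d by simp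
next
  case (insert k F)
  define M where "M = meeting Q (f ` {s..t})"
  let ?c = "\<lambda>F i. if i \<in> F then w i else o' i"
  have fI: "f x \<in> Q i \<Longrightarrow> x \<in> {s..t} \<Longrightarrow> i \<in> M" for x i by (auto simp: M_def meeting_def)
  show ?case
  proof (cases "k \<in> M")
    case False
    have "ennreal \<bar>\<psi> (f s) - \<psi> (f t)\<bar> \<le> infsum (?c F) M" unfolding M_def using insert by blast
    also have "\<dots> = infsum (?c (insert k F)) M" using False by (intro infsum_cong) auto
    finally show ?thesis unfolding M_def .
  next
    case True
    have fst': "continuous_on {s..t} f" using f insert.prems by (auto intro: continuous_on_subset)
    \<comment> \<open>Before the first and after the last element of this set the path stays off the
      closed disk \<open>k\<close>.\<close>
    define T where "T = {x \<in> {s..t}. f x \<in> closure (Q k)}"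
    have "compact T"
    proof -
      have "closed ({s..t} \<inter> f -` closure (Q k))" using fst' by (intro continuous_closed_preimage) auto
      moreover have "{s..t} \<inter> f -` closure (Q k) = T" by (auto simp: T_def)
      ultimately have "closed T" by simp
      moreover have "bounded T" by (rule bounded_subset[of "{s..t}"]) (auto simp: T_def)
      ultimately show ?thesis by (simp add: compact_eq_bounded_closed)
    qed
    have "T \<noteq> {}" using True closure_subset[of "Q k"] by (force simp: T_def M_def meeting_def)
    obtain p where p: "p \<in> T" "\<And>x. x \<in> T \<Longrightarrow> p \<le> x" using compact_attains_inf[OF \<open>compact T\<close> \<open>T \<noteq> {}\<close>] by blast
    obtain q where q: "q \<in> T" "\<And>x. x \<in> T \<Longrightarrow> x \<le> q" using compact_attains_sup[OF \<open>compact T\<close> \<open>T \<noteq> {}\<close>] by blast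
    have pq: "s \<le> p" "p \<le> q" "q \<le> t" using p q by (auto simp: T_def)
    define R where "R = {z \<in> {s..p} \<times> {q..t}. f (fst z) = f (snd z) \<or> (\<exists>i\<in>M. f (fst z) \<in> closure (Q i) \<and> f (snd z) \<in> closure (Q i))}"
    have cR: "compact R" unfolding R_def
      by (rule compact_loop_relation[OF fst']) (use pq in auto)
    have RI: "(x, y) \<in> R" if "x \<in> {s..p}" "y \<in> {q..t}" "f x = f y \<or> (\<exists>i\<in>M. f x \<in> closure (Q i) \<and> f y \<in> closure (Q i))" for x y
      using that by (auto simp: R_def)
    have "(p, q) \<in> R" using p(1) q(1) pq True by (intro RI) (auto simp: T_def)
    then have "R \<noteq> {}" by blast
    have "compact (fst ` R)" by (intro compact_continuous_image cR continuous_intros)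
    \<comment> \<open>Minimality of \<open>t1\<close> makes the two shortened pieces meet disjoint
      sets of disks. Maximality of \<open>s1\<close>, chosen next, keeps the final piece away from
      the disk that relates \<open>t1\<close> to \<open>s1\<close>.\<close>
    then obtain t1 where t1: "t1 \<in> fst ` R" "\<And>x y. (x, y) \<in> R \<Longrightarrow> t1 \<le> x"
      using compact_attains_inf[of "fst ` R"] \<open>R \<noteq> {}\<close> by force
    define R1 where "R1 = R \<inter> ({t1} \<times> UNIV)"
    have "compact R1" unfolding R1_def by (intro compact_Int_closed cR closed_Times) auto
    then have "compact (snd ` R1)" by (intro compact_continuous_image continuous_intros)
    moreover have "R1 \<noteq> {}" using t1(1) by (force simp: R1_def)
    ultimately obtain s1 where s1: "s1 \<in> snd ` R1" "\<And>y. (t1, y) \<in> R \<Longrightarrow> y \<le> s1"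
      using compact_attains_sup[of "snd ` R1"] by (force simp: R1_def)
    have ts: "(t1, s1) \<in> R" using s1(1) by (auto simp: R1_def)
    then have I: "s \<le> t1" "t1 \<le> p" "q \<le> s1" "s1 \<le> t"
      and rel: "f t1 = f s1 \<or> (\<exists>i\<in>M. f t1 \<in> closure (Q i) \<and> f s1 \<in> closure (Q i))" by (auto simp: R_def)
    have rel_open: "f s1 \<in> closure (Q i)" if "f t1 \<in> Q i" for i
    proof -
      from rel show ?thesis
      proof
        assume "f t1 = f s1" then show ?thesis using that closure_subset[of "Q i"] by auto
      next
        assume "\<exists>i\<in>M. f t1 \<in> closure (Q i) \<and> f s1 \<in> closure (Q i)"
        then obtain i' where "f t1 \<in> closure (Q i')" "f s1 \<in> closure (Q i')" by blast
        moreover have "i' = i" using calculation(1) that closure_Q_disjoint_Q[of i' i] by blast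
        ultimately show ?thesis by simp
      qed
    qed
    have rel_open': "f t1 \<in> closure (Q i)" if "f s1 \<in> Q i" for i
    proof -
      from rel show ?thesis
      proof
        assume "f t1 = f s1" then show ?thesis using that closure_subset[of "Q i"] by auto
      next
        assume "\<exists>i\<in>M. f t1 \<in> closure (Q i) \<and> f s1 \<in> closure (Q i)"
        then obtain i' where "f t1 \<in> closure (Q i')" "f s1 \<in> closure (Q i')" by blast
        moreover have "i' = i" using calculation(2) that closure_Q_disjoint_Q[of i' i] by blast
        ultimately show ?thesis by simp
      qed
    qed
    have near: "\<exists>e>0. \<forall>y\<in>{s..t}. \<bar>y - x\<bar> < e \<longrightarrow> f y \<in> Q i" if x: "x \<in> {s..t}" "f x \<in> Q i" for x i
    proof -
      obtain e where e: "0 < e" "ball (f x) e \<subseteq> Q i" using open_Q x(2) open_contains_ball by metis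
      obtain e' where "0 < e'" "\<And>y. y \<in> {s..t} \<Longrightarrow> dist y x < e' \<Longrightarrow> dist (f y) (f x) < e"
        using fst' x(1) e(1) unfolding continuous_on_iff by metis
      then show ?thesis using e(2) by (intro exI[of _ e']) (auto simp: dist_real_def dist_commute)
    qed
    \<comment> \<open>Inside an open disk \<open>t1\<close> could be moved a little earlier without
      losing its partner \<open>s1\<close>, since both lie in the same closed disk.\<close>
    have t1S: "f t1 \<in> S"
    proof (rule ccontr)
      assume "f t1 \<notin> S"
      then have "t1 \<noteq> s" using insert.prems by auto
      then have "s < t1" using I by simp
      have "f t1 \<in> \<Omega>" using f\<Omega> I pq insert.prems by auto
      then obtain i where i: "f t1 \<in> Q i" using \<open>f t1 \<notin> S\<close> S_or_Q by blast
      obtain e where e: "0 < e" "\<And>y. y \<in> {s..t} \<Longrightarrow> \<bar>y - t1\<bar> < e \<Longrightarrow> f y \<in> Q i" using near[of t1 i] i I pq by auto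
      define x where "x = max s (t1 - e / 2)"
      have x: "x \<in> {s..t}" "x < t1" "\<bar>x - t1\<bar> < e" using e(1) \<open>s < t1\<close> I pq by (auto simp: x_def)
      have "f x \<in> Q i" using e x by blast
      then have "(x, s1) \<in> R" using x I rel_open[OF i] fI[of x i] closure_subset[of "Q i"] by (intro RI) auto
      then show False using t1(2) x by force
    qed
    have s1S: "f s1 \<in> S"
    proof (rule ccontr)
      assume "f s1 \<notin> S"
      then have "s1 \<noteq> t" using insert.prems by auto
      then have "s1 < t" using I by simp
      have "f s1 \<in> \<Omega>" using f\<Omega> I pq insert.prems by auto
      then obtain i where i: "f s1 \<in> Q i" using \<open>f s1 \<notin> S\<close> S_or_Q by blast
      obtain e where e: "0 < e" "\<And>y. y \<in> {s..t} \<Longrightarrow> \<bar>y - s1\<bar> < e \<Longrightarrow> f y \<in> Q i" using near[of s1 i] i I pq by auto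
      define x where "x = min t (s1 + e / 2)"
      have x: "x \<in> {s..t}" "s1 < x" "\<bar>x - s1\<bar> < e" using e(1) \<open>s1 < t\<close> I pq by (auto simp: x_def)
      have "f x \<in> Q i" using e x by blast
      then have "(t1, x) \<in> R" using x I rel_open'[OF i] fI[of x i] closure_subset[of "Q i"] by (intro RI) auto
      then show False using s1(2) x by force
    qed
    have disj: "i \<notin> meeting Q (f ` {s1..t})" if i: "i \<in> meeting Q (f ` {s..t1})" for i
    proof
      assume "i \<in> meeting Q (f ` {s1..t})"
      then obtain y where y: "y \<in> {s1..t}" "f y \<in> Q i" unfolding meeting_def by blast
      obtain x where x: "x \<in> {s..t1}" "f x \<in> Q i" using i unfolding meeting_def by blast
      have "x \<noteq> t1" using x t1S S_not_Q by auto
      moreover have "(x, y) \<in> R" using x y I pq fI[of x i] closure_subset[of "Q i"] by (intro RI) auto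
      ultimately show False using t1(2) x by force
    qed
    have k1: "k \<notin> meeting Q (f ` {s..t1})"
    proof
      assume "k \<in> meeting Q (f ` {s..t1})"
      then obtain x where x: "x \<in> {s..t1}" "f x \<in> Q k" unfolding meeting_def by blast
      then have "x \<in> T" using I pq closure_subset[of "Q k"] by (auto simp: T_def)
      then have "x = t1" using p(2)[of x] x I by auto
      then show False using x t1S S_not_Q by auto
    qed
    have k2: "k \<notin> meeting Q (f ` {s1..t})"
    proof
      assume "k \<in> meeting Q (f ` {s1..t})"
      then obtain x where x: "x \<in> {s1..t}" "f x \<in> Q k" unfolding meeting_def by blast
      then have "x \<in> T" using I pq closure_subset[of "Q k"] by (auto simp: T_def)
      then have "x = s1" using q(2)[of x] x I by auto
      then show False using x s1S S_not_Q by auto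
    qed
    let ?A1 = "meeting Q (f ` {s..t1})" and ?A2 = "meeting Q (f ` {s1..t})"
    have sub: "?A1 \<subseteq> M" "?A2 \<subseteq> M" unfolding M_def using I pq by (auto intro!: meeting_mono image_mono)
    have E1: "ennreal \<bar>\<psi> (f s) - \<psi> (f t1)\<bar> \<le> infsum (?c (insert k F)) ?A1"
    proof -
      have "ennreal \<bar>\<psi> (f s) - \<psi> (f t1)\<bar> \<le> infsum (?c F) ?A1" using insert.prems I pq t1S by (intro insert.IH) auto
      also have "\<dots> = infsum (?c (insert k F)) ?A1" using k1 by (intro infsum_cong) auto
      finally show ?thesis .
    qed
    have E2: "ennreal \<bar>\<psi> (f s1) - \<psi> (f t)\<bar> \<le> infsum (?c (insert k F)) ?A2"
    proof -
      have "ennreal \<bar>\<psi> (f s1) - \<psi> (f t)\<bar> \<le> infsum (?c F) ?A2" using insert.prems I pq s1S by (intro insert.IH) auto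
      also have "\<dots> = infsum (?c (insert k F)) ?A2" using k2 by (intro infsum_cong) auto
      finally show ?thesis .
    qed
    \<comment> \<open>The gap between the pieces costs nothing or one disk \<open>m\<close> that
      neither piece meets; its ends lie on the boundary curve of \<open>m\<close>, so
      \<open>w m\<close> pays for it.\<close>
    have E3: "\<exists>A\<subseteq>M. A \<inter> (?A1 \<union> ?A2) = {} \<and> ennreal \<bar>\<psi> (f t1) - \<psi> (f s1)\<bar> \<le> infsum (?c (insert k F)) A"
    proof (cases "f t1 = f s1")
      case True then show ?thesis by (intro exI[of _ "{}"]) auto
    next
      case False
      then obtain m where m: "m \<in> M" "f t1 \<in> closure (Q m)" "f s1 \<in> closure (Q m)" using rel by blast
      then have "f t1 \<in> frontier (Q m)" "f s1 \<in> frontier (Q m)" using t1S s1S S_not_Q by (auto simp: frontier_Q_eq)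
      then have "ennreal \<bar>\<psi> (f t1) - \<psi> (f s1)\<bar> \<le> w m" by (rule w)
      also have "\<dots> \<le> ?c (insert k F) m" using wo by simp
      finally have "ennreal \<bar>\<psi> (f t1) - \<psi> (f s1)\<bar> \<le> infsum (?c (insert k F)) {m}" by simp
      moreover have "m \<notin> ?A1"
      proof
        assume "m \<in> ?A1"
        then obtain x where x: "x \<in> {s..t1}" "f x \<in> Q m" unfolding meeting_def by blast
        have "x \<noteq> t1" using x t1S S_not_Q by auto
        moreover have "(x, s1) \<in> R" using x I m closure_subset[of "Q m"] by (intro RI) auto
        ultimately show False using t1(2) x by force
      qed
      moreover have "m \<notin> ?A2"
      proof
        assume "m \<in> ?A2"
        then obtain x where x: "x \<in> {s1..t}" "f x \<in> Q m" unfolding meeting_def by blast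
        have "x \<noteq> s1" using x s1S S_not_Q by auto
        moreover have "(t1, x) \<in> R" using x I m closure_subset[of "Q m"] by (intro RI) auto
        ultimately show False using s1(2) x by force
      qed
      ultimately show ?thesis using m by (intro exI[of _ "{m}"]) auto
    qed
    then obtain A where A: "A \<subseteq> M" "A \<inter> (?A1 \<union> ?A2) = {}" "ennreal \<bar>\<psi> (f t1) - \<psi> (f s1)\<bar> \<le> infsum (?c (insert k F)) A" by blast
    have "\<bar>\<psi> (f s) - \<psi> (f t)\<bar> \<le> \<bar>\<psi> (f s) - \<psi> (f t1)\<bar> + \<bar>\<psi> (f s1) - \<psi> (f t)\<bar> + \<bar>\<psi> (f t1) - \<psi> (f s1)\<bar>" by simp
    then have "ennreal \<bar>\<psi> (f s) - \<psi> (f t)\<bar> \<le> ennreal \<bar>\<psi> (f s) - \<psi> (f t1)\<bar> + ennreal \<bar>\<psi> (f s1) - \<psi> (f t)\<bar> + ennreal \<bar>\<psi> (f t1) - \<psi> (f s1)\<bar>"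
      by (simp add: ennreal_plus[symmetric] ennreal_leI del: ennreal_plus)
    also have "\<dots> \<le> infsum (?c (insert k F)) ?A1 + infsum (?c (insert k F)) ?A2 + infsum (?c (insert k F)) A"
      by (intro add_mono E1 E2 A)
    also have "\<dots> = infsum (?c (insert k F)) ((?A1 \<union> ?A2) \<union> A)"
    proof -
      have "infsum (?c (insert k F)) ((?A1 \<union> ?A2) \<union> A) = infsum (?c (insert k F)) (?A1 \<union> ?A2) + infsum (?c (insert k F)) A"
        by (rule infsum_Un_disjoint) (use A(2) in \<open>auto intro: ennreal_summable_on\<close>)
      moreover have "infsum (?c (insert k F)) (?A1 \<union> ?A2) = infsum (?c (insert k F)) ?A1 + infsum (?c (insert k F)) ?A2"
        by (rule infsum_Un_disjoint) (use disj in \<open>auto intro: ennreal_summable_on\<close>)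
      ultimately show ?thesis by simp
    qed
    also have "\<dots> \<le> infsum (?c (insert k F)) M" using sub A(1) by (intro infsum_ennreal_mono) auto
    finally show ?thesis unfolding M_def .
  qed
qed

text \<open>Off a finite set of disks the weights \<open>o'\<close> have a sum below any
  \<open>e\<close>, and on the finite set they are lowered to \<open>w\<close>. For test functions
  this lowers twice the oscillation of \<open>u\<close> to the oscillation of the test function
  itself, as membership in the Sobolev space demands.\<close>

lemma loop_erasure:
  fixes f :: "real \<Rightarrow> complex" and o' w :: "nat \<Rightarrow> ennreal" and \<psi> :: "complex \<Rightarrow> real"
  assumes "a \<le> b" and f: "continuous_on {a..b} f" and f\<Omega>: "f ` {a..b} \<subseteq> \<Omega>" and fab: "f a \<in> S" "f b \<in> S"
    and d: "\<And>s t. a \<le> s \<Longrightarrow> s \<le> t \<Longrightarrow> t \<le> b \<Longrightarrow> f s \<in> S \<Longrightarrow> f t \<in> S \<Longrightarrow>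
        ennreal \<bar>\<psi> (f s) - \<psi> (f t)\<bar> \<le> infsum o' (meeting Q (f ` {s..t}))"
    and w: "\<And>i x y. x \<in> frontier (Q i) \<Longrightarrow> y \<in> frontier (Q i) \<Longrightarrow> ennreal \<bar>\<psi> x - \<psi> y\<bar> \<le> w i"
    and wo: "\<And>i. w i \<le> o' i"
    and fin: "infsum o' (meeting Q (f ` {a..b})) < \<infinity>"
  shows "ennreal \<bar>\<psi> (f a) - \<psi> (f b)\<bar> \<le> infsum w (meeting Q (f ` {a..b}))"
proof (rule ennreal_le_epsilon)
  fix e :: real assume e: "0 < e"
  let ?M = "meeting Q (f ` {a..b})"
  have "0 < ennreal e" using e by simp
  obtain F where F: "finite F" "F \<subseteq> ?M" "infsum o' (?M - F) < ennreal e"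
    by (rule infsum_ennreal_tail[OF fin \<open>0 < ennreal e\<close>]) (rule that)
  have "ennreal \<bar>\<psi> (f a) - \<psi> (f b)\<bar> \<le> (\<Sum>\<^sub>\<infinity>i\<in>?M. if i \<in> F then w i else o' i)"
    by (rule loop_erasure_finite[OF f f\<Omega> d w wo F(1)]) (use assms in auto)
  also have "\<dots> \<le> (\<Sum>\<^sub>\<infinity>i\<in>F \<union> (?M - F). if i \<in> F then w i else o' i)" by (rule infsum_ennreal_mono) auto
  also have "\<dots> \<le> (\<Sum>\<^sub>\<infinity>i\<in>F. if i \<in> F then w i else o' i) + (\<Sum>\<^sub>\<infinity>i\<in>?M - F. if i \<in> F then w i else o' i)"
    by (rule infsum_ennreal_Un_le)
  also have "\<dots> \<le> infsum w ?M + infsum o' (?M - F)"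
    using F(2) by (intro add_mono infsum_ennreal_mono) auto
  also have "\<dots> \<le> infsum w ?M + ennreal e" using F(3) by (intro add_left_mono) simp
  finally show "ennreal \<bar>\<psi> (f a) - \<psi> (f b)\<bar> \<le> infsum w ?M + ennreal e" .
qed

end

text \<open>The truncation at 1 makes the function bounded, which \<open>sobolev_of_real\<close>
  uses to sum its squared suprema against squared diameters.\<close>

definition test :: "(complex \<Rightarrow> real) \<Rightarrow> real \<Rightarrow> complex set \<Rightarrow> complex \<Rightarrow> real" where
  "test u a V x = (if x \<in> V then min (max (u x - a) 0) 1 else 0)"

lemma test_range: "0 \<le> test u a V x" "test u a V x \<le> 1"
  by (auto simp: test_def)

text \<open>The equality case of a termwise comparison. Finiteness of the total allows the remaining
  terms to be cancelled.\<close>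

lemma infsum_ennreal_eq_terms:
  fixes f g :: "nat \<Rightarrow> ennreal"
  assumes le: "\<And>i. i \<in> A \<Longrightarrow> f i \<le> g i" and ge: "infsum g A \<le> infsum f A" and fin: "infsum g A < \<infinity>" and i: "i \<in> A"
  shows "f i = g i"
proof (rule ccontr)
  assume "f i \<noteq> g i"
  then have lt: "f i < g i" using le[OF i] by simp
  have split: "infsum h A = h i + infsum h (A - {i})" for h :: "nat \<Rightarrow> ennreal"
  proof -
    have "infsum h ({i} \<union> (A - {i})) = infsum h {i} + infsum h (A - {i})"
      by (rule infsum_Un_disjoint) (auto intro: ennreal_summable_on)
    then show ?thesis using i by (simp add: insert_absorb)
  qed
  have l: "infsum f (A - {i}) \<le> infsum g (A - {i})" using le by (intro infsum_ennreal_mono) auto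
  have "infsum g (A - {i}) < \<infinity>" using fin split[of g] by simp
  then have "infsum f (A - {i}) < \<infinity>" using l by (rule order_le_less_trans[rotated])
  then have "infsum f (A - {i}) + f i < infsum f (A - {i}) + g i" using lt by (intro ennreal_add_left_cancel_less[THEN iffD2]) auto
  also have "\<dots> \<le> infsum g (A - {i}) + g i" using l by (rule add_right_mono)
  also have "\<dots> = infsum g A" by (simp add: split[of g] add.commute)
  also have "\<dots> \<le> infsum f A" by fact
  also have "\<dots> = infsum f (A - {i}) + f i" by (simp add: split[of f] add.commute)
  finally show False by simp
qed

section \<open>Truncations of \<open>u\<close> as competitors\<close>

context rel_carpet
begin

lemma sobolev_real_uminus:
  assumes "sobolev_real v \<Omega> Q u" shows "sobolev_real v \<Omega> Q (\<lambda>x. - u x)"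
proof -
  have "bounded ((\<lambda>x. - u x) ` frontier (Q i))" for i
    using bounded_uminus[of "u ` frontier (Q i)"] sobolev_realD(1)[OF assms, of i] by (simp add: image_image)
  moreover have "\<bar>ereal (- u x) - ereal (- u y)\<bar> = \<bar>ereal (u x) - ereal (u y)\<bar>" for x y
    by (simp add: abs_minus_commute)
  ultimately show ?thesis using assms unfolding sobolev_real_def oscr_uminus upper_gradient_def
    by simp
qed

lemma frontier_Q_crossing:
  assumes "x \<in> frontier (Q i)" "x \<in> V" "y \<in> frontier (Q i)" "y \<notin> V"
  obtains z where "z \<in> frontier (Q i)" "z \<in> frontier V" "z \<in> S"
proof -
  have "frontier (Q i) \<inter> frontier V \<noteq> {}"
    using assms by (intro connected_Int_frontier connected_frontier_Q) auto
  then show ?thesis using that frontier_Q_subset_S by blast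
qed

text \<open>A boundary curve that leaves \<open>V\<close> crosses the frontier of \<open>V\<close>
  at a point with \<open>u <= a\<close>, so the excess of \<open>u\<close> over \<open>a\<close> on
  the curve is at most the oscillation of \<open>u\<close>.\<close>

lemma oscr_test_le:
  assumes bd: "bounded (u ` frontier (Q i))" and le: "\<And>z. z \<in> S \<Longrightarrow> z \<in> frontier V \<Longrightarrow> u z \<le> a"
  shows "oscr Q (test u a V) i \<le> oscr Q u i"
proof (rule oscr_le)
  fix x y assume xy: "x \<in> frontier (Q i)" "y \<in> frontier (Q i)"
  have o0: "0 \<le> oscr Q u i" by (rule oscr_nonneg[OF bd])
  have oxy: "\<bar>u x - u y\<bar> \<le> oscr Q u i" by (rule abs_diff_le_oscr[OF bd xy])
  show "test u a V x - test u a V y \<le> oscr Q u i"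
  proof (cases "x \<in> V")
    case False then show ?thesis using o0 test_range(1)[of u a V y] by (simp add: test_def)
  next
    case True
    show ?thesis
    proof (cases "y \<in> V")
      case True
      with \<open>x \<in> V\<close> oxy o0 show ?thesis by (auto simp: test_def min_def max_def)
    next
      case False
      obtain z where z: "z \<in> frontier (Q i)" "z \<in> frontier V" "z \<in> S"
        using frontier_Q_crossing[OF xy(1) True xy(2) False] by blast
      have "u z \<le> a" using le z by blast
      then show ?thesis using True False abs_diff_le_oscr[OF bd xy(1) z(1)] o0 by (auto simp: test_def min_def max_def)
    qed
  qed
qed

lemma connected_subset_disk:
  assumes "connected C" "C \<subseteq> (\<Union>i. Q i)" "x \<in> C" "x \<in> Q j" shows "C \<subseteq> Q j"
proof (rule ccontr)
  let ?U = "\<Union>i\<in>-{j}. Q i"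
  assume "\<not> C \<subseteq> Q j"
  then obtain y where y: "y \<in> C" "y \<notin> Q j" by blast
  have 3: "C \<subseteq> Q j \<union> ?U"
  proof
    fix y assume "y \<in> C"
    then obtain i where "y \<in> Q i" using assms(2) by blast
    then show "y \<in> Q j \<union> ?U" by (cases "i = j") auto
  qed
  then have 1: "?U \<inter> C \<noteq> {}" using y by blast
  have 4: "Q j \<inter> ?U \<inter> C = {}" using disjoint_Q by blast
  have 5: "open ?U" using open_Q by blast
  show False using connectedD[OF assms(1) open_Q 5 4 3] 1 assms(3,4) by blast
qed

text \<open>A path can leave \<open>V\<close> inside a disk, where \<open>u\<close> has no values.
  In that case the boundary curve of the disk crosses the frontier of \<open>V\<close>, and the path
  touches the same curve.\<close>

lemma path_crossing:
  fixes f :: "real \<Rightarrow> complex"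
  assumes st: "s \<le> t" and f: "continuous_on {s..t} f" and f\<Omega>: "f ` {s..t} \<subseteq> \<Omega>" and fS: "f s \<in> S" "f t \<in> S"
    and V: "open V" "f s \<in> V \<longleftrightarrow> f t \<notin> V"
  obtains \<tau> z where "\<tau> \<in> {s..t}" "f \<tau> \<in> S" "z \<in> S" "z \<in> frontier V"
    "f \<tau> = z \<or> (\<exists>j\<in>meeting Q (f ` {s..t}). f \<tau> \<in> frontier (Q j) \<and> z \<in> frontier (Q j))"
proof (cases "\<exists>\<tau>\<in>{s..t}. f \<tau> \<in> S \<and> f \<tau> \<in> frontier V")
  case True then show ?thesis using that by blast
next
  case no: False
  have clo: "closed ({s..t} \<inter> f -` X)" if "closed X" for X using f that by (intro continuous_closed_preimage) auto
  have SX: "{s..t} \<inter> f -` (S \<inter> X) = {s..t} \<inter> f -` (- (\<Union>i. Q i) \<inter> X)" for X using f\<Omega> by (auto simp: carpet_def)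
  have clQ: "closed (- (\<Union>i. Q i))" using open_Q by auto
  \<comment> \<open>Parameters of carpet points in \<open>V\<close>, and below of carpet points off
    \<open>V\<close>. The closure makes \<open>A\<close> compact; as no carpet point of the path
    lies on the frontier in this case, nothing is added.\<close>
  define A where "A = {s..t} \<inter> f -` (S \<inter> closure V)"
  define B where "B = {s..t} \<inter> f -` (S \<inter> - V)"
  have "closed A" "closed B"
    unfolding A_def B_def SX by (rule clo[OF closed_Int[OF clQ]], use V(1) in \<open>simp add: closed_Compl\<close>)+
  then have cAB: "compact A" "compact B"
    by (auto simp: A_def B_def compact_eq_bounded_closed intro: bounded_subset[of "{s..t}"])
  have AV: "\<tau> \<in> A \<Longrightarrow> f \<tau> \<in> V" for \<tau> using no V(1) by (auto simp: A_def frontier_def interior_open)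
  have "A \<noteq> {} \<and> B \<noteq> {}"
  proof (cases "f s \<in> V")
    case True
    then have "s \<in> A" "t \<in> B" using V st fS closure_subset[of V] by (auto simp: A_def B_def)
    then show ?thesis by blast
  next
    case False
    then have "t \<in> A" "s \<in> B" using V st fS closure_subset[of V] by (auto simp: A_def B_def)
    then show ?thesis by blast
  qed
  then have "A \<times> B \<noteq> {}" by simp
  \<comment> \<open>No carpet parameter lies strictly between the members of a closest pair, as it
    would belong to \<open>A\<close> or \<open>B\<close> and give a closer one. The path therefore
    stays in one disk there.\<close>
  then obtain z where z: "z \<in> A \<times> B" "\<forall>y\<in>A \<times> B. dist (fst z) (snd z) \<le> dist (fst y) (snd y)"
    using continuous_attains_inf[OF compact_Times[OF cAB], of "\<lambda>z. dist (fst z) (snd z)"]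
      continuous_on_dist[OF continuous_on_fst[OF continuous_on_id] continuous_on_snd[OF continuous_on_id]] by blast
  define p q where "p = fst z" and "q = snd z"
  have pq: "p \<in> A" "q \<in> B" "\<And>x y. x \<in> A \<Longrightarrow> y \<in> B \<Longrightarrow> dist p q \<le> dist x y"
    using z by (auto simp: p_def q_def)
  have "p \<noteq> q" using AV pq by (auto simp: B_def)
  define I where "I = {min p q<..<max p q}"
  have I: "I \<subseteq> {s..t}" using pq(1,2) by (auto simp: I_def A_def B_def)
  have "f ` I \<inter> S = {}"
  proof (rule ccontr)
    assume "f ` I \<inter> S \<noteq> {}"
    then obtain x where x: "x \<in> I" "f x \<in> S" by blast
    then have "x \<in> A \<or> x \<in> B" using I closure_subset[of V] by (auto simp: A_def B_def)
    then show False using pq(3)[of x q] pq(3)[of p x] pq(1,2) x(1) by (auto simp: I_def dist_real_def min_def max_def split: if_splits)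
  qed
  have IQ: "f ` I \<subseteq> (\<Union>i. Q i)"
  proof (rule image_subsetI)
    fix x assume x: "x \<in> I"
    then have "f x \<in> \<Omega>" "f x \<notin> S" using f\<Omega> I \<open>f ` I \<inter> S = {}\<close> by blast+
    then show "f x \<in> (\<Union>i. Q i)" using S_or_Q by blast
  qed
  have "connected (f ` I)" using f I by (intro connected_continuous_image) (auto simp: I_def intro: continuous_on_subset)
  have Ine: "I \<noteq> {}" using \<open>p \<noteq> q\<close> by (auto simp: I_def min_def max_def)
  then obtain w where w: "w \<in> I" by blast
  then obtain j where j: "f w \<in> Q j" using IQ by blast
  have "f ` I \<subseteq> Q j" using connected_subset_disk[OF \<open>connected (f ` I)\<close> IQ _ j] w by simp
  have cl: "f x \<in> closure (Q j)" if "x \<in> {min p q..max p q}" for x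
  proof -
    have "closure I = {min p q..max p q}" using \<open>p \<noteq> q\<close> unfolding I_def by (intro closure_greaterThanLessThan) (auto simp: min_def max_def)
    moreover have "{min p q..max p q} \<subseteq> {s..t}" using pq(1,2) by (auto simp: A_def B_def)
    ultimately have "continuous_on (closure I) f" using f continuous_on_subset by metis
    then have "f ` closure I \<subseteq> closure (Q j)"
      by (rule image_closure_subset) (use \<open>f ` I \<subseteq> Q j\<close> closure_subset in auto)
    then show ?thesis using that \<open>closure I = _\<close> by blast
  qed
  have fp: "f p \<in> S" "f q \<in> S" "f q \<notin> V" using pq(1,2) by (auto simp: A_def B_def)
  then have pF: "f p \<in> frontier (Q j)" and qF: "f q \<in> frontier (Q j)"
    using cl[of p] cl[of q] S_not_Q by (auto simp: frontier_Q_eq)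
  obtain z where z: "z \<in> frontier (Q j)" "z \<in> frontier V" "z \<in> S"
    using frontier_Q_crossing[OF pF AV[OF pq(1)] qF fp(3)] by blast
  have "j \<in> meeting Q (f ` {s..t})" using w j I by (auto simp: meeting_def)
  then show ?thesis using that[of p z] pq(1) fp z pF by (auto simp: A_def)
qed

text \<open>The upper gradient inequality is first shown with two copies of the oscillation of
  \<open>u\<close>: one for the variation along the path up to the crossing, one for the disk in
  which the crossing may be hidden. \<open>loop_erasure\<close> then lowers the weight.\<close>

lemma sobolev_real_test:
  assumes u: "sobolev_real v \<Omega> Q u" and V: "open V" and le: "\<And>z. z \<in> S \<Longrightarrow> z \<in> frontier V \<Longrightarrow> u z \<le> a"
  shows "sobolev_real v \<Omega> Q (test u a V)"
proof -
  note bd = sobolev_realD(1)[OF u]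
  let ?\<psi> = "test u a V"
  have bdt: "bounded (?\<psi> ` frontier (Q i))" for i
    by (rule boundedI[of _ 1]) (auto simp: test_def)
  have ol: "oscr Q ?\<psi> i \<le> oscr Q u i" for i using oscr_test_le[OF bd le] by blast
  obtain \<Gamma> where G: "\<Gamma> \<subseteq> paths_in \<Omega>" "carpet_modulus v \<Omega> Q \<Gamma> = 0"
    "\<And>\<gamma> a b. \<gamma> \<in> paths_in \<Omega> - \<Gamma> \<Longrightarrow> a \<le> b \<Longrightarrow> {a..b} \<subseteq> fst \<gamma> \<Longrightarrow>
       (\<Sum>\<^sub>\<infinity>i\<in>meeting Q (snd \<gamma> ` {a..b}). ennreal (oscr Q u i)) < \<infinity>"
    "\<And>\<gamma> a b. \<gamma> \<in> paths_in \<Omega> - \<Gamma> \<Longrightarrow> a \<le> b \<Longrightarrow> {a..b} \<subseteq> fst \<gamma> \<Longrightarrow> snd \<gamma> a \<in> S \<Longrightarrow> snd \<gamma> b \<in> S \<Longrightarrow>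
       ennreal \<bar>u (snd \<gamma> a) - u (snd \<gamma> b)\<bar> \<le> (\<Sum>\<^sub>\<infinity>i\<in>meeting Q (snd \<gamma> ` {a..b}). ennreal (oscr Q u i))"
    by (rule sobolev_good_family[OF u]) (rule that)
  have main: "ennreal \<bar>?\<psi> (snd \<gamma> c) - ?\<psi> (snd \<gamma> d)\<bar> \<le> (\<Sum>\<^sub>\<infinity>i\<in>meeting Q (trace \<gamma>). ennreal (oscr Q ?\<psi> i))"
    if g: "\<gamma> \<in> paths_in \<Omega> - \<Gamma>" and cd: "c \<le> d" "c \<in> fst \<gamma>" "d \<in> fst \<gamma>" and cdS: "snd \<gamma> c \<in> S" "snd \<gamma> d \<in> S" for \<gamma> c d
  proof -
    let ?f = "snd \<gamma>"
    have "is_interval (fst \<gamma>)" using g by (simp add: paths_in_def is_cpath_def)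
    then have sub: "{c..d} \<subseteq> fst \<gamma>" using cd unfolding is_interval_1 by (meson atLeastAtMost_iff subsetI)
    have f: "continuous_on {c..d} ?f" and p: "({c..d}, ?f) \<in> paths_in \<Omega>"
      using compact_cpath[of \<gamma> c d] g cd sub by auto
    have f\<Omega>: "?f ` {c..d} \<subseteq> \<Omega>" using p by (simp add: paths_in_def trace_def)
    let ?o = "\<lambda>i. ennreal (oscr Q u i) + ennreal (oscr Q u i)"
    have "ennreal \<bar>?\<psi> (?f c) - ?\<psi> (?f d)\<bar> \<le> (\<Sum>\<^sub>\<infinity>i\<in>meeting Q (?f ` {c..d}). ennreal (oscr Q ?\<psi> i))"
    proof (rule loop_erasure[OF cd(1) f f\<Omega> cdS, where o'="?o"])
      fix i x y assume "x \<in> frontier (Q i)" "y \<in> frontier (Q i)"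
      then show "ennreal \<bar>?\<psi> x - ?\<psi> y\<bar> \<le> ennreal (oscr Q ?\<psi> i)"
        using abs_diff_le_oscr[OF bdt] by (intro ennreal_leI) auto
    next
      fix i
      have "ennreal (oscr Q ?\<psi> i) + 0 \<le> ?o i" using ol by (intro add_mono ennreal_leI) auto
      then show "ennreal (oscr Q ?\<psi> i) \<le> ?o i" by simp
    next
      show "infsum ?o (meeting Q (?f ` {c..d})) < \<infinity>"
        using G(3)[OF g cd(1) sub] by (simp add: infsum_ennreal_add)
    next
      fix s t assume st: "c \<le> s" "s \<le> t" "t \<le> d" and stS: "?f s \<in> S" "?f t \<in> S"
      let ?M = "meeting Q (?f ` {s..t})"
      have est: "ennreal \<bar>u (?f x) - u (?f y)\<bar> \<le> (\<Sum>\<^sub>\<infinity>i\<in>?M. ennreal (oscr Q u i))"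
        if "s \<le> x" "x \<le> y" "y \<le> t" "?f x \<in> S" "?f y \<in> S" for x y
      proof -
        have "ennreal \<bar>u (?f x) - u (?f y)\<bar> \<le> (\<Sum>\<^sub>\<infinity>i\<in>meeting Q (?f ` {x..y}). ennreal (oscr Q u i))"
          using that st sub by (intro G(4)[OF g]) auto
        also have "\<dots> \<le> (\<Sum>\<^sub>\<infinity>i\<in>?M. ennreal (oscr Q u i))"
          using that by (intro infsum_ennreal_mono meeting_mono image_mono) auto
        finally show ?thesis .
      qed
      have half: "(\<Sum>\<^sub>\<infinity>i\<in>?M. ennreal (oscr Q u i)) \<le> infsum ?o ?M" by (rule infsum_ennreal_mono) auto
      show "ennreal \<bar>?\<psi> (?f s) - ?\<psi> (?f t)\<bar> \<le> infsum ?o ?M"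
      proof (cases "?f s \<in> V \<longleftrightarrow> ?f t \<in> V")
        case True
        then have "\<bar>?\<psi> (?f s) - ?\<psi> (?f t)\<bar> \<le> \<bar>u (?f s) - u (?f t)\<bar>" by (auto simp: test_def min_def max_def)
        then have "ennreal \<bar>?\<psi> (?f s) - ?\<psi> (?f t)\<bar> \<le> ennreal \<bar>u (?f s) - u (?f t)\<bar>" by (rule ennreal_leI)
        also have "\<dots> \<le> infsum ?o ?M" using est[of s t] st stS half by auto
        finally show ?thesis .
      next
        case False
        have fst': "continuous_on {s..t} ?f" "?f ` {s..t} \<subseteq> \<Omega>" using f f\<Omega> st by (auto intro: continuous_on_subset)
        obtain \<tau> z where tz: "\<tau> \<in> {s..t}" "?f \<tau> \<in> S" "z \<in> S" "z \<in> frontier V"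
           "?f \<tau> = z \<or> (\<exists>j\<in>?M. ?f \<tau> \<in> frontier (Q j) \<and> z \<in> frontier (Q j))"
          using path_crossing[OF st(2) fst' stS V] False by (metis (no_types, lifting))
        have uz: "u z \<le> a" using le tz by blast
        \<comment> \<open>The end of the subpath that lies in \<open>V\<close>; the test function
          vanishes at the other one.\<close>
        define x where "x = (if ?f s \<in> V then s else t)"
        have xV: "?f x \<in> V" "x \<in> {s..t}" "?f x \<in> S" using False st stS by (auto simp: x_def)
        have "\<bar>?\<psi> (?f s) - ?\<psi> (?f t)\<bar> = ?\<psi> (?f x)"
          using False test_range(1)[of u a V] by (auto simp: x_def test_def)
        also have "\<dots> \<le> max (u (?f x) - u z) 0" using uz xV by (auto simp: test_def min_def max_def)
        also have "\<dots> \<le> \<bar>u (?f x) - u (?f \<tau>)\<bar> + \<bar>u (?f \<tau>) - u z\<bar>" by simp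
        finally have "ennreal \<bar>?\<psi> (?f s) - ?\<psi> (?f t)\<bar> \<le> ennreal \<bar>u (?f x) - u (?f \<tau>)\<bar> + ennreal \<bar>u (?f \<tau>) - u z\<bar>"
          by (simp add: ennreal_plus[symmetric] ennreal_leI del: ennreal_plus)
        also have "\<dots> \<le> (\<Sum>\<^sub>\<infinity>i\<in>?M. ennreal (oscr Q u i)) + (\<Sum>\<^sub>\<infinity>i\<in>?M. ennreal (oscr Q u i))"
        proof (rule add_mono)
          show "ennreal \<bar>u (?f x) - u (?f \<tau>)\<bar> \<le> (\<Sum>\<^sub>\<infinity>i\<in>?M. ennreal (oscr Q u i))"
            using est[of x \<tau>] est[of \<tau> x] xV tz by (cases "x \<le> \<tau>") (auto simp: abs_minus_commute)
          show "ennreal \<bar>u (?f \<tau>) - u z\<bar> \<le> (\<Sum>\<^sub>\<infinity>i\<in>?M. ennreal (oscr Q u i))"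
          proof (cases "?f \<tau> = z")
            case False
            then obtain j where j: "j \<in> ?M" "?f \<tau> \<in> frontier (Q j)" "z \<in> frontier (Q j)" using tz by blast
            have "ennreal \<bar>u (?f \<tau>) - u z\<bar> \<le> ennreal (oscr Q u j)" using j by (intro ennreal_leI abs_diff_le_oscr bd)
            also have "\<dots> \<le> (\<Sum>\<^sub>\<infinity>i\<in>?M. ennreal (oscr Q u i))" using j(1) by (rule infsum_ennreal_ge)
            finally show ?thesis .
          qed simp
        qed
        also have "\<dots> = infsum ?o ?M" by (simp add: infsum_ennreal_add)
        finally show ?thesis .
      qed
    qed
    also have "\<dots> \<le> (\<Sum>\<^sub>\<infinity>i\<in>meeting Q (trace \<gamma>). ennreal (oscr Q ?\<psi> i))"
      using sub by (intro infsum_ennreal_mono meeting_mono) (auto simp: trace_def)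
    finally show ?thesis .
  qed
  have "upper_gradient v \<Omega> Q (\<lambda>i. ennreal (oscr Q ?\<psi> i)) (\<lambda>x. ereal (?\<psi> x))"
    unfolding upper_gradient_def
  proof (intro exI[of _ \<Gamma>] conjI G(1,2) ballI)
    fix \<gamma> x y assume g: "\<gamma> \<in> paths_in \<Omega> - \<Gamma>" and x: "x \<in> trace \<gamma> \<inter> S" and y: "y \<in> trace \<gamma> \<inter> S"
    obtain c d where cd: "c \<in> fst \<gamma>" "d \<in> fst \<gamma>" "x = snd \<gamma> c" "y = snd \<gamma> d" using x y by (auto simp: trace_def)
    have "ennreal \<bar>?\<psi> x - ?\<psi> y\<bar> \<le> (\<Sum>\<^sub>\<infinity>i\<in>meeting Q (trace \<gamma>). ennreal (oscr Q ?\<psi> i))"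
      using main[OF g, of c d] main[OF g, of d c] cd x y by (cases "c \<le> d") (auto simp: abs_minus_commute)
    then show "\<bar>ereal (?\<psi> x) - ereal (?\<psi> y)\<bar> \<le> enn2ereal (\<Sum>\<^sub>\<infinity>i\<in>meeting Q (trace \<gamma>). ennreal (oscr Q ?\<psi> i))"
      by (simp add: less_eq_ennreal.rep_eq enn2ereal_ennreal)
  qed simp_all
  moreover have "(\<Sum>\<^sub>\<infinity>i\<in>meeting Q (ball x r). (ennreal (oscr Q ?\<psi> i))\<^sup>2) < \<infinity>" if "0 < r" "compactly_contained (ball x r) \<Omega>" for x r
  proof -
    have "(\<Sum>\<^sub>\<infinity>i\<in>meeting Q (ball x r). (ennreal (oscr Q ?\<psi> i))\<^sup>2) \<le> (\<Sum>\<^sub>\<infinity>i\<in>meeting Q (ball x r). (ennreal (oscr Q u i))\<^sup>2)"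
      using ol by (intro infsum_ennreal_mono power_mono ennreal_leI) auto
    also have "\<dots> < \<infinity>" using that by (rule sobolev_realD(2)[OF u])
    finally show ?thesis .
  qed
  ultimately show ?thesis using bdt by (simp add: sobolev_real_def)
qed

text \<open>Unlike normalization, these consequences of it are symmetric under \<open>u \<mapsto> - u\<close>.\<close>

definition tame :: "version \<Rightarrow> (complex \<Rightarrow> real) \<Rightarrow> bool" where
  "tame v u \<longleftrightarrow> sobolev_real v \<Omega> Q u \<and>
     (\<forall>x\<in>S. \<forall>e>0. \<exists>j. Q j \<subseteq> ball x e \<and> (\<forall>y\<in>frontier (Q j). \<bar>u y - u x\<bar> < e)) \<and>
     (\<forall>V \<zeta>. open V \<and> compactly_contained V \<Omega> \<and> sobolev_real v \<Omega> Q \<zeta> \<and> bounded (range \<zeta>) \<and> (\<forall>x\<in>S - V. \<zeta> x = 0) \<longrightarrow>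
        (\<Sum>\<^sub>\<infinity>i\<in>meeting Q V. (ennreal (oscr Q u i))\<^sup>2) \<le> (\<Sum>\<^sub>\<infinity>i\<in>meeting Q V. (ennreal (oscr Q (\<lambda>x. u x + \<zeta> x) i))\<^sup>2))"

lemma tame_uminus: "tame v u \<Longrightarrow> tame v (\<lambda>x. - u x)"
  unfolding tame_def
proof (elim conjE, intro conjI allI impI)
  assume "\<forall>x\<in>S. \<forall>e>0. \<exists>j. Q j \<subseteq> ball x e \<and> (\<forall>y\<in>frontier (Q j). \<bar>u y - u x\<bar> < e)"
  then show "\<forall>x\<in>S. \<forall>e>0. \<exists>j. Q j \<subseteq> ball x e \<and> (\<forall>y\<in>frontier (Q j). \<bar>- u y - - u x\<bar> < e)"
    by (simp add: abs_minus_commute)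
next
  fix V \<zeta>
  assume min: "\<forall>V \<zeta>. open V \<and> compactly_contained V \<Omega> \<and> sobolev_real v \<Omega> Q \<zeta> \<and> bounded (range \<zeta>) \<and> (\<forall>x\<in>S - V. \<zeta> x = 0) \<longrightarrow>
        (\<Sum>\<^sub>\<infinity>i\<in>meeting Q V. (ennreal (oscr Q u i))\<^sup>2) \<le> (\<Sum>\<^sub>\<infinity>i\<in>meeting Q V. (ennreal (oscr Q (\<lambda>x. u x + \<zeta> x) i))\<^sup>2)"
    and \<zeta>: "open V \<and> compactly_contained V \<Omega> \<and> sobolev_real v \<Omega> Q \<zeta> \<and> bounded (range \<zeta>) \<and> (\<forall>x\<in>S - V. \<zeta> x = 0)"
  have "bounded (range (\<lambda>x. - \<zeta> x))" using bounded_uminus[of "range \<zeta>"] \<zeta> by (simp add: image_image)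
  then have "(\<Sum>\<^sub>\<infinity>i\<in>meeting Q V. (ennreal (oscr Q u i))\<^sup>2) \<le> (\<Sum>\<^sub>\<infinity>i\<in>meeting Q V. (ennreal (oscr Q (\<lambda>x. u x + - \<zeta> x) i))\<^sup>2)"
    using min[rule_format, of V "\<lambda>x. - \<zeta> x"] \<zeta> sobolev_real_uminus by auto
  moreover have "oscr Q (\<lambda>x. - u x + \<zeta> x) i = oscr Q (\<lambda>x. u x + - \<zeta> x) i" for i
    using oscr_uminus[of "\<lambda>x. u x + - \<zeta> x" i] by simp
  ultimately show "(\<Sum>\<^sub>\<infinity>i\<in>meeting Q V. (ennreal (oscr Q (\<lambda>x. - u x) i))\<^sup>2) \<le> (\<Sum>\<^sub>\<infinity>i\<in>meeting Q V. (ennreal (oscr Q (\<lambda>x. - u x + \<zeta> x) i))\<^sup>2)"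
    by (simp add: oscr_uminus)
qed (rule sobolev_real_uminus)

lemma tame_minimal:
  assumes "tame v u" "open V" "compactly_contained V \<Omega>" "sobolev_real v \<Omega> Q \<zeta>" "bounded (range \<zeta>)" "\<forall>x\<in>S - V. \<zeta> x = 0"
  shows "(\<Sum>\<^sub>\<infinity>i\<in>meeting Q V. (ennreal (oscr Q u i))\<^sup>2) \<le> (\<Sum>\<^sub>\<infinity>i\<in>meeting Q V. (ennreal (oscr Q (\<lambda>x. u x + \<zeta> x) i))\<^sup>2)"
  using assms unfolding tame_def by blast

text \<open>Subtracting the test function increases no oscillation, so minimality and finite energy
  force equality on every disk meeting \<open>V\<close>. On a boundary curve inside \<open>V\<close>
  the competitor is a nondecreasing function of \<open>u\<close>, and equal oscillation leaves the
  test function no room to vary. If \<open>u <= a\<close> on the part of the curve in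
  \<open>V\<close>, the test function vanishes on the curve.\<close>

lemma oscr_test_eq_0:
  assumes u: "tame v u" and V: "open V" "compactly_contained V \<Omega>"
    and le: "\<And>z. z \<in> S \<Longrightarrow> z \<in> frontier V \<Longrightarrow> u z \<le> a"
    and i: "frontier (Q i) \<subseteq> V \<or> (\<forall>y\<in>frontier (Q i) \<inter> V. u y \<le> a)"
  shows "oscr Q (test u a V) i = 0"
proof -
  have us: "sobolev_real v \<Omega> Q u" using u by (simp add: tame_def)
  note bd = sobolev_realD(1)[OF us]
  let ?\<psi> = "test u a V"
  have bdt: "bounded (?\<psi> ` frontier (Q i))" for i
    by (rule boundedI[of _ 1]) (auto simp: test_def)
  show ?thesis
  proof (cases "\<forall>y\<in>frontier (Q i) \<inter> V. u y \<le> a")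
    case True
    then have "?\<psi> x = 0" if "x \<in> frontier (Q i)" for x using that by (auto simp: test_def)
    then have "oscr Q ?\<psi> i \<le> 0" by (intro oscr_le) simp
    then show ?thesis using oscr_nonneg[OF bdt, of i] by simp
  next
    case False
    then have iV: "frontier (Q i) \<subseteq> V" using i by blast
    let ?h = "\<lambda>x. u x + - ?\<psi> x"
    have hl: "oscr Q ?h k \<le> oscr Q u k" for k
    proof (rule oscr_le)
      fix x y assume xy: "x \<in> frontier (Q k)" "y \<in> frontier (Q k)"
      have oxy: "\<bar>u x - u y\<bar> \<le> oscr Q u k" by (rule abs_diff_le_oscr[OF bd xy])
      show "?h x - ?h y \<le> oscr Q u k"
      proof (cases "y \<in> V \<and> x \<notin> V")
        case True
        \<comment> \<open>If \<open>u y\<close> exceeds \<open>a\<close>, the competitor at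
          \<open>y\<close> is still at least \<open>a\<close>, hence at least
          \<open>u z\<close>.\<close>
        obtain z where z: "z \<in> frontier (Q k)" "z \<in> frontier V" "z \<in> S"
          using frontier_Q_crossing[of y k V x] xy True by blast
        have "u z \<le> a" using le z by blast
        moreover have "\<bar>u x - u z\<bar> \<le> oscr Q u k" by (rule abs_diff_le_oscr[OF bd xy(1) z(1)])
        ultimately show ?thesis using True oxy by (auto simp: test_def min_def max_def)
      next
        case False
        then show ?thesis using oxy by (auto simp: test_def min_def max_def)
      qed
    qed
    have "bounded (range (\<lambda>x. - ?\<psi> x))" by (rule boundedI[of _ 1]) (auto simp: test_def)
    moreover have "sobolev_real v \<Omega> Q (\<lambda>x. - ?\<psi> x)" by (intro sobolev_real_uminus sobolev_real_test us V le)
    ultimately have ge: "(\<Sum>\<^sub>\<infinity>i\<in>meeting Q V. (ennreal (oscr Q u i))\<^sup>2) \<le> (\<Sum>\<^sub>\<infinity>i\<in>meeting Q V. (ennreal (oscr Q ?h i))\<^sup>2)"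
      by (intro tame_minimal[OF u V]) (auto simp: test_def)
    obtain y where "y \<in> frontier (Q i)" using frontier_Q_ne by blast
    then have "y \<in> closure (Q i)" "y \<in> V" using iV by (auto simp: frontier_def)
    then have iM: "i \<in> meeting Q V" using V(1) open_Int_closure_eq_empty[of V "Q i"] by (auto simp: meeting_def)
    have fin: "(\<Sum>\<^sub>\<infinity>i\<in>meeting Q V. (ennreal (oscr Q u i))\<^sup>2) < \<infinity>"
    proof -
      have "(\<Sum>\<^sub>\<infinity>i\<in>meeting Q V. (ennreal (oscr Q u i))\<^sup>2) \<le> (\<Sum>\<^sub>\<infinity>i\<in>meeting Q (closure V). (ennreal (oscr Q u i))\<^sup>2)"
        by (intro infsum_ennreal_mono meeting_mono closure_subset) auto
      also have "\<dots> < \<infinity>" using V(2) by (intro compact_energy[OF us]) (auto simp: compactly_contained_def)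
      finally show ?thesis .
    qed
    have "(ennreal (oscr Q ?h i))\<^sup>2 = (ennreal (oscr Q u i))\<^sup>2"
      using hl by (intro infsum_ennreal_eq_terms[OF _ ge fin iM] power_mono ennreal_leI) auto
    moreover have "bounded (?h ` frontier (Q i))"
    proof -
      obtain B where B: "\<And>x. x \<in> frontier (Q i) \<Longrightarrow> norm (u x) \<le> B" using bd[of i] by (auto simp: bounded_iff)
      have "norm (?h x) \<le> B + 1" if "x \<in> frontier (Q i)" for x
        using B[OF that] test_range[of u a V x] by (auto simp: abs_le_iff)
      then show ?thesis by (intro boundedI[of _ "B + 1"]) blast
    qed
    ultimately have heq: "oscr Q ?h i = oscr Q u i"
      using oscr_nonneg[OF bd, of i] oscr_nonneg[of ?h i]
      by (simp add: ennreal_power power2_eq_iff_nonneg)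
    define M m where "M = Sup (u ` frontier (Q i))" and "m = Inf (u ` frontier (Q i))"
    have ml: "m \<le> u x" "u x \<le> M" if "x \<in> frontier (Q i)" for x
      unfolding M_def m_def using that bd[of i] bounded_imp_bdd_above bounded_imp_bdd_below
      by (auto intro!: cSUP_upper cINF_lower)
    \<comment> \<open>Both \<open>?c s\<close> and \<open>s - ?c s\<close> are nondecreasing in
      \<open>s\<close>, so the oscillations are bounded through the values at \<open>M\<close> and
      \<open>m\<close>, which \<open>u\<close> need not attain.\<close>
    let ?c = "\<lambda>s. min (max (s - a) 0) 1"
    have "oscr Q ?h i \<le> (M - ?c M) - (m - ?c m)"
    proof (rule oscr_le)
      fix x y assume xy: "x \<in> frontier (Q i)" "y \<in> frontier (Q i)"
      then have "x \<in> V" "y \<in> V" using iV by auto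
      then show "?h x - ?h y \<le> (M - ?c M) - (m - ?c m)"
        using ml[OF xy(1)] ml[OF xy(2)] by (auto simp: test_def min_def max_def)
    qed
    then have "?c M \<le> ?c m" using heq by (simp add: oscr_def M_def m_def)
    have "oscr Q ?\<psi> i \<le> 0"
    proof (rule oscr_le)
      fix x y assume xy: "x \<in> frontier (Q i)" "y \<in> frontier (Q i)"
      then have "x \<in> V" "y \<in> V" using iV by auto
      then have "?\<psi> x \<le> ?c M" "?c m \<le> ?\<psi> y" using ml[OF xy(1)] ml[OF xy(2)] by (auto simp: test_def)
      then show "?\<psi> x - ?\<psi> y \<le> 0" using \<open>?c M \<le> ?c m\<close> by linarith
    qed
    then show ?thesis using oscr_nonneg[OF bdt, of i] by simp
  qed
qed

end

section \<open>Functions without oscillation off finitely many disks\<close>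

lemma AE_lborel_exists:
  assumes "AE r in lborel. P r" "a < (b::real)" obtains r where "a < r" "r < b" "P r"
proof -
  obtain N where N: "{r. \<not> P r} \<subseteq> N" "N \<in> null_sets lborel" using assms(1) unfolding eventually_ae_filter by auto
  have "\<not> {a<..<b} \<subseteq> N"
  proof
    assume "{a<..<b} \<subseteq> N"
    then have "emeasure lborel {a<..<b} \<le> emeasure lborel N" using N by (intro emeasure_mono) auto
    then show False using N assms(2) by (simp add: null_setsD1)
  qed
  then obtain r where "r \<in> {a<..<b}" "r \<notin> N" by blast
  then show ?thesis using N(1) by (intro that[of r]) auto
qed

context rel_carpet
begin

text \<open>Janiszewski's theorem for the closed disk \<open>k\<close> and the closed complement of
  the set reached so far: they are disjoint, and each has connected complement, by the Jordan curve
  theorem and by induction. \<open>\<Omega>\<close> may be multiply connected.\<close>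

lemma connected_minus_disks:
  "finite F \<Longrightarrow> connected (\<Omega> - (\<Union>i\<in>F. closure (Q i)))"
proof (induction F rule: finite_induct)
  case empty then show ?case using connected_Omega by simp
next
  case (insert k F)
  let ?T = "- \<Omega> \<union> (\<Union>i\<in>F. closure (Q i))"
  have cT: "closed ?T" using insert open_Omega by (auto intro: closed_Un closed_UN)
  have dis: "closure (Q k) \<inter> ?T = {}" using insert.hyps disjoint_closures[of k] closure_Q_subset[of k] by fastforce
  have "- ?T = \<Omega> - (\<Union>i\<in>F. closure (Q i))" by auto
  then have cT': "connected (- ?T)" using insert.IH by simp
  have "connected (- (closure (Q k) \<union> ?T))"
    by (rule Janiszewski_connected[OF compact_closure_Q cT _ connected_compl_closure_Q cT']) (simp only: dis connected_empty)
  moreover have "- (closure (Q k) \<union> ?T) = \<Omega> - (\<Union>i\<in>insert k F. closure (Q i))" by auto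
  ultimately show ?case by simp
qed

lemma open_meets_disk:
  assumes "open U" "U \<subseteq> \<Omega>" "U \<noteq> {}" obtains i where "Q i \<inter> U \<noteq> {}"
proof -
  have "\<not> U \<subseteq> S" using assms interior_maximal[of U S] interior_S by auto
  then obtain x where "x \<in> U" "x \<notin> S" by blast
  then show ?thesis using S_or_Q[of x] assms(2) that by blast
qed

text \<open>Between parameters in two different disks the loop hits both boundary curves. The sum of
  oscillations between these hits vanishes, and the function is constant on either curve.\<close>

lemma loop_constant:
  assumes z: "\<And>s t. 0 \<le> s \<Longrightarrow> s \<le> t \<Longrightarrow> t \<le> 16 \<Longrightarrow> loop c r s \<in> S \<Longrightarrow> loop c r t \<in> S \<Longrightarrow>
       ennreal \<bar>\<zeta> (loop c r s) - \<zeta> (loop c r t)\<bar> \<le> (\<Sum>\<^sub>\<infinity>i\<in>meeting Q (loop c r ` {s..t}). ennreal (oscr Q \<zeta> i))"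
    and osc: "\<And>i. i \<in> meeting Q (sqs c r) \<Longrightarrow> oscr Q \<zeta> i = 0" and bd: "\<And>i. bounded (\<zeta> ` frontier (Q i))"
    and r: "0 \<le> r" and st: "0 \<le> s" "s \<le> t" "t \<le> 16" "loop c r s \<in> Q i" "loop c r t \<in> Q k"
    and xy: "x \<in> frontier (Q i)" "y \<in> frontier (Q k)"
  shows "\<zeta> x = \<zeta> y"
proof (cases "i = k")
  case True
  have "i \<in> meeting Q (sqs c r)" using st loop_in_sqs[of r s c] r by (auto simp: meeting_def)
  then show ?thesis using abs_diff_le_oscr[OF bd, of x i y] xy True osc by auto
next
  case False
  let ?f = "loop c r" and ?A = "loop c r ` {s..t}"
  have c: "connected ?A" using st by (intro connected_continuous_image continuous_on_subset[OF continuous_on_loop]) auto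
  have inA: "?f s \<in> ?A" "?f t \<in> ?A" using st by auto
  have mi: "i \<in> meeting Q (sqs c r)" "k \<in> meeting Q (sqs c r)" using st loop_in_sqs[of r _ c] r by (fastforce simp: meeting_def)+
  have "?f t \<notin> Q i" "?f s \<notin> Q k" using st False disjoint_Q[of i k] by blast+
  then have h: "?f s \<in> ?A \<inter> Q i" "?f t \<in> ?A - Q i" "?f t \<in> ?A \<inter> Q k" "?f s \<in> ?A - Q k" using inA st by simp_all
  have "?A \<inter> frontier (Q i) \<noteq> {}"
    using connected_Int_frontier[OF c, of "Q i"] h(1,2) by (metis empty_iff)
  then have "\<exists>a\<in>{s..t}. ?f a \<in> frontier (Q i)" by auto
  then obtain a where a: "a \<in> {s..t}" "?f a \<in> frontier (Q i)" by (elim bexE)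
  have "?A \<inter> frontier (Q k) \<noteq> {}"
    using connected_Int_frontier[OF c, of "Q k"] h(3,4) by (metis empty_iff)
  then have "\<exists>b\<in>{s..t}. ?f b \<in> frontier (Q k)" by auto
  then obtain b where b: "b \<in> {s..t}" "?f b \<in> frontier (Q k)" by (elim bexE)
  have zero: "\<zeta> (?f a') = \<zeta> (?f b')" if ab: "s \<le> a'" "a' \<le> b'" "b' \<le> t" "?f a' \<in> S" "?f b' \<in> S" for a' b'
  proof -
    have "ennreal \<bar>\<zeta> (?f a') - \<zeta> (?f b')\<bar> \<le> (\<Sum>\<^sub>\<infinity>i\<in>meeting Q (?f ` {a'..b'}). ennreal (oscr Q \<zeta> i))" using ab st by (intro z) auto
    also have "\<dots> = (\<Sum>\<^sub>\<infinity>i\<in>meeting Q (?f ` {a'..b'}). 0)"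
    proof (rule infsum_cong)
      fix i assume "i \<in> meeting Q (?f ` {a'..b'})"
      then have "i \<in> meeting Q (sqs c r)" using loop_in_sqs[of r _ c] r st ab by (fastforce simp: meeting_def)
      then show "ennreal (oscr Q \<zeta> i) = 0" using osc by simp
    qed
    finally show ?thesis by simp
  qed
  have abS: "?f a \<in> S" "?f b \<in> S" using a b frontier_Q_subset_S by blast+
  have "\<zeta> (?f a) = \<zeta> (?f b)"
  proof (cases "a \<le> b")
    case True
    show ?thesis by (rule zero) (use a b abS True in auto)
  next
    case False
    have "\<zeta> (?f b) = \<zeta> (?f a)" by (rule zero) (use a b abS False in auto)
    then show ?thesis by simp
  qed
  moreover have "\<zeta> x = \<zeta> (?f a)" using abs_diff_le_oscr[OF bd xy(1) a(2)] osc mi by auto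
  moreover have "\<zeta> y = \<zeta> (?f b)" using abs_diff_le_oscr[OF bd xy(2) b(2)] osc mi by auto
  ultimately show ?thesis by simp
qed

text \<open>Two points of the given disks are antipodal on a square about their midpoint. As the
  disks are open, all nearby radii still give squares through both of them, so a property of almost
  every radius is enough.\<close>

lemma locally_constant_on_disks:
  assumes u: "sobolev_real v \<Omega> Q \<zeta>" and W: "open W" "W \<subseteq> \<Omega>" and osc: "\<And>i. i \<in> meeting Q W \<Longrightarrow> oscr Q \<zeta> i = 0" and z: "z \<in> W"
  obtains e where "0 < e" "ball z e \<subseteq> W"
    "\<And>i k x y. i \<in> meeting Q (ball z e) \<Longrightarrow> k \<in> meeting Q (ball z e) \<Longrightarrow> x \<in> frontier (Q i) \<Longrightarrow> y \<in> frontier (Q k) \<Longrightarrow> \<zeta> x = \<zeta> y"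
proof -
  note bd = sobolev_realD(1)[OF u]
  obtain e0 where e0: "0 < e0" "ball z e0 \<subseteq> W" using W z open_contains_ball by metis
  \<comment> \<open>The square will have its center within \<open>2 * e\<close> of \<open>z\<close>
    and a radius below \<open>e\<close>, which keeps it inside \<open>ball z e0\<close>.\<close>
  define e where "e = e0 / 8"
  have e: "0 < e" "e \<le> e0" using e0 by (auto simp: e_def)
  have "\<zeta> x = \<zeta> y" if ik: "i \<in> meeting Q (ball z e)" "k \<in> meeting Q (ball z e)" and xy: "x \<in> frontier (Q i)" "y \<in> frontier (Q k)" for i k x y
  proof (cases "i = k")
    case True
    have "i \<in> meeting Q W" using ik(1) e e0 meeting_mono[of "ball z e" W Q] by (auto simp: subset_iff)
    then show ?thesis using abs_diff_le_oscr[OF bd, of x i y] xy True osc by auto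
  next
    case False
    obtain x0 where x0: "x0 \<in> Q i" "dist z x0 < e" using ik(1) by (auto simp: meeting_def)
    obtain y0 where y0: "y0 \<in> Q k" "dist z y0 < e" using ik(2) by (auto simp: meeting_def)
    have "x0 \<noteq> y0" using False x0 y0 disjoint_Q[of i k] by blast
    define h where "h = (x0 - y0) / 2"
    define c where "c = (x0 + y0) / 2"
    define r0 where "r0 = sqn h"
    have hc: "x0 = c + h" "y0 = c - h" by (simp_all add: h_def c_def field_simps)
    have r0: "0 < r0" using \<open>x0 \<noteq> y0\<close> sqn_nonneg[of h] sqn_0_iff[of h] by (simp add: r0_def h_def less_le del: sqn_nonneg sqn_0_iff)
    have "h \<noteq> 0" using \<open>x0 \<noteq> y0\<close> by (simp add: h_def)
    have "norm h < e"
    proof -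
      have "dist x0 y0 < 2 * e" using x0 y0 dist_triangle3[of x0 y0 z] by (simp add: dist_commute)
      then show ?thesis by (simp add: h_def norm_divide dist_norm)
    qed
    then have r0e: "r0 < e" using sqn_le_norm[of h] by (simp add: r0_def)
    have h2: "norm h \<le> 2 * r0" using norm_le_sqn[of h] by (simp add: r0_def)
    \<comment> \<open>Scaling by \<open>r / r0\<close> moves the point \<open>c + h'\<close> by at
      most twice the change of the radius.\<close>
    have near: "\<exists>d>0. \<forall>r. \<bar>r - r0\<bar> < d \<longrightarrow> c + of_real (r / r0) * h' \<in> U" if "open U" "c + h' \<in> U" "norm h' \<le> 2 * r0" for U h'
    proof -
      from that obtain d where d: "0 < d" "ball (c + h') d \<subseteq> U" using open_contains_ball by metis
      have "c + of_real (r / r0) * h' \<in> U" if "\<bar>r - r0\<bar> < d / 2" for r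
      proof -
        have "c + h' - (c + of_real (r / r0) * h') = of_real ((r0 - r) / r0) * h'" using r0 by (simp add: field_simps)
        then have "dist (c + h') (c + of_real (r / r0) * h') = \<bar>(r0 - r) / r0\<bar> * norm h'" by (simp only: dist_norm norm_mult norm_of_real)
        also have "\<dots> \<le> \<bar>(r0 - r) / r0\<bar> * (2 * r0)" using \<open>norm h' \<le> 2 * r0\<close> by (intro mult_left_mono) auto
        also have "\<dots> < d" using that r0 by (simp add: abs_divide abs_minus_commute)
        finally show ?thesis using d by auto
      qed
      then show ?thesis using d by (intro exI[of _ "d / 2"]) auto
    qed
    obtain d1 where d1: "0 < d1" "\<And>r. \<bar>r - r0\<bar> < d1 \<Longrightarrow> c + of_real (r / r0) * h \<in> Q i"
      using near[of "Q i" h] open_Q x0 hc h2 by auto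
    obtain d2 where d2: "0 < d2" "\<And>r. \<bar>r - r0\<bar> < d2 \<Longrightarrow> c + of_real (r / r0) * (- h) \<in> Q k"
      using near[of "Q k" "- h"] open_Q y0 hc h2 by auto
    have R: "0 < 2 * e" using e by simp
    obtain r where r: "r0 < r" "r < r0 + min (min d1 d2) (e - r0)"
      and L: "0 < r \<and> r < 2 * e \<and> sqs c r \<subseteq> \<Omega> \<longrightarrow> (\<forall>s t. 0 \<le> s \<and> s \<le> t \<and> t \<le> 16 \<and> loop c r s \<in> S \<and> loop c r t \<in> S \<longrightarrow>
     ennreal \<bar>\<zeta> (loop c r s) - \<zeta> (loop c r t)\<bar> \<le> (\<Sum>\<^sub>\<infinity>i\<in>meeting Q (loop c r ` {s..t}). ennreal (oscr Q \<zeta> i)))"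
      by (rule AE_lborel_exists[OF AE_loop_sobolev[OF u R, of c], of r0 "r0 + min (min d1 d2) (e - r0)"])
         (use d1 d2 r0e in simp, rule that)
    have r': "0 < r" "r < e" "\<bar>r - r0\<bar> < d1" "\<bar>r - r0\<bar> < d2" using r r0 by auto
    have sqW: "sqs c r \<subseteq> W"
    proof
      fix p assume "p \<in> sqs c r"
      then have "norm (p - c) \<le> 2 * r" using norm_le_sqn[of "p - c"] by (simp add: sqs_def)
      moreover have "norm (c - z) < 2 * e"
        using x0(2) \<open>norm h < e\<close> norm_triangle_ineq4[of "x0 - z" h] hc(1) by (simp add: dist_norm norm_minus_commute)
      ultimately have "dist z p < e0"
        using norm_triangle_ineq[of "p - c" "c - z"] r' e0 by (simp add: dist_norm norm_minus_commute e_def)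
      then show "p \<in> W" using e0 by auto
    qed
    have x1: "c + of_real (r / r0) * h \<in> sqs c r" and y1: "c + of_real (r / r0) * (- h) \<in> sqs c r"
    proof -
      have "sqn (- h) = sqn h" by (simp add: sqn_def)
      then show "c + of_real (r / r0) * h \<in> sqs c r" "c + of_real (r / r0) * (- h) \<in> sqs c r"
        using r0 r' \<open>h \<noteq> 0\<close> unfolding sqs_def by (simp_all only: mem_Collect_eq add_diff_cancel_left' sqn_mult_of_real) (simp_all add: r0_def)
    qed
    obtain s where s: "0 \<le> s" "s \<le> 8" "loop c r s = c + of_real (r / r0) * h" using loop_surj[OF r'(1) x1] by blast
    obtain t where t: "0 \<le> t" "t \<le> 8" "loop c r t = c + of_real (r / r0) * (- h)" using loop_surj[OF r'(1) y1] by blast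
    have sQ: "loop c r s \<in> Q i" "loop c r t \<in> Q k" using s t d1 d2 r' by auto
    have L': "ennreal \<bar>\<zeta> (loop c r s) - \<zeta> (loop c r t)\<bar> \<le> (\<Sum>\<^sub>\<infinity>i\<in>meeting Q (loop c r ` {s..t}). ennreal (oscr Q \<zeta> i))"
      if "0 \<le> s" "s \<le> t" "t \<le> 16" "loop c r s \<in> S" "loop c r t \<in> S" for s t using L that r' sqW W e by auto
    have osc': "oscr Q \<zeta> i = 0" if "i \<in> meeting Q (sqs c r)" for i using that sqW meeting_mono[OF sqW, of Q] osc by blast
    show ?thesis
    proof (cases "s \<le> t")
      case True
      show ?thesis by (rule loop_constant[OF L' osc' bd, of s t i k]) (use True s t sQ xy r' in auto)
    next
      case False
      have "\<zeta> y = \<zeta> x" by (rule loop_constant[OF L' osc' bd, of t s k i]) (use False s t sQ xy r' in auto)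
      then show ?thesis by simp
    qed
  qed
  moreover have "ball z e \<subseteq> W" using e e0 by auto
  ultimately show ?thesis using e that by blast
qed

text \<open>Every point of the connected set \<open>?W\<close> has a local value, read off from the
  disks nearby; it is unique because every ball in \<open>\<Omega>\<close> meets a disk. Having a
  common local value is an open equivalence relation.\<close>

lemma constant_on_disks:
  assumes u: "sobolev_real v \<Omega> Q \<zeta>" and F: "finite F" and osc: "\<And>i. i \<notin> F \<Longrightarrow> oscr Q \<zeta> i = 0"
    and ik: "i \<notin> F" "k \<notin> F" and xy: "x \<in> frontier (Q i)" "y \<in> frontier (Q k)"
  shows "\<zeta> x = \<zeta> y"
proof -
  let ?W = "\<Omega> - (\<Union>i\<in>F. closure (Q i))"
  have W: "open ?W" "connected ?W" using F open_Omega connected_minus_disks[OF F] by (auto intro!: open_Diff closed_UN)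
  have mW: "j \<notin> F" if "j \<in> meeting Q ?W" for j
    using that closure_subset[of "Q j"] by (auto simp: meeting_def)
  define P where "P z c \<longleftrightarrow> (\<exists>e>0. ball z e \<subseteq> ?W \<and> (\<forall>i\<in>meeting Q (ball z e). \<forall>x\<in>frontier (Q i). \<zeta> x = c))" for z c
  have uniq: "c = d" if Pc: "P z c" and Pd: "P z d" for z c d
  proof -
    obtain e where e: "0 < e" "ball z e \<subseteq> ?W" "\<forall>i\<in>meeting Q (ball z e). \<forall>x\<in>frontier (Q i). \<zeta> x = c" using Pc by (auto simp: P_def)
    obtain e' where e': "0 < e'" "ball z e' \<subseteq> ?W" "\<forall>i\<in>meeting Q (ball z e'). \<forall>x\<in>frontier (Q i). \<zeta> x = d" using Pd by (auto simp: P_def)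
    obtain i where i: "Q i \<inter> ball z (min e e') \<noteq> {}"
      by (rule open_meets_disk[of "ball z (min e e')"]) (use e e' in auto)
    then have "i \<in> meeting Q (ball z e)" "i \<in> meeting Q (ball z e')" by (auto simp: meeting_def)
    moreover obtain x where "x \<in> frontier (Q i)" using frontier_Q_ne by blast
    ultimately have "\<zeta> x = c" "\<zeta> x = d" using e(3) e'(3) by blast+
    then show ?thesis by simp
  qed
  have ex: "\<exists>e>0. ball z e \<subseteq> ?W \<and> (\<exists>c. \<forall>i\<in>meeting Q (ball z e). \<forall>x\<in>frontier (Q i). \<zeta> x = c)" if z: "z \<in> ?W" for z
  proof -
    obtain e where e: "0 < e" "ball z e \<subseteq> ?W"
      "\<And>i k x y. i \<in> meeting Q (ball z e) \<Longrightarrow> k \<in> meeting Q (ball z e) \<Longrightarrow> x \<in> frontier (Q i) \<Longrightarrow> y \<in> frontier (Q k) \<Longrightarrow> \<zeta> x = \<zeta> y"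
      by (rule locally_constant_on_disks[OF u W(1) _ osc z]) (use mW in blast, use mW in blast, rule that)
    obtain j where j: "Q j \<inter> ball z e \<noteq> {}" by (rule open_meets_disk[of "ball z e"]) (use e in auto)
    obtain x where x: "x \<in> frontier (Q j)" using frontier_Q_ne by blast
    have "j \<in> meeting Q (ball z e)" using j by (auto simp: meeting_def)
    then have "\<forall>i\<in>meeting Q (ball z e). \<forall>y\<in>frontier (Q i). \<zeta> y = \<zeta> x" using e(3) x by blast
    then show ?thesis using e by blast
  qed
  have sub: "Q j \<subseteq> ?W" if "j \<notin> F" for j
  proof
    fix x assume x: "x \<in> Q j"
    have "x \<notin> closure (Q k)" if "k \<in> F" for k using closure_Q_disjoint_Q[of k j] x that \<open>j \<notin> F\<close> by blast
    then show "x \<in> ?W" using x Q_subset by blast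
  qed
  obtain a where a: "a \<in> Q i" using Q_ne by blast
  obtain b where b: "b \<in> Q k" using Q_ne by blast
  have "\<exists>c. P a c \<and> P b c"
  proof (rule connected_equivalence_relation[OF W(2), of a b "\<lambda>a b. \<exists>c. P a c \<and> P b c"])
    show "a \<in> ?W" "b \<in> ?W" using a b sub ik by blast+
    show "\<exists>T. openin (top_of_set ?W) T \<and> z \<in> T \<and> (\<forall>x\<in>T. \<exists>c. P z c \<and> P x c)" if z: "z \<in> ?W" for z
    proof -
      obtain e c where e: "0 < e" "ball z e \<subseteq> ?W" and c: "\<forall>i\<in>meeting Q (ball z e). \<forall>x\<in>frontier (Q i). \<zeta> x = c" using ex[OF z] by blast
      have "P x c" if x: "x \<in> ball z e" for x
      proof -
        obtain e' where e': "0 < e'" "ball x e' \<subseteq> ball z e" using x open_contains_ball open_ball by metis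
        then have "meeting Q (ball x e') \<subseteq> meeting Q (ball z e)" by (intro meeting_mono)
        then show ?thesis unfolding P_def using e' e c by (intro exI[of _ e']) blast
      qed
      then have "\<forall>x\<in>ball z e. \<exists>c. P z c \<and> P x c" using e(1) centre_in_ball[of z e] by blast
      moreover have "openin (top_of_set ?W) (ball z e)" using e(2) by (intro open_subset) auto
      ultimately show ?thesis using e(1) by (intro exI[of _ "ball z e"]) auto
    qed
  next
    fix x y z assume "\<exists>c. P x c \<and> P y c" "\<exists>c. P y c \<and> P z c"
    then obtain c d where cd: "P x c" "P y c" "P y d" "P z d" by blast
    moreover have "c = d" using uniq[OF cd(2,3)] .
    ultimately show "\<exists>c. P x c \<and> P z c" by blast
  qed blast
  then obtain c where c: "P a c" "P b c" by blast
  have at: "\<zeta> x = c" if Pc: "P a c" and a: "a \<in> Q i" and x: "x \<in> frontier (Q i)" for a i x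
  proof -
    obtain e where e: "0 < e" "\<forall>i\<in>meeting Q (ball a e). \<forall>x\<in>frontier (Q i). \<zeta> x = c" using Pc by (auto simp: P_def)
    have "i \<in> meeting Q (ball a e)" using a e(1) centre_in_ball[of a e] by (auto simp: meeting_def)
    then show ?thesis using e(2) x by blast
  qed
  show ?thesis using at[OF c(1) a xy(1)] at[OF c(2) b xy(2)] by simp
qed

end

section \<open>Crosscuts at the boundary of a disk\<close>

lemma open_sqb: "open (sqb p r)"
proof -
  have "open {z. sqn (z - p) < r}" by (intro open_Collect_less continuous_intros)
  then show ?thesis by (simp add: sqb_def)
qed

lemma convex_sqb: "convex (sqb p r)"
proof (rule convexI)
  fix x y and a b :: real assume xy: "x \<in> sqb p r" "y \<in> sqb p r" and ab: "0 \<le> a" "0 \<le> b" "a + b = 1"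
  have "(a *\<^sub>R x + b *\<^sub>R y) - p = of_real a * (x - p) + of_real b * (y - p)"
  proof -
    have "p = of_real a * p + of_real b * p" using ab(3) by (metis distrib_right mult_1 of_real_1 of_real_add)
    then show ?thesis by (simp add: scaleR_conv_of_real algebra_simps)
  qed
  then have "sqn ((a *\<^sub>R x + b *\<^sub>R y) - p) \<le> a * sqn (x - p) + b * sqn (y - p)"
    using sqn_triangle[of "of_real a * (x - p)" "of_real b * (y - p)"] ab by simp
  also have "\<dots> < r" using xy ab convex_bound_lt[of "sqn (x - p)" r "sqn (y - p)" a b] by (simp add: sqb_def)
  finally show "a *\<^sub>R x + b *\<^sub>R y \<in> sqb p r" by (simp add: sqb_def)
qed

lemma sqb_subset_ball: "sqb p r \<subseteq> ball p (2 * r)"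
proof
  fix z assume "z \<in> sqb p r"
  then show "z \<in> ball p (2 * r)" using norm_le_sqn[of "z - p"] by (simp add: sqb_def dist_norm norm_minus_commute)
qed

lemma ball_subset_sqb: "ball p r \<subseteq> sqb p r"
proof
  fix z assume "z \<in> ball p r"
  then show "z \<in> sqb p r" using sqn_le_norm[of "z - p"] by (simp add: sqb_def dist_norm norm_minus_commute)
qed

lemma sqb_mono: "r \<le> r' \<Longrightarrow> sqb p r \<subseteq> sqb p r'" by (auto simp: sqb_def)

lemma sqb_center: "0 < r \<Longrightarrow> p \<in> sqb p r" by (simp add: sqb_def sqn_def)

lemma bounded_sqb: "bounded (sqb p r)"
  using bounded_subset[OF bounded_ball sqb_subset_ball] .

lemma connected_Compl_sqb: "connected (- sqb p r)"
  by (intro connected_complement_bounded_convex convex_sqb bounded_sqb) simp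

lemma connected_meets_sqs:
  assumes "connected X" "x \<in> X" "y \<in> X" "sqn (x - p) \<le> r" "r \<le> sqn (y - p)"
  obtains z where "z \<in> X" "z \<in> sqs p r"
proof -
  have "connected ((\<lambda>z. sqn (z - p)) ` X)"
    using assms(1) by (intro connected_continuous_image continuous_intros)
  then have "r \<in> (\<lambda>z. sqn (z - p)) ` X"
    using connected_contains_Icc[of "(\<lambda>z. sqn (z - p)) ` X" "sqn (x - p)" "sqn (y - p)"] assms by auto
  then show ?thesis using that by (auto simp: sqs_def)
qed

context rel_carpet
begin

text \<open>After a shift of the parametrization the curve starts and ends at \<open>p\<close>;
  \<open>A\<close> consists of its two end pieces and \<open>B\<close> of the middle. Connectedness
  of both is what Janiszewski's theorem will ask for.\<close>

lemma small_boundary_arc: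
  assumes p: "p \<in> frontier (Q j)" and \<eta>: "0 < \<eta>"
  obtains A B where "compact A" "connected A" "compact B" "connected B" "frontier (Q j) = A \<union> B" "p \<in> A" "p \<notin> B" "A \<subseteq> sqb p \<eta>"
proof -
  obtain c where c: "simple_path c" "pathfinish c = pathstart c" "frontier (Q j) = path_image c"
    by (rule jordan_QE[of j]) (rule that)
  obtain t0 where t0: "t0 \<in> {0..1}" "c t0 = p" using p c(3) by (auto simp: path_image_def)
  define g where "g = shiftpath t0 c"
  have g: "simple_path g" "path_image g = frontier (Q j)" "g 0 = p" "g 1 = p"
  proof -
    show "simple_path g" unfolding g_def using c t0 by (intro simple_path_shiftpath) auto
    show "path_image g = frontier (Q j)" unfolding g_def using c t0 by (simp add: path_image_shiftpath)
    show "g 0 = p" using t0 pathstart_shiftpath[of t0 c] by (simp add: g_def pathstart_def)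
    show "g 1 = p" using t0 c pathfinish_shiftpath[of t0 c] by (simp add: g_def pathfinish_def)
  qed
  have cont: "continuous_on {0..1} g" using g(1) by (simp add: simple_path_def path_def)
  have ev: "\<exists>d>0. \<forall>t\<in>{0..1}. dist t x < d \<longrightarrow> g t \<in> sqb p \<eta>" if x: "x \<in> {0..1}" "g x = p" for x
  proof -
    obtain d where "0 < d" "\<forall>t\<in>{0..1}. dist t x < d \<longrightarrow> dist (g t) (g x) < \<eta>"
      using cont x(1) \<eta> unfolding continuous_on_iff by blast
    then show ?thesis using ball_subset_sqb[of p \<eta>] x(2) by (intro exI[of _ d]) (auto simp: dist_commute subset_iff)
  qed
  obtain d0 where d0: "0 < d0" "\<And>t. t \<in> {0..1} \<Longrightarrow> dist t 0 < d0 \<Longrightarrow> g t \<in> sqb p \<eta>" using ev[of 0] g by auto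
  obtain d1 where d1: "0 < d1" "\<And>t. t \<in> {0..1} \<Longrightarrow> dist t 1 < d1 \<Longrightarrow> g t \<in> sqb p \<eta>" using ev[of 1] g by auto
  define d where "d = min (min d0 d1) (1 / 2) / 2"
  have d: "0 < d" "d < d0" "d < d1" "d \<le> 1 / 4" using d0 d1 by (auto simp: d_def)
  let ?A = "g ` {0..d} \<union> g ` {1 - d..1}" and ?B = "g ` {d..1 - d}"
  have im: "compact (g ` {a..b})" "connected (g ` {a..b})" if "0 \<le> a" "b \<le> 1" for a b
  proof -
    have "continuous_on {a..b} g" using that by (intro continuous_on_subset[OF cont]) auto
    then show "compact (g ` {a..b})" "connected (g ` {a..b})"
      by (auto intro: compact_continuous_image connected_continuous_image)
  qed
  show ?thesis
  proof (rule that[of ?A ?B])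
    show "compact ?A" using im d by (intro compact_Un) auto
    have "p \<in> g ` {0..d}" "p \<in> g ` {1 - d..1}" using g d by (auto simp: image_iff intro: bexI[of _ 0] bexI[of _ 1])
    then show "connected ?A" "p \<in> ?A" using im d by (auto intro!: connected_Un)
    show "compact ?B" "connected ?B" using im d by auto
    have "{0..1} = {0..d} \<union> {1 - d..1} \<union> {d..1 - d}" using d by auto
    then have "g ` {0..1} = ?A \<union> ?B" by (simp add: image_Un)
    then show "frontier (Q j) = ?A \<union> ?B" using g(2) by (simp add: path_image_def)
    show "p \<notin> ?B"
    proof
      assume "p \<in> ?B"
      then obtain t where t: "t \<in> {d..1 - d}" "g t = p" by auto
      then have "t = 0 \<or> t = 1"
        using g(1,3) d unfolding simple_path_def loop_free_def by (metis atLeastAtMost_iff diff_ge_0_iff_ge le_add_same_cancel1 less_eq_real_def order_trans zero_le_one diff_le_self dual_order.trans add_increasing2 le_diff_eq)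
      then show False using t d by auto
    qed
    show "?A \<subseteq> sqb p \<eta>"
    proof -
      have "g t \<in> sqb p \<eta>" if "t \<in> {0..d}" for t using that d by (intro d0) (auto simp: dist_real_def)
      moreover have "g t \<in> sqb p \<eta>" if "t \<in> {1 - d..1}" for t using that d by (intro d1) (auto simp: dist_real_def)
      ultimately show ?thesis by blast
    qed
  qed
qed

text \<open>The boundary curve meets the union of the far arc \<open>B\<close> with the outside of
  the square exactly in the connected set \<open>B\<close>, and neither of the two separates
  \<open>x\<close> from \<open>y\<close>. By Janiszewski's theorem their union does not either: the
  exterior is locally connected at the curve.\<close>

lemma locally_connected_outside:
  assumes p: "p \<in> frontier (Q j)" and \<eta>: "0 < \<eta>"
  obtains d where "0 < d" "d \<le> \<eta>" "\<And>x y. x \<in> sqb p d - closure (Q j) \<Longrightarrow> y \<in> sqb p d - closure (Q j) \<Longrightarrow>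
     connected_component (sqb p \<eta> - frontier (Q j)) x y"
proof -
  let ?C = "frontier (Q j)"
  obtain A B where AB: "compact A" "connected A" "compact B" "connected B" "?C = A \<union> B" "p \<in> A" "p \<notin> B" "A \<subseteq> sqb p \<eta>"
    by (rule small_boundary_arc[OF p \<eta>]) (rule that)
  have "open (- B)" using AB(3) compact_imp_closed by blast
  then obtain e where e: "0 < e" "ball p e \<subseteq> - B" using AB(7) open_contains_ball by (metis ComplI)
  define d where "d = min \<eta> (e / 2)"
  have d: "0 < d" "d \<le> \<eta>" "sqb p d \<inter> B = {}"
  proof -
    have "sqb p d \<subseteq> ball p e" by (rule order_trans[OF sqb_subset_ball]) (auto simp: d_def)
    then show "sqb p d \<inter> B = {}" using e by blast
  qed (use \<eta> e in \<open>auto simp: d_def\<close>)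
  have "connected_component (sqb p \<eta> - ?C) x y" if xy: "x \<in> sqb p d - closure (Q j)" "y \<in> sqb p d - closure (Q j)" for x y
  proof -
    let ?T = "- sqb p \<eta> \<union> B"
    have "connected_component (- (?C \<union> ?T)) x y"
    proof (rule Janiszewski)
      show "compact ?C" by (rule compact_frontier_Q)
      show "closed ?T" using AB(3) open_sqb by (auto intro: compact_imp_closed)
      have "?C \<inter> ?T = B" using AB(5,8) by blast
      then show "connected (?C \<inter> ?T)" using AB(4) by simp
      show "connected_component (- ?C) x y"
        using connected_compl_closure_Q[of j] xy by (auto simp: connected_component_def frontier_Q_eq intro!: exI[of _ "- closure (Q j)"])
      have "sqb p d \<subseteq> - ?T" using sqb_mono[OF d(2)] d(3) by blast
      then show "connected_component (- ?T) x y"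
        using xy convex_connected[OF convex_sqb[of p d]] by (auto simp: connected_component_def intro!: exI[of _ "sqb p d"])
    qed
    moreover have "- (?C \<union> ?T) = sqb p \<eta> - ?C" using AB(5) by blast
    ultimately show ?thesis by simp
  qed
  then show ?thesis using d that by blast
qed

lemma ends_of_component:
  fixes U I :: "real set"
  assumes U: "open U" "U \<subseteq> {a<..<b}" and I: "I \<in> components U"
  obtains s t where "I = {s<..<t}" "a \<le> s" "s < t" "t \<le> b" "s \<notin> U" "t \<notin> U"
proof -
  have oI: "open I" "connected I" "I \<noteq> {}" "I \<subseteq> U"
    using I U by (auto simp: open_components in_components_connected in_components_nonempty in_components_subset)
  have bd: "bdd_above I" "bdd_below I" using oI U by (auto intro!: bdd_aboveI[of _ b] bdd_belowI[of _ a])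
  define s t where "s = Inf I" and "t = Sup I"
  have le: "s \<le> x" "x \<le> t" if "x \<in> I" for x using that bd by (auto simp: s_def t_def intro: cInf_lower cSup_upper)
  have "s \<notin> I"
  proof
    assume "s \<in> I"
    then obtain e where e: "0 < e" "ball s e \<subseteq> I" using oI open_contains_ball by metis
    then have "s - e / 2 \<in> I" by (auto simp: subset_iff dist_real_def)
    then show False using le e by fastforce
  qed
  have "t \<notin> I"
  proof
    assume "t \<in> I"
    then obtain e where e: "0 < e" "ball t e \<subseteq> I" using oI open_contains_ball by metis
    then have "t + e / 2 \<in> I" by (auto simp: subset_iff dist_real_def)
    then show False using le e by fastforce
  qed
  have "x \<in> I" if "s < x" "x < t" for x
  proof -
    from that obtain y where y: "y \<in> I" "y < x" using cInf_lessD[OF oI(3)] by (auto simp: s_def)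
    from that obtain z where z: "z \<in> I" "x < z" using less_cSupD[OF oI(3)] by (auto simp: t_def)
    show ?thesis using connected_contains_Icc[OF oI(2) y(1) z(1)] y z by auto
  qed
  then have Ist: "I = {s<..<t}" using le \<open>s \<notin> I\<close> \<open>t \<notin> I\<close> by (auto simp: less_le)
  obtain x where x: "x \<in> I" using oI by blast
  then have "s < t" using Ist by auto
  have "a \<le> s" unfolding s_def using oI U by (intro cInf_greatest) auto
  have "t \<le> b" unfolding t_def using oI U by (intro cSup_least) auto
  have max: "J \<subseteq> I" if "connected J" "J \<subseteq> U" "x \<in> J" for J
    using components_maximal[OF I that(1,2)] x that(3) by blast
  have "s \<notin> U"
  proof
    assume "s \<in> U"
    then have "{s..x} \<subseteq> U" using Ist x oI(4) by (auto simp: less_le)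
    then have "{s..x} \<subseteq> I" using le x by (intro max) auto
    moreover have "s \<in> {s..x}" using le x by simp
    ultimately show False using \<open>s \<notin> I\<close> by blast
  qed
  moreover have "t \<notin> U"
  proof
    assume "t \<in> U"
    then have "{x..t} \<subseteq> U" using Ist x oI(4) by (auto simp: less_le)
    then have "{x..t} \<subseteq> I" using le x by (intro max) auto
    moreover have "t \<in> {x..t}" using le x by simp
    ultimately show False using \<open>t \<notin> I\<close> by blast
  qed
  ultimately show ?thesis using that Ist \<open>a \<le> s\<close> \<open>s < t\<close> \<open>t \<le> b\<close> by blast
qed

end

lemma connected_component_trans_set:
  "connected_component X a b \<Longrightarrow> X \<subseteq> Y \<Longrightarrow> connected_component Y a b"
  by (auto simp: connected_component_def)

context rel_carpet
begin

text \<open>A small square around a boundary point \<open>p\<close> of \<open>Q j\<close> contains an arc that together with the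
  boundary curve separates \<open>p\<close> from far away points of the exterior: otherwise, by Janiszewski's
  theorem, finitely many arcs would not separate either, although a path meets only finitely many of them.\<close>

lemma separating_arc:
  assumes p: "p \<in> frontier (Q j)" and r: "0 < r" and big: "\<not> frontier (Q j) \<subseteq> sqb p r"
    and x0: "x0 \<in> sqb p r - closure (Q j)" and w: "w \<notin> sqb p r" "w \<notin> closure (Q j)"
  obtains s t where "0 \<le> s" "s < t" "t \<le> 16" "loop p r ` {s<..<t} \<inter> closure (Q j) = {}"
    "loop p r s \<in> frontier (Q j)" "loop p r t \<in> frontier (Q j)"
    "\<not> connected_component (- (frontier (Q j) \<union> loop p r ` {s..t})) x0 w"
proof -
  let ?C = "frontier (Q j)" and ?O = "- closure (Q j)" and ?f = "loop p r"
  have C_cl: "?C \<subseteq> closure (Q j)" by (auto simp: frontier_def)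
  obtain y where y: "y \<in> ?C" "y \<notin> sqb p r" using big by blast
  obtain b where b: "b \<in> ?C" "b \<in> sqs p r"
  proof (rule connected_meets_sqs[OF connected_frontier_Q p y(1), of p r])
    show "sqn (p - p) \<le> r" "r \<le> sqn (y - p)" using r y(2) by (auto simp: sqb_def sqn_def)
  qed (rule that)
  \<comment> \<open>The turn is started at a point \<open>b\<close> of the boundary curve, so that
    no arc of the square in the exterior is cut in two by the ends of the parameter
    interval.\<close>
  obtain \<theta> where \<theta>: "0 \<le> \<theta>" "\<theta> \<le> 8" "?f \<theta> = b" using loop_surj[OF r b(2)] by blast
  have \<theta>8: "?f (\<theta> + 8) = b" using loop_periodic[OF \<theta>(1)] \<theta>(3) by simp
  have cf: "continuous_on {\<theta>..\<theta> + 8} ?f" using \<theta> by (intro continuous_on_subset[OF continuous_on_loop]) auto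
  have inj: "s = t" if "s \<in> {\<theta><..<\<theta> + 8}" "t \<in> {\<theta>..\<theta> + 8}" "?f s = ?f t" for s t
  proof (cases "s \<le> t")
    case True
    show ?thesis by (rule loop_inj[OF r _ True _ that(3)]) (use that \<theta> in auto)
  next
    case False
    have "t = s" by (rule loop_inj[OF r _ _ _ that(3)[symmetric]]) (use that \<theta> False in auto)
    then show ?thesis by simp
  qed
  define U where "U = {t \<in> {\<theta><..<\<theta> + 8}. ?f t \<in> ?O}"
  have "open U"
  proof -
    have "continuous_on {\<theta><..<\<theta> + 8} ?f" using cf by (rule continuous_on_subset) auto
    then have "open ({\<theta><..<\<theta> + 8} \<inter> ?f -` ?O)" by (intro continuous_open_preimage) auto
    moreover have "{\<theta><..<\<theta> + 8} \<inter> ?f -` ?O = U" by (auto simp: U_def)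
    ultimately show ?thesis by simp
  qed
  have Usub: "U \<subseteq> {\<theta><..<\<theta> + 8}" by (auto simp: U_def)
  have endb: "?f e \<in> ?C" if I: "{s<..<t} \<in> components U" "e = s \<or> e = t" "s < t" "\<theta> \<le> s" "t \<le> \<theta> + 8" "s \<notin> U" "t \<notin> U" for s t e
  proof -
    have eI: "e \<in> {\<theta>..\<theta> + 8}" using I by auto
    have "?f e \<in> closure (Q j)"
    proof (cases "e \<in> {\<theta><..<\<theta> + 8}")
      case True then show ?thesis using I by (auto simp: U_def)
    next
      case False
      then have "e = \<theta> \<or> e = \<theta> + 8" using eI by auto
      then show ?thesis using \<theta>(3) \<theta>8 b(1) C_cl by auto
    qed
    moreover have "?f e \<in> closure ?O"
    proof -
      have "closure {s<..<t} = {s..t}" using I by simp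
      moreover have "{s..t} \<subseteq> {\<theta>..\<theta> + 8}" using I by auto
      ultimately have "continuous_on (closure {s<..<t}) ?f" using cf continuous_on_subset by metis
      then have "?f ` closure {s<..<t} \<subseteq> closure ?O"
      proof (rule image_closure_subset)
        have "{s<..<t} \<subseteq> U" using in_components_subset[OF I(1)] .
        then have "?f ` {s<..<t} \<subseteq> ?O" unfolding U_def by auto
        then show "?f ` {s<..<t} \<subseteq> closure ?O" using closure_subset[of ?O] by (meson order_trans)
      qed simp
      moreover have "e \<in> closure {s<..<t}" using I \<open>closure {s<..<t} = {s..t}\<close> by auto
      ultimately show ?thesis by blast
    qed
    moreover have "Q j \<inter> closure ?O = {}"
      using open_Int_closure_eq_empty[OF open_Q[of j], of ?O] closure_subset[of "Q j"] by blast
    ultimately show ?thesis by (auto simp: frontier_Q_eq)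
  qed
  have "\<exists>I\<in>components U. \<not> connected_component (- (?C \<union> ?f ` I)) x0 w"
  proof (rule ccontr)
    assume "\<not> ?thesis"
    then have all: "connected_component (- (?C \<union> ?f ` I)) x0 w" if "I \<in> components U" for I using that by blast
    have Iends: "\<exists>s t. I = {s<..<t} \<and> \<theta> \<le> s \<and> s < t \<and> t \<le> \<theta> + 8 \<and> ?f s \<in> ?C \<and> ?f t \<in> ?C" if I: "I \<in> components U" for I
    proof -
      obtain s t where "I = {s<..<t}" "\<theta> \<le> s" "s < t" "t \<le> \<theta> + 8" "s \<notin> U" "t \<notin> U"
        by (rule ends_of_component[OF \<open>open U\<close> Usub I]) (rule that)
      then show ?thesis using endb[of s t] I by blast
    qed
    have comp: "compact (?C \<union> ?f ` I)" if I: "I \<in> components U" for I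
    proof -
      obtain s t where st: "I = {s<..<t}" "\<theta> \<le> s" "s < t" "t \<le> \<theta> + 8" "?f s \<in> ?C" "?f t \<in> ?C" using Iends[OF I] by blast
      have "{s..t} = insert s (insert t {s<..<t})" using st by auto
      then have "?C \<union> ?f ` I = ?C \<union> ?f ` {s..t}" using st by auto
      moreover have "compact (?f ` {s..t})" using st by (intro compact_continuous_image continuous_on_subset[OF cf]) auto
      ultimately show ?thesis using compact_frontier_Q[of j] by auto
    qed
    have IO: "?f t \<in> ?O" "t \<in> {\<theta><..<\<theta> + 8}" if "I \<in> components U" "t \<in> I" for I t
      using in_components_subset[OF that(1)] that(2) by (auto simp: U_def)
    \<comment> \<open>Arcs are added one at a time. Distinct arcs share no point, by injectivity of
      the loop within a turn, so the two sets in Janiszewski's theorem meet exactly in the boundary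
      curve, which is connected.\<close>
    have fin: "connected_component (- (?C \<union> (\<Union>I\<in>F. ?f ` I))) x0 w \<and> compact (?C \<union> (\<Union>I\<in>F. ?f ` I))"
      if "finite F" "F \<subseteq> components U" for F
      using that
    proof (induction F rule: finite_induct)
      case empty
      have "connected_component (- ?C) x0 w"
        using connected_compl_closure_Q[of j] x0 w C_cl by (auto simp: connected_component_def intro!: exI[of _ ?O])
      then show ?case using compact_frontier_Q[of j] by simp
    next
      case (insert I F)
      let ?X = "?C \<union> ?f ` I" and ?T = "?C \<union> (\<Union>I\<in>F. ?f ` I)"
      have XT: "?X \<inter> ?T = ?C"
      proof -
        have "?f t \<notin> ?f ` J" if "t \<in> I" "J \<in> F" for t J
        proof
          assume "?f t \<in> ?f ` J"
          then obtain t' where t': "t' \<in> J" "?f t = ?f t'" by blast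
          have "t = t'" using inj[OF IO(2)[of I t] _ t'(2)] IO(2)[of J t'] that t' insert.prems by auto
          then have "I = J" using that t' insert.prems components_nonoverlap[of I U J] by auto
          then show False using that insert.hyps by blast
        qed
        then show ?thesis by auto
      qed
      have "connected_component (- (?X \<union> ?T)) x0 w"
      proof (rule Janiszewski)
        show "compact ?X" using comp insert.prems by auto
        show "closed ?T" using insert by (auto intro: compact_imp_closed)
        show "connected (?X \<inter> ?T)" unfolding XT by (rule connected_frontier_Q)
      qed (use all insert in auto)
      moreover have "?X \<union> ?T = ?C \<union> (\<Union>I\<in>insert I F. ?f ` I)" by blast
      moreover have "compact (?X \<union> ?T)"
        by (rule compact_Un) (use comp insert.prems in simp, use insert.IH insert.prems in simp)
      ultimately show ?case by simp
    qed
    have "path_connected ?O" by (rule connected_open_path_connected[OF _ connected_compl_closure_Q]) (simp add: open_Compl)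
    then obtain g where g: "path g" "path_image g \<subseteq> ?O" "pathstart g = x0" "pathfinish g = w"
      using x0 w unfolding path_connected_def by (metis ComplI DiffD2)
    let ?P = "path_image g"
    define K where "K = {\<theta>..\<theta> + 8} \<inter> ?f -` ?P"
    have "closed K" unfolding K_def using cf closed_path_image[OF g(1)] by (intro continuous_closed_preimage) auto
    then have cK: "compact K" by (auto simp: K_def compact_eq_bounded_closed intro: bounded_subset[of "{\<theta>..\<theta> + 8}"])
    have "K \<subseteq> U"
    proof
      fix t assume t: "t \<in> K"
      then have fO: "?f t \<in> ?O" using g(2) by (auto simp: K_def)
      then have "t \<noteq> \<theta>" "t \<noteq> \<theta> + 8" using \<theta>(3) \<theta>8 b(1) C_cl by auto
      then show "t \<in> U" using t fO by (auto simp: K_def U_def)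
    qed
    then have "K \<subseteq> \<Union>(components U)" by (simp add: Union_components[symmetric])
    then obtain F where F: "F \<subseteq> components U" "finite F" "K \<subseteq> \<Union>F"
      using compactE[OF cK, of "components U"] \<open>open U\<close> open_components by metis
    \<comment> \<open>\<open>?X\<close> collects finitely many arcs that cover all meetings of
      \<open>g\<close> with the square, \<open>?T\<close> the rest of the square; \<open>g\<close>
      itself shows that \<open>?T\<close> does not separate.\<close>
    let ?X = "?C \<union> (\<Union>I\<in>F. ?f ` I)" and ?T = "?C \<union> ?f ` ({\<theta>..\<theta> + 8} - \<Union>F)"
    have oF: "open (\<Union>F)" using F(1) \<open>open U\<close> open_components by blast
    have "compact ?T"
    proof -
      have "compact ({\<theta>..\<theta> + 8} - \<Union>F)" using oF by (intro compact_diff) auto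
      then have "compact (?f ` ({\<theta>..\<theta> + 8} - \<Union>F))" by (intro compact_continuous_image continuous_on_subset[OF cf]) auto
      then show ?thesis using compact_frontier_Q[of j] by (rule compact_Un[rotated])
    qed
    have XT: "?X \<inter> ?T = ?C"
    proof -
      have "?f t \<notin> ?f ` ({\<theta>..\<theta> + 8} - \<Union>F)" if "I \<in> F" "t \<in> I" for I t
      proof
        assume "?f t \<in> ?f ` ({\<theta>..\<theta> + 8} - \<Union>F)"
        then obtain t' where t': "t' \<in> {\<theta>..\<theta> + 8}" "t' \<notin> \<Union>F" "?f t = ?f t'" by blast
        have "t = t'" using inj[OF IO(2)[of I t] t'(1,3)] that F by blast
        then show False using t' that by blast
      qed
      then show ?thesis by auto
    qed
    have "connected_component (- (?X \<union> ?T)) x0 w"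
    proof (rule Janiszewski)
      show "compact ?X" "connected_component (- ?X) x0 w" using fin[OF F(2,1)] by auto
      show "closed ?T" using \<open>compact ?T\<close> by (rule compact_imp_closed)
      show "connected (?X \<inter> ?T)" unfolding XT by (rule connected_frontier_Q)
      have "z \<notin> ?T" if z: "z \<in> ?P" for z
      proof
        assume "z \<in> ?T"
        then have "z \<in> ?f ` ({\<theta>..\<theta> + 8} - \<Union>F)" using z g(2) C_cl by blast
        then obtain t where t: "t \<in> {\<theta>..\<theta> + 8}" "t \<notin> \<Union>F" "z = ?f t" by blast
        then have "t \<in> K" using z by (auto simp: K_def)
        then show False using t F by blast
      qed
      then have "?P \<subseteq> - ?T" by blast
      then show "connected_component (- ?T) x0 w"
        unfolding connected_component_def using g connected_path_image[OF g(1)]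
        by (intro exI[of _ ?P]) (auto simp: pathstart_in_path_image[of g, unfolded g(3)] pathfinish_in_path_image[of g, unfolded g(4)])
    qed
    then obtain Y where Y: "connected Y" "Y \<subseteq> - (?X \<union> ?T)" "x0 \<in> Y" "w \<in> Y" unfolding connected_component_def by blast
    \<comment> \<open>A connected set joining the inside of the square to the outside crosses it,
      although every point of the square belongs to \<open>?X\<close> or \<open>?T\<close>.\<close>
    obtain z where z: "z \<in> Y" "z \<in> sqs p r"
      by (rule connected_meets_sqs[OF Y(1,3,4), of p r]) (use x0 w in \<open>auto simp: sqb_def\<close>)
    obtain t where t: "0 \<le> t" "t \<le> 8" "?f t = z" using loop_surj[OF r z(2)] by blast
    obtain t' where t': "t' \<in> {\<theta>..\<theta> + 8}" "?f t' = z"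
    proof (cases "\<theta> \<le> t")
      case True then show ?thesis using t \<theta> that[of t] by auto
    next
      case False then show ?thesis using t \<theta> that[of "t + 8"] loop_periodic[OF t(1)] by auto
    qed
    have "z \<in> ?X \<union> ?T"
    proof (cases "t' \<in> \<Union>F")
      case True then show ?thesis using t' by blast
    next
      case False then show ?thesis using t' by blast
    qed
    then show False using Y z by blast
  qed
  then obtain I where I: "I \<in> components U" "\<not> connected_component (- (?C \<union> ?f ` I)) x0 w" by blast
  obtain s t where st: "I = {s<..<t}" "\<theta> \<le> s" "s < t" "t \<le> \<theta> + 8" "s \<notin> U" "t \<notin> U"
    by (rule ends_of_component[OF \<open>open U\<close> Usub I(1)]) (rule that)
  have e: "?f s \<in> ?C" "?f t \<in> ?C" using endb[of s t] I(1) st by blast+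
  have "{s..t} = insert s (insert t {s<..<t})" using st by auto
  then have CI: "?C \<union> ?f ` I = ?C \<union> ?f ` {s..t}" using st e by auto
  have IU: "I \<subseteq> U" using in_components_subset[OF I(1)] .
  have "?f ` {s<..<t} \<inter> closure (Q j) = {}" using IU st(1) unfolding U_def by auto
  then show ?thesis using that[of s t] st \<theta> e I(2)[unfolded CI] by auto
qed

text \<open>The component \<open>N\<close> cut off by the arc has points of the boundary curve in
  its frontier; these are carpet points at which \<open>u\<close> is not controlled. It is therefore
  enlarged across the curve into \<open>Q j\<close>, where a frontier meets no carpet point.\<close>

lemma crosscut_region:
  assumes p: "p \<in> frontier (Q j)" and \<eta>: "0 < \<eta>" and big: "\<not> frontier (Q j) \<subseteq> sqb p \<eta>"
  obtains \<delta> where "0 < \<delta>" "\<And>r. 0 < r \<Longrightarrow> r < \<delta> \<Longrightarrow> \<exists>V s t d. open V \<and> 0 \<le> s \<and> s \<le> t \<and> t \<le> 16 \<and>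
     loop p r ` {s..t} \<inter> Q j = {} \<and> frontier V - Q j \<subseteq> loop p r ` {s..t} \<and>
     0 < d \<and> sqb p d - closure (Q j) \<subseteq> V \<and> V \<subseteq> sqb p \<eta> \<union> closure (Q j)"
proof -
  let ?C = "frontier (Q j)" and ?O = "- closure (Q j)"
  have C_cl: "?C \<subseteq> closure (Q j)" by (auto simp: frontier_def)
  have oO: "open ?O" by (simp add: open_Compl)
  obtain A B where AB: "compact A" "connected A" "compact B" "connected B" "?C = A \<union> B" "p \<in> A" "p \<notin> B" "A \<subseteq> sqb p \<eta>"
    by (rule small_boundary_arc[OF p \<eta>]) (rule that)
  have "open (- B)" using AB(3) compact_imp_closed by blast
  then obtain e where e: "0 < e" "ball p e \<subseteq> - B" using AB(7) open_contains_ball by (metis ComplI)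
  \<comment> \<open>Squares of smaller radius avoid the far arc \<open>B\<close> and so meet the
    curve only in the near arc \<open>A\<close>.\<close>
  define \<delta> where "\<delta> = min \<eta> (e / 2)"
  have \<delta>: "0 < \<delta>" "\<delta> \<le> \<eta>" "sqb p \<delta> \<inter> B = {}"
  proof -
    have "sqb p \<delta> \<subseteq> ball p e" by (rule order_trans[OF sqb_subset_ball]) (auto simp: \<delta>_def)
    then show "sqb p \<delta> \<inter> B = {}" using e by blast
  qed (use \<eta> e in \<open>auto simp: \<delta>_def\<close>)
  have "\<exists>V s t d. open V \<and> 0 \<le> s \<and> s \<le> t \<and> t \<le> 16 \<and>
     loop p r ` {s..t} \<inter> Q j = {} \<and> frontier V - Q j \<subseteq> loop p r ` {s..t} \<and>
     0 < d \<and> sqb p d - closure (Q j) \<subseteq> V \<and> V \<subseteq> sqb p \<eta> \<union> closure (Q j)" if r: "0 < r" "r < \<delta>" for r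
  proof -
    obtain d where d: "0 < d" "d \<le> r" "\<And>x y. x \<in> sqb p d - closure (Q j) \<Longrightarrow> y \<in> sqb p d - closure (Q j) \<Longrightarrow>
       connected_component (sqb p r - ?C) x y"
      by (rule locally_connected_outside[OF p r(1)]) (rule that)
    have "sqb p d \<inter> ?O \<noteq> {}"
      using frontier_subset_closure_outside[of j] p sqb_center[OF d(1), of p] open_Int_closure_eq_empty[OF open_sqb, of p d ?O] by blast
    then obtain x0 where x0: "x0 \<in> sqb p d - closure (Q j)" by blast
    have "bounded (sqb p \<eta> \<union> closure (Q j))" using bounded_sqb bounded_Q by (simp add: bounded_closure)
    then have "sqb p \<eta> \<union> closure (Q j) \<noteq> UNIV" using not_bounded_UNIV by metis
    then obtain w where w: "w \<notin> sqb p \<eta>" "w \<notin> closure (Q j)" by blast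
    have r\<eta>: "r < \<eta>" using r \<delta> by simp
    have sub: "sqb p d \<subseteq> sqb p r" "sqb p r \<subseteq> sqb p \<eta>" using d r\<eta> by (auto intro!: sqb_mono)
    obtain s t where st: "0 \<le> s" "s < t" "t \<le> 16" "loop p r ` {s<..<t} \<inter> closure (Q j) = {}"
      "loop p r s \<in> ?C" "loop p r t \<in> ?C" "\<not> connected_component (- (?C \<union> loop p r ` {s..t})) x0 w"
    proof (rule separating_arc[OF p r(1), of x0 w])
      show "\<not> ?C \<subseteq> sqb p r" using big sub by blast
      show "x0 \<in> sqb p r - closure (Q j)" using x0 sub by blast
      show "w \<notin> sqb p r" "w \<notin> closure (Q j)" using w sub by blast+
    qed (rule that)
    define \<alpha> where "\<alpha> = loop p r ` {s..t}"
    have "compact \<alpha>" unfolding \<alpha>_def using st by (intro compact_continuous_image continuous_on_subset[OF continuous_on_loop]) auto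
    then have cl\<alpha>: "closed \<alpha>" by (rule compact_imp_closed)
    have \<alpha>S: "\<alpha> \<subseteq> sqs p r" unfolding \<alpha>_def using loop_in_sqs r st by auto
    have sq_disj: "sqs p r \<inter> sqb p r = {}" "sqs p r \<subseteq> sqb p \<eta>" "sqs p r \<subseteq> sqb p \<delta>" using r\<eta> r by (auto simp: sqs_def sqb_def)
    have "{s..t} = insert s (insert t {s<..<t})" using st by auto
    then have \<alpha>_eq: "\<alpha> = insert (loop p r s) (insert (loop p r t) (loop p r ` {s<..<t}))" by (simp add: \<alpha>_def)
    have \<alpha>Q: "\<alpha> \<inter> Q j = {}"
      unfolding \<alpha>_eq using st(4,5,6) closure_subset[of "Q j"] by (auto simp: frontier_Q_eq)
    have C\<alpha>: "?C \<inter> \<alpha> \<subseteq> A" using \<alpha>S sq_disj(3) \<delta>(3) AB(5) by blast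
    let ?Y = "- (?C \<union> \<alpha>)"
    define N where "N = connected_component_set ?Y x0"
    have oY: "open ?Y" by (intro open_Compl closed_Un cl\<alpha> compact_imp_closed[OF compact_frontier_Q])
    have oN: "open N" unfolding N_def by (intro open_connected_component oY)
    have wN: "w \<notin> N" using st(7) by (simp add: N_def \<alpha>_def)
    have x0Y: "x0 \<in> ?Y" using x0 sub sq_disj(1) \<alpha>S C_cl by blast
    then have x0N: "x0 \<in> N" by (simp add: N_def)
    have NY: "N \<subseteq> ?Y" unfolding N_def by (rule connected_component_subset)
    have NO: "N \<subseteq> ?O"
    proof
      fix y assume y: "y \<in> N"
      show "y \<in> ?O"
      proof (rule ccontr)
        assume "y \<notin> ?O"
        then have yQ: "y \<in> Q j" using y NY by (auto simp: frontier_Q_eq)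
        have "connected N" by (simp add: N_def)
        then have "N \<inter> ?C \<noteq> {}"
          using y yQ x0N x0 closure_subset[of "Q j"] by (intro connected_Int_frontier) blast+
        then show False using NY by blast
      qed
    qed
    have comp_N: "y \<in> N" if "x \<in> N" "connected_component ?Y x y" for x y
      using that connected_component_trans unfolding N_def by (metis mem_Collect_eq)
    \<comment> \<open>The near arc and the cut both lie in \<open>sqb p \<eta>\<close>, so together
      they do not separate points outside this square. As they meet the curve in the connected set
      \<open>A\<close>, Janiszewski's theorem would join a point of \<open>N\<close> out there to
      \<open>w\<close>.\<close>
    have N\<eta>: "N \<subseteq> sqb p \<eta>"
    proof
      fix y assume y: "y \<in> N"
      show "y \<in> sqb p \<eta>"
      proof (rule ccontr)
        assume y\<eta>: "y \<notin> sqb p \<eta>"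
        let ?T = "A \<union> \<alpha>"
        have "connected_component (- (?C \<union> ?T)) y w"
        proof (rule Janiszewski)
          show "compact ?C" by (rule compact_frontier_Q)
          show "closed ?T" using AB(1) cl\<alpha> by (auto intro: compact_imp_closed)
          have "?C \<inter> ?T = A" using C\<alpha> AB(5) by blast
          then show "connected (?C \<inter> ?T)" using AB(2) by simp
          show "connected_component (- ?C) y w"
            using connected_compl_closure_Q[of j] y NO w C_cl by (auto simp: connected_component_def intro!: exI[of _ ?O])
          have "- sqb p \<eta> \<subseteq> - ?T" using AB(8) \<alpha>S sq_disj(2) by blast
          then show "connected_component (- ?T) y w"
            using connected_Compl_sqb[of p \<eta>] y\<eta> w by (auto simp: connected_component_def intro!: exI[of _ "- sqb p \<eta>"])
        qed
        moreover have "- (?C \<union> ?T) = ?Y" using AB(5) by blast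
        ultimately have "w \<in> N" using comp_N[OF y] by simp
        then show False using wN by simp
      qed
    qed
    \<comment> \<open>The rest of the exterior off the cut. Both \<open>N\<close> and
      \<open>N'\<close> are open, hence neither meets the closure of the other.\<close>
    define N' where "N' = (?O - \<alpha>) - N"
    have wN': "w \<in> N'" using w wN \<alpha>S sq_disj(2) by (auto simp: N'_def)
    have oN': "open N'"
      unfolding open_contains_ball
    proof
      fix y assume y: "y \<in> N'"
      have "open (?O - \<alpha>)" using oO cl\<alpha> by blast
      moreover have "y \<in> ?O - \<alpha>" using y by (simp add: N'_def)
      ultimately obtain e where e: "0 < e" "ball y e \<subseteq> ?O - \<alpha>" using open_contains_ball by metis
      have eY: "ball y e \<subseteq> ?Y" using e(2) C_cl by blast
      have "z \<notin> N" if z: "z \<in> ball y e" for z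
      proof
        assume zN: "z \<in> N"
        have "connected_component ?Y z y"
          using eY z e(1) by (auto simp: connected_component_def intro!: exI[of _ "ball y e"])
        then have "y \<in> N" using comp_N[OF zN] by blast
        then show False using y by (simp add: N'_def)
      qed
      then have "ball y e \<subseteq> N'" using e(2) by (auto simp: N'_def)
      then show "\<exists>e>0. ball y e \<subseteq> N'" using e(1) by blast
    qed
    have disjN: "N \<inter> N' = {}" by (auto simp: N'_def)
    have clN: "N \<inter> closure N' = {}" "N' \<inter> closure N = {}"
      using open_Int_closure_eq_empty[OF oN, of N'] open_Int_closure_eq_empty[OF oN', of N] disjN by auto
    have ne: "N \<noteq> {}" "N' \<noteq> {}" using x0N wN' by auto
    have inf0: "infdist x N = 0 \<longleftrightarrow> x \<in> closure N" "infdist x N' = 0 \<longleftrightarrow> x \<in> closure N'" for x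
      using in_closure_iff_infdist_zero[OF ne(1)] in_closure_iff_infdist_zero[OF ne(2)] by auto
    \<comment> \<open>The points closer to \<open>N\<close> than to \<open>N'\<close>. It contains
      \<open>N\<close>, misses \<open>N'\<close>, and on its frontier the two distances agree;
      inside \<open>Q j\<close> this chooses some continuation of the frontier.\<close>
    define V where "V = {x. infdist x N < infdist x N'}"
    have cinf: "continuous_on UNIV (\<lambda>x. infdist x X)" for X :: "complex set"
      by (intro continuous_intros)
    have oV: "open V" unfolding V_def by (intro open_Collect_less cinf)
    have NV: "N \<subseteq> V"
    proof
      fix y assume y: "y \<in> N"
      then have "infdist y N = 0" using closure_subset[of N] inf0 by blast
      moreover have "infdist y N' \<noteq> 0" using y clN inf0 by blast
      ultimately show "y \<in> V" using infdist_nonneg[of y N'] by (simp add: V_def less_le)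
    qed
    have "frontier V - Q j \<subseteq> \<alpha>"
    proof
      fix x assume x: "x \<in> frontier V - Q j"
      have "closed {x. infdist x N \<le> infdist x N'}" by (intro closed_Collect_le cinf)
      then have "closure V \<subseteq> {x. infdist x N \<le> infdist x N'}" by (intro closure_minimal) (auto simp: V_def)
      then have "infdist x N \<le> infdist x N'" using x by (auto simp: frontier_def)
      moreover have "x \<notin> V" using x oV by (auto simp: frontier_def interior_open)
      ultimately have eq: "infdist x N = infdist x N'" by (simp add: V_def)
      show "x \<in> \<alpha>"
      proof (rule ccontr)
        assume xa: "x \<notin> \<alpha>"
        show False
        proof (cases "x \<in> closure (Q j)")
          case False
          then have "x \<in> N \<or> x \<in> N'" using xa by (auto simp: N'_def)
          then have "x \<in> closure N \<and> x \<in> closure N'" using eq inf0 closure_subset[of N] closure_subset[of N'] by (metis subsetD)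
          then show False using \<open>x \<in> N \<or> x \<in> N'\<close> clN by blast
        next
          case True
          \<comment> \<open>On the curve off the cut both distances vanish. As the exterior is
            locally connected there, nearby points of \<open>N\<close> and \<open>N'\<close> would
            be joined without crossing the cut.\<close>
          then have xC: "x \<in> ?C" using x by (simp add: frontier_Q_eq)
          have "?O \<subseteq> N \<union> N' \<union> \<alpha>" by (auto simp: N'_def)
          then have "closure ?O \<subseteq> closure N \<union> closure N' \<union> \<alpha>"
            using closure_mono[of ?O "N \<union> N' \<union> \<alpha>"] cl\<alpha> by (simp add: closure_closed)
          moreover have "x \<in> closure ?O" using frontier_subset_closure_outside xC by blast
          ultimately have "x \<in> closure N \<or> x \<in> closure N'" using xa by blast
          then have both: "x \<in> closure N" "x \<in> closure N'" by (metis eq inf0)+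
          have "x \<in> - \<alpha>" "open (- \<alpha>)" using xa cl\<alpha> by (auto simp: open_Compl)
          then obtain e1 where e1: "0 < e1" "ball x e1 \<subseteq> - \<alpha>" using open_contains_ball by metis
          define e2 where "e2 = e1 / 2"
          have e2: "0 < e2" "sqb x e2 \<inter> \<alpha> = {}" using e1 sqb_subset_ball[of x e2] by (auto simp: e2_def)
          obtain d2 where d2: "0 < d2" "d2 \<le> e2" "\<And>a b. a \<in> sqb x d2 - closure (Q j) \<Longrightarrow> b \<in> sqb x d2 - closure (Q j) \<Longrightarrow>
             connected_component (sqb x e2 - ?C) a b"
            by (rule locally_connected_outside[OF xC e2(1)]) (rule that)
          have "sqb x d2 \<inter> N \<noteq> {}" "sqb x d2 \<inter> N' \<noteq> {}"
            using both sqb_center[OF d2(1), of x] open_Int_closure_eq_empty[OF open_sqb, of x d2] by blast+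
          then obtain n n' where n: "n \<in> sqb x d2" "n \<in> N" "n' \<in> sqb x d2" "n' \<in> N'" by blast
          have "connected_component (sqb x e2 - ?C) n n'"
            using n NO by (intro d2(3)) (auto simp: N'_def)
          moreover have "sqb x e2 - ?C \<subseteq> ?Y" using e2(2) by blast
          ultimately have "connected_component ?Y n n'" by (rule connected_component_trans_set)
          then have "n' \<in> N" using comp_N[OF n(2)] by blast
          then show False using n(4) disjN by blast
        qed
      qed
    qed
    moreover have "sqb p d - closure (Q j) \<subseteq> V"
    proof
      fix y assume y: "y \<in> sqb p d - closure (Q j)"
      have "connected_component (sqb p r - ?C) x0 y" by (rule d(3)[OF x0 y])
      moreover have "sqb p r - ?C \<subseteq> ?Y" using sq_disj(1) \<alpha>S by blast
      ultimately have "connected_component ?Y x0 y" by (rule connected_component_trans_set)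
      then show "y \<in> V" using comp_N[OF x0N] NV by blast
    qed
    moreover have "V \<subseteq> sqb p \<eta> \<union> closure (Q j)"
    proof
      fix y assume y: "y \<in> V"
      have "y \<notin> N'"
      proof
        assume "y \<in> N'"
        then have "infdist y N' = 0" using closure_subset[of N'] inf0 by blast
        then show False using y infdist_nonneg[of y N] by (simp add: V_def)
      qed
      then have "y \<in> N \<or> y \<in> \<alpha> \<or> y \<in> closure (Q j)" by (auto simp: N'_def)
      then show "y \<in> sqb p \<eta> \<union> closure (Q j)" using N\<eta> \<alpha>S sq_disj(2) by blast
    qed
    ultimately show ?thesis using oV st(1,2,3) d(1) \<alpha>Q unfolding \<alpha>_def
      by (intro exI[of _ V] exI[of _ s] exI[of _ t] exI[of _ d]) simp
  qed
  then show ?thesis using \<delta>(1) that by blast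
qed

lemma frontier_Q_other_point:
  obtains y where "y \<in> frontier (Q j)" "y \<noteq> p"
proof -
  obtain c where c: "simple_path c" "pathfinish c = pathstart c" "frontier (Q j) = path_image c"
    by (rule jordan_QE[of j]) (rule that)
  have "c 0 \<noteq> c (1 / 2)"
  proof
    assume "c 0 = c (1 / 2)"
    have "loop_free c" using c(1) by (simp add: simple_path_def)
    then have "c x = c y \<longrightarrow> x = y \<or> x = 0 \<and> y = 1 \<or> x = 1 \<and> y = 0" if "x \<in> {0..1}" "y \<in> {0..1}" for x y
      using that unfolding loop_free_def by blast
    from this[of 0 "1 / 2"] show False using \<open>c 0 = c (1 / 2)\<close> by simp
  qed
  moreover have "c 0 \<in> frontier (Q j)" "c (1 / 2) \<in> frontier (Q j)" using c(3) by (auto simp: path_image_def)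
  ultimately show ?thesis using that by (cases "c 0 = p") auto
qed

lemma disks_at_point:
  assumes "p \<in> S"
  shows "{i. p \<in> closure (Q i)} = {} \<or> (\<exists>j. p \<in> frontier (Q j) \<and> {i. p \<in> closure (Q i)} = {j})"
proof (cases "\<exists>j. p \<in> closure (Q j)")
  case True
  then obtain j where j: "p \<in> closure (Q j)" by blast
  have f: "p \<in> frontier (Q j)" using j S_not_Q[OF assms] by (simp add: frontier_Q_eq)
  have "p \<in> closure (Q i) \<longleftrightarrow> i = j" for i
  proof (cases "i = j")
    case False
    from disjoint_closures[OF False] show ?thesis using j False by blast
  qed (simp add: j)
  then have "{i. p \<in> closure (Q i)} = {j}" by simp
  with f show ?thesis by metis
next
  case False
  then show ?thesis by simp
qed

text \<open>One form for two cases: with no disk at \<open>p\<close> the open square itself serves,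
  with a full turn of the loop as arc; otherwise the crosscut region does.\<close>

lemma cut_region:
  assumes p: "p \<in> S" and \<eta>: "0 < \<eta>" and big: "\<And>j. p \<in> frontier (Q j) \<Longrightarrow> \<not> frontier (Q j) \<subseteq> sqb p \<eta>"
    and F: "F = {i. p \<in> closure (Q i)}"
  obtains \<delta> where "0 < \<delta>" "\<And>r. 0 < r \<Longrightarrow> r < \<delta> \<Longrightarrow> \<exists>V s t d. open V \<and> 0 \<le> s \<and> s \<le> t \<and> t \<le> 16 \<and>
     (\<forall>i\<in>F. loop p r ` {s..t} \<inter> Q i = {}) \<and> S \<inter> frontier V \<subseteq> loop p r ` {s..t} \<and>
     0 < d \<and> sqb p d - (\<Union>i\<in>F. closure (Q i)) \<subseteq> V \<and> V \<subseteq> sqb p \<eta> \<union> (\<Union>i\<in>F. closure (Q i))"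
  using disks_at_point[OF p]
proof (elim disjE exE conjE)
  assume e: "{i. p \<in> closure (Q i)} = {}"
  show ?thesis
  proof (rule that[OF \<eta>])
    fix r assume r: "0 < r" "r < \<eta>"
    have "frontier (sqb p r) \<subseteq> loop p r ` {0..8}"
    proof
      fix z assume z: "z \<in> frontier (sqb p r)"
      have "closed {z. sqn (z - p) \<le> r}" by (intro closed_Collect_le continuous_intros)
      then have "closure (sqb p r) \<subseteq> {z. sqn (z - p) \<le> r}" by (intro closure_minimal) (auto simp: sqb_def)
      then have "sqn (z - p) \<le> r" "z \<notin> sqb p r" using z by (auto simp: frontier_def interior_open open_sqb)
      then have "z \<in> sqs p r" by (simp add: sqs_def sqb_def)
      then obtain t where "0 \<le> t" "t \<le> 8" "loop p r t = z" using loop_surj[OF r(1)] by blast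
      then show "z \<in> loop p r ` {0..8}" by auto
    qed
    then show "\<exists>V s t d. open V \<and> 0 \<le> s \<and> s \<le> t \<and> t \<le> 16 \<and>
     (\<forall>i\<in>F. loop p r ` {s..t} \<inter> Q i = {}) \<and> S \<inter> frontier V \<subseteq> loop p r ` {s..t} \<and>
     0 < d \<and> sqb p d - (\<Union>i\<in>F. closure (Q i)) \<subseteq> V \<and> V \<subseteq> sqb p \<eta> \<union> (\<Union>i\<in>F. closure (Q i))"
      using r e F open_sqb[of p r] sqb_mono[of r \<eta> p]
      by (intro exI[of _ "sqb p r"] exI[of _ 0] exI[of _ 8] exI[of _ r]) auto
  qed
next
  fix j assume j: "p \<in> frontier (Q j)" "{i. p \<in> closure (Q i)} = {j}"
  obtain \<delta> where \<delta>: "0 < \<delta>" "\<And>r. 0 < r \<Longrightarrow> r < \<delta> \<Longrightarrow> \<exists>V s t d. open V \<and> 0 \<le> s \<and> s \<le> t \<and> t \<le> 16 \<and>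
     loop p r ` {s..t} \<inter> Q j = {} \<and> frontier V - Q j \<subseteq> loop p r ` {s..t} \<and>
     0 < d \<and> sqb p d - closure (Q j) \<subseteq> V \<and> V \<subseteq> sqb p \<eta> \<union> closure (Q j)"
    by (rule crosscut_region[OF j(1) \<eta> big[OF j(1)]]) (rule that)
  show ?thesis
  proof (rule that[OF \<delta>(1)])
    fix r assume r: "0 < r" "r < \<delta>"
    from \<delta>(2)[OF r] obtain V s t d where V: "open V" "0 \<le> s" "s \<le> t" "t \<le> 16" "loop p r ` {s..t} \<inter> Q j = {}" "frontier V - Q j \<subseteq> loop p r ` {s..t}"
     "0 < d" "sqb p d - closure (Q j) \<subseteq> V" "V \<subseteq> sqb p \<eta> \<union> closure (Q j)" by (elim exE conjE) (rule that)
    have "S \<inter> frontier V \<subseteq> frontier V - Q j" using S_not_Q by blast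
    then have "S \<inter> frontier V \<subseteq> loop p r ` {s..t}" using V(6) by (rule order_trans)
    then show "\<exists>V s t d. open V \<and> 0 \<le> s \<and> s \<le> t \<and> t \<le> 16 \<and>
     (\<forall>i\<in>F. loop p r ` {s..t} \<inter> Q i = {}) \<and> S \<inter> frontier V \<subseteq> loop p r ` {s..t} \<and>
     0 < d \<and> sqb p d - (\<Union>i\<in>F. closure (Q i)) \<subseteq> V \<and> V \<subseteq> sqb p \<eta> \<union> (\<Union>i\<in>F. closure (Q i))"
      using V j F by (intro exI[of _ V] exI[of _ s] exI[of _ t] exI[of _ d]) simp
  qed
qed

text \<open>Off \<open>F\<close>, a disk whose boundary curve meets the frontier of \<open>V\<close>
  has oscillation at most \<open>e\<close>, and the margin \<open>e\<close> keeps
  \<open>u <= a\<close> on that curve. So the test function can vary only on disks in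
  \<open>F\<close>, and the disk \<open>k\<close>, whose curve misses \<open>V\<close>, fixes its
  constant value as 0.\<close>

lemma cut_bound:
  assumes u: "tame v u" and V: "open V" "compactly_contained V \<Omega>" and F: "finite F"
    and K: "\<And>z. z \<in> S \<Longrightarrow> z \<in> frontier V \<Longrightarrow> u z \<le> a - e" and e: "0 \<le> e"
    and osc: "\<And>i z. i \<notin> F \<Longrightarrow> z \<in> frontier (Q i) \<Longrightarrow> z \<in> frontier V \<Longrightarrow> oscr Q u i \<le> e"
    and k: "k \<notin> F" "frontier (Q k) \<inter> V = {}" and i: "i \<notin> F" "x \<in> frontier (Q i)" "x \<in> V"
  shows "u x \<le> a"
proof -
  have us: "sobolev_real v \<Omega> Q u" using u by (simp add: tame_def)
  note bd = sobolev_realD(1)[OF us]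
  let ?\<psi> = "test u a V"
  have le: "u z \<le> a" if "z \<in> S" "z \<in> frontier V" for z using K[OF that] e by simp
  have z: "oscr Q ?\<psi> i = 0" if i: "i \<notin> F" for i
  proof (rule oscr_test_eq_0[OF u V le])
    show "frontier (Q i) \<subseteq> V \<or> (\<forall>y\<in>frontier (Q i) \<inter> V. u y \<le> a)"
    proof (rule disjCI, rule subsetI, rule ccontr)
      fix x assume no: "\<not> (\<forall>y\<in>frontier (Q i) \<inter> V. u y \<le> a)" and x: "x \<in> frontier (Q i)" "x \<notin> V"
      then obtain y where y: "y \<in> frontier (Q i)" "y \<in> V" "\<not> u y \<le> a" by blast
      obtain z where z: "z \<in> frontier (Q i)" "z \<in> frontier V" "z \<in> S" by (rule frontier_Q_crossing[OF y(1,2) x]) (rule that)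
      have "\<bar>u y - u z\<bar> \<le> e" using abs_diff_le_oscr[OF bd y(1) z(1)] osc[OF i z(1,2)] by simp
      then show False using K[OF z(3,2)] y(3) by linarith
    qed
  qed
  obtain y where y: "y \<in> frontier (Q k)" using frontier_Q_ne by blast
  have "?\<psi> x = ?\<psi> y"
    by (rule constant_on_disks[OF sobolev_real_test[OF us V(1) le] F z i(1) k(1) i(2) y])
  also have "\<dots> = 0" using y k(2) by (auto simp: test_def)
  finally show ?thesis using i(3) by (auto simp: test_def min_def max_def split: if_splits)
qed

section \<open>Continuity and the maximum principle\<close>

text \<open>The ball is taken so small that no disk of \<open>F\<close> fits into it.\<close>

lemma disk_near:
  assumes u: "tame v u" and x: "x \<in> S" and e: "0 < e" and F: "finite F"
  obtains m where "m \<notin> F" "closure (Q m) \<subseteq> cball x e" "\<And>y. y \<in> frontier (Q m) \<Longrightarrow> \<bar>u y - u x\<bar> < e"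
proof -
  obtain e1 where e1: "0 < e1" "\<And>i. i \<in> F \<Longrightarrow> x \<notin> closure (Q i) \<Longrightarrow> ball x e1 \<inter> closure (Q i) = {}"
      "\<And>i. i \<in> F \<Longrightarrow> \<not> Q i \<subseteq> ball x e1"
    by (rule finite_disks_near[OF F, of x]) (rule that)
  define e2 where "e2 = min e e1"
  have "0 < e2" using e e1(1) by (simp add: e2_def)
  then obtain j where j: "Q j \<subseteq> ball x e2" "\<forall>y\<in>frontier (Q j). \<bar>u y - u x\<bar> < e2"
    using u x unfolding tame_def by blast
  have "ball x e2 \<subseteq> ball x e1" "ball x e2 \<subseteq> cball x e" by (auto simp: e2_def)
  then have "j \<notin> F" "Q j \<subseteq> cball x e" using j(1) e1(3)[of j] by blast+
  moreover from this(2) have "closure (Q j) \<subseteq> cball x e" by (rule closure_minimal) simp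
  ultimately show ?thesis using that[of j] j(2) by (auto simp: e2_def)
qed

lemma tame_continuous:
  assumes u: "tame v u" and p: "p \<in> S" and e: "0 < e"
  obtains d where "0 < d" "\<And>y. y \<in> S \<Longrightarrow> dist p y < d \<Longrightarrow> \<bar>u y - u p\<bar> < e"
proof -
  have us: "sobolev_real v \<Omega> Q u" using u by (simp add: tame_def)
  note bd = sobolev_realD(1)[OF us]
  \<comment> \<open>\<open>u\<close> will be within \<open>e1\<close> of some \<open>c\<close> on
    the frontier of the region, within \<open>2 * e1\<close> on boundary curves inside it and within
    \<open>3 * e1\<close> at nearby carpet points. Two such errors add up to less than
    \<open>e\<close>.\<close>
  define e1 where "e1 = e / 8"
  have e1: "0 < e1" using e by (simp add: e1_def)
  define F where "F = {i. p \<in> closure (Q i)}"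
  have finF: "finite F" using disks_at_point[OF p] by (auto simp: F_def)
  have p\<Omega>: "p \<in> \<Omega>" using p S_subset by blast
  obtain k where k: "k \<notin> F"
  proof -
    have "F \<noteq> UNIV" using finF by auto
    then show ?thesis using that by blast
  qed
  obtain r1 where r1: "0 < r1" "compactly_contained (ball p r1) \<Omega>" "cball p r1 \<subseteq> \<Omega>" using ball_at p\<Omega> by blast
  \<comment> \<open>Only finitely many disks near \<open>p\<close> have a large oscillation. Except
    for a disk at \<open>p\<close> itself, they and the comparison disk \<open>k\<close> are kept
    away from the square \<open>sqb p \<eta>\<close>.\<close>
  define G where "G = {i \<in> meeting Q (ball p r1). (ennreal e1)\<^sup>2 \<le> (ennreal (oscr Q u i))\<^sup>2}"
  have "finite G" unfolding G_def
    by (rule finite_ge_of_infsum_less_top[OF sobolev_realD(2)[OF us r1(1,2)]]) (use e1 in \<open>simp add: ennreal_power\<close>)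
  then have fin: "finite (insert k G)" by simp
  obtain r2 where r2: "0 < r2" "\<And>i. i \<in> insert k G \<Longrightarrow> p \<notin> closure (Q i) \<Longrightarrow> ball p r2 \<inter> closure (Q i) = {}"
    by (rule finite_disks_near[OF fin, of p]) (rule that)
  have "\<exists>r3>0. \<forall>j. p \<in> frontier (Q j) \<longrightarrow> \<not> frontier (Q j) \<subseteq> ball p r3"
  proof (cases "\<exists>j. p \<in> frontier (Q j)")
    case True
    then obtain j where j: "p \<in> frontier (Q j)" by blast
    obtain y where y: "y \<in> frontier (Q j)" "y \<noteq> p" by (rule frontier_Q_other_point) (rule that)
    have "\<not> frontier (Q j) \<subseteq> ball p (dist p y)" using y by auto
    moreover have "i = j" if "p \<in> frontier (Q i)" for i using frontier_Q_unique[OF that j] .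
    ultimately show ?thesis using y by (intro exI[of _ "dist p y"]) auto
  qed (auto intro: exI[of _ 1])
  then obtain r3 where r3: "0 < r3" "\<And>j. p \<in> frontier (Q j) \<Longrightarrow> \<not> frontier (Q j) \<subseteq> ball p r3" by blast
  define \<eta> where "\<eta> = min r1 (min r2 r3) / 4"
  have \<eta>: "0 < \<eta>" "4 * \<eta> \<le> r1" "4 * \<eta> \<le> r2" "4 * \<eta> \<le> r3" using r1 r2 r3 by (auto simp: \<eta>_def)
  have \<eta>sub: "sqb p \<eta> \<subseteq> ball p r1" "sqb p \<eta> \<subseteq> ball p r2" "sqb p \<eta> \<subseteq> ball p r3" "sqb p \<eta> \<subseteq> cball p (2 * \<eta>)"
    using sqb_subset_ball[of p \<eta>] \<eta> by (auto simp: subset_iff)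
  have big: "\<not> frontier (Q j) \<subseteq> sqb p \<eta>" if "p \<in> frontier (Q j)" for j using r3(2)[OF that] \<eta>sub by blast
  obtain \<delta> where \<delta>: "0 < \<delta>" "\<And>r. 0 < r \<Longrightarrow> r < \<delta> \<Longrightarrow> \<exists>V s t d. open V \<and> 0 \<le> s \<and> s \<le> t \<and> t \<le> 16 \<and>
     (\<forall>i\<in>F. loop p r ` {s..t} \<inter> Q i = {}) \<and> S \<inter> frontier V \<subseteq> loop p r ` {s..t} \<and>
     0 < d \<and> sqb p d - (\<Union>i\<in>F. closure (Q i)) \<subseteq> V \<and> V \<subseteq> sqb p \<eta> \<union> (\<Union>i\<in>F. closure (Q i))"
    by (rule cut_region[OF p \<eta>(1) big F_def]) (assumption, rule that)
  have R: "0 < min \<delta> \<eta>" using \<delta> \<eta> by simp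
  have AT: "AE r in lborel. True" by simp
  obtain r where r: "0 < r" "r < min \<delta> \<eta>"
    "\<And>s t. 0 \<le> s \<Longrightarrow> s \<le> t \<Longrightarrow> t \<le> 16 \<Longrightarrow> loop p r s \<in> S \<Longrightarrow> loop p r t \<in> S \<Longrightarrow>
       ennreal \<bar>u (loop p r s) - u (loop p r t)\<bar> \<le> (\<Sum>\<^sub>\<infinity>i\<in>meeting Q (loop p r ` {s..t}). ennreal (oscr Q u i))"
    "(\<Sum>\<^sub>\<infinity>i\<in>{i. p \<notin> closure (Q i)} \<inter> meeting Q (sqs p r). ennreal (oscr Q u i)) < ennreal e1"
    by (rule good_radius[OF us p\<Omega> R e1 AT]) (rule that)
  have "r < \<delta>" "r < \<eta>" using r(2) by auto
  from \<delta>(2)[OF r(1) \<open>r < \<delta>\<close>] obtain V s t d where V: "open V" and st: "0 \<le> s" "s \<le> t" "t \<le> 16"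
     and LF: "\<forall>i\<in>F. loop p r ` {s..t} \<inter> Q i = {}" and Vf: "S \<inter> frontier V \<subseteq> loop p r ` {s..t}"
     and d: "0 < d" "sqb p d - (\<Union>i\<in>F. closure (Q i)) \<subseteq> V" and Vs: "V \<subseteq> sqb p \<eta> \<union> (\<Union>i\<in>F. closure (Q i))"
    by (elim exE conjE) (rule that)
  have VO: "compactly_contained V \<Omega>"
  proof -
    let ?X = "cball p (2 * \<eta>) \<union> (\<Union>i\<in>F. closure (Q i))"
    have "compact ?X" using finF compact_closure_Q by (intro compact_Un compact_UN) auto
    moreover have "V \<subseteq> ?X" using Vs \<eta>sub(4) by blast
    ultimately have c: "closure V \<subseteq> ?X" by (intro closure_minimal compact_imp_closed)
    have "cball p (2 * \<eta>) \<subseteq> cball p r1" using \<eta> by auto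
    then have "?X \<subseteq> \<Omega>" using r1(3) closure_Q_subset by blast
    moreover have "compact (closure V)"
      using bounded_subset[OF compact_imp_bounded[OF \<open>compact ?X\<close>] \<open>V \<subseteq> ?X\<close>] by (simp add: compact_closure)
    ultimately show ?thesis using c by (auto simp: compactly_contained_def)
  qed
  have close: "\<bar>u x - u y\<bar> < e1" if xy: "x \<in> S \<inter> loop p r ` {s..t}" "y \<in> S \<inter> loop p r ` {s..t}" for x y
  proof -
    have *: "\<bar>u (loop p r a) - u (loop p r b)\<bar> < e1" if ab: "s \<le> a" "a \<le> b" "b \<le> t" "loop p r a \<in> S" "loop p r b \<in> S" for a b
    proof -
      have sub: "loop p r ` {a..b} \<subseteq> loop p r ` {s..t}" using ab by (intro image_mono) auto
      have "loop p r ` {s..t} \<subseteq> sqs p r" using loop_in_sqs r(1) st by auto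
      have "ennreal \<bar>u (loop p r a) - u (loop p r b)\<bar> \<le> (\<Sum>\<^sub>\<infinity>i\<in>meeting Q (loop p r ` {a..b}). ennreal (oscr Q u i))"
        using ab st by (intro r(3)) auto
      also have "\<dots> \<le> (\<Sum>\<^sub>\<infinity>i\<in>{i. p \<notin> closure (Q i)} \<inter> meeting Q (sqs p r). ennreal (oscr Q u i))"
      proof (rule infsum_ennreal_mono)
        show "meeting Q (loop p r ` {a..b}) \<subseteq> {i. p \<notin> closure (Q i)} \<inter> meeting Q (sqs p r)"
        proof
          fix i assume i: "i \<in> meeting Q (loop p r ` {a..b})"
          then have i': "i \<in> meeting Q (loop p r ` {s..t})" using meeting_mono[OF sub, of Q] by blast
          then have "i \<notin> F" using LF by (auto simp: meeting_def)
          then show "i \<in> {i. p \<notin> closure (Q i)} \<inter> meeting Q (sqs p r)"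
            using i' meeting_mono[OF \<open>loop p r ` {s..t} \<subseteq> sqs p r\<close>, of Q] by (auto simp: F_def)
        qed
      qed simp
      also have "\<dots> < ennreal e1" by (rule r(4))
      finally show ?thesis by (simp add: ennreal_less_iff)
    qed
    obtain a b where "a \<in> {s..t}" "b \<in> {s..t}" "x = loop p r a" "y = loop p r b" using xy by auto
    then show ?thesis using *[of a b] *[of b a] xy by (cases "a \<le> b") (auto simp: abs_minus_commute)
  qed
  \<comment> \<open>If the arc contains no carpet point, the bound is vacuous and any
    \<open>c\<close> will do; otherwise \<open>c\<close> is the value at one of its carpet
    points.\<close>
  obtain c where c: "\<And>z. z \<in> S \<Longrightarrow> z \<in> frontier V \<Longrightarrow> \<bar>u z - c\<bar> \<le> e1"
  proof (cases "S \<inter> loop p r ` {s..t} = {}")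
    case True
    then show ?thesis using Vf by (intro that[of 0]) blast
  next
    case False
    then obtain z0 where "z0 \<in> S \<inter> loop p r ` {s..t}" by blast
    then show ?thesis using Vf close by (intro that[of "u z0"]) (meson IntI less_imp_le subsetD)
  qed
  have kV: "frontier (Q k) \<inter> V = {}"
  proof -
    have "p \<notin> closure (Q k)" using k by (simp add: F_def)
    then have "ball p r2 \<inter> closure (Q k) = {}" using r2(2) by blast
    moreover have "closure (Q k) \<inter> closure (Q i) = {}" if "i \<in> F" for i using that k by (intro disjoint_closures) auto
    then have "closure (Q k) \<inter> (\<Union>i\<in>F. closure (Q i)) = {}" by blast
    ultimately have kk: "ball p r2 \<inter> closure (Q k) = {}" "closure (Q k) \<inter> (\<Union>i\<in>F. closure (Q i)) = {}" by simp_all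
    have "z \<notin> V" if z: "z \<in> closure (Q k)" for z
    proof
      assume "z \<in> V"
      then have "z \<in> sqb p \<eta> \<union> (\<Union>i\<in>F. closure (Q i))" by (rule subsetD[OF Vs])
      then show False
      proof
        assume "z \<in> sqb p \<eta>"
        then have "z \<in> ball p r2" by (rule subsetD[OF \<eta>sub(2)])
        then show False using kk(1) z by (meson disjoint_iff)
      next
        assume "z \<in> (\<Union>i\<in>F. closure (Q i))"
        then show False using kk(2) z by (meson disjoint_iff)
      qed
    qed
    then have "closure (Q k) \<inter> V = {}" by (meson disjoint_iff)
    then show ?thesis unfolding frontier_def by (meson Diff_iff disjoint_iff)
  qed
  have small: "oscr Q u i \<le> e1" if i: "i \<notin> F" and z: "z \<in> frontier (Q i)" "z \<in> frontier V" for i z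
  proof (rule ccontr)
    assume no: "\<not> oscr Q u i \<le> e1"
    have "z \<in> S" using z frontier_Q_subset_S by blast
    then have "z \<in> sqs p r" using Vf z(2) loop_in_sqs[of r _ p] r(1) st by (auto simp: subset_iff)
    then have "z \<in> sqb p \<eta>" using \<open>r < \<eta>\<close> by (simp add: sqs_def sqb_def)
    then have zb: "z \<in> ball p r1" "z \<in> ball p r2" using \<eta>sub by blast+
    have zc: "z \<in> closure (Q i)" using z by (simp add: frontier_def)
    then have "ball p r1 \<inter> Q i \<noteq> {}" using zb open_Int_closure_eq_empty[OF open_ball, of p r1 "Q i"] by blast
    then have "i \<in> meeting Q (ball p r1)" by (auto simp: meeting_def)
    moreover have "(ennreal e1)\<^sup>2 \<le> (ennreal (oscr Q u i))\<^sup>2" using no by (intro power_mono ennreal_leI) auto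
    ultimately have "i \<in> G" by (simp add: G_def)
    then have "ball p r2 \<inter> closure (Q i) = {}" using i r2(2)[of i] by (simp add: F_def)
    then show False using zb zc by blast
  qed
  have bounds: "\<bar>u x - c\<bar> \<le> 2 * e1" if x: "x \<in> frontier (Q i)" "i \<notin> F" "x \<in> V" for x i
  proof -
    have "u x \<le> c + 2 * e1"
    proof (rule cut_bound[OF u V VO finF, of "c + 2 * e1" e1])
      show "u z \<le> c + 2 * e1 - e1" if "z \<in> S" "z \<in> frontier V" for z using c[OF that] by linarith
    qed (use e1 small k kV x in auto)
    moreover have "- u x \<le> - c + 2 * e1"
    proof (rule cut_bound[OF tame_uminus[OF u] V VO finF, of "- c + 2 * e1" e1])
      show "- u z \<le> - c + 2 * e1 - e1" if "z \<in> S" "z \<in> frontier V" for z using c[OF that] by linarith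
      show "oscr Q (\<lambda>x. - u x) i \<le> e1" if "i \<notin> F" "z \<in> frontier (Q i)" "z \<in> frontier V" for i z
        using small[OF that] by (simp add: oscr_uminus)
    qed (use e1 k kV x in auto)
    ultimately show ?thesis by linarith
  qed
  have near: "\<bar>u y - c\<bar> < 3 * e1" if y: "y \<in> S" "y \<in> sqb p d" for y
  proof -
    obtain e2 where e2: "0 < e2" "ball y e2 \<subseteq> sqb p d" using y(2) open_sqb open_contains_ball by metis
    have e3: "0 < min (e2 / 2) e1" using e2 e1 by simp
    obtain m where m: "m \<notin> F" "closure (Q m) \<subseteq> cball y (min (e2 / 2) e1)" "\<And>x. x \<in> frontier (Q m) \<Longrightarrow> \<bar>u x - u y\<bar> < min (e2 / 2) e1"
      by (rule disk_near[OF u y(1) e3 finF]) (rule that)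
    obtain x where x: "x \<in> frontier (Q m)" using frontier_Q_ne by blast
    have xc: "x \<in> closure (Q m)" using x by (simp add: frontier_def)
    have "cball y (min (e2 / 2) e1) \<subseteq> ball y e2" using e2(1) by auto
    then have "x \<in> sqb p d" using xc m(2) e2(2) by blast
    moreover have "x \<notin> closure (Q i)" if "i \<in> F" for i using disjoint_closures[of m i] that m(1) xc by blast
    ultimately have "x \<in> V" using d(2) by blast
    then have "\<bar>u x - c\<bar> \<le> 2 * e1" using bounds x m(1) by blast
    then show ?thesis using m(3)[OF x] by linarith
  qed
  show ?thesis
  proof (rule that[OF d(1)])
    fix y assume y: "y \<in> S" "dist p y < d"
    then have "y \<in> sqb p d" using ball_subset_sqb[of p d] by auto
    then have "\<bar>u y - c\<bar> < 3 * e1" using near y(1) by blast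
    moreover have "\<bar>u p - c\<bar> < 3 * e1" using near[OF p sqb_center[OF d(1)]] .
    ultimately show "\<bar>u y - u p\<bar> < e" using e unfolding e1_def by linarith
  qed
qed

text \<open>Otherwise finitely many disks cover the frontier of \<open>V\<close>, and since their
  boundary curves lie in \<open>V\<close>, the union of \<open>V\<close> with them is open and
  compact. The carpet point off \<open>V\<close> will be a place where the test function
  vanishes.\<close>

lemma S_not_subset_relatively_compact:
  assumes V: "open V" "compactly_contained V \<Omega>" and ne: "V \<noteq> {}"
  obtains y where "y \<in> S" "y \<notin> V"
proof (rule ccontr)
  assume "\<not> thesis"
  then have SV: "S \<subseteq> V" using that by blast
  have cf: "compact (frontier V)" "frontier V \<subseteq> \<Omega>"
    using V by (auto simp: compactly_contained_def frontier_def compact_diff)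
  have "frontier V \<subseteq> (\<Union>i. Q i)"
  proof
    fix z assume z: "z \<in> frontier V"
    then have "z \<in> \<Omega>" "z \<notin> S" using cf(2) SV V(1) by (auto simp: frontier_def interior_open)
    then show "z \<in> (\<Union>i. Q i)" using S_or_Q by blast
  qed
  then obtain G where G: "finite G" "frontier V \<subseteq> (\<Union>i\<in>G. Q i)"
    using compactE_image[OF cf(1), of UNIV Q] open_Q by metis
  let ?Y = "closure V \<union> (\<Union>i\<in>G. closure (Q i))"
  have "compact ?Y" using V(2) G(1) compact_closure_Q by (intro compact_Un compact_UN) (auto simp: compactly_contained_def)
  have "?Y = V \<union> (\<Union>i\<in>G. Q i)"
  proof
    show "?Y \<subseteq> V \<union> (\<Union>i\<in>G. Q i)"
    proof
      fix y assume "y \<in> ?Y"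
      then consider "y \<in> closure V" | i where "i \<in> G" "y \<in> closure (Q i)" by blast
      then show "y \<in> V \<union> (\<Union>i\<in>G. Q i)"
      proof cases
        case 1
        then show ?thesis using G(2) V(1) by (auto simp: frontier_def interior_open)
      next
        case 2
        then show ?thesis using frontier_Q_subset_S[of i] SV by (auto simp: frontier_Q_eq)
      qed
    qed
    show "V \<union> (\<Union>i\<in>G. Q i) \<subseteq> ?Y" using closure_subset[of V] closure_subset[of "Q _"] by blast
  qed
  moreover have "open (V \<union> (\<Union>i\<in>G. Q i))" by (intro open_Un open_UN V(1) ballI open_Q)
  ultimately have "open ?Y" by (simp only:)
  moreover have "closed ?Y" using \<open>compact ?Y\<close> by (rule compact_imp_closed)
  ultimately have "?Y = {} \<or> ?Y = UNIV" using clopen[of ?Y] by metis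
  moreover have "?Y \<noteq> UNIV" using \<open>compact ?Y\<close> not_compact_UNIV by metis
  ultimately show False using ne by simp
qed

text \<open>By continuity of \<open>u\<close> only finitely many peripheral disks can obstruct the constancy of the test function.\<close>

lemma tame_maximum_principle:
  assumes u: "tame v u" and V: "open V" "compactly_contained V \<Omega>"
    and x: "x \<in> S" "x \<in> V" and lt: "a < u x" and bdV: "\<And>z. z \<in> S \<Longrightarrow> z \<in> frontier V \<Longrightarrow> u z < a"
  shows False
proof -
  have us: "sobolev_real v \<Omega> Q u" using u by (simp add: tame_def)
  let ?\<psi> = "test u a V" and ?K = "frontier V \<inter> S"
  have le: "u z \<le> a" if "z \<in> S" "z \<in> frontier V" for z using bdV[OF that] by simp
  have cK: "compact ?K"
  proof (rule compact_Int_S)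
    show "compact (frontier V)" "frontier V \<subseteq> \<Omega>" using V by (auto simp: compactly_contained_def frontier_def compact_diff)
  qed
  \<comment> \<open>Continuity and compactness give a uniform distance within which
    \<open>u < a\<close> at carpet points near the frontier.\<close>
  have "\<exists>d>0. \<forall>z\<in>?K. \<forall>y\<in>S. dist z y < d \<longrightarrow> u y < a"
  proof -
    have "\<exists>d>0. \<forall>y\<in>S. dist z y < d \<longrightarrow> u y < a" if z: "z \<in> ?K" for z
    proof -
      have zS: "z \<in> S" and e: "0 < a - u z" using z bdV[of z] by auto
      obtain d where d: "0 < d" "\<And>y. y \<in> S \<Longrightarrow> dist z y < d \<Longrightarrow> \<bar>u y - u z\<bar> < a - u z"
        by (rule tame_continuous[OF u zS e]) (rule that)
      have "u y < a" if "y \<in> S" "dist z y < d" for y using d(2)[OF that] by linarith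
      then show ?thesis using d(1) by blast
    qed
    then obtain d where d: "\<And>z. z \<in> ?K \<Longrightarrow> 0 < d z" "\<And>z y. z \<in> ?K \<Longrightarrow> y \<in> S \<Longrightarrow> dist z y < d z \<Longrightarrow> u y < a" by metis
    obtain X where X: "finite X" "X \<subseteq> ?K" "?K \<subseteq> (\<Union>z\<in>X. ball z (d z / 2))"
      by (rule compactE_image[OF cK, of ?K "\<lambda>z. ball z (d z / 2)"]) (use d(1) in force, use d(1) in force, rule that)
    define \<delta> where "\<delta> = Min (insert 1 ((\<lambda>z. d z / 2) ` X))"
    have "0 < \<delta>" unfolding \<delta>_def using X(1,2) d(1) by (subst Min_gr_iff) auto
    moreover have "u y < a" if z: "z \<in> ?K" and y: "y \<in> S" "dist z y < \<delta>" for z y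
    proof -
      obtain z' where z': "z' \<in> X" "dist z' z < d z' / 2" using X(3) z by auto
      have "\<delta> \<le> d z' / 2" unfolding \<delta>_def using X(1) z'(1) by (intro Min_le) auto
      then have "dist z' y < d z'" using dist_triangle[of z' y z] z' y by linarith
      then show ?thesis using d(2)[of z' y] X(2) z'(1) y(1) by blast
    qed
    ultimately show ?thesis by blast
  qed
  then obtain \<delta> where \<delta>: "0 < \<delta>" "\<And>z y. z \<in> ?K \<Longrightarrow> y \<in> S \<Longrightarrow> dist z y < \<delta> \<Longrightarrow> u y < a" by blast
  \<comment> \<open>A disk that touches \<open>?K\<close> and is smaller than
    \<open>\<delta>\<close> has \<open>u < a\<close> on its whole boundary curve. Only the larger
    ones can be exceptional.\<close>
  define B where "B = {i. closure (Q i) \<inter> ?K \<noteq> {} \<and> \<delta> \<le> diameter (Q i)}"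
  have finB: "finite B" unfolding B_def by (rule finite_disks_meeting_compact[OF cK \<delta>(1)])
  have z: "oscr Q ?\<psi> i = 0" if i: "i \<notin> B" for i
  proof (rule oscr_test_eq_0[OF u V le])
    show "frontier (Q i) \<subseteq> V \<or> (\<forall>y\<in>frontier (Q i) \<inter> V. u y \<le> a)"
    proof (rule disjCI, rule subsetI, rule ccontr)
      fix x assume no: "\<not> (\<forall>y\<in>frontier (Q i) \<inter> V. u y \<le> a)" and x: "x \<in> frontier (Q i)" "x \<notin> V"
      then obtain y where y: "y \<in> frontier (Q i)" "y \<in> V" "\<not> u y \<le> a" by blast
      obtain z where z: "z \<in> frontier (Q i)" "z \<in> frontier V" "z \<in> S" by (rule frontier_Q_crossing[OF y(1,2) x]) (rule that)
      have cl: "z \<in> closure (Q i)" "y \<in> closure (Q i)" using y z by (auto simp: frontier_def)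
      then have "diameter (Q i) < \<delta>" using i z by (auto simp: B_def)
      then have "dist z y < \<delta>" using dist_le_diameter_Q[OF cl] by simp
      then have "u y < a" using \<delta>(2)[of z y] z y frontier_Q_subset_S by blast
      then show False using y(3) by simp
    qed
  qed
  obtain y where y: "y \<in> S" "y \<notin> V" by (rule S_not_subset_relatively_compact[OF V]) (use x in blast, rule that)
  \<comment> \<open>Two ways for the test function to vanish on small disks near \<open>y\<close>:
    the ball misses \<open>V\<close>, or \<open>y\<close> is a frontier point with
    \<open>u y < a\<close>.\<close>
  have "\<exists>e>0. ball y e \<inter> V = {} \<or> u y + e < a"
  proof (cases "y \<in> closure V")
    case True
    then have "y \<in> frontier V" using y(2) V(1) by (simp add: frontier_def interior_open)
    then have "u y < a" using bdV y by blast
    then show ?thesis by (intro exI[of _ "(a - u y) / 2"]) (auto simp: field_simps)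
  next
    case False
    then have "y \<in> - closure V" "open (- closure V)" by (auto simp: open_Compl)
    then obtain e where e: "0 < e" "ball y e \<subseteq> - closure V" using open_contains_ball by metis
    then show ?thesis using closure_subset[of V] by (intro exI[of _ e]) blast
  qed
  then obtain e where e: "0 < e" "ball y e \<inter> V = {} \<or> u y + e < a" by blast
  have e': "0 < e / 2" using e(1) by simp
  obtain k where k: "k \<notin> B" "closure (Q k) \<subseteq> cball y (e / 2)" "\<And>q. q \<in> frontier (Q k) \<Longrightarrow> \<bar>u q - u y\<bar> < e / 2"
    by (rule disk_near[OF u y(1) e' finB]) (rule that)
  obtain q where q: "q \<in> frontier (Q k)" using frontier_Q_ne by blast
  have "q \<in> ball y e" using q k(2) e(1) by (auto simp: frontier_def subset_iff)
  moreover have "u q < u y + e" using k(3)[OF q] e(1) by linarith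
  ultimately have q0: "?\<psi> q = 0" using e(2) by (auto simp: test_def min_def max_def)
  obtain e2 where e2: "0 < e2" "ball x e2 \<subseteq> V" using x(2) V(1) open_contains_ball by metis
  have e3: "0 < min (e2 / 2) (u x - a)" using e2 lt by simp
  obtain m where m: "m \<notin> B" "closure (Q m) \<subseteq> cball x (min (e2 / 2) (u x - a))" "\<And>q. q \<in> frontier (Q m) \<Longrightarrow> \<bar>u q - u x\<bar> < min (e2 / 2) (u x - a)"
    by (rule disk_near[OF u x(1) e3 finB]) (rule that)
  obtain w where w: "w \<in> frontier (Q m)" using frontier_Q_ne by blast
  have "w \<in> cball x (min (e2 / 2) (u x - a))" using w m(2) by (auto simp: frontier_def)
  then have "w \<in> V" using e2 by (auto simp: subset_iff)
  then have "0 < ?\<psi> w" using m(3)[OF w] by (auto simp: test_def)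
  moreover have "?\<psi> w = ?\<psi> q"
    by (rule constant_on_disks[OF sobolev_real_test[OF us V(1) le] finB z m(1) k(1) w q])
  ultimately show False using q0 by simp
qed

end

section \<open>Normalized carpet-harmonic functions\<close>

text \<open>A constant path off the disks meets no disk and has line integral 0 for every density,
  so neither weights nor densities can be admissible for it. As a consequence, Sobolev functions are
  finite at every carpet point.\<close>

lemma constant_path_not_exceptional:
  assumes x: "\<And>i. x \<notin> Q i" and null: "carpet_modulus v \<Omega> Q \<Gamma> = 0"
  shows "({0}, \<lambda>_. x) \<notin> \<Gamma>"
proof
  assume c: "({0}, \<lambda>_. x) \<in> \<Gamma>"
  have len: "curve_length (\<lambda>_. x) I = 0" for I
    unfolding curve_length_def by (auto simp: SUP_eq_const bot_ennreal intro!: antisym SUP_least)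
  have li: "line_integral l ({0}, \<lambda>_. x) = 0" for l
  proof -
    have i0: "(\<integral>\<^sup>+ s. g s * indicator {0..enn2real 0} s \<partial>lborel) = 0" for g :: "real \<Rightarrow> ennreal"
    proof -
      have "AE s in lborel. s \<noteq> (0::real)" by (rule AE_lborel_singleton)
      then have "AE s in lborel. g s * indicator {0..enn2real 0} s = 0" by eventually_elim auto
      then have "(\<integral>\<^sup>+ s. g s * indicator {0..enn2real 0} s \<partial>lborel) = (\<integral>\<^sup>+ (s::real). 0 \<partial>lborel)" by (rule nn_integral_cong_AE)
      then show ?thesis by simp
    qed
    have "line_integral l ({0}, \<lambda>_. x) = (SUP p\<in>{(a, b). a \<le> b \<and> {a..b} \<subseteq> {0::real}}. (0::ennreal))"
      unfolding line_integral_def locally_rectifiable_def fst_conv snd_conv len i0 by (simp add: split_beta)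
    also have "\<dots> = 0" by (intro SUP_eq_const) (auto intro!: exI[of _ 0])
    finally show ?thesis .
  qed
  have tr: "meeting Q (trace ({0}, \<lambda>_. x)) = {}" using x by (auto simp: meeting_def trace_def)
  show False
  proof (cases v)
    case Weak
    then have "mod_weak Q \<Gamma> = 0" using null by (simp add: carpet_modulus_def)
    from this[unfolded mod_weak_null_iff, rule_format, OF zero_less_one]
    obtain \<rho> \<Gamma>0 where \<Gamma>0: "mod2 \<Gamma>0 = 0" "\<forall>\<gamma>\<in>\<Gamma> - \<Gamma>0. (\<Sum>\<^sub>\<infinity>i\<in>meeting Q (trace \<gamma>). \<rho> i) \<ge> (1::ennreal)"
      by (elim exE conjE) (rule that)
    have "({0}, \<lambda>_. x) \<in> \<Gamma>0"
    proof (rule ccontr)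
      assume "({0}, \<lambda>_. x) \<notin> \<Gamma>0"
      with c \<Gamma>0(2) have "(\<Sum>\<^sub>\<infinity>i\<in>meeting Q (trace ({0}, \<lambda>_. x)). \<rho> i) \<ge> 1" by blast
      then show False by (simp only: tr infsum_empty) simp
    qed
    moreover obtain l where "\<forall>\<gamma>\<in>\<Gamma>0. line_integral l \<gamma> \<ge> 1"
      using \<Gamma>0(1)[unfolded mod2_null_iff, rule_format, OF zero_less_one] by blast
    ultimately have "line_integral l ({0}, \<lambda>_. x) \<ge> 1" by blast
    then show False by (simp add: li)
  next
    case Strong
    then have "mod_strong \<Omega> Q \<Gamma> = 0" using null by (simp add: carpet_modulus_def)
    from this[unfolded mod_strong_null_iff, rule_format, OF zero_less_one]
    obtain \<rho> where \<rho>: "\<forall>\<gamma>\<in>\<Gamma>. hausdorff1 (trace \<gamma> \<inter> carpet \<Omega> Q) = 0 \<longrightarrow> (\<Sum>\<^sub>\<infinity>i\<in>meeting Q (trace \<gamma>). \<rho> i) \<ge> (1::ennreal)"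
      by (elim exE conjE) (rule that)
    have "hausdorff1 (trace ({0}, \<lambda>_. x) \<inter> carpet \<Omega> Q) = 0"
    proof (rule hausdorff1_mono_null[of "{x}"])
      show "hausdorff1 {x} = 0"
        unfolding hausdorff1_eq_0_iff
        by (intro allI impI exI[of _ "\<lambda>_. {x}"]) auto
    qed (auto simp: trace_def)
    with c \<rho> have "(\<Sum>\<^sub>\<infinity>i\<in>meeting Q (trace ({0}, \<lambda>_. x)). \<rho> i) \<ge> 1" by blast
    then show False by (simp only: tr infsum_empty) simp
  qed
qed

text \<open>A finite lower limit is a cluster value. Its finiteness also rules out the trivial
  filter, for which the lower limit would be infinite.\<close>

lemma Liminf_real_cluster:
  fixes f :: "'a \<Rightarrow> ereal"
  assumes "Liminf F f = ereal L" "0 < e" "eventually P F"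
  obtains z where "P z" "ereal (L - e) < f z" "f z < ereal (L + e)"
proof -
  have "ereal (L - e) < Liminf F f" using assms by simp
  then have e1: "eventually (\<lambda>z. ereal (L - e) < f z) F" by (rule less_LiminfD)
  have "\<not> eventually (\<lambda>z. ereal (L + e) \<le> f z) F"
  proof
    assume "eventually (\<lambda>z. ereal (L + e) \<le> f z) F"
    then have "ereal (L + e) \<le> Liminf F f" by (rule Liminf_bounded)
    then show False using assms by simp
  qed
  moreover have "eventually (\<lambda>z. ereal (L + e) \<le> f z) F" if "\<And>z. P z \<Longrightarrow> ereal (L - e) < f z \<Longrightarrow> \<not> f z < ereal (L + e)"
    using e1 assms(3) by eventually_elim (use that in \<open>auto simp: not_less\<close>)
  ultimately show ?thesis using that by blast
qed

lemma eventually_disks_to: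
  assumes "0 < e" shows "eventually (\<lambda>i. i \<in> meeting Q (trace \<gamma>) \<and> Q i \<subseteq> ball x e) (disks_to Q \<gamma> x)"
proof -
  have "disks_to Q \<gamma> x \<le> principal {i \<in> meeting Q (trace \<gamma>). Q i \<subseteq> ball x e}"
    unfolding disks_to_def using assms by (intro INF_lower) auto
  then show ?thesis by (auto simp: le_principal)
qed

context rel_carpet
begin

lemma sobolev_loc_finite:
  assumes g: "g \<in> sobolev_loc v \<Omega> Q" and x: "x \<in> S" shows "\<bar>g x\<bar> \<noteq> \<infinity>"
proof -
  have "upper_gradient v \<Omega> Q (osc Q g) g" using g by (simp add: sobolev_loc_def)
  then obtain \<Gamma>0 where G: "carpet_modulus v \<Omega> Q \<Gamma>0 = 0"
    "\<forall>\<gamma> \<in> paths_in \<Omega> - \<Gamma>0. \<forall>x \<in> trace \<gamma> \<inter> carpet \<Omega> Q. \<forall>y \<in> trace \<gamma> \<inter> carpet \<Omega> Q.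
       \<bar>g x\<bar> \<noteq> \<infinity> \<and> \<bar>g y\<bar> \<noteq> \<infinity> \<and> \<bar>g x - g y\<bar> \<le> enn2ereal (\<Sum>\<^sub>\<infinity>i\<in>meeting Q (trace \<gamma>). osc Q g i)"
    unfolding upper_gradient_def by (elim exE conjE) (rule that)
  have "({0}, \<lambda>_. x) \<in> paths_in \<Omega>"
    using x S_subset by (auto simp: paths_in_def is_cpath_def trace_def is_interval_1 intro!: exI[of _ "\<lambda>_. x"])
  moreover have "({0}, \<lambda>_. x) \<notin> \<Gamma>0" using constant_path_not_exceptional[OF _ G(1)] S_not_Q[OF x] by blast
  moreover have "x \<in> trace ({0}, \<lambda>_. x) \<inter> S" using x by (auto simp: trace_def)
  ultimately show ?thesis using bspec[OF G(2), of "({0}, \<lambda>_. x)"] by (meson DiffI)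
qed

lemma bd_real:
  assumes "\<And>x. x \<in> S \<Longrightarrow> g x = ereal (u x)" and "\<bar>sup_bd Q g i\<bar> \<noteq> \<infinity>" "\<bar>inf_bd Q g i\<bar> \<noteq> \<infinity>"
  shows "bounded (u ` frontier (Q i))" "sup_bd Q g i = ereal (Sup (u ` frontier (Q i)))"
    "inf_bd Q g i = ereal (Inf (u ` frontier (Q i)))" "osc Q g i = ennreal (oscr Q u i)"
proof -
  have s: "sup_bd Q g i = (SUP x\<in>frontier (Q i). ereal (u x))"
    unfolding sup_bd_def using assms(1) frontier_Q_subset_S[of i] by (intro SUP_cong) auto
  have m: "inf_bd Q g i = (INF x\<in>frontier (Q i). ereal (u x))"
    unfolding inf_bd_def using assms(1) frontier_Q_subset_S[of i] by (intro INF_cong) auto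
  show sup: "sup_bd Q g i = ereal (Sup (u ` frontier (Q i)))" using ereal_SUP[of u "frontier (Q i)"] assms(2) s by simp
  show inf: "inf_bd Q g i = ereal (Inf (u ` frontier (Q i)))" using ereal_INF[of u "frontier (Q i)"] assms(3) m by simp
  show "osc Q g i = ennreal (oscr Q u i)" unfolding osc_def sup inf oscr_def by simp
  have "u x \<le> Sup (u ` frontier (Q i)) \<and> Inf (u ` frontier (Q i)) \<le> u x" if "x \<in> frontier (Q i)" for x
  proof -
    have "ereal (u x) \<le> sup_bd Q g i" "inf_bd Q g i \<le> ereal (u x)" unfolding s m using that by (auto intro: SUP_upper INF_lower)
    then show ?thesis by (simp add: sup inf)
  qed
  then show "bounded (u ` frontier (Q i))"
    unfolding bounded_iff by (intro exI[of _ "max \<bar>Sup (u ` frontier (Q i))\<bar> \<bar>Inf (u ` frontier (Q i))\<bar>"]) (force simp: abs_le_iff)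
qed

lemma bd_real_bounded:
  assumes "bounded (u ` frontier (Q i))"
  shows "\<bar>sup_bd Q (\<lambda>x. ereal (u x)) i\<bar> \<noteq> \<infinity>" "\<bar>inf_bd Q (\<lambda>x. ereal (u x)) i\<bar> \<noteq> \<infinity>"
proof -
  obtain B where B: "\<And>x. x \<in> frontier (Q i) \<Longrightarrow> \<bar>u x\<bar> \<le> B" using assms by (auto simp: bounded_iff)
  obtain x where x: "x \<in> frontier (Q i)" using frontier_Q_ne by blast
  have "sup_bd Q (\<lambda>x. ereal (u x)) i \<le> ereal B" unfolding sup_bd_def using B by (intro SUP_least) (auto simp: abs_le_iff)
  moreover have "ereal (u x) \<le> sup_bd Q (\<lambda>x. ereal (u x)) i" unfolding sup_bd_def using x by (rule SUP_upper)
  ultimately show "\<bar>sup_bd Q (\<lambda>x. ereal (u x)) i\<bar> \<noteq> \<infinity>" by auto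
  have "ereal (- B) \<le> inf_bd Q (\<lambda>x. ereal (u x)) i" unfolding inf_bd_def
  proof (intro INF_greatest)
    fix x assume "x \<in> frontier (Q i)"
    then show "ereal (- B) \<le> ereal (u x)" using B[of x] by (simp add: abs_le_iff)
  qed
  moreover have "inf_bd Q (\<lambda>x. ereal (u x)) i \<le> ereal (u x)" unfolding inf_bd_def using x by (rule INF_lower)
  ultimately show "\<bar>inf_bd Q (\<lambda>x. ereal (u x)) i\<bar> \<noteq> \<infinity>" by auto
qed

lemma upper_gradient_cong:
  assumes "\<And>x. x \<in> S \<Longrightarrow> g x = g' x" "\<rho> = \<rho>'"
  shows "upper_gradient v \<Omega> Q \<rho> g \<longleftrightarrow> upper_gradient v \<Omega> Q \<rho>' g'"
  using assms unfolding upper_gradient_def by (metis (no_types, lifting) IntD2)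

lemma sobolev_loc_real:
  assumes g: "g \<in> sobolev_loc v \<Omega> Q" and gu: "\<And>x. x \<in> S \<Longrightarrow> g x = ereal (u x)"
  shows "sobolev_real v \<Omega> Q u" "sup_bd Q g i = ereal (Sup (u ` frontier (Q i)))" "osc Q g i = ennreal (oscr Q u i)"
proof -
  have b: "\<bar>sup_bd Q g i\<bar> \<noteq> \<infinity>" "\<bar>inf_bd Q g i\<bar> \<noteq> \<infinity>" for i using g by (auto simp: sobolev_loc_def)
  note R = bd_real[OF gu b(1) b(2)]
  show "sup_bd Q g i = ereal (Sup (u ` frontier (Q i)))" "osc Q g i = ennreal (oscr Q u i)" by (rule R; assumption)+
  have o: "osc Q g = (\<lambda>i. ennreal (oscr Q u i))" using R(4) by blast
  have "upper_gradient v \<Omega> Q (osc Q g) g" using g by (simp add: sobolev_loc_def)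
  then have "upper_gradient v \<Omega> Q (\<lambda>i. ennreal (oscr Q u i)) (\<lambda>x. ereal (u x))"
    using upper_gradient_cong[of g "\<lambda>x. ereal (u x)", OF gu o] by blast
  moreover have "(\<Sum>\<^sub>\<infinity>i\<in>meeting Q (ball x r). (ennreal (oscr Q u i))\<^sup>2) < \<infinity>" if "0 < r" "compactly_contained (ball x r) \<Omega>" for x r
    using g that by (auto simp: sobolev_loc_def finite_energy_on_def o)
  ultimately show "sobolev_real v \<Omega> Q u" using R(1) by (simp add: sobolev_real_def)
qed

text \<open>A disk missing the open set \<open>V\<close> has its boundary curve off \<open>V\<close>
  as well and contributes nothing. Over the other disks the squared diameters are summable by area
  packing, once the finitely many disks of diameter at least \<open>R\<close> are split off.\<close>

lemma sobolev_of_real: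
  assumes z: "sobolev_real v \<Omega> Q \<zeta>" and bd: "bounded (range \<zeta>)" and V: "open V" "compactly_contained V \<Omega>" and off: "\<forall>x\<in>S - V. \<zeta> x = 0"
  shows "(\<lambda>x. ereal (\<zeta> x)) \<in> sobolev v \<Omega> Q"
proof -
  let ?g = "\<lambda>x. ereal (\<zeta> x)"
  note bdz = sobolev_realD(1)[OF z]
  note B = bd_real[where g="\<lambda>x. ereal (\<zeta> x)" and u=\<zeta>, OF refl bd_real_bounded[OF bdz]]
  obtain b where b: "\<And>x. \<bar>\<zeta> x\<bar> \<le> b" using bd by (auto simp: bounded_iff)
  have b0: "0 \<le> b" using b[of 0] by simp
  have off': "\<zeta> x = 0" if i: "i \<notin> meeting Q V" and x: "x \<in> frontier (Q i)" for i x
  proof -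
    have "V \<inter> closure (Q i) = {}" using i open_Int_closure_eq_empty[OF V(1), of "Q i"] by (auto simp: meeting_def)
    then have "x \<notin> V" using x by (auto simp: frontier_def)
    then show ?thesis using off x frontier_Q_subset_S by blast
  qed
  have o0: "oscr Q \<zeta> i = 0" if "i \<notin> meeting Q V" for i
  proof -
    have "oscr Q \<zeta> i \<le> 0" by (rule oscr_le) (simp add: off'[OF that])
    then show ?thesis using oscr_nonneg[OF bdz, of i] by simp
  qed
  have s0: "Sup (\<zeta> ` frontier (Q i)) = 0" if "i \<notin> meeting Q V" for i
  proof -
    have "\<zeta> ` frontier (Q i) = {0}" using off'[OF that] frontier_Q_ne[of i] by force
    then show ?thesis by simp
  qed
  have sb: "\<bar>Sup (\<zeta> ` frontier (Q i))\<bar> \<le> b" for i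
  proof -
    obtain x where x: "x \<in> frontier (Q i)" using frontier_Q_ne by blast
    have "Sup (\<zeta> ` frontier (Q i)) \<le> b" using b by (intro cSUP_least frontier_Q_ne) (auto simp: abs_le_iff)
    moreover have "\<zeta> x \<le> Sup (\<zeta> ` frontier (Q i))" using x bdz by (intro cSUP_upper bounded_imp_bdd_above)
    ultimately show ?thesis using b[of x] by (simp add: abs_le_iff)
  qed
  have bV: "bounded (closure V)" using V(2) by (auto simp: compactly_contained_def intro: compact_imp_bounded)
  obtain R where R: "0 < R" "closure V \<subseteq> ball 0 R" using bounded_subset_ballD[OF bV] by blast
  have V1: "meeting Q V \<subseteq> meeting Q (ball 0 R)" using R(2) closure_subset[of V] by (intro meeting_mono) blast
  have diam: "(\<Sum>\<^sub>\<infinity>i\<in>meeting Q V. ennreal ((diameter (Q i))\<^sup>2)) < \<infinity>"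
  proof -
    let ?L = "{i \<in> meeting Q (ball 0 R). R \<le> diameter (Q i)}"
    have fin: "finite ?L" by (intro finite_large_disks R) simp
    obtain C where C: "0 < C" "\<And>p R. 0 < R \<Longrightarrow>
      (\<Sum>\<^sub>\<infinity>i\<in>meeting Q (ball p R). ennreal ((min (diameter (Q i)) R)\<^sup>2)) \<le> ennreal (C * R\<^sup>2)"
      by (rule sum_min_diameter) (rule that)
    have "(\<Sum>\<^sub>\<infinity>i\<in>meeting Q V. ennreal ((diameter (Q i))\<^sup>2)) \<le> (\<Sum>\<^sub>\<infinity>i\<in>?L \<union> (meeting Q (ball 0 R) - ?L). ennreal ((diameter (Q i))\<^sup>2))"
      using V1 by (intro infsum_ennreal_mono) auto
    also have "\<dots> \<le> (\<Sum>\<^sub>\<infinity>i\<in>?L. ennreal ((diameter (Q i))\<^sup>2)) + (\<Sum>\<^sub>\<infinity>i\<in>meeting Q (ball 0 R) - ?L. ennreal ((diameter (Q i))\<^sup>2))"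
      by (rule infsum_ennreal_Un_le)
    also have "\<dots> \<le> (\<Sum>\<^sub>\<infinity>i\<in>?L. ennreal ((diameter (Q i))\<^sup>2)) + (\<Sum>\<^sub>\<infinity>i\<in>meeting Q (ball 0 R). ennreal ((min (diameter (Q i)) R)\<^sup>2))"
      by (intro add_left_mono infsum_ennreal_mono) (auto simp: min_def)
    also have "\<dots> < \<infinity>"
    proof -
      have "(\<Sum>\<^sub>\<infinity>i\<in>?L. ennreal ((diameter (Q i))\<^sup>2)) < \<infinity>" using fin by simp
      moreover have "(\<Sum>\<^sub>\<infinity>i\<in>meeting Q (ball 0 R). ennreal ((min (diameter (Q i)) R)\<^sup>2)) < \<infinity>"
        using C(2)[OF R(1), of 0] by (rule order_le_less_trans) simp
      ultimately show ?thesis by simp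
    qed
    finally show ?thesis .
  qed
  have fe: "finite_energy_on Q UNIV ?g"
    unfolding finite_energy_on_def
  proof
    have "(\<Sum>\<^sub>\<infinity>i\<in>UNIV. ennreal ((real_of_ereal (sup_bd Q ?g i))\<^sup>2 * (diameter (Q i))\<^sup>2))
        = (\<Sum>\<^sub>\<infinity>i\<in>meeting Q V. ennreal ((real_of_ereal (sup_bd Q ?g i))\<^sup>2 * (diameter (Q i))\<^sup>2))"
      by (rule infsum_cong_neutral) (auto simp: B(2) s0)
    also have "\<dots> \<le> (\<Sum>\<^sub>\<infinity>i\<in>meeting Q V. ennreal (b\<^sup>2) * ennreal ((diameter (Q i))\<^sup>2))"
    proof (rule infsum_ennreal_mono)
      fix i
      have "(Sup (\<zeta> ` frontier (Q i)))\<^sup>2 \<le> b\<^sup>2" using sb[of i] b0 abs_le_square_iff[of "Sup (\<zeta> ` frontier (Q i))" b] by simp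
      then show "ennreal ((real_of_ereal (sup_bd Q ?g i))\<^sup>2 * (diameter (Q i))\<^sup>2) \<le> ennreal (b\<^sup>2) * ennreal ((diameter (Q i))\<^sup>2)"
        by (simp add: B(2) ennreal_mult[symmetric] ennreal_leI mult_right_mono)
    qed simp
    also have "\<dots> < \<infinity>" using diam by (simp add: infsum_ennreal_cmult ennreal_mult_less_top)
    finally show "(\<Sum>\<^sub>\<infinity>i\<in>UNIV. ennreal ((real_of_ereal (sup_bd Q ?g i))\<^sup>2 * (diameter (Q i))\<^sup>2)) < \<infinity>" .
    have "(\<Sum>\<^sub>\<infinity>i\<in>UNIV. (osc Q ?g i)\<^sup>2) = (\<Sum>\<^sub>\<infinity>i\<in>meeting Q V. (ennreal (oscr Q \<zeta> i))\<^sup>2)"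
      by (rule infsum_cong_neutral) (auto simp: B(4) o0)
    also have "\<dots> \<le> (\<Sum>\<^sub>\<infinity>i\<in>meeting Q (closure V). (ennreal (oscr Q \<zeta> i))\<^sup>2)"
      by (intro infsum_ennreal_mono meeting_mono closure_subset) simp
    also have "\<dots> < \<infinity>" using V(2) by (intro compact_energy[OF z]) (auto simp: compactly_contained_def)
    finally show "(\<Sum>\<^sub>\<infinity>i\<in>UNIV. (osc Q ?g i)\<^sup>2) < \<infinity>" .
  qed
  have fe': "finite_energy_on Q I ?g" for I
    using fe unfolding finite_energy_on_def
    by (intro conjI; elim conjE) (rule order_le_less_trans[OF infsum_ennreal_mono[OF subset_UNIV order_refl]], assumption)+
  have "osc Q ?g = (\<lambda>i. ennreal (oscr Q \<zeta> i))" using B(4) by blast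
  then have "upper_gradient v \<Omega> Q (osc Q ?g) ?g" using sobolev_realD(3)[OF z] by simp
  then show ?thesis using fe fe' bd_real_bounded[OF bdz] by (simp add: sobolev_def sobolev_loc_def)
qed

lemma harmonic_minimal:
  assumes h: "carpet_harmonic v \<Omega> Q (\<lambda>x. ereal (u x))"
    and V: "open V" "compactly_contained V \<Omega>" and z: "sobolev_real v \<Omega> Q \<zeta>" "bounded (range \<zeta>)" "\<forall>x\<in>S - V. \<zeta> x = 0"
  shows "(\<Sum>\<^sub>\<infinity>i\<in>meeting Q V. (ennreal (oscr Q u i))\<^sup>2) \<le> (\<Sum>\<^sub>\<infinity>i\<in>meeting Q V. (ennreal (oscr Q (\<lambda>x. u x + \<zeta> x) i))\<^sup>2)"
proof -
  have ul: "(\<lambda>x. ereal (u x)) \<in> sobolev_loc v \<Omega> Q" using h by (simp add: carpet_harmonic_def)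
  note U = sobolev_loc_real[OF ul refl]
  have zs: "(\<lambda>x. ereal (\<zeta> x)) \<in> sobolev v \<Omega> Q" by (rule sobolev_of_real[OF z(1,2) V z(3)])
  have "dirichlet_energy Q V (\<lambda>x. ereal (u x)) \<le> dirichlet_energy Q V (\<lambda>x. ereal (u x) + ereal (\<zeta> x))"
    using h[unfolded carpet_harmonic_def, THEN conjunct2, rule_format, of V "\<lambda>x. ereal (\<zeta> x)"] V zs z(3) by simp
  moreover have "bounded ((\<lambda>x. u x + \<zeta> x) ` frontier (Q i))" for i
  proof -
    obtain B where B: "\<And>x. x \<in> frontier (Q i) \<Longrightarrow> norm (u x) \<le> B" using sobolev_realD(1)[OF U(1), of i] by (auto simp: bounded_iff)
    obtain B' where B': "\<And>x. norm (\<zeta> x) \<le> B'" using z(2) by (auto simp: bounded_iff)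
    have "norm (u x + \<zeta> x) \<le> B + B'" if "x \<in> frontier (Q i)" for x
      using norm_triangle_ineq[of "u x" "\<zeta> x"] B[OF that] B'[of x] by linarith
    then show ?thesis by (intro boundedI[of _ "B + B'"]) blast
  qed
  then have "osc Q (\<lambda>x. ereal (u x + \<zeta> x)) i = ennreal (oscr Q (\<lambda>x. u x + \<zeta> x) i)" for i
    using bd_real(4)[of "\<lambda>x. ereal (u x + \<zeta> x)" "\<lambda>x. u x + \<zeta> x" i] bd_real_bounded by simp
  ultimately show ?thesis using U(3) by (simp add: dirichlet_energy_def)
qed

section \<open>Boundary values of the normalized version\<close>

lemma accessible_in_S: "accessible \<Omega> Q g \<subseteq> S"
  by (auto simp: accessible_def access_path_def carpet_interior_def split: if_splits)

lemma accessible_valueE: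
  assumes "x \<in> accessible \<Omega> Q g"
  obtains \<gamma>0 \<gamma> where "\<gamma>0 \<in> good_paths \<Omega> Q g" "access_path \<Omega> Q x \<gamma>0 \<gamma>"
    "accessible_value \<Omega> Q g x = Liminf (disks_to Q \<gamma> x) (sup_bd Q g)"
proof -
  define \<gamma> where "\<gamma> = (SOME \<gamma>. \<exists>\<gamma>0 \<in> good_paths \<Omega> Q g. access_path \<Omega> Q x \<gamma>0 \<gamma>)"
  have "\<exists>\<gamma>. \<exists>\<gamma>0 \<in> good_paths \<Omega> Q g. access_path \<Omega> Q x \<gamma>0 \<gamma>" using assms by (auto simp: accessible_def)
  then have "\<exists>\<gamma>0 \<in> good_paths \<Omega> Q g. access_path \<Omega> Q x \<gamma>0 \<gamma>" unfolding \<gamma>_def by (rule someI_ex)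
  then show ?thesis using that[of _ \<gamma>] by (auto simp: accessible_value_def \<gamma>_def)
qed

text \<open>The lower limit provides disks along the path near \<open>x\<close> with supremum close
  to \<open>L\<close>, and their parameters accumulate at some \<open>t0\<close>. Since the path is
  good and avoids \<open>Q j\<close>, its sum of oscillations near \<open>t0\<close> is small, which
  carries the estimate over to every disk on that piece of the path.\<close>

lemma access_tail:
  assumes g: "g \<in> sobolev_loc v \<Omega> Q" and gu: "\<And>x. x \<in> S \<Longrightarrow> g x = ereal (G x)"
    and \<gamma>0: "\<gamma>0 \<in> good_paths \<Omega> Q g" and acc: "access_path \<Omega> Q x \<gamma>0 \<gamma>" and x: "x \<in> frontier (Q j)"
    and L: "Liminf (disks_to Q \<gamma> x) (sup_bd Q g) = ereal L" and \<eta>: "0 < \<eta>"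
  obtains X where "connected X" "X \<subseteq> trace \<gamma>0" "X \<inter> Q j = {}" "x \<notin> X" "x \<in> closure X"
    "\<And>k. Q k \<inter> X \<noteq> {} \<Longrightarrow> \<bar>Sup (G ` frontier (Q k)) - L\<bar> < 2 * \<eta>"
proof -
  have U: "sobolev_real v \<Omega> Q G" "sup_bd Q g i = ereal (Sup (G ` frontier (Q i)))" for i
    by (rule sobolev_loc_real[OF g], erule gu)+
  define M where "M i = Sup (G ` frontier (Q i))" for i
  have sM: "sup_bd Q g i = ereal (M i)" for i using U(2) by (simp add: M_def)
  have xS: "x \<in> S" using x frontier_Q_subset_S by blast
  have "x \<notin> carpet_interior \<Omega> Q" using x by (auto simp: carpet_interior_def)
  then have acc': "\<gamma> \<in> open_subpaths \<gamma>0" "x \<in> closure (trace \<gamma>) - trace \<gamma>" "trace \<gamma> \<inter> Q j = {}"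
    using acc x by (auto simp: access_path_def)
  obtain J where J: "\<gamma> = (J, snd \<gamma>0)" "J \<noteq> {}" "is_interval J" "J \<subseteq> fst \<gamma>0"
    using acc'(1) unfolding open_subpaths_def subpaths_def by blast
  define f where "f = snd \<gamma>0"
  have tr: "trace \<gamma> = f ` J" by (simp add: J(1) f_def trace_def)
  have \<gamma>0p: "\<gamma>0 \<in> paths_in \<Omega>"
    and \<gamma>0M: "\<And>\<gamma>' i k. \<gamma>' \<in> subpaths \<gamma>0 \<Longrightarrow> i \<in> meeting Q (trace \<gamma>') \<Longrightarrow> k \<in> meeting Q (trace \<gamma>') \<Longrightarrow>
           \<bar>sup_bd Q g i - sup_bd Q g k\<bar> \<le> enn2ereal (\<Sum>\<^sub>\<infinity>l\<in>meeting Q (trace \<gamma>'). osc Q g l)"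
    and \<gamma>0f: "\<And>\<gamma>'. \<gamma>' \<in> subpaths \<gamma>0 \<Longrightarrow> compactly_contained (trace \<gamma>') \<Omega> \<Longrightarrow>
           (\<Sum>\<^sub>\<infinity>l\<in>meeting Q (trace \<gamma>'). osc Q g l) < \<infinity>"
    using \<gamma>0 by (auto simp: good_paths_def)
  obtain h where h: "continuous_on (closure (fst \<gamma>0)) h" "\<And>t. t \<in> fst \<gamma>0 \<Longrightarrow> h t = f t"
    and bd: "bounded (fst \<gamma>0)"
    using \<gamma>0p unfolding paths_in_def is_cpath_def f_def by blast
  have hJ: "continuous_on (closure J) h" using h(1) closure_mono[OF J(4)] by (rule continuous_on_subset)
  have hf: "h t = f t" if "t \<in> J" for t using h(2) J(4) that by blast
  have cJ: "compact (closure J)" using bounded_subset[OF bd J(4)] by (simp add: compact_closure)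
  have "\<exists>t\<in>J. dist x (f t) < 1 / real (Suc n) \<and> (\<exists>i. f t \<in> Q i \<and> \<bar>M i - L\<bar> < \<eta>)" for n
  proof -
    have "0 < 1 / real (Suc n)" by simp
    from eventually_disks_to[OF this] obtain i where i: "i \<in> meeting Q (trace \<gamma>) \<and> Q i \<subseteq> ball x (1 / real (Suc n))"
        "ereal (L - \<eta>) < sup_bd Q g i" "sup_bd Q g i < ereal (L + \<eta>)"
      by (rule Liminf_real_cluster[OF L \<eta>]) (rule that)
    then obtain t where t: "t \<in> J" "f t \<in> Q i" by (auto simp: meeting_def tr)
    have "\<bar>M i - L\<bar> < \<eta>" using i(2,3) by (simp add: sM abs_less_iff)
    moreover have "f t \<in> ball x (1 / real (Suc n))" using i(1) t(2) by blast
    ultimately show ?thesis using t by auto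
  qed
  then obtain \<tau> where \<tau>: "\<And>n. \<tau> n \<in> J" "\<And>n. dist x (f (\<tau> n)) < 1 / real (Suc n)"
     "\<And>n. \<exists>i. f (\<tau> n) \<in> Q i \<and> \<bar>M i - L\<bar> < \<eta>" by metis
  have "\<forall>n. \<tau> n \<in> closure J" using \<tau>(1) closure_subset by blast
  \<comment> \<open>The accumulation point lies in the closed interval only; the continuous
    extension \<open>h\<close> of the path takes the value \<open>x\<close> there.\<close>
  with cJ obtain t0 \<sigma> where t0: "t0 \<in> closure J" "strict_mono \<sigma>" "(\<tau> \<circ> \<sigma>) \<longlonglongrightarrow> t0"
    unfolding compact_def by blast
  have fl: "(\<lambda>n. f (\<tau> n)) \<longlonglongrightarrow> x"
  proof (rule tendsto_dist_iff[THEN iffD2], rule tendsto_sandwich[of "\<lambda>_. 0"])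
    show "\<forall>\<^sub>F n in sequentially. dist (f (\<tau> n)) x \<le> 1 / real (Suc n)"
      using \<tau>(2) by (intro always_eventually allI) (simp add: dist_commute less_imp_le)
    show "(\<lambda>n. 1 / real (Suc n)) \<longlonglongrightarrow> 0" by (rule LIMSEQ_Suc) (rule lim_1_over_n)
  qed auto
  have fl': "(\<lambda>n. f (\<tau> (\<sigma> n))) \<longlonglongrightarrow> x" using LIMSEQ_subseq_LIMSEQ[OF fl t0(2)] by (simp add: o_def)
  have "(\<lambda>n. h ((\<tau> \<circ> \<sigma>) n)) \<longlonglongrightarrow> h t0"
    using \<tau>(1) closure_subset[of J] by (intro continuous_on_tendsto_compose[OF hJ t0(3,1)] always_eventually) auto
  then have "(\<lambda>n. f (\<tau> (\<sigma> n))) \<longlonglongrightarrow> h t0" using hf \<tau>(1) by simp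
  then have ht0: "h t0 = x" using fl' LIMSEQ_unique by blast
  have near: "\<exists>d>0. \<forall>t\<in>J. dist t t0 < d \<longrightarrow> f t \<in> ball x \<rho>" if "0 < \<rho>" for \<rho>
  proof -
    from hJ[unfolded continuous_on_iff, rule_format, OF t0(1) that]
    obtain d where "d > 0" "\<forall>t\<in>closure J. dist t t0 < d \<longrightarrow> dist (h t) (h t0) < \<rho>" by blast
    then have "\<forall>t\<in>J. dist t t0 < d \<longrightarrow> f t \<in> ball x \<rho>"
      using hf subsetD[OF closure_subset, of _ J] by (metis dist_commute ht0 mem_ball)
    with \<open>d > 0\<close> show ?thesis by blast
  qed
  obtain r1 where r1: "0 < r1" "compactly_contained (ball x r1) \<Omega>" using ball_at xS S_subset by blast
  obtain d1 where d1: "d1 > 0" "\<forall>t\<in>J. dist t t0 < d1 \<longrightarrow> f t \<in> ball x r1" using near[OF r1(1)] by blast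
  \<comment> \<open>\<open>J1\<close> keeps the path relatively compact, which makes its sum of
    oscillations finite. \<open>J2\<close> below also avoids the finitely many disks that carry all
    but \<open>\<eta>\<close> of the sum.\<close>
  define J1 where "J1 = J \<inter> ball t0 d1"
  have tr1: "trace (J1, f) = f ` J1" by (simp add: trace_def)
  have sub: "(J', f) \<in> subpaths \<gamma>0" if "J' \<noteq> {}" "J' = J \<inter> ball t0 d" for J' d
    using that J(3,4) unfolding subpaths_def f_def by (auto intro!: is_interval_Int is_interval_ball_real)
  have inJ: "\<exists>n. \<tau> (\<sigma> n) \<in> J \<inter> ball t0 d" if "0 < d" for d
  proof -
    have "\<forall>\<^sub>F n in sequentially. dist ((\<tau> \<circ> \<sigma>) n) t0 < d" using t0(3) that by (rule tendstoD)
    then obtain n where "dist ((\<tau> \<circ> \<sigma>) n) t0 < d" by (auto simp: eventually_sequentially)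
    then show ?thesis using \<tau>(1) by (auto simp: dist_commute)
  qed
  have J1: "(J1, f) \<in> subpaths \<gamma>0" by (rule sub[OF _ J1_def]) (use inJ[OF d1(1)] J1_def in blast)
  have "f ` J1 \<subseteq> ball x r1" using d1(2) by (auto simp: J1_def dist_commute)
  then have "closure (f ` J1) \<subseteq> closure (ball x r1)" "bounded (f ` J1)"
    using bounded_subset[OF bounded_ball] closure_mono by blast+
  then have "compactly_contained (f ` J1) \<Omega>"
    using r1(2) unfolding compactly_contained_def by (simp add: compact_closure subset_trans)
  then have fin: "(\<Sum>\<^sub>\<infinity>l\<in>meeting Q (f ` J1). osc Q g l) < \<infinity>" using \<gamma>0f[OF J1] by (simp add: tr1)
  have "0 < ennreal \<eta>" using \<eta> by simp
  from infsum_ennreal_tail[OF fin this] obtain F where F: "finite F" "(\<Sum>\<^sub>\<infinity>l\<in>meeting Q (f ` J1) - F. osc Q g l) < ennreal \<eta>"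
    by metis
  obtain e1 where e1: "0 < e1" "\<And>i. i \<in> F \<Longrightarrow> x \<notin> closure (Q i) \<Longrightarrow> ball x e1 \<inter> closure (Q i) = {}"
    by (rule finite_disks_near[OF F(1), of x]) (rule that)
  obtain d2 where d2: "d2 > 0" "\<forall>t\<in>J. dist t t0 < d2 \<longrightarrow> f t \<in> ball x e1" using near[OF e1(1)] by blast
  define J2 where "J2 = J \<inter> ball t0 (min d1 d2)"
  have d12: "0 < min d1 d2" using d1 d2 by simp
  have J2J: "J2 \<subseteq> J" "J2 \<subseteq> J1" by (auto simp: J2_def J1_def)
  have J2: "(J2, f) \<in> subpaths \<gamma>0" by (rule sub[OF _ J2_def]) (use inJ[OF d12] J2_def in blast)
  have xc: "i = j" if "x \<in> closure (Q i)" for i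
    using that x disjoint_closures[of i j] by (auto simp: frontier_def)
  have m2: "meeting Q (f ` J2) \<subseteq> meeting Q (f ` J1) - F"
  proof
    fix i assume i: "i \<in> meeting Q (f ` J2)"
    then obtain t where t: "t \<in> J2" "f t \<in> Q i" by (auto simp: meeting_def)
    have "i \<noteq> j" using t J2J(1) acc'(3) by (auto simp: tr)
    then have "x \<notin> closure (Q i)" using xc by blast
    moreover have "f t \<in> ball x e1" using t(1) d2(2) by (auto simp: J2_def dist_commute)
    moreover have "f t \<in> closure (Q i)" using t(2) closure_subset by blast
    ultimately have "i \<notin> F" using e1(2)[of i] by blast
    then show "i \<in> meeting Q (f ` J1) - F" using i meeting_mono[OF image_mono[OF J2J(2)], of Q f] by blast
  qed
  have small: "(\<Sum>\<^sub>\<infinity>l\<in>meeting Q (f ` J2). osc Q g l) < ennreal \<eta>"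
    using infsum_ennreal_mono[OF m2, of "osc Q g" "osc Q g"] F(2) by (rule order_le_less_trans) simp
  have MM: "\<bar>M i - M k\<bar> < \<eta>" if ik: "i \<in> meeting Q (f ` J2)" "k \<in> meeting Q (f ` J2)" for i k
  proof -
    have "\<bar>sup_bd Q g i - sup_bd Q g k\<bar> \<le> enn2ereal (\<Sum>\<^sub>\<infinity>l\<in>meeting Q (f ` J2). osc Q g l)"
      using \<gamma>0M[OF J2] ik by (simp add: trace_def)
    also have "\<dots> < enn2ereal (ennreal \<eta>)" using small by (simp add: less_ennreal.rep_eq)
    finally show ?thesis using \<eta> by (simp add: sM)
  qed
  obtain n where n: "\<tau> (\<sigma> n) \<in> J2" using inJ[OF d12] by (auto simp: J2_def)
  obtain k0 where k0: "f (\<tau> (\<sigma> n)) \<in> Q k0" "\<bar>M k0 - L\<bar> < \<eta>" using \<tau>(3) by blast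
  have k0m: "k0 \<in> meeting Q (f ` J2)" using n k0(1) by (auto simp: meeting_def)
  show ?thesis
  proof (rule that[of "f ` J2"])
    have "continuous_on J2 f"
    proof (rule continuous_on_eq)
      show "continuous_on J2 h" using hJ by (rule continuous_on_subset) (use J2J closure_subset in blast)
      show "h t = f t" if "t \<in> J2" for t using hf J2J that by blast
    qed
    moreover have "is_interval J2" unfolding J2_def using J(3) by (intro is_interval_Int is_interval_ball_real)
    ultimately show "connected (f ` J2)" by (intro connected_continuous_image is_interval_connected)
    have t2: "f ` J2 \<subseteq> trace \<gamma>" using J2J(1) by (auto simp: tr)
    then show "x \<notin> f ` J2" "f ` J2 \<inter> Q j = {}" using acc' by blast+
    show "f ` J2 \<subseteq> trace \<gamma>0" using J2J(1) J(4) by (auto simp: trace_def f_def)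
    show "x \<in> closure (f ` J2)"
    proof -
      have ev: "\<forall>\<^sub>F n in sequentially. \<tau> (\<sigma> n) \<in> J2"
      proof -
        have "\<forall>\<^sub>F n in sequentially. dist ((\<tau> \<circ> \<sigma>) n) t0 < min d1 d2" using t0(3) d12 by (rule tendstoD)
        then show ?thesis by eventually_elim (use \<tau>(1) in \<open>auto simp: J2_def dist_commute\<close>)
      qed
      then obtain N where N: "\<And>n. n \<ge> N \<Longrightarrow> \<tau> (\<sigma> n) \<in> J2" by (auto simp: eventually_sequentially)
      have "(\<lambda>n. f (\<tau> (\<sigma> (n + N)))) \<longlonglongrightarrow> x" using LIMSEQ_ignore_initial_segment[OF fl', of N] by simp
      moreover have "f (\<tau> (\<sigma> (n + N))) \<in> closure (f ` J2)" for n
        by (rule subsetD[OF closure_subset], rule imageI, rule N) simp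
      ultimately show ?thesis by (metis (mono_tags, lifting) closed_closure closed_sequentially)
    qed
    show "\<bar>Sup (G ` frontier (Q k)) - L\<bar> < 2 * \<eta>" if k: "Q k \<inter> f ` J2 \<noteq> {}" for k
    proof -
      have "k \<in> meeting Q (f ` J2)" using k by (simp add: meeting_def)
      then have "\<bar>M k - M k0\<bar> < \<eta>" using MM k0m by blast
      then show ?thesis using k0(2) by (simp add: M_def)
    qed
  qed
qed

text \<open>A small square around \<open>x\<close> crosses both the tail of the access path and the
  boundary curve of \<open>Q j\<close>. Its radius is chosen so that it misses the carpet points of
  the path; hence it meets the tail inside a disk \<open>Q k\<close>, whose supremum is close to
  \<open>L\<close>. From there to the curve \<open>G\<close> varies little along the square.\<close>

lemma access_value_bounds:
  assumes g: "g \<in> sobolev_loc v \<Omega> Q" and gu: "\<And>x. x \<in> S \<Longrightarrow> g x = ereal (G x)"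
    and x: "x \<in> accessible \<Omega> Q g" "x \<in> frontier (Q j)" and L: "accessible_value \<Omega> Q g x = ereal L"
  shows "Inf (G ` frontier (Q j)) \<le> L" "L \<le> Sup (G ` frontier (Q j))"
proof -
  have U: "sobolev_real v \<Omega> Q G" "sup_bd Q g i = ereal (Sup (G ` frontier (Q i)))" for i
    by (rule sobolev_loc_real[OF g], erule gu)+
  note bd = sobolev_realD(1)[OF U(1)]
  obtain \<gamma>0 \<gamma> where \<gamma>: "\<gamma>0 \<in> good_paths \<Omega> Q g" "access_path \<Omega> Q x \<gamma>0 \<gamma>" "Liminf (disks_to Q \<gamma> x) (sup_bd Q g) = ereal L"
    using accessible_valueE[OF x(1)] L by metis
  have xS: "x \<in> S" using x frontier_Q_subset_S by blast
  then have x\<Omega>: "x \<in> \<Omega>" using S_subset by blast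
  have "\<exists>y\<in>frontier (Q j). \<bar>L - G y\<bar> < 4 * \<eta>" if \<eta>: "0 < \<eta>" for \<eta>
  proof -
    obtain X where X: "connected X" "X \<subseteq> trace \<gamma>0" "X \<inter> Q j = {}" "x \<notin> X" "x \<in> closure X"
      "\<And>k. Q k \<inter> X \<noteq> {} \<Longrightarrow> \<bar>Sup (G ` frontier (Q k)) - L\<bar> < 2 * \<eta>"
      by (rule access_tail[OF g gu \<gamma>(1,2) x(2) \<gamma>(3) \<eta>]) (assumption, rule that)
    have "X \<noteq> {}" using X(5) by auto
    then obtain y1 where y1: "y1 \<in> X" by blast
    obtain y2 where y2: "y2 \<in> frontier (Q j)" "y2 \<noteq> x" by (rule frontier_Q_other_point) (rule that)
    have pos: "0 < sqn (y - x)" if "y \<noteq> x" for y using norm_le_sqn[of "y - x"] that by (smt (verit) right_minus_eq zero_less_norm_iff)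
    define R where "R = min (sqn (y1 - x)) (sqn (y2 - x))"
    have "0 < R" using pos[of y1] pos[of y2] y1 y2 X(4) unfolding R_def by (metis min_less_iff_conj)
    have tn: "hausdorff1 (trace \<gamma>0 \<inter> S) = 0" "trace \<gamma>0 \<subseteq> \<Omega>" using \<gamma>(1) by (auto simp: good_paths_def paths_in_def)
    have AT: "AE r in lborel. sqs x r \<inter> (trace \<gamma>0 \<inter> S) = {}" by (rule AE_sqs_disjoint_of_hausdorff1_null[OF tn(1)])
    obtain r where r: "0 < r" "r < R" "sqs x r \<inter> (trace \<gamma>0 \<inter> S) = {}"
      "\<And>s t. 0 \<le> s \<Longrightarrow> s \<le> t \<Longrightarrow> t \<le> 16 \<Longrightarrow> loop x r s \<in> S \<Longrightarrow> loop x r t \<in> S \<Longrightarrow>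
         ennreal \<bar>G (loop x r s) - G (loop x r t)\<bar> \<le> (\<Sum>\<^sub>\<infinity>i\<in>meeting Q (loop x r ` {s..t}). ennreal (oscr Q G i))"
      "(\<Sum>\<^sub>\<infinity>i\<in>{i. x \<notin> closure (Q i)} \<inter> meeting Q (sqs x r). ennreal (oscr Q G i)) < ennreal \<eta>"
      by (rule good_radius[OF U(1) x\<Omega> \<open>0 < R\<close> \<eta> AT]) (rule that)
    have "sqb x r \<inter> X \<noteq> {}"
      using open_Int_closure_eq_empty[OF open_sqb, of x r X] X(5) sqb_center[OF r(1), of x] by blast
    then obtain y0 where y0: "y0 \<in> X" "sqn (y0 - x) \<le> r" by (auto simp: sqb_def intro: less_imp_le)
    have "r \<le> sqn (y1 - x)" "r \<le> sqn (y2 - x)" using r(2) by (auto simp: R_def)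
    obtain z where z: "z \<in> X" "z \<in> sqs x r" by (rule connected_meets_sqs[OF X(1) y0(1) y1 y0(2) \<open>r \<le> sqn (y1 - x)\<close>]) (rule that)
    have "sqn (x - x) \<le> r" using r(1) by (simp add: sqn_def)
    obtain w where w: "w \<in> frontier (Q j)" "w \<in> sqs x r"
      by (rule connected_meets_sqs[OF connected_frontier_Q x(2) y2(1) \<open>sqn (x - x) \<le> r\<close> \<open>r \<le> sqn (y2 - x)\<close>]) (rule that)
    obtain b where b: "0 \<le> b" "b \<le> 8" "loop x r b = z" by (rule loop_surj[OF r(1) z(2)]) (rule that)
    obtain c' where c': "0 \<le> c'" "c' \<le> 8" "loop x r c' = w" by (rule loop_surj[OF r(1) w(2)]) (rule that)
    have c'8: "loop x r (c' + 8) = w" using loop_periodic c' by simp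
    have "z \<in> \<Omega>" "z \<notin> S" using z X(2) tn(2) r(3) by auto
    then obtain k where k: "z \<in> Q k" using S_or_Q by blast
    have kj: "k \<noteq> j" using k z(1) X(3) by blast
    \<comment> \<open>The second turn guarantees a hit of the curve at or after \<open>b\<close>. Up
      to the first hit the loop stays out of \<open>Q j\<close>, whose oscillation is not
      controlled.\<close>
    define T where "T = {b..c' + 8} \<inter> loop x r -` frontier (Q j)"
    have cont: "continuous_on {s..t} (loop x r)" if "0 \<le> s" "t \<le> 16" for s t
      by (rule continuous_on_subset[OF continuous_on_loop]) (use that in auto)
    have "closed T" unfolding T_def
      by (rule continuous_closed_preimage[OF cont]) (use b c' in \<open>auto simp: frontier_closed\<close>)
    moreover have "bounded T" unfolding T_def by (rule bounded_subset[of "{b..c' + 8}"]) auto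
    moreover have "c' + 8 \<in> T" using c' b c'8 w(1) by (auto simp: T_def)
    ultimately obtain c where c: "c \<in> T" "\<And>t. t \<in> T \<Longrightarrow> c \<le> t"
      using compact_attains_inf[of T] compact_eq_bounded_closed by blast
    have cb: "b \<le> c" "c \<le> 16" "loop x r c \<in> frontier (Q j)" using c(1) c' by (auto simp: T_def)
    have cS: "loop x r c \<in> S" using cb(3) frontier_Q_subset_S by blast
    have avoid: "loop x r t \<notin> Q j" if t: "b \<le> t" "t \<le> c" for t
    proof
      assume inQ: "loop x r t \<in> Q j"
      then have tc: "t < c" using t S_not_Q[OF cS] by (cases "t = c") auto
      have "connected (loop x r ` {b..t})" by (intro connected_continuous_image cont) (use b t tc cb in auto)
      moreover have "loop x r ` {b..t} \<inter> Q j \<noteq> {}"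
      proof -
        have "loop x r t \<in> loop x r ` {b..t}" using t by auto
        then show ?thesis using inQ by blast
      qed
      moreover have "z \<in> loop x r ` {b..t} - Q j"
      proof -
        have "z \<in> loop x r ` {b..t}" using b(3) t by (intro image_eqI[of _ _ b]) auto
        then show ?thesis using disjoint_Q[OF kj] k by blast
      qed
      ultimately have "loop x r ` {b..t} \<inter> frontier (Q j) \<noteq> {}" by (intro connected_Int_frontier) blast+
      then obtain t' where "t' \<in> {b..t}" "loop x r t' \<in> frontier (Q j)" by blast
      then have "t' \<in> T" using tc cb c(1) by (auto simp: T_def)
      then show False using c(2) \<open>t' \<in> {b..t}\<close> tc by fastforce
    qed
    have "connected (loop x r ` {b..c})" by (intro connected_continuous_image cont) (use b cb in auto)
    moreover have "loop x r ` {b..c} \<inter> Q k \<noteq> {}"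
    proof -
      have "z \<in> loop x r ` {b..c}" using b(3) cb by (intro image_eqI[of _ _ b]) auto
      then show ?thesis using k by blast
    qed
    moreover have "loop x r c \<in> loop x r ` {b..c} - Q k" using S_not_Q[OF cS] cb by auto
    ultimately have "loop x r ` {b..c} \<inter> frontier (Q k) \<noteq> {}" by (intro connected_Int_frontier) blast+
    then obtain a where a: "b \<le> a" "a \<le> c" "loop x r a \<in> frontier (Q k)" by auto
    have aS: "loop x r a \<in> S" using a(3) frontier_Q_subset_S by blast
    have xc: "i = j" if "x \<in> closure (Q i)" for i
      using that x(2) disjoint_closures[of i j] by (auto simp: frontier_def)
    have "ennreal \<bar>G (loop x r a) - G (loop x r c)\<bar> \<le> (\<Sum>\<^sub>\<infinity>i\<in>meeting Q (loop x r ` {a..c}). ennreal (oscr Q G i))"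
      using a b cb aS cS by (intro r(4)) auto
    also have "\<dots> \<le> (\<Sum>\<^sub>\<infinity>i\<in>{i. x \<notin> closure (Q i)} \<inter> meeting Q (sqs x r). ennreal (oscr Q G i))"
    proof (rule infsum_ennreal_mono)
      show "meeting Q (loop x r ` {a..c}) \<subseteq> {i. x \<notin> closure (Q i)} \<inter> meeting Q (sqs x r)"
      proof
        fix i assume "i \<in> meeting Q (loop x r ` {a..c})"
        then obtain y where y: "y \<in> Q i" "y \<in> loop x r ` {a..c}" by (auto simp: meeting_def)
        from y(2) obtain t where "t \<in> {a..c}" "y = loop x r t" by (rule imageE)
        with y(1) have t: "t \<in> {a..c}" "loop x r t \<in> Q i" by simp_all
        then have "i \<noteq> j" using avoid[of t] a by auto
        moreover have "loop x r t \<in> sqs x r" using loop_in_sqs[of r t x] r(1) t a b by auto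
        ultimately show "i \<in> {i. x \<notin> closure (Q i)} \<inter> meeting Q (sqs x r)" using xc t(2) by (auto simp: meeting_def)
      qed
    qed simp
    also have "\<dots> < ennreal \<eta>" by (rule r(5))
    finally have 1: "\<bar>G (loop x r a) - G (loop x r c)\<bar> < \<eta>" by (simp add: ennreal_less_iff)
    have "k \<in> {i. x \<notin> closure (Q i)} \<inter> meeting Q (sqs x r)" using kj xc k z(2) by (auto simp: meeting_def)
    then have "ennreal (oscr Q G k) \<le> (\<Sum>\<^sub>\<infinity>i\<in>{i. x \<notin> closure (Q i)} \<inter> meeting Q (sqs x r). ennreal (oscr Q G i))"
      by (rule infsum_ennreal_ge)
    then have "ennreal (oscr Q G k) < ennreal \<eta>" using r(5) by (rule order_le_less_trans)
    then have 2: "oscr Q G k < \<eta>" using oscr_nonneg[OF bd] by (simp add: ennreal_less_iff)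
    have "G (loop x r a) \<le> Sup (G ` frontier (Q k))" "Inf (G ` frontier (Q k)) \<le> G (loop x r a)"
      using bd[of k] a(3) by (auto intro!: cSUP_upper cINF_lower bounded_imp_bdd_above bounded_imp_bdd_below)
    then have 3: "\<bar>Sup (G ` frontier (Q k)) - G (loop x r a)\<bar> < \<eta>" using 2 by (simp add: oscr_def)
    have "\<bar>Sup (G ` frontier (Q k)) - L\<bar> < 2 * \<eta>" using k z(1) by (intro X(6)) blast
    \<comment> \<open>Two \<open>\<eta>\<close> come from the tail, one from the oscillation on
      \<open>Q k\<close> and one from the arc of the square.\<close>
    then have "\<bar>L - G (loop x r c)\<bar> < 4 * \<eta>" using 1 3 by linarith
    then show ?thesis using cb(3) by blast
  qed note approx = this
  have b: "G y \<le> Sup (G ` frontier (Q j))" "Inf (G ` frontier (Q j)) \<le> G y" if "y \<in> frontier (Q j)" for y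
    using bd[of j] that by (auto intro!: cSUP_upper cINF_lower bounded_imp_bdd_above bounded_imp_bdd_below)
  show "Inf (G ` frontier (Q j)) \<le> L"
  proof (rule field_le_epsilon)
    fix e :: real assume "0 < e"
    then obtain y where "y \<in> frontier (Q j)" "\<bar>L - G y\<bar> < e" using approx[of "e / 4"] by auto
    then show "Inf (G ` frontier (Q j)) \<le> L + e" using b(2)[of y] by linarith
  qed
  show "L \<le> Sup (G ` frontier (Q j))"
  proof (rule field_le_epsilon)
    fix e :: real assume "0 < e"
    then obtain y where "y \<in> frontier (Q j)" "\<bar>L - G y\<bar> < e" using approx[of "e / 4"] by auto
    then show "L \<le> Sup (G ` frontier (Q j)) + e" using b(1)[of y] by linarith
  qed
qed

text \<open>\<open>u\<close> is the normalized version of some \<open>g\<close>, which may differ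
  from \<open>u\<close>. On each boundary curve \<open>u\<close> lies between the infimum and the
  supremum of \<open>G\<close>. Small disks along an access path have suprema of \<open>G\<close>
  near \<open>u x\<close> and small oscillation of \<open>G\<close>, so all values of
  \<open>u\<close> on their curves are near \<open>u x\<close>.\<close>

lemma normalized_tame:
  assumes h: "carpet_harmonic v \<Omega> Q (\<lambda>x. ereal (u x))" and n: "normalized v \<Omega> Q (\<lambda>x. ereal (u x))"
  shows "tame v u"
proof -
  obtain g where g: "g \<in> sobolev_loc v \<Omega> Q" and ug: "\<And>x. x \<in> S \<Longrightarrow> ereal (u x) = normalized_version \<Omega> Q g x"
    using n by (auto simp: normalized_def)
  define G where "G = (\<lambda>x. real_of_ereal (g x))"
  have gu: "g x = ereal (G x)" if "x \<in> S" for x using sobolev_loc_finite[OF g that] by (simp add: G_def ereal_real)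
  have U: "sobolev_real v \<Omega> Q G" "sup_bd Q g i = ereal (Sup (G ` frontier (Q i)))" for i
    by (rule sobolev_loc_real[OF g], erule gu)+
  note bd = sobolev_realD(1)[OF U(1)]
  let ?A = "accessible \<Omega> Q g"
  have uA: "accessible_value \<Omega> Q g x = ereal (u x)" if "x \<in> ?A" for x
    using ug[of x] that accessible_in_S[of g] by (auto simp: normalized_version_def)
  have cluster: "\<exists>y\<in>?A \<inter> B. dist y x < e \<and> \<bar>u y - u x\<bar> < e"
    if L: "Liminf (at x within (?A \<inter> B)) (accessible_value \<Omega> Q g) = ereal (u x)" and e: "0 < e" for x B e
  proof -
    have "\<forall>\<^sub>F y in at x within (?A \<inter> B). y \<in> ?A \<inter> B \<and> dist y x < e"
      using e by (auto simp: eventually_at)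
    then obtain y where y: "y \<in> ?A \<inter> B \<and> dist y x < e"
      "ereal (u x - e) < accessible_value \<Omega> Q g y" "accessible_value \<Omega> Q g y < ereal (u x + e)"
      by (rule Liminf_real_cluster[OF L e]) (rule that)
    then have "\<bar>u y - u x\<bar> < e" using uA[of y] by auto
    then show ?thesis using y(1) by blast
  qed
  \<comment> \<open>For a point on a boundary curve the accessible point is found on the same curve,
    so that bounds for \<open>G\<close> on that curve pass on to \<open>u\<close>.\<close>
  have acc_near: "\<exists>y\<in>?A. dist y x < e \<and> \<bar>u y - u x\<bar> < e \<and> (\<forall>j. x \<in> frontier (Q j) \<longrightarrow> y \<in> frontier (Q j))"
    if x: "x \<in> S" and e: "0 < e" for x e
  proof (cases "x \<in> ?A")
    case True
    then show ?thesis using e by (intro bexI[of _ x]) auto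
  next
    case nA: False
    show ?thesis
    proof (cases "\<exists>i. x \<in> frontier (Q i)")
      case True
      then obtain j where j: "x \<in> frontier (Q j)" by blast
      have "(THE i. x \<in> frontier (Q i)) = j" using j frontier_Q_unique by blast
      then have "Liminf (at x within (?A \<inter> frontier (Q j))) (accessible_value \<Omega> Q g) = ereal (u x)"
        using ug[OF x] nA True by (simp add: normalized_version_def Int_commute)
      from cluster[OF this e] show ?thesis using frontier_Q_unique[OF j] by blast
    next
      case False
      then have "Liminf (at x within (?A \<inter> UNIV)) (accessible_value \<Omega> Q g) = ereal (u x)"
        using ug[OF x] nA by (simp add: normalized_version_def)
      from cluster[OF this e] show ?thesis using False by blast
    qed
  qed
  have bounds: "Inf (G ` frontier (Q j)) \<le> u y" "u y \<le> Sup (G ` frontier (Q j))" if y: "y \<in> frontier (Q j)" for y j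
  proof -
    have *: "Inf (G ` frontier (Q j)) \<le> u y + e \<and> u y \<le> Sup (G ` frontier (Q j)) + e" if e: "0 < e" for e
    proof -
      have "y \<in> S" using y frontier_Q_subset_S by blast
      from acc_near[OF this e] obtain z where "z \<in> ?A" "\<bar>u z - u y\<bar> < e" "\<forall>j. y \<in> frontier (Q j) \<longrightarrow> z \<in> frontier (Q j)"
        by (elim bexE conjE) (rule that)
      with y have z: "z \<in> ?A" "\<bar>u z - u y\<bar> < e" "z \<in> frontier (Q j)" by simp_all
      have "Inf (G ` frontier (Q j)) \<le> u z" "u z \<le> Sup (G ` frontier (Q j))"
        using access_value_bounds[OF g gu z(1,3) uA[OF z(1)]] by auto
      then show ?thesis using z(2) by linarith
    qed
    show "Inf (G ` frontier (Q j)) \<le> u y" by (rule field_le_epsilon) (simp add: *)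
    show "u y \<le> Sup (G ` frontier (Q j))" by (rule field_le_epsilon) (simp add: *)
  qed
  have approxA: "\<exists>i. Q i \<subseteq> ball x e \<and> (\<forall>y\<in>frontier (Q i). \<bar>u y - u x\<bar> < e)" if x: "x \<in> ?A" and e: "0 < e" for x e
  proof -
    have xS: "x \<in> S" using x accessible_in_S by blast
    obtain \<gamma>0 \<gamma> where L: "Liminf (disks_to Q \<gamma> x) (sup_bd Q g) = ereal (u x)"
      using accessible_valueE[OF x] uA[OF x] by metis
    have e2: "0 < e / 2" using e by simp
    obtain r1 where r1: "0 < r1" "compactly_contained (ball x r1) \<Omega>" using ball_at xS S_subset by blast
    \<comment> \<open>Finite energy leaves only finitely many disks near \<open>x\<close> with large
      oscillation, and none of them fits into a sufficiently small ball.\<close>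
    define F where "F = {i \<in> meeting Q (ball x r1). (ennreal (e / 2))\<^sup>2 \<le> (ennreal (oscr Q G i))\<^sup>2}"
    have "finite F" unfolding F_def
      by (rule finite_ge_of_infsum_less_top[OF sobolev_realD(2)[OF U(1) r1]]) (use e in \<open>simp add: ennreal_power\<close>)
    then obtain e1 where e1: "0 < e1" "\<And>i. i \<in> F \<Longrightarrow> x \<notin> closure (Q i) \<Longrightarrow> ball x e1 \<inter> closure (Q i) = {}"
      "\<And>i. i \<in> F \<Longrightarrow> \<not> Q i \<subseteq> ball x e1" by (rule finite_disks_near[of F x]) (rule that)
    define \<rho> where "\<rho> = min e (min r1 e1)"
    have \<rho>: "0 < \<rho>" "ball x \<rho> \<subseteq> ball x e" "ball x \<rho> \<subseteq> ball x r1" "ball x \<rho> \<subseteq> ball x e1"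
      using e r1 e1(1) by (auto simp: \<rho>_def)
    from eventually_disks_to[OF \<rho>(1)] obtain i where i: "i \<in> meeting Q (trace \<gamma>) \<and> Q i \<subseteq> ball x \<rho>"
        "ereal (u x - e / 2) < sup_bd Q g i" "sup_bd Q g i < ereal (u x + e / 2)"
      by (rule Liminf_real_cluster[OF L e2]) (rule that)
    have "i \<in> meeting Q (ball x r1)" using i(1) \<rho>(3) Q_ne[of i] by (auto simp: meeting_def)
    moreover have "i \<notin> F" using e1(3) i(1) \<rho>(4) by blast
    ultimately have "(ennreal (oscr Q G i))\<^sup>2 < (ennreal (e / 2))\<^sup>2" by (simp add: F_def not_le)
    then have o: "oscr Q G i < e / 2"
      by (metis ennreal_leI not_le power_mono zero_le)
    have s: "\<bar>Sup (G ` frontier (Q i)) - u x\<bar> < e / 2" using i(2,3) unfolding U(2) ereal_less(1) less_ereal.simps by linarith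
    have "\<bar>u y - u x\<bar> < e" if "y \<in> frontier (Q i)" for y
      using bounds[OF that] o s unfolding oscr_def by linarith
    then show ?thesis using i(1) \<rho>(2) by (intro exI[of _ i]) blast
  qed
  have approx: "\<exists>i. Q i \<subseteq> ball x e \<and> (\<forall>y\<in>frontier (Q i). \<bar>u y - u x\<bar> < e)" if x: "x \<in> S" and e: "0 < e" for x e
  proof -
    have e2: "0 < e / 2" using e by simp
    obtain y where y: "y \<in> ?A" "dist y x < e / 2" "\<bar>u y - u x\<bar> < e / 2" using acc_near[OF x e2] by blast
    obtain i where i: "Q i \<subseteq> ball y (e / 2)" "\<And>z. z \<in> frontier (Q i) \<Longrightarrow> \<bar>u z - u y\<bar> < e / 2" using approxA[OF y(1) e2] by blast
    have "ball y (e / 2) \<subseteq> ball x e"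
    proof
      fix z assume "z \<in> ball y (e / 2)"
      then show "z \<in> ball x e" using y(2) dist_triangle[of x z y] by (simp add: dist_commute)
    qed
    moreover have "\<bar>u z - u x\<bar> < e" if "z \<in> frontier (Q i)" for z using i(2)[OF that] y(3) by linarith
    ultimately show ?thesis using i(1) by blast
  qed
  have "(\<lambda>x. ereal (u x)) \<in> sobolev_loc v \<Omega> Q" using h by (simp add: carpet_harmonic_def)
  then have "sobolev_real v \<Omega> Q u" by (rule sobolev_loc_real(1)) (rule refl)
  then show ?thesis unfolding tame_def using approx harmonic_minimal[OF h] by blast
qed

section \<open>Suprema and infima over the closure\<close>

lemma tame_SUP_frontier:
  assumes u: "tame v u" and V: "open V" "compactly_contained V \<Omega>"
  shows "(SUP x\<in>S \<inter> closure V. ereal (u x)) = (SUP x\<in>S \<inter> frontier V. ereal (u x))"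
proof (rule antisym)
  show "(SUP x\<in>S \<inter> frontier V. ereal (u x)) \<le> (SUP x\<in>S \<inter> closure V. ereal (u x))"
    by (rule SUP_subset_mono) (auto simp: frontier_def)
  show "(SUP x\<in>S \<inter> closure V. ereal (u x)) \<le> (SUP x\<in>S \<inter> frontier V. ereal (u x))"
  proof (rule SUP_least)
    fix x assume x: "x \<in> S \<inter> closure V"
    show "ereal (u x) \<le> (SUP x\<in>S \<inter> frontier V. ereal (u x))"
    proof (cases "x \<in> V")
      case False
      then have "x \<in> S \<inter> frontier V" using x V(1) by (auto simp: frontier_def interior_open)
      then show ?thesis by (rule SUP_upper)
    next
      case True
      show ?thesis
      proof (rule ccontr)
        assume "\<not> ?thesis"
        \<comment> \<open>A real level strictly between the two values. It also exists when no
          carpet point lies on the frontier, where the supremum is minus infinity.\<close>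
        then obtain a where a: "(SUP x\<in>S \<inter> frontier V. ereal (u x)) < ereal a" "ereal a < ereal (u x)"
          using ereal_dense2[of "SUP x\<in>S \<inter> frontier V. ereal (u x)" "ereal (u x)"] by (auto simp: not_le)
        have "u z < a" if "z \<in> S" "z \<in> frontier V" for z
        proof -
          have "ereal (u z) \<le> (SUP x\<in>S \<inter> frontier V. ereal (u x))" using that by (intro SUP_upper) blast
          then have "ereal (u z) < ereal a" using a(1) by (rule order_le_less_trans)
          then show ?thesis by simp
        qed
        then show False using tame_maximum_principle[OF u V _ True] x a(2) by auto
      qed
    qed
  qed
qed

end

theorem theorem2p64:
  fixes \<Omega> :: "complex set" and Q :: "nat \<Rightarrow> complex set" and v :: version
    and u :: "complex \<Rightarrow> real" and V :: "complex set"
  assumes "relative_carpet \<Omega> Q"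
    and "carpet_harmonic v \<Omega> Q (\<lambda>x. ereal (u x))"
    and "normalized v \<Omega> Q (\<lambda>x. ereal (u x))"
    and "open V" and "compactly_contained V \<Omega>"
  shows "(SUP x\<in>carpet \<Omega> Q \<inter> closure V. ereal (u x)) = (SUP x\<in>carpet \<Omega> Q \<inter> frontier V. ereal (u x)) \<and>
         (INF x\<in>carpet \<Omega> Q \<inter> closure V. ereal (u x)) = (INF x\<in>carpet \<Omega> Q \<inter> frontier V. ereal (u x))"
proof -
  interpret rel_carpet \<Omega> Q by (rule rel_carpet.intro) (rule assms(1))
  have t: "tame v u" by (rule normalized_tame[OF assms(2,3)])
  have neg: "(INF x\<in>A. ereal (u x)) = - (SUP x\<in>A. ereal (- u x))" for A
    using ereal_SUP_uminus_eq[of "\<lambda>x. ereal (u x)" A] by simp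
  show ?thesis
    unfolding neg tame_SUP_frontier[OF t assms(4,5)] tame_SUP_frontier[OF tame_uminus[OF t] assms(4,5)] by simp
qed

end
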